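(* Let $\zeta$ be the solution of the Cauchy problem \[ \begin{cases} -T^2\zeta_{tt}+\dfrac{1}{K^2}\zeta_{rr}+\left(\dfrac{2}{K^2 r}-\dfrac{1}{K^2}\left(\dfrac{T'}{T}+\dfrac{K'}{K}\right)\right)\zeta_r+\dfrac{1}{r^2}\Delta_{S^2}\zeta=0 & \text{on } \mathbb{R}\times(0,\infty)\times S^2,\\ \partial_r\zeta|_{r=0}=0,\\ (\zeta,i\zeta_t)(0,\cdot)=Z_0, \end{cases} \] where the data $Z_0$ is smooth and compactly supported away from the origin, i.e. $Z_0\in C_0^\infty(\mathbb{R}^3\setminus\{0\})^2$. Then $\zeta(t,\cdot)\to0$ in $L^\infty_{\mathrm{loc}}$ as $t\to\infty$; in particular $\zeta(t,r,\theta,\phi)\to0$ as $t\to\infty$ for each fixed $(r,\theta,\phi)$ with $r\in[0,\infty)$.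
   Context: Standing assumptions: $T,K\in C^\infty([0,\infty))$ satisfy $T,K>0$, $K(0)=1$, $T'(0)=K'(0)=0$, $T(r)=1+O(1/r)$ and $K(r)=1+O(1/r)$ as $r\to\infty$, and $\frac{T'(r)}{T(r)}+\frac{K'(r)}{K(r)}=O(1/r^2)$ as $r\to\infty$ (a "particle-like" geometry). These describe the metric $ds^2=-T^{-2}(r)dt^2+K^2(r)dr^2+r^2(d\theta^2+\sin^2\theta\,d\phi^2)$, and the displayed equation is its wave equation; $\Delta_{S^2}$ is the Laplacian on the unit sphere. Points of $\mathbb{R}^3$ are written $x=r\omega$ with $\omega\in S^2$; the solution $\zeta$ exists, is unique, globally smooth, and compactly supported in $x$ for each $t$. *)

theory Defs
  imports "HOL-Analysis.Analysis" "HOL-Library.Landau_Symbols"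
begin

fun pd_list :: "'a::euclidean_space list \<Rightarrow> ('a \<Rightarrow> 'b::real_normed_vector) \<Rightarrow> 'a \<Rightarrow> 'b" where
  "pd_list [] f = f"
| "pd_list (b # bs) f = (\<lambda>x. frechet_derivative (pd_list bs f) (at x) b)"

definition smooth_on :: "'a::euclidean_space set \<Rightarrow> ('a \<Rightarrow> 'b::real_normed_vector) \<Rightarrow> bool" where
  "smooth_on S f \<longleftrightarrow> (\<forall>bs. set bs \<subseteq> Basis \<longrightarrow> (\<forall>x\<in>S. pd_list bs f differentiable (at x)))"

definition smooth_halfline :: "(real \<Rightarrow> real) \<Rightarrow> bool" where
  "smooth_halfline f \<longleftrightarrow> (\<exists>D :: nat \<Rightarrow> real \<Rightarrow> real. (\<forall>x\<ge>0. D 0 x = f x) \<and>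
      (\<forall>n. \<forall>x\<ge>0. (D n has_real_derivative D (Suc n) x) (at x within {0..})))"

definition sph :: "real \<Rightarrow> real \<Rightarrow> real \<Rightarrow> real^3" where
  "sph r th ph = vector [r * sin th * cos ph, r * sin th * sin ph, r * cos th]"

definition particle_like :: "(real \<Rightarrow> real) \<Rightarrow> (real \<Rightarrow> real) \<Rightarrow> bool" where
  "particle_like T K \<longleftrightarrow>
     smooth_halfline T \<and> smooth_halfline K \<and>
     (\<forall>r\<ge>0. T r > 0 \<and> K r > 0) \<and> K 0 = 1 \<and>
     (T has_real_derivative 0) (at 0 within {0..}) \<and>
     (K has_real_derivative 0) (at 0 within {0..}) \<and>
     (\<lambda>r. T r - 1) \<in> O[at_top](\<lambda>r. 1 / r) \<and>
     (\<lambda>r. K r - 1) \<in> O[at_top](\<lambda>r. 1 / r) \<and>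
     (\<lambda>r. deriv T r / T r + deriv K r / K r) \<in> O[at_top](\<lambda>r. 1 / r^2)"

text \<open>The wave operator in polar coordinates applied to zeta at (t, r, th, ph);
  the spherical Laplacian is written in the chart (th, ph), valid for sin th \<noteq> 0.\<close>
definition wave_op :: "(real \<Rightarrow> real) \<Rightarrow> (real \<Rightarrow> real) \<Rightarrow> (real \<Rightarrow> real^3 \<Rightarrow> complex)
     \<Rightarrow> real \<Rightarrow> real \<Rightarrow> real \<Rightarrow> real \<Rightarrow> complex" where
  "wave_op T K \<zeta> t r th ph =
     (let u = (\<lambda>s \<rho> a b. \<zeta> s (sph \<rho> a b));
          u_tt = vector_derivative (\<lambda>s. vector_derivative (\<lambda>s'. u s' r th ph) (at s)) (at t);
          u_r = vector_derivative (\<lambda>\<rho>. u t \<rho> th ph) (at r);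
          u_rr = vector_derivative (\<lambda>\<rho>. vector_derivative (\<lambda>\<rho>'. u t \<rho>' th ph) (at \<rho>)) (at r);
          lap = of_real (1 / sin th) *
                  vector_derivative (\<lambda>a. of_real (sin a) * vector_derivative (\<lambda>a'. u t r a' ph) (at a)) (at th)
                + of_real (1 / (sin th)^2) *
                  vector_derivative (\<lambda>b. vector_derivative (\<lambda>b'. u t r th b') (at b)) (at ph)
      in - of_real ((T r)^2) * u_tt + of_real (1 / (K r)^2) * u_rr
         + of_real (2 / ((K r)^2 * r) - (1 / (K r)^2) * (deriv T r / T r + deriv K r / K r)) * u_r
         + of_real (1 / r^2) * lap)"

end

theory Submission
  imports Defs "HOL-Computational_Algebra.Polynomial"
begin

text \<open>
  Write \<open>\<mu> = K T\<close> and \<open>a = K / T\<close>. Averaging a solution against the zonal kernel \<open>P\<^sub>n (\<omega> \<bullet> x)\<close> on each sphere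
  gives a radial function \<open>v\<close> with
  \<open>\<partial>\<^sub>r (r\<^sup>2 v\<^sub>r / \<mu>) = \<mu> r\<^sup>2 v\<^sub>t\<^sub>t + n (n + 1) a v\<close>. Conservation of energy for \<open>v\<close> and its time derivatives bounds \<open>v\<close>,
  and finite propagation speed makes its Laplace transform in time an outgoing solution of an ordinary
  differential equation. Splitting this solution into incoming and outgoing amplitudes bounds it uniformly as the
  frequency approaches the imaginary axis away from 0; the frequency 0 is handled by the boundedness of the time
  integral of \<open>v\<close>, which again follows from energy conservation. A Tauberian theorem of Ingham type then gives
  \<open>v (t, r) \<rightarrow> 0\<close>. Since \<open>1 - \<Delta>\<close> on the sphere commutes with the equation, the energies of the modes decay like
  \<open>(1 + n (n + 1))\<^bsup>-4\<^esup>\<close>, and the solution is recovered from its modes by the approximate identity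
  \<open>((1 + \<omega> \<bullet> x) / 2)\<^sup>N\<close>, whose normalised Legendre coefficients are \<open>O (1 + n (n + 1))\<close> uniformly in \<open>N\<close>; so the decay of the modes can be summed.
\<close>

section \<open>Tauberian theorem\<close>

text \<open>The Tauberian step consumes only bounds on Laplace transforms that stay uniform as the
  damping \<open>d\<close> tends to 0; no boundary values on the imaginary axis are constructed.
  Each transform is cut off at a finite time \<open>q\<close>. Finite propagation then gives it
  compact support in \<open>r\<close>, so "outgoing" turns into vanishing at a radius
  \<open>Rm\<close>. The price is a boundary source of size exp(-dq) times a polynomial in
  \<open>q\<close>, harmless once \<open>q\<close> is large depending on \<open>d\<close>. Frequency
  0 stands apart because the amplitude is recovered from Z - W = 2 \<sigma> \<psi>, which
  degenerates there. The powers of l = 1 + n(n+1) are balanced thus: three applications of 1 -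
  \<Delta> make the data of a mode O(l^-3); energies of order l^-4 bound the mode itself by O(l^-2);
  reconstruction costs one factor l; what is left, l^-1, is summable because l grows like n^2. The
  radial equation is imposed only for r > 0, and the decay argument degenerates at the origin; decay
  there is transported inward from positive radii.\<close>

lemma barbalat_nonneg:
  fixes \<phi> :: "real \<Rightarrow> real"
  assumes nonneg: "\<And>t. 0 \<le> t \<Longrightarrow> 0 \<le> \<phi> t"
    and lip: "\<And>s t. 0 \<le> s \<Longrightarrow> 0 \<le> t \<Longrightarrow> \<bar>\<phi> s - \<phi> t\<bar> \<le> L * \<bar>s - t\<bar>"
    and bnd: "\<And>X. 0 \<le> X \<Longrightarrow> integral {0..X} \<phi> \<le> C"
  shows "(\<phi> \<longlongrightarrow> 0) at_top"
proof -
  define L' where "L' = \<bar>L\<bar> + 1"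
  have lip': "\<bar>\<phi> s - \<phi> t\<bar> \<le> L' * \<bar>s - t\<bar>" if "0 \<le> s" "0 \<le> t" for s t
  proof -
    have "L * \<bar>s - t\<bar> \<le> L' * \<bar>s - t\<bar>" by (intro mult_right_mono) (auto simp: L'_def)
    with lip[OF that] show ?thesis by linarith
  qed
  have L'0: "L' > 0" by (simp add: L'_def)
  have cont: "continuous_on {0..} \<phi>"
    by (rule lipschitz_on_continuous_on[of L']) (use L'0 in \<open>auto intro!: lipschitz_onI simp: dist_real_def lip'\<close>)
  then have int: "\<phi> integrable_on {a..b}" if "0 \<le> a" for a b
    using that by (intro integrable_continuous_real continuous_on_subset[OF cont]) auto
  define F where "F n = integral {0..real n} \<phi>" for n :: nat
  have split: "integral {0..b} \<phi> = integral {0..a} \<phi> + integral {a..b} \<phi>" if "0 \<le> a" "a \<le> b" for a b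
    using that by (simp add: Henstock_Kurzweil_Integration.integral_combine int)
  have mono: "integral {0..a} \<phi> \<le> integral {0..b} \<phi>" if "0 \<le> a" "a \<le> b" for a b
    unfolding split[OF that] using that by (auto intro!: integral_nonneg int nonneg)
  have "incseq F"
    unfolding F_def by (intro monoI mono) auto
  moreover have "bdd_above (range F)"
    unfolding F_def by (rule bdd_aboveI[of _ C]) (auto intro: bnd)
  ultimately have lim: "F \<longlonglongrightarrow> (SUP n. F n)"
    by (rule LIMSEQ_incseq_SUP[rotated])
  show ?thesis
  proof (rule tendstoI)
    fix e :: real assume e: "e > 0"
    \<comment> \<open>If \<phi> t \<ge> e, the Lipschitz bound keeps \<phi> above e/2 on [t, t + h].
      That interval adds at least e h / 2 to the integral, which the Cauchy property of
      \<open>F\<close> forbids for large t.\<close>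
    define h where "h = min 1 (e / (2 * L'))"
    have h: "0 < h" "h \<le> 1" "L' * h \<le> e / 2"
      using e L'0 by (auto simp: h_def min_def field_simps)
    from lim have "Cauchy F" by (rule LIMSEQ_imp_Cauchy)
    then obtain n0 where n0: "\<And>m n. m \<ge> n0 \<Longrightarrow> n \<ge> n0 \<Longrightarrow> dist (F m) (F n) < e / 2 * h"
      using e h by (meson metric_CauchyD half_gt_zero mult_pos_pos)
    show "\<forall>\<^sub>F t in at_top. dist (\<phi> t) 0 < e"
    proof (rule eventually_at_top_linorderI[of "real n0"])
      fix t assume t: "t \<ge> real n0"
      then have t0: "t \<ge> 0" by (meson of_nat_0_le_iff order_trans)
      show "dist (\<phi> t) 0 < e"
      proof (rule ccontr)
        assume "\<not> dist (\<phi> t) 0 < e"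
        then have big: "\<phi> t \<ge> e" using nonneg[OF t0] by simp
        obtain n where n: "real n \<ge> t + h" using real_arch_simple by blast
        have ge: "\<phi> s \<ge> e / 2" if "s \<in> {t..t+h}" for s
        proof -
          have "\<bar>\<phi> t - \<phi> s\<bar> \<le> L' * \<bar>t - s\<bar>" using that t0 by (intro lip') auto
          also have "\<dots> \<le> L' * h" using that L'0 by (intro mult_left_mono) auto
          finally show ?thesis using big h(3) by linarith
        qed
        have "e / 2 * h = integral {t..t+h} (\<lambda>_. e / 2)" using h by simp
        also have "\<dots> \<le> integral {t..t+h} \<phi>"
          using t0 ge by (intro integral_le int) auto
        also have "\<dots> \<le> F n - F n0"
          using mono[of "real n0" t] mono[of "t+h" "real n"] split[of t "t+h"] t t0 n h
          by (simp add: F_def)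
        also have "\<dots> \<le> dist (F n) (F n0)" by (simp add: dist_real_def)
        also have "\<dots> < e / 2 * h" using n t h by (intro n0) auto
        finally show False by simp
      qed
    qed
  qed
qed

section \<open>Fejer kernel: cosine transform of a triangle of width \<open>a\<close>, dominated by
  the Cauchy kernel\<close>

definition fejer :: "real \<Rightarrow> real \<Rightarrow> real" where
  "fejer a x = integral {0..a} (\<lambda>w. (1 - w / a) * cos (w * x))"

definition fejer_deriv :: "real \<Rightarrow> real \<Rightarrow> real" where
  "fejer_deriv a x = integral {0..a} (\<lambda>w. - ((1 - w / a) * w * sin (w * x)))"

lemma fejer_eq:
  assumes "a > 0" "x \<noteq> 0"
  shows "fejer a x = (1 - cos (a * x)) / (a * x\<^sup>2)"
proof -
  have "((\<lambda>w. (1 - w / a) * cos (w * x)) has_integral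
      ((1 - a / a) * sin (a * x) / x - cos (a * x) / (a * x\<^sup>2))
      - ((1 - 0 / a) * sin (0 * x) / x - cos (0 * x) / (a * x\<^sup>2))) {0..a}"
    using assms
    by (intro fundamental_theorem_of_calculus)
       (auto intro!: derivative_eq_intros simp flip: has_real_derivative_iff_has_vector_derivative
          simp: field_simps power2_eq_square)
  then have "fejer a x = ((1 - a / a) * sin (a * x) / x - cos (a * x) / (a * x\<^sup>2))
      - ((1 - 0 / a) * sin (0 * x) / x - cos (0 * x) / (a * x\<^sup>2))"
    unfolding fejer_def by (rule integral_unique)
  then show ?thesis
    using assms by (simp add: field_simps)
qed

lemma fejer_upper_at_0:
  assumes "a > 0"
  shows "\<bar>fejer a x\<bar> \<le> a / 2"
proof -
  have i: "((\<lambda>w. 1 - w / a) has_integral (a - a\<^sup>2 / (2 * a)) - (0 - 0\<^sup>2 / (2 * a))) {0..a}"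
    using assms
    by (intro fundamental_theorem_of_calculus)
       (auto intro!: derivative_eq_intros simp flip: has_real_derivative_iff_has_vector_derivative
          simp: field_simps)
  have "norm (fejer a x) \<le> integral {0..a} (\<lambda>w. 1 - w / a)"
    unfolding fejer_def
  proof (rule integral_norm_bound_integral)
    show "(\<lambda>w. (1 - w / a) * cos (w * x)) integrable_on {0..a}"
      using assms by (intro integrable_continuous_real continuous_intros) auto
    fix w assume "w \<in> {0..a}"
    then show "norm ((1 - w / a) * cos (w * x)) \<le> 1 - w / a"
      using assms by (auto simp: abs_mult mult_left_le)
  qed (use i in auto)
  with i assms show ?thesis by (simp add: integral_unique power2_eq_square)
qed

lemma fejer_nonneg: "a > 0 \<Longrightarrow> 0 \<le> fejer a x"
proof (cases "x = 0")
  case True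
  assume "a > 0"
  then show ?thesis unfolding fejer_def True by (intro integral_nonneg integrable_continuous_real continuous_intros) auto
qed (auto simp: fejer_eq)

text \<open>The Cauchy kernel on the right has integral at most pi whatever \<open>a\<close> is, so
  this amounts to an L1 bound uniform in \<open>a\<close>. Below (ax)^2 = 4 the bound a/2 suffices,
  above it the closed form.\<close>

lemma fejer_bound:
  assumes "a > 0"
  shows "fejer a x \<le> 5 / 2 * (a / (1 + (a * x)\<^sup>2))"
proof -
  have pos: "1 + (a * x)\<^sup>2 > 0" by (smt (verit) zero_le_power2)
  show ?thesis
  proof (cases "(a * x)\<^sup>2 \<le> 4")
    case True
    have "fejer a x * (1 + (a * x)\<^sup>2) \<le> a / 2 * 5"
      using fejer_upper_at_0[OF assms, of x] True assms pos by (intro mult_mono) auto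
    then show ?thesis using pos by (simp add: field_simps)
  next
    case False
    then have x: "x \<noteq> 0" by auto
    have "fejer a x \<le> 2 / (a * x\<^sup>2)"
      unfolding fejer_eq[OF assms x] using assms cos_ge_minus_one[of "a * x"]
      by (intro divide_right_mono) auto
    also have "\<dots> = 2 * a / (a * x)\<^sup>2"
      using assms x by (simp add: field_simps power2_eq_square)
    also have "2 * a / Y \<le> 5 / 2 * (a / (1 + Y))" if "Y > 4" for Y
      using that assms by (simp add: field_simps)
    then have "2 * a / (a * x)\<^sup>2 \<le> 5 / 2 * (a / (1 + (a * x)\<^sup>2))"
      using False by simp
    finally show ?thesis .
  qed
qed

lemma fejer_has_derivative:
  assumes "a > 0"
  shows "(fejer a has_real_derivative fejer_deriv a x) (at x)"
proof -
  have "((\<lambda>x. integral (cbox 0 a) (\<lambda>w. (1 - w / a) * cos (w * x))) has_vector_derivative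
      integral (cbox 0 a) (\<lambda>w. - ((1 - w / a) * w * sin (w * x)))) (at x within UNIV)"
    using assms
    by (intro leibniz_rule_vector_derivative)
       (auto intro!: derivative_eq_intros integrable_continuous_real continuous_intros
          simp: split_beta simp flip: has_real_derivative_iff_has_vector_derivative)
  then show ?thesis
    by (simp add: fejer_def[abs_def] fejer_deriv_def has_real_derivative_iff_has_vector_derivative)
qed

lemma fejer_continuous: "a > 0 \<Longrightarrow> continuous_on S (fejer a)"
  by (meson DERIV_continuous_on fejer_has_derivative has_field_derivative_at_within)

lemma fejer_deriv_continuous: "a > 0 \<Longrightarrow> continuous_on S (fejer_deriv a)"
proof -
  assume "a > 0"
  then have "continuous_on UNIV (\<lambda>x. integral (cbox 0 a) (\<lambda>w. - ((1 - w / a) * w * sin (w * x))))"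
    by (intro integral_continuous_on_param) (auto intro!: continuous_intros simp: split_beta)
  then show ?thesis
    unfolding fejer_deriv_def[abs_def] by (auto intro: continuous_on_subset)
qed

text \<open>For |ax| \<le> 1 the integral is estimated directly; elsewhere the closed form
  \<open>fejer_eq\<close> is differentiated, away from its singularity at 0. The extra factor
  \<open>a\<close> is the usual cost of a derivative at this scale.\<close>

lemma fejer_deriv_bound:
  assumes "a > 0"
  shows "\<bar>fejer_deriv a x\<bar> \<le> 10 * (a * (a / (1 + (a * x)\<^sup>2)))"
proof -
  have pos: "1 + (a * x)\<^sup>2 > 0" by (smt (verit) zero_le_power2)
  show ?thesis
  proof (cases "\<bar>a * x\<bar> \<le> 1")
    case True
    have "norm (fejer_deriv a x) \<le> a * (a - 0)"
      unfolding fejer_deriv_def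
    proof (rule integral_bound)
      fix w assume w: "w \<in> {0..a}"
      have "\<bar>(1 - w / a) * w * sin (w * x)\<bar> \<le> 1 * a * 1"
        unfolding abs_mult using w assms by (intro mult_mono) auto
      then show "norm (- ((1 - w / a) * w * sin (w * x))) \<le> a" by simp
    qed (use assms in \<open>auto intro!: continuous_intros\<close>)
    moreover have "(a * x)\<^sup>2 \<le> 1" using True by (simp add: abs_square_le_1)
    then have "a * a \<le> 10 * (a * (a / (1 + (a * x)\<^sup>2)))"
      using assms pos by (simp add: field_simps)
    ultimately show ?thesis by simp
  next
    case False
    then have x: "x \<noteq> 0" and ax: "(a * x)\<^sup>2 \<ge> 1"
      using abs_square_less_1[of "a * x"] by (force, linarith)
    have "((\<lambda>x. (1 - cos (a * x)) / (a * x\<^sup>2)) has_real_derivative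
        sin (a * x) / x\<^sup>2 - 2 * (1 - cos (a * x)) / (a * x ^ 3)) (at x)"
      using assms x by (auto intro!: derivative_eq_intros simp: field_simps power2_eq_square power3_eq_cube)
    moreover have "\<forall>\<^sub>F y in nhds x. (1 - cos (a * y)) / (a * y\<^sup>2) = fejer a y"
      using t1_space_nhds[OF x] by eventually_elim (use assms in \<open>simp add: fejer_eq\<close>)
    ultimately have "(fejer a has_real_derivative
        sin (a * x) / x\<^sup>2 - 2 * (1 - cos (a * x)) / (a * x ^ 3)) (at x)"
      by (subst (asm) DERIV_cong_ev[OF refl _ refl]) auto
    then have eq: "fejer_deriv a x = sin (a * x) / x\<^sup>2 - 2 * (1 - cos (a * x)) / (a * x ^ 3)"
      using fejer_has_derivative[OF assms] DERIV_unique by blast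
    have 1: "\<bar>sin (a * x) / x\<^sup>2\<bar> \<le> 1 / x\<^sup>2"
      using abs_sin_le_one by (simp add: abs_divide divide_right_mono)
    have "\<bar>2 * (1 - cos (a * x)) / (a * x ^ 3)\<bar> = 2 * (1 - cos (a * x)) / (\<bar>a * x\<bar> * x\<^sup>2)"
      using assms by (simp add: abs_divide abs_mult power2_eq_square power3_eq_cube mult.assoc)
    also have "\<dots> \<le> 4 / (1 * x\<^sup>2)"
    proof (intro frac_le mult_right_mono)
      have "2 * (1 - c) \<le> 4" if "- 1 \<le> c" for c :: real using that by simp
      then show "2 * (1 - cos (a * x)) \<le> 4" using cos_ge_minus_one by blast
    qed (use False x in auto)
    finally have "\<bar>fejer_deriv a x\<bar> \<le> 1 / x\<^sup>2 + 4 / (1 * x\<^sup>2)"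
      unfolding eq using 1 by (intro order_trans[OF abs_triangle_ineq4] add_mono)
    then have 2: "\<bar>fejer_deriv a x\<bar> \<le> 5 / x\<^sup>2" by simp
    have "5 * c / Y \<le> 10 * (c / (1 + Y))" if "Y \<ge> 1" "c \<ge> 0" for c Y :: real
      using that mult_left_mono[of 1 Y c] by (simp add: field_simps)
    then have "5 * (a * a) / (a * x)\<^sup>2 \<le> 10 * (a * a / (1 + (a * x)\<^sup>2))"
      using ax assms by simp
    moreover have "5 * (a * a) / (a * x)\<^sup>2 = 5 / x\<^sup>2"
      using assms x by (simp add: field_simps power2_eq_square)
    ultimately have "5 / x\<^sup>2 \<le> 10 * (a * (a / (1 + (a * x)\<^sup>2)))" by simp
    with 2 show ?thesis by linarith
  qed
qed

lemma integral_cauchy_kernel: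
  fixes a :: real
  assumes "a > 0" "p \<le> q"
  shows "(\<lambda>s. a / (1 + (a * (t - s))\<^sup>2)) integrable_on {p..q}"
    and "integral {p..q} (\<lambda>s. a / (1 + (a * (t - s))\<^sup>2)) \<le> pi"
proof -
  have "((\<lambda>s. a / (1 + (a * (t - s))\<^sup>2)) has_integral
      - arctan (a * (t - q)) - - arctan (a * (t - p))) {p..q}"
    using assms
    by (intro fundamental_theorem_of_calculus)
       (auto intro!: derivative_eq_intros simp flip: has_real_derivative_iff_has_vector_derivative
          simp: inverse_eq_divide)
  then show "(\<lambda>s. a / (1 + (a * (t - s))\<^sup>2)) integrable_on {p..q}"
    and "integral {p..q} (\<lambda>s. a / (1 + (a * (t - s))\<^sup>2)) \<le> pi"
    using arctan_ubound[of "a * (t - p)"] arctan_lbound[of "a * (t - q)"]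
    by (auto simp: integral_unique dest: has_integral_integrable)
qed

section \<open>De la Vallee Poussin kernel: its transform is 1 up to \<open>a\<close> and falls
  linearly to 0 at 2a\<close>

definition vallee_poussin :: "real \<Rightarrow> real \<Rightarrow> real" where
  "vallee_poussin a x = 2 * fejer (2 * a) x - fejer a x"

definition vallee_poussin_deriv :: "real \<Rightarrow> real \<Rightarrow> real" where
  "vallee_poussin_deriv a x = 2 * fejer_deriv (2 * a) x - fejer_deriv a x"

lemma vallee_poussin_has_derivative:
  "a > 0 \<Longrightarrow> (vallee_poussin a has_real_derivative vallee_poussin_deriv a x) (at x)"
  unfolding vallee_poussin_def[abs_def] vallee_poussin_deriv_def
  by (auto intro!: derivative_eq_intros fejer_has_derivative)

lemma vallee_poussin_continuous: "a > 0 \<Longrightarrow> continuous_on S (vallee_poussin a)"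
  unfolding vallee_poussin_def[abs_def] by (intro continuous_intros fejer_continuous) auto

lemma vallee_poussin_deriv_continuous: "a > 0 \<Longrightarrow> continuous_on S (vallee_poussin_deriv a)"
  unfolding vallee_poussin_deriv_def[abs_def] by (intro continuous_intros fejer_deriv_continuous) auto

lemma cauchy_kernel_double:
  fixes a :: real
  assumes "a > 0"
  shows "2 * a / (1 + (2 * a * x)\<^sup>2) \<le> 2 * (a / (1 + (a * x)\<^sup>2))"
proof -
  have "1 + (a * x)\<^sup>2 \<le> 1 + (2 * a * x)\<^sup>2" "0 < 1 + (a * x)\<^sup>2"
    by (simp_all add: power_mult_distrib add_pos_nonneg)
  then have "2 * a / (1 + (2 * a * x)\<^sup>2) \<le> 2 * a / (1 + (a * x)\<^sup>2)"
    using assms by (intro divide_left_mono) auto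
  then show ?thesis by simp
qed

lemma vallee_poussin_bound:
  assumes "a > 0"
  shows "\<bar>vallee_poussin a x\<bar> \<le> 15 * (a / (1 + (a * x)\<^sup>2))"
proof -
  have "0 \<le> fejer (2 * a) x" "fejer (2 * a) x \<le> 5 / 2 * (2 * a / (1 + (2 * a * x)\<^sup>2))"
    "0 \<le> fejer a x" "fejer a x \<le> 5 / 2 * (a / (1 + (a * x)\<^sup>2))"
    using assms fejer_nonneg fejer_bound[of "2 * a" x] fejer_bound[of a x] by auto
  with cauchy_kernel_double[OF assms, of x] show ?thesis
    unfolding vallee_poussin_def by linarith
qed

lemma vallee_poussin_deriv_bound:
  assumes "a > 0"
  shows "\<bar>vallee_poussin_deriv a x\<bar> \<le> 90 * (a * (a / (1 + (a * x)\<^sup>2)))"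
proof -
  have "\<bar>fejer_deriv (2 * a) x\<bar> \<le> 10 * (2 * a * (2 * a / (1 + (2 * a * x)\<^sup>2)))"
    "\<bar>fejer_deriv a x\<bar> \<le> 10 * (a * (a / (1 + (a * x)\<^sup>2)))"
    using assms fejer_deriv_bound[of "2 * a" x] fejer_deriv_bound[of a x] by auto
  moreover have "2 * a * (2 * a / (1 + (2 * a * x)\<^sup>2)) \<le> 2 * a * (2 * (a / (1 + (a * x)\<^sup>2)))"
    using assms by (intro mult_left_mono cauchy_kernel_double) auto
  moreover have "2 * a * (2 * (a / (1 + (a * x)\<^sup>2))) = 4 * (a * (a / (1 + (a * x)\<^sup>2)))" by simp
  ultimately show ?thesis
    unfolding vallee_poussin_deriv_def by linarith
qed

lemma fejer_at_0: "a > 0 \<Longrightarrow> fejer a 0 = a / 2"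
proof -
  assume a: "a > 0"
  have "((\<lambda>w. 1 - w / a) has_integral (a - a\<^sup>2 / (2 * a)) - (0 - 0\<^sup>2 / (2 * a))) {0..a}"
    using a
    by (intro fundamental_theorem_of_calculus)
       (auto intro!: derivative_eq_intros simp flip: has_real_derivative_iff_has_vector_derivative
          simp: field_simps)
  from integral_unique[OF this] a show ?thesis by (simp add: fejer_def power2_eq_square)
qed

lemma fejer_double: "a > 0 \<Longrightarrow> fejer (2 * a) x = 2 * fejer a (2 * x)"
  by (cases "x = 0") (simp_all add: fejer_eq fejer_at_0 field_simps)

text \<open>On this range |wx| \<le> 1 < pi/3, so the cosine in the integrand is at least
  1/2.\<close>

lemma fejer_lower:
  assumes "a > 0" "\<bar>a * x\<bar> \<le> 1"
  shows "a / 4 \<le> fejer a x"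
proof -
  have "a / 4 = integral {0..a} (\<lambda>w. (1 - w / a) * (1 / 2))"
    using fejer_at_0[OF assms(1)] by (simp add: fejer_def)
  also have "\<dots> \<le> fejer a x"
    unfolding fejer_def
  proof (intro integral_le integrable_continuous_real continuous_intros)
    fix w assume w: "w \<in> {0..a}"
    have "\<bar>w * x\<bar> \<le> \<bar>a * x\<bar>"
      unfolding abs_mult using w by (intro mult_right_mono) auto
    then have "\<bar>w * x\<bar> \<le> pi / 3" using assms pi_gt3 by linarith
    then have "cos (pi / 3) \<le> cos \<bar>w * x\<bar>"
      using pi_gt3 by (intro cos_monotone_0_pi_le) auto
    then show "(1 - w / a) * (1 / 2) \<le> (1 - w / a) * cos (w * x)"
      using w assms by (intro mult_left_mono) (auto simp: cos_60)
  qed (use assms in auto)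
  finally show ?thesis .
qed

text \<open>The map s to 2s - t carries [0, q] onto an interval containing [0, q] and turns the
  kernel of parameter \<open>a\<close> into that of 2a. So the Fejer mass on [0, q] does not
  decrease when \<open>a\<close> is doubled, and the mass here is at least that of a single Fejer
  kernel: height a/4 on a window of length 2/a, hence 1/2.\<close>

lemma vallee_poussin_mass:
  assumes a: "a > 0" and t: "t \<ge> 1 / a" and q: "q \<ge> t + 1 / a"
  shows "1 / 2 \<le> integral {0..q} (\<lambda>s. vallee_poussin a (t - s))"
proof -
  have a1: "1 / a > 0" using a by simp
  have t0: "t > 0" "q > t" using t q a1 by linarith+
  have int: "(\<lambda>s. fejer b (t - s)) integrable_on {c..d}" if "b > 0" for b c d
    using that by (intro integrable_continuous_real continuous_on_compose2[OF fejer_continuous[of b UNIV]]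
        continuous_intros) auto
  have "integral {0..q} (\<lambda>s. fejer a (t - s)) \<le> integral {-t..2 * q - t} (\<lambda>s. fejer a (t - s))"
    using t0 a by (intro integral_subset_le int) (auto simp: fejer_nonneg)
  also have "\<dots> = integral {0..q} (\<lambda>s. 2 * fejer a (t - (2 * s - t)))"
  proof -
    have "((\<lambda>s. 2 *\<^sub>R fejer a (t - (2 * s - t))) has_integral
        integral {2 * 0 - t..2 * q - t} (\<lambda>s. fejer a (t - s))) {0..q}"
      using t0 a
      by (intro has_integral_substitution[where c = "-t" and d = "2 * q - t"])
         (auto intro!: derivative_eq_intros continuous_on_compose2[OF fejer_continuous[of a UNIV]]
           continuous_intros)
    from integral_unique[OF this] show ?thesis by simp
  qed
  also have "\<dots> = integral {0..q} (\<lambda>s. fejer (2 * a) (t - s))"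
    using a by (intro integral_cong) (simp add: fejer_double right_diff_distrib)
  finally have le: "integral {0..q} (\<lambda>s. fejer a (t - s)) \<le> integral {0..q} (\<lambda>s. fejer (2 * a) (t - s))" .
  have "1 / 2 = integral {t - 1 / a..t + 1 / a} (\<lambda>_. a / 4)"
    using a by (simp add: field_simps)
  also have "\<dots> \<le> integral {t - 1 / a..t + 1 / a} (\<lambda>s. fejer a (t - s))"
  proof (intro integral_le int fejer_lower a)
    fix s assume "s \<in> {t - 1 / a..t + 1 / a}"
    then have "a * \<bar>t - s\<bar> \<le> a * (1 / a)" using a by (intro mult_left_mono) auto
    then show "\<bar>a * (t - s)\<bar> \<le> 1" using a by (simp add: abs_mult del: right_diff_distrib)
  qed auto
  also have "\<dots> \<le> integral {0..q} (\<lambda>s. fejer a (t - s))"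
    using t q a by (intro integral_subset_le int) (auto simp: fejer_nonneg)
  also have "\<dots> \<le> 2 * integral {0..q} (\<lambda>s. fejer (2 * a) (t - s)) - integral {0..q} (\<lambda>s. fejer a (t - s))"
    using le by simp
  also have "\<dots> = integral {0..q} (\<lambda>s. vallee_poussin a (t - s))"
    unfolding vallee_poussin_def using a by (subst integral_diff) (auto intro: int)
  finally show ?thesis .
qed

text \<open>Split at distance 1 / sqrt B from t. Inside, the Lipschitz bound makes the difference
  O(1 / sqrt B); outside, g is merely bounded but the kernel has little mass.\<close>

lemma vallee_poussin_approx:
  fixes g :: "real \<Rightarrow> real"
  assumes B: "B > 0" and t: "t \<ge> 0" and q: "q \<ge> 0"
    and g: "continuous_on {0..} g" "\<And>s. s \<ge> 0 \<Longrightarrow> \<bar>g s\<bar> \<le> M"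
    and lip: "\<And>s t. s \<ge> 0 \<Longrightarrow> t \<ge> 0 \<Longrightarrow> \<bar>g s - g t\<bar> \<le> L * \<bar>s - t\<bar>" and L: "L \<ge> 0"
  shows "\<bar>integral {0..q} (\<lambda>s. vallee_poussin B (t - s) * (g s - g t))\<bar> \<le> (15 * pi * L + 60 * pi * M) / sqrt B"
proof -
  have M: "M \<ge> 0" using g(2)[of 0] by simp
  define R where "R = sqrt B"
  have R: "R > 0" "R * R = B" using B by (auto simp: R_def)
  define h where "h s = 15 * (L / R) * (B / (1 + (B * (t - s))\<^sup>2)) + 60 * M / R * (R / (1 + (R * (t - s))\<^sup>2))" for s
  have hint: "h integrable_on {0..q}"
    unfolding h_def using B R q by (intro integrable_add integrable_on_mult_right integral_cauchy_kernel) auto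
  have "norm (integral {0..q} (\<lambda>s. vallee_poussin B (t - s) * (g s - g t))) \<le> integral {0..q} h"
  proof (rule integral_norm_bound_integral[OF _ hint])
    show "(\<lambda>s. vallee_poussin B (t - s) * (g s - g t)) integrable_on {0..q}"
      using B by (intro integrable_continuous_real continuous_intros
          continuous_on_compose2[OF vallee_poussin_continuous[of B UNIV]] continuous_on_subset[OF g(1)]) auto
    fix s assume s: "s \<in> {0..q}"
    have vp: "\<bar>vallee_poussin B (t - s)\<bar> \<le> 15 * (B / (1 + (B * (t - s))\<^sup>2))"
      by (rule vallee_poussin_bound[OF B])
    have pos: "0 < 1 + (B * (t - s))\<^sup>2" "0 < 1 + (R * (t - s))\<^sup>2" by (simp_all add: add_pos_nonneg)
    show "norm (vallee_poussin B (t - s) * (g s - g t)) \<le> h s"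
    proof (cases "\<bar>t - s\<bar> \<le> 1 / R")
      case True
      have "\<bar>g s - g t\<bar> \<le> L * \<bar>s - t\<bar>" using s t by (intro lip) auto
      also have "\<dots> \<le> L * (1 / R)" using True L by (intro mult_left_mono) auto
      finally have "\<bar>vallee_poussin B (t - s)\<bar> * \<bar>g s - g t\<bar> \<le> 15 * (B / (1 + (B * (t - s))\<^sup>2)) * (L * (1 / R))"
        using vp L R B pos by (intro mult_mono) auto
      moreover have "0 \<le> 60 * M / R * (R / (1 + (R * (t - s))\<^sup>2))" using M R pos by simp
      ultimately show ?thesis by (simp add: h_def abs_mult mult.commute mult.left_commute)
    next
      case False
      then have "1 < R * \<bar>t - s\<bar>" using R by (simp add: field_simps)
      then have "1 < (R * \<bar>t - s\<bar>)\<^sup>2" by (smt (verit) one_less_power pos2)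
      moreover have "R\<^sup>2 = B" using R by (simp add: power2_eq_square)
      ultimately have *: "1 < B * (t - s)\<^sup>2" by (simp add: power_mult_distrib)
      \<comment> \<open>Since B (t - s)^2 > 1, the Cauchy kernel of rate B is at most 2 / (1 + (R (t
        - s))^2); integrating that gives the factor 1 / R.\<close>
      have "B * (1 + B * (t - s)\<^sup>2) \<le> 2 * (1 + (B * (t - s))\<^sup>2)"
      proof -
        have "B * 1 \<le> B * (B * (t - s)\<^sup>2)" using * B by (intro mult_left_mono) auto
        then show ?thesis by (simp add: algebra_simps power2_eq_square)
      qed
      moreover have RB: "(R * (t - s))\<^sup>2 = B * (t - s)\<^sup>2" using R by (simp add: power_mult_distrib power2_eq_square)
      ultimately have "B / (1 + (B * (t - s))\<^sup>2) \<le> 2 / (1 + (R * (t - s))\<^sup>2)"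
        using pos by (simp add: field_simps)
      with vp have "\<bar>vallee_poussin B (t - s)\<bar> \<le> 30 / (1 + (R * (t - s))\<^sup>2)" by simp
      moreover have "\<bar>g s - g t\<bar> \<le> 2 * M" using g(2)[of s] g(2)[of t] s t by auto
      ultimately have "\<bar>vallee_poussin B (t - s)\<bar> * \<bar>g s - g t\<bar> \<le> 30 / (1 + (R * (t - s))\<^sup>2) * (2 * M)"
        using pos by (intro mult_mono) auto
      moreover have "0 \<le> 15 * (L / R) * (B / (1 + (B * (t - s))\<^sup>2))" using L R B pos by simp
      ultimately show ?thesis using R by (simp add: h_def abs_mult)
    qed
  qed
  also have "integral {0..q} h = 15 * (L / R) * integral {0..q} (\<lambda>s. B / (1 + (B * (t - s))\<^sup>2))
      + 60 * M / R * integral {0..q} (\<lambda>s. R / (1 + (R * (t - s))\<^sup>2))"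
    unfolding h_def using B R q
    by (subst integral_add) (auto intro!: integrable_on_mult_right integral_cauchy_kernel simp: integral_mult_right
        simp del: times_divide_eq_right)
  also have "\<dots> \<le> 15 * (L / R) * pi + 60 * M / R * pi"
    using L M R B q by (intro add_mono mult_left_mono integral_cauchy_kernel) auto
  finally show ?thesis by (simp add: R_def algebra_simps add_divide_distrib)
qed

text \<open>Integration by parts puts the derivative on the kernel, whose derivative has L1 norm
  O(e). A bounded primitive therefore leaves only O(e) at frequencies below \<open>e\<close>; this
  is how the exceptional frequency 0 is discarded.\<close>

lemma vallee_poussin_low:
  fixes g :: "real \<Rightarrow> real"
  assumes e: "e > 0" and q: "q \<ge> 0"
    and g: "continuous_on {0..} g" "\<And>s. s \<ge> 0 \<Longrightarrow> \<bar>integral {0..s} g\<bar> \<le> W"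
  shows "\<bar>integral {0..q} (\<lambda>s. vallee_poussin e (t - s) * g s)\<bar> \<le> (15 + 90 * pi) * W * e"
proof -
  have W: "W \<ge> 0" using g(2)[of 0] by simp
  define G where "G s = integral {0..s} g" for s
  have gc: "continuous_on {0..q} g" by (rule continuous_on_subset[OF g(1)]) auto
  have Gd: "(G has_vector_derivative g s) (at s within {0..q})" if "s \<in> {0..q}" for s
    unfolding G_def[abs_def] by (rule integral_has_vector_derivative[OF gc that])
  have Gc: "continuous_on {0..q} G"
    by (rule continuous_on_vector_derivative[OF Gd])
  have vpd: "((\<lambda>s. vallee_poussin e (t - s)) has_vector_derivative - vallee_poussin_deriv e (t - s)) (at s within A)" for s A
  proof -
    have "((\<lambda>s. t - s) has_real_derivative - 1) (at s within A)" by (auto intro!: derivative_eq_intros)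
    from DERIV_chain'[OF this vallee_poussin_has_derivative[OF e]] show ?thesis
      by (simp add: has_real_derivative_iff_has_vector_derivative)
  qed
  have "((\<lambda>s. vallee_poussin e (t - s) * g s + - vallee_poussin_deriv e (t - s) * G s) has_integral
      vallee_poussin e (t - q) * G q - vallee_poussin e (t - 0) * G 0) {0..q}"
    by (rule fundamental_theorem_of_calculus[OF q], rule has_vector_derivative_mult[OF vpd Gd])
  moreover have i2: "(\<lambda>s. vallee_poussin_deriv e (t - s) * G s) integrable_on {0..q}"
    using e by (intro integrable_continuous_real continuous_intros Gc
        continuous_on_compose2[OF vallee_poussin_deriv_continuous[of e UNIV]]) auto
  ultimately have "((\<lambda>s. vallee_poussin e (t - s) * g s) has_integral
     (vallee_poussin e (t - q) * G q - vallee_poussin e (t - 0) * G 0) + integral {0..q} (\<lambda>s. vallee_poussin_deriv e (t - s) * G s)) {0..q}"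
    using has_integral_add[OF _ integrable_integral[OF i2]] by fastforce
  then have eq: "integral {0..q} (\<lambda>s. vallee_poussin e (t - s) * g s) =
      vallee_poussin e (t - q) * G q + integral {0..q} (\<lambda>s. vallee_poussin_deriv e (t - s) * G s)"
    by (simp add: integral_unique G_def)
  have "\<bar>vallee_poussin e (t - q) * G q\<bar> \<le> (15 * e) * W"
    unfolding abs_mult
  proof (intro mult_mono)
    have "e / (1 + (e * (t - q))\<^sup>2) \<le> e / 1" using e by (intro divide_left_mono) (auto simp: add_pos_nonneg)
    with vallee_poussin_bound[OF e, of "t - q"] show "\<bar>vallee_poussin e (t - q)\<bar> \<le> 15 * e" by linarith
  qed (use g q e G_def in auto)
  moreover have "norm (integral {0..q} (\<lambda>s. vallee_poussin_deriv e (t - s) * G s))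
      \<le> integral {0..q} (\<lambda>s. 90 * e * W * (e / (1 + (e * (t - s))\<^sup>2)))"
  proof (rule integral_norm_bound_integral[OF i2])
    fix s assume s: "s \<in> {0..q}"
    have "\<bar>vallee_poussin_deriv e (t - s)\<bar> * \<bar>G s\<bar> \<le> 90 * (e * (e / (1 + (e * (t - s))\<^sup>2))) * W"
      using s g(2)[of s] vallee_poussin_deriv_bound[OF e, of "t - s"] by (intro mult_mono) (auto simp: G_def)
    then show "norm (vallee_poussin_deriv e (t - s) * G s) \<le> 90 * e * W * (e / (1 + (e * (t - s))\<^sup>2))"
      by (simp add: abs_mult mult_ac)
  qed (use e q in \<open>intro integrable_on_mult_right integral_cauchy_kernel\<close>)
  moreover have "integral {0..q} (\<lambda>s. 90 * e * W * (e / (1 + (e * (t - s))\<^sup>2))) \<le> 90 * e * W * pi"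
    unfolding integral_mult_right using e W q by (intro mult_left_mono integral_cauchy_kernel) auto
  ultimately show ?thesis unfolding eq by (simp add: algebra_simps abs_le_iff)
qed

section \<open>Frequency side: trapezoids and an L2 bound for band-limited signals\<close>

definition trapezoid :: "real \<Rightarrow> real \<Rightarrow> real" where
  "trapezoid a w = 2 * max 0 (1 - w / (2 * a)) - max 0 (1 - w / a)"

lemma trapezoid_continuous: "a > 0 \<Longrightarrow> continuous_on S (trapezoid a)"
  unfolding trapezoid_def[abs_def] by (intro continuous_intros) auto

lemma trapezoid_eq_1: "a > 0 \<Longrightarrow> w \<le> a \<Longrightarrow> trapezoid a w = 1"
  by (auto simp: trapezoid_def max_def field_simps)

lemma trapezoid_bounds: "a > 0 \<Longrightarrow> w \<ge> 0 \<Longrightarrow> 0 \<le> trapezoid a w \<and> trapezoid a w \<le> 1"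
  by (auto simp: trapezoid_def max_def field_simps)

lemma fejer_eq_triangle:
  assumes "a > 0" "a \<le> A"
  shows "fejer a x = integral {0..A} (\<lambda>w. max 0 (1 - w / a) * cos (w * x))"
proof -
  let ?h = "\<lambda>w. max 0 (1 - w / a) * cos (w * x)"
  have "integral {0..A} ?h = integral {0..a} ?h + integral {a..A} ?h"
    using assms by (intro Henstock_Kurzweil_Integration.integral_combine[symmetric] integrable_continuous_real continuous_intros) auto
  also have "integral {0..a} ?h = fejer a x"
    unfolding fejer_def using assms by (intro integral_cong) (auto simp: max_def field_simps)
  also have "integral {a..A} ?h = integral {a..A} (\<lambda>_. 0)"
    using assms by (intro integral_cong) (auto simp: max_def field_simps)
  finally show ?thesis by simp
qed

lemma vallee_poussin_eq_trapezoid: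
  assumes "a > 0" "2 * a \<le> A"
  shows "vallee_poussin a x = integral {0..A} (\<lambda>w. trapezoid a w * cos (w * x))"
proof -
  let ?h = "\<lambda>b w. max 0 (1 - w / b) * cos (w * x)"
  have "vallee_poussin a x = 2 * integral {0..A} (?h (2 * a)) - integral {0..A} (?h a)"
    unfolding vallee_poussin_def using assms by (simp add: fejer_eq_triangle[of _ A])
  also have "\<dots> = integral {0..A} (\<lambda>w. 2 * ?h (2 * a) w) - integral {0..A} (?h a)" by simp
  also have "\<dots> = integral {0..A} (\<lambda>w. 2 * ?h (2 * a) w - ?h a w)"
    using assms by (intro integral_diff[symmetric] integrable_continuous_real continuous_intros) auto
  finally show ?thesis by (simp add: trapezoid_def algebra_simps)
qed

text \<open>A Schur test: exchanging the integrals turns the weight 1 - t/N into Fejer kernels in w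
  - w' and w + w', whose L1 norms do not depend on N. The sign \<sigma> lets one statement serve
  cosines (1) and sines (-1). The sum is written as - w - w' so that it has the shape t - s of
  \<open>integral_cauchy_kernel\<close>.\<close>

lemma fejer_weighted_L2:
  fixes A :: "real \<Rightarrow> real" and \<kappa> :: "real \<Rightarrow> real \<Rightarrow> real"
  assumes A: "continuous_on {0..b} A" "\<And>w. w \<in> {0..b} \<Longrightarrow> \<bar>A w\<bar> \<le> C" and b: "b \<ge> 0" and N: "N > 0"
    and \<kappa>: "continuous_on UNIV (\<lambda>(w, t). \<kappa> w t)"
    and prod: "\<And>w w' t. \<kappa> w t * \<kappa> w' t = (cos (t * (w - w')) + \<sigma> * cos (t * (- w - w'))) / 2"
    and \<sigma>: "\<bar>\<sigma>\<bar> \<le> 1"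
  shows "integral {0..N} (\<lambda>t. (1 - t / N) * (integral {0..b} (\<lambda>w. A w * \<kappa> w t))\<^sup>2) \<le> C\<^sup>2 * b * (5 / 2 * pi)"
proof -
  have C: "C \<ge> 0" using A(2)[of 0] b by auto
  define X where "X t = integral {0..b} (\<lambda>w. A w * \<kappa> w t)" for t
  note \<kappa>c = continuous_on_compose2[OF \<kappa>, unfolded split_beta]
  have \<kappa>cI: "continuous_on S (\<lambda>x. \<kappa> (p x) (q x))" if "continuous_on S p" "continuous_on S q" for S :: "'a::topological_space set" and p q
    using \<kappa>c[of S "\<lambda>x. (p x, q x)"] that by (auto intro: continuous_on_Pair)
  have \<kappa>cI2: "continuous_on S (\<lambda>x. \<kappa> (p x) (q x))" if "continuous_on S p" "continuous_on S q" for S :: "(real \<times> real) set" and p q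
    using \<kappa>c[of S "\<lambda>x. (p x, q x)"] that by (auto intro: continuous_on_Pair)
  have Ac: "continuous_on S (\<lambda>x. A (p x))" if "continuous_on S p" "p ` S \<subseteq> {0..b}" for S :: "'a::topological_space set" and p
    using continuous_on_compose2[OF A(1)] that by auto
  have Ac2: "continuous_on S (\<lambda>x. A (p x))" if "continuous_on S p" "p ` S \<subseteq> {0..b}" for S :: "(real \<times> real) set" and p
    using continuous_on_compose2[OF A(1)] that by auto
  have Xc: "continuous_on S X" for S
  proof -
    have "continuous_on UNIV (\<lambda>t. integral (cbox 0 b) (\<lambda>w. A w * \<kappa> w t))"
      by (intro integral_continuous_on_param) (auto simp: split_beta intro!: continuous_intros \<kappa>cI2 Ac2)
    then show ?thesis by (auto simp: X_def[abs_def] intro: continuous_on_subset)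
  qed
  have Xc2: "continuous_on S (\<lambda>x. X (p x))" if "continuous_on S p" for S :: "(real \<times> real) set" and p
    using continuous_on_compose2[OF Xc[of UNIV]] that by auto
  \<comment> \<open>\<open>Y\<close> is the weighted transform of \<open>X\<close> back to
    frequency. The quantity to be bounded becomes the integral of A w * Y w over [0, b], and both
    factors are bounded pointwise.\<close>
  define Y where "Y w = integral {0..N} (\<lambda>t. (1 - t / N) * X t * \<kappa> w t)" for w
  have Yc: "continuous_on S Y" for S
  proof -
    have "continuous_on UNIV (\<lambda>w. integral (cbox 0 N) (\<lambda>t. (1 - t / N) * X t * \<kappa> w t))"
      using N by (intro integral_continuous_on_param) (auto simp: split_beta intro!: continuous_intros \<kappa>cI2 Xc2)
    then show ?thesis by (auto simp: Y_def[abs_def] intro: continuous_on_subset)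
  qed
  have Y: "Y w = integral {0..b} (\<lambda>w'. A w' * ((fejer N (w - w') + \<sigma> * fejer N (- w - w')) / 2))" for w
  proof -
    have "Y w = integral (cbox 0 N) (\<lambda>t. integral (cbox 0 b) (\<lambda>w'. (1 - t / N) * \<kappa> w t * (A w' * \<kappa> w' t)))"
      unfolding Y_def X_def by (simp add: mult_ac flip: integral_mult_right)
    also have "\<dots> = integral (cbox 0 b) (\<lambda>w'. integral (cbox 0 N) (\<lambda>t. (1 - t / N) * \<kappa> w t * (A w' * \<kappa> w' t)))"
      using N by (intro integral_swap_continuous)
        (auto simp: split_beta cbox_Pair_eq intro!: continuous_intros \<kappa>cI2 Ac2)
    also have "\<dots> = integral {0..b} (\<lambda>w'. A w' * ((fejer N (w - w') + \<sigma> * fejer N (- w - w')) / 2))"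
      unfolding cbox_interval
    proof (rule integral_cong)
      fix w'
      have "integral {0..N} (\<lambda>t. (1 - t / N) * \<kappa> w t * (A w' * \<kappa> w' t))
        = integral {0..N} (\<lambda>t. A w' / 2 * ((1 - t / N) * cos (t * (w - w')) + \<sigma> * ((1 - t / N) * cos (t * (- w - w')))))"
      proof (rule integral_cong)
        fix t
        have "(1 - t / N) * \<kappa> w t * (A w' * \<kappa> w' t) = A w' * (1 - t / N) * (\<kappa> w t * \<kappa> w' t)" by simp
        then show "(1 - t / N) * \<kappa> w t * (A w' * \<kappa> w' t) = A w' / 2 * ((1 - t / N) * cos (t * (w - w')) + \<sigma> * ((1 - t / N) * cos (t * (- w - w'))))"
          unfolding prod by (simp add: field_simps)
      qed
      also have "\<dots> = A w' / 2 * (fejer N (w - w') + \<sigma> * fejer N (- w - w'))"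
        unfolding fejer_def integral_mult_right using N
        by (subst integral_add) (auto intro!: integrable_continuous_real continuous_intros)
      finally show "integral {0..N} (\<lambda>t. (1 - t / N) * \<kappa> w t * (A w' * \<kappa> w' t)) = A w' * ((fejer N (w - w') + \<sigma> * fejer N (- w - w')) / 2)"
        by simp
    qed
    finally show ?thesis .
  qed
  have fc: "continuous_on S (\<lambda>s. fejer N (w - s))" for w S
    using N by (intro continuous_on_compose2[OF fejer_continuous[of N UNIV]] continuous_intros) auto
  have Ybound: "\<bar>Y w\<bar> \<le> C * (5 / 2 * pi)" for w
  proof -
    have "norm (Y w) \<le> integral {0..b} (\<lambda>w'. C * (5 / 4) * (N / (1 + (N * (w - w'))\<^sup>2)) + C * (5 / 4) * (N / (1 + (N * (- w - w'))\<^sup>2)))"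
      unfolding Y
    proof (rule integral_norm_bound_integral)
      show "(\<lambda>w'. A w' * ((fejer N (w - w') + \<sigma> * fejer N (- w - w')) / 2)) integrable_on {0..b}"
        by (intro integrable_continuous_real continuous_intros A fc) auto
      show "(\<lambda>w'. C * (5 / 4) * (N / (1 + (N * (w - w'))\<^sup>2)) + C * (5 / 4) * (N / (1 + (N * (- w - w'))\<^sup>2))) integrable_on {0..b}"
        using N b by (intro integrable_add integrable_on_mult_right integral_cauchy_kernel)
      fix w' assume w': "w' \<in> {0..b}"
      have "\<bar>\<sigma> * fejer N (- w - w')\<bar> \<le> 1 * fejer N (- w - w')"
        unfolding abs_mult using \<sigma> fejer_nonneg[OF N] by (intro mult_mono) auto
      then have "\<bar>(fejer N (w - w') + \<sigma> * fejer N (- w - w')) / 2\<bar> \<le> 5 / 4 * (N / (1 + (N * (w - w'))\<^sup>2)) + 5 / 4 * (N / (1 + (N * (- w - w'))\<^sup>2))"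
      proof -
        have "\<bar>(p + q) / 2\<bar> \<le> 5 / 4 * u + 5 / 4 * v"
          if "0 \<le> p" "p \<le> 5 / 2 * u" "\<bar>q\<bar> \<le> 1 * r" "r \<le> 5 / 2 * v" for p q r u v :: real
        proof -
          have "\<bar>p + q\<bar> \<le> p + r" using that by linarith
          also have "\<dots> \<le> 5 / 2 * u + 5 / 2 * v" using that by linarith
          finally show ?thesis by simp
        qed
        then show ?thesis
          using \<open>\<bar>\<sigma> * fejer N (- w - w')\<bar> \<le> 1 * fejer N (- w - w')\<close>
          by (meson N fejer_nonneg fejer_bound)
      qed
      then have "\<bar>A w'\<bar> * \<bar>(fejer N (w - w') + \<sigma> * fejer N (- w - w')) / 2\<bar> \<le> C * (5 / 4 * (N / (1 + (N * (w - w'))\<^sup>2)) + 5 / 4 * (N / (1 + (N * (- w - w'))\<^sup>2)))"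
        using A(2)[OF w'] C by (intro mult_mono) auto
      then show "norm (A w' * ((fejer N (w - w') + \<sigma> * fejer N (- w - w')) / 2)) \<le> C * (5 / 4) * (N / (1 + (N * (w - w'))\<^sup>2)) + C * (5 / 4) * (N / (1 + (N * (- w - w'))\<^sup>2))"
        by (simp only: real_norm_def abs_mult distrib_left mult.assoc)
    qed
    also have "\<dots> = C * (5 / 4) * integral {0..b} (\<lambda>w'. N / (1 + (N * (w - w'))\<^sup>2)) + C * (5 / 4) * integral {0..b} (\<lambda>w'. N / (1 + (N * (- w - w'))\<^sup>2))"
      using N b by (subst integral_add) (auto intro!: integrable_on_mult_right integral_cauchy_kernel simp del: times_divide_eq_right simp: integral_mult_right)
    also have "\<dots> \<le> C * (5 / 4) * pi + C * (5 / 4) * pi"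
      using N b C by (intro add_mono mult_left_mono integral_cauchy_kernel) auto
    finally show ?thesis by simp
  qed
  have "integral {0..N} (\<lambda>t. (1 - t / N) * (X t)\<^sup>2) = integral (cbox 0 N) (\<lambda>t. integral (cbox 0 b) (\<lambda>w. (1 - t / N) * X t * (A w * \<kappa> w t)))"
    by (subst (1) integral_mult_right) (simp add: X_def power2_eq_square mult_ac)
  also have "\<dots> = integral (cbox 0 b) (\<lambda>w. integral (cbox 0 N) (\<lambda>t. (1 - t / N) * X t * (A w * \<kappa> w t)))"
    using N by (intro integral_swap_continuous)
      (auto simp: split_beta cbox_Pair_eq intro!: continuous_intros \<kappa>cI2 Ac2 Xc2)
  also have "\<dots> = integral {0..b} (\<lambda>w. A w * Y w)"
    by (simp add: Y_def mult_ac flip: integral_mult_right)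
  also have "\<dots> \<le> norm (integral {0..b} (\<lambda>w. A w * Y w))" by simp
  also have "\<dots> \<le> (C * (C * (5 / 2 * pi))) * (b - 0)"
  proof (rule integral_bound[OF b])
    show "continuous_on {0..b} (\<lambda>w. A w * Y w)" by (intro continuous_intros A Yc)
    show "norm (A w * Y w) \<le> C * (C * (5 / 2 * pi))" if "w \<in> {0..b}" for w
      unfolding real_norm_def abs_mult using A(2)[OF that] Ybound[of w] C by (intro mult_mono) auto
  qed
  finally show ?thesis by (simp add: X_def power2_eq_square mult_ac)
qed

text \<open>Damping shifts the Laplace transform to the line of real part \<open>d\<close>. The
  point is that every constant in the conclusion is free of \<open>d\<close>.\<close>

lemma exp_damped_bounds:
  fixes f :: "real \<Rightarrow> real"
  assumes d: "0 < d" "d \<le> 1"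
    and f: "continuous_on {0..} f" "\<And>s. s \<ge> 0 \<Longrightarrow> \<bar>f s\<bar> \<le> M"
    and lip: "\<And>s t. s \<ge> 0 \<Longrightarrow> t \<ge> 0 \<Longrightarrow> \<bar>f s - f t\<bar> \<le> L * \<bar>s - t\<bar>" and L: "L \<ge> 0"
    and prim: "\<And>s. s \<ge> 0 \<Longrightarrow> \<bar>integral {0..s} f\<bar> \<le> W"
  defines "g \<equiv> \<lambda>s. exp (- d * s) * f s"
  shows "continuous_on {0..} g" "\<And>s. s \<ge> 0 \<Longrightarrow> \<bar>g s\<bar> \<le> M"
    and "\<And>s t. s \<ge> 0 \<Longrightarrow> t \<ge> 0 \<Longrightarrow> \<bar>g s - g t\<bar> \<le> (L + M) * \<bar>s - t\<bar>"
    and "\<And>s. s \<ge> 0 \<Longrightarrow> \<bar>integral {0..s} g\<bar> \<le> 2 * W"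
proof -
  have M: "M \<ge> 0" using f(2)[of 0] by simp
  have W: "W \<ge> 0" using prim[of 0] by simp
  have e1: "exp (- d * s) \<le> 1" if "s \<ge> 0" for s using d that by simp
  show "continuous_on {0..} g" unfolding g_def by (intro continuous_intros f)
  show "\<bar>g s\<bar> \<le> M" if "s \<ge> 0" for s
    unfolding g_def abs_mult abs_exp_cancel using f(2)[OF that] e1[OF that] mult_mono[of "exp (- d * s)" 1 "\<bar>f s\<bar>" M] by simp
  have ediff: "\<bar>exp (- d * s) - exp (- d * t)\<bar> \<le> \<bar>s - t\<bar>" if "s \<ge> 0" "t \<ge> 0" for s t
  proof -
    have *: "exp (- d * s) - exp (- d * t) \<le> t - s" if "0 \<le> s" "s \<le> t" for s t
    proof -
      have "exp (- d * s) - exp (- d * t) = exp (- d * s) * (1 - exp (- d * (t - s)))"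
        by (simp add: algebra_simps flip: exp_add)
      also have "\<dots> \<le> 1 * (d * (t - s))"
        using e1[of s] exp_ge_add_one_self[of "- d * (t - s)"] that d by (intro mult_mono) auto
      also have "\<dots> \<le> 1 * (1 * (t - s))"
        using d that by (intro mult_mono) auto
      finally show ?thesis by simp
    qed
    have **: "exp (- d * t) \<le> exp (- d * s)" if "s \<le> t" for s t using d that by simp
    show ?thesis
      using *[of s t] *[of t s] **[of s t] **[of t s] that by (cases "s \<le> t") auto
  qed
  show "\<bar>g s - g t\<bar> \<le> (L + M) * \<bar>s - t\<bar>" if st: "s \<ge> 0" "t \<ge> 0" for s t
  proof -
    have "g s - g t = exp (- d * s) * (f s - f t) + f t * (exp (- d * s) - exp (- d * t))"
      by (simp add: g_def algebra_simps)
    also have "\<bar>\<dots>\<bar> \<le> exp (- d * s) * \<bar>f s - f t\<bar> + \<bar>f t\<bar> * \<bar>exp (- d * s) - exp (- d * t)\<bar>"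
      by (rule order_trans[OF abs_triangle_ineq]) (simp add: abs_mult)
    also have "\<dots> \<le> 1 * (L * \<bar>s - t\<bar>) + M * \<bar>s - t\<bar>"
      using st e1 lip ediff f(2) M by (intro add_mono mult_mono) auto
    finally show ?thesis by (simp add: algebra_simps)
  qed
  show "\<bar>integral {0..s} g\<bar> \<le> 2 * W" if s: "s \<ge> 0" for s
  proof -
    define F where "F r = integral {0..r} f" for r
    have fc: "continuous_on {0..s} f" by (rule continuous_on_subset[OF f(1)]) auto
    have Fd: "(F has_vector_derivative f r) (at r within {0..s})" if "r \<in> {0..s}" for r
      unfolding F_def[abs_def] by (rule integral_has_vector_derivative[OF fc that])
    have Fc: "continuous_on {0..s} F" by (rule continuous_on_vector_derivative[OF Fd])
    have ed: "((\<lambda>r. exp (- d * r)) has_vector_derivative - d * exp (- d * r)) (at r within {0..s})" for r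
      by (auto intro!: derivative_eq_intros simp flip: has_real_derivative_iff_has_vector_derivative)
    \<comment> \<open>Integration by parts against the primitive \<open>F\<close>: the boundary
      weight exp(-ds) and the integral of d exp(-dr) add up to 1, so the bound W survives for every
      \<open>d\<close>.\<close>
    have "((\<lambda>r. exp (- d * r) * f r + (- d * exp (- d * r)) * F r) has_integral
        exp (- d * s) * F s - exp (- d * 0) * F 0) {0..s}"
      by (rule fundamental_theorem_of_calculus[OF s], rule has_vector_derivative_mult[OF ed Fd])
    moreover have i2: "(\<lambda>r. d * exp (- d * r) * F r) integrable_on {0..s}"
      by (intro integrable_continuous_real continuous_intros Fc)
    ultimately have "((\<lambda>r. exp (- d * r) * f r) has_integral
        (exp (- d * s) * F s - exp (- d * 0) * F 0) + integral {0..s} (\<lambda>r. d * exp (- d * r) * F r)) {0..s}"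
      using has_integral_add[OF _ integrable_integral[OF i2]] by fastforce
    then have eq: "integral {0..s} g = exp (- d * s) * F s + integral {0..s} (\<lambda>r. d * exp (- d * r) * F r)"
      by (simp add: g_def integral_unique F_def)
    have "((\<lambda>r. W * (d * exp (- d * r))) has_integral W * (- exp (- d * s) - - exp (- d * 0))) {0..s}"
      by (intro has_integral_mult_right fundamental_theorem_of_calculus s)
         (auto intro!: derivative_eq_intros simp flip: has_real_derivative_iff_has_vector_derivative)
    then have k1: "((\<lambda>r. W * (d * exp (- d * r))) has_integral W * (1 - exp (- d * s))) {0..s}" by simp
    note k = has_integral_integrable[OF k1] integral_unique[OF k1]
    have "norm (integral {0..s} (\<lambda>r. d * exp (- d * r) * F r)) \<le> integral {0..s} (\<lambda>r. W * (d * exp (- d * r)))"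
    proof (rule integral_norm_bound_integral[OF i2 k(1)])
      fix r assume "r \<in> {0..s}"
      then show "norm (d * exp (- d * r) * F r) \<le> W * (d * exp (- d * r))"
        using prim[of r] d mult_left_mono[of "\<bar>F r\<bar>" W "d * exp (- d * r)"] by (simp add: abs_mult F_def mult.commute)
    qed
    moreover have "\<bar>exp (- d * s) * F s\<bar> \<le> exp (- d * s) * W"
      unfolding abs_mult abs_exp_cancel using prim[OF s] by (intro mult_left_mono) (auto simp: F_def)
    ultimately have "\<bar>integral {0..s} g\<bar> \<le> exp (- d * s) * W + W * (1 - exp (- d * s))"
      unfolding eq k real_norm_def by (intro order_trans[OF abs_triangle_ineq] add_mono)
    then show ?thesis using W by (simp add: algebra_simps)
  qed
qed

text \<open>Ingham's Tauberian theorem with an exceptional frequency 0: bounded Laplace transforms near the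
  remaining imaginary axis put the band-passed function in \<open>L\<^sup>2\<close>, and the primitive controls low frequencies.\<close>

theorem tauberian_tendsto_zero:
  fixes f :: "real \<Rightarrow> real"
  assumes f: "continuous_on {0..} f" "\<And>s. s \<ge> 0 \<Longrightarrow> \<bar>f s\<bar> \<le> M"
    and lip: "\<And>s t. s \<ge> 0 \<Longrightarrow> t \<ge> 0 \<Longrightarrow> \<bar>f s - f t\<bar> \<le> L * \<bar>s - t\<bar>" and L: "L \<ge> 0"
    and prim: "\<And>s. s \<ge> 0 \<Longrightarrow> \<bar>integral {0..s} f\<bar> \<le> W"
    and lap: "\<And>e B. 0 < e \<Longrightarrow> e < B \<Longrightarrow> \<exists>C. \<forall>d. 0 < d \<longrightarrow> d \<le> 1 \<longrightarrow> (\<exists>q0. \<forall>q\<ge>q0. \<forall>w. e \<le> w \<longrightarrow> w \<le> B \<longrightarrow>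
        \<bar>integral {0..q} (\<lambda>s. cos (w * s) * (exp (- d * s) * f s))\<bar> \<le> C \<and>
        \<bar>integral {0..q} (\<lambda>s. sin (w * s) * (exp (- d * s) * f s))\<bar> \<le> C)"
  shows "(f \<longlongrightarrow> 0) at_top"
proof -
  have M: "M \<ge> 0" using f(2)[of 0] by simp
  have W: "W \<ge> 0" using prim[of 0] by simp
  \<comment> \<open>Only the part of |f| above \<epsilon> is followed. The kernel errors can be
    pushed below \<epsilon>, so this part is dominated by the band-passed signal; its square has a
    bounded integral, as \<open>barbalat_nonneg\<close> requires.\<close>
  have key: "((\<lambda>t. (max 0 (\<bar>f t\<bar> - \<epsilon>))\<^sup>2) \<longlongrightarrow> 0) at_top" if eps: "\<epsilon> > 0" for \<epsilon>
  proof -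
    define \<phi> where "\<phi> t = (max 0 (\<bar>f t\<bar> - \<epsilon>))\<^sup>2" for t
    define c1 where "c1 = 15 * pi * (L + M) + 60 * pi * M"
    define c2 where "c2 = (15 + 90 * pi) * (2 * W)"
    have c12: "c1 \<ge> 0" "c2 \<ge> 0" unfolding c1_def c2_def using L M W by auto
    define R where "R = 8 * c1 / \<epsilon> + 1"
    define B where "B = R\<^sup>2"
    have R: "R \<ge> 1" using c12 eps by (simp add: R_def)
    then have B: "B > 0" "sqrt B = R" by (auto simp: B_def)
    have err1: "c1 / R \<le> \<epsilon> / 8" using eps R c12 by (simp add: R_def field_simps)
    define e where "e = min (B / 2) (\<epsilon> / (8 * (c2 + 1)))"
    have e: "e > 0" "e < 2 * B" using B eps c12 by (auto simp: e_def)
    have eB: "e \<le> B" using B by (simp add: e_def)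
    have "c2 * e \<le> (c2 + 1) * (\<epsilon> / (8 * (c2 + 1)))"
      using c12 e by (intro mult_mono) (auto simp: e_def)
    also have "(c2 + 1) * (\<epsilon> / (8 * (c2 + 1))) = \<epsilon> / 8" using c12 by (simp add: field_simps)
    finally have err2: "c2 * e \<le> \<epsilon> / 8" .
    obtain C0 where C0: "\<And>d. 0 < d \<Longrightarrow> d \<le> 1 \<Longrightarrow> (\<exists>q0. \<forall>q\<ge>q0. \<forall>w. e \<le> w \<longrightarrow> w \<le> 2 * B \<longrightarrow>
        \<bar>integral {0..q} (\<lambda>s. cos (w * s) * (exp (- d * s) * f s))\<bar> \<le> C0 \<and>
        \<bar>integral {0..q} (\<lambda>s. sin (w * s) * (exp (- d * s) * f s))\<bar> \<le> C0)"
      using lap[OF e] by blast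
    define C where "C = max 0 C0"
    define D where "D = C\<^sup>2 * (2 * B) * (5 / 2 * pi)"
    have band: "integral {1 / B..N / 2} \<phi> \<le> 128 * D" if N: "N \<ge> 2 / B" for N
    proof -
      have N0: "N > 0" using N B by (smt (verit) divide_pos_pos)
      \<comment> \<open>\<open>d\<close> is tied to \<open>N\<close>, so that damping costs at most
        a factor 2 on the window considered. The transform bound \<open>C0\<close> was fixed before
        \<open>d\<close>, so the final estimate does not depend on \<open>N\<close>.\<close>
      define d where "d = min 1 (1 / (2 * N))"
      have d: "0 < d" "d \<le> 1" "d \<le> 1 / (2 * N)" using N0 by (auto simp: d_def)
      obtain q0 where q0: "\<And>q w. q \<ge> q0 \<Longrightarrow> e \<le> w \<Longrightarrow> w \<le> 2 * B \<Longrightarrow>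
        \<bar>integral {0..q} (\<lambda>s. cos (w * s) * (exp (- d * s) * f s))\<bar> \<le> C0 \<and>
        \<bar>integral {0..q} (\<lambda>s. sin (w * s) * (exp (- d * s) * f s))\<bar> \<le> C0"
        using C0[OF d(1,2)] by blast
      define q where "q = max q0 (N + 1 / B)"
      have q: "q \<ge> q0" "q \<ge> N + 1 / B" by (auto simp: q_def)
      have q00: "q \<ge> 0" using q N0 B by (smt (verit) divide_pos_pos)
      define g where "g s = exp (- d * s) * f s" for s
      have gb: "continuous_on {0..} g" "\<And>s. s \<ge> 0 \<Longrightarrow> \<bar>g s\<bar> \<le> M"
        "\<And>s t. s \<ge> 0 \<Longrightarrow> t \<ge> 0 \<Longrightarrow> \<bar>g s - g t\<bar> \<le> (L + M) * \<bar>s - t\<bar>"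
        "\<And>s. s \<ge> 0 \<Longrightarrow> \<bar>integral {0..s} g\<bar> \<le> 2 * W"
        unfolding g_def by (rule exp_damped_bounds[of d f M L W]; use d f lip L prim in simp)+
      have gc: "continuous_on S (\<lambda>x. g (p x))" if "continuous_on S p" "p ` S \<subseteq> {0..q}" for S :: "(real \<times> real) set" and p
        using continuous_on_compose2[OF gb(1)] that by force
      have gc1: "continuous_on {0..q} g" using gb(1) by (rule continuous_on_subset) auto
      \<comment> \<open>The spectrum of the difference of the two kernels. It vanishes below
        \<open>e\<close>, where no bound on the transform is available, and beyond 2B.\<close>
      define \<theta> where "\<theta> w = trapezoid B w - trapezoid e w" for w
      have \<theta>c: "continuous_on S \<theta>" for S
        unfolding \<theta>_def[abs_def] using B e by (intro continuous_intros trapezoid_continuous)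
      have \<theta>0: "\<theta> w = 0" if "w \<le> e" for w
        using that eB e B by (simp add: \<theta>_def trapezoid_eq_1)
      have \<theta>1: "\<bar>\<theta> w\<bar> \<le> 1" if "w \<ge> 0" for w
        using trapezoid_bounds[OF B(1) that] trapezoid_bounds[OF e(1) that] by (auto simp: \<theta>_def)
      define A where "A w = \<theta> w * integral {0..q} (\<lambda>s. cos (w * s) * g s)" for w
      define S where "S w = \<theta> w * integral {0..q} (\<lambda>s. sin (w * s) * g s)" for w
      have "continuous_on UNIV (\<lambda>w. integral (cbox 0 q) (\<lambda>s. cos (w * s) * g s))"
        "continuous_on UNIV (\<lambda>w. integral (cbox 0 q) (\<lambda>s. sin (w * s) * g s))"
        by (intro integral_continuous_on_param; auto simp: split_beta intro!: continuous_intros gc)+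
      then have AS: "continuous_on U A" "continuous_on U S" for U
        unfolding A_def[abs_def] S_def[abs_def]
        by (auto intro!: continuous_intros \<theta>c intro: continuous_on_subset)
      have AS_bound: "\<bar>A w\<bar> \<le> C \<and> \<bar>S w\<bar> \<le> C" if w: "w \<in> {0..2 * B}" for w
      proof (cases "w \<le> e")
        case True
        then show ?thesis by (simp add: A_def S_def \<theta>0 C_def)
      next
        case False
        then have *: "\<bar>integral {0..q} (\<lambda>s. cos (w * s) * g s)\<bar> \<le> C0" "\<bar>integral {0..q} (\<lambda>s. sin (w * s) * g s)\<bar> \<le> C0"
          using q0[OF q(1), of w] w by (auto simp: g_def)
        have "\<bar>\<theta> w\<bar> \<le> 1" using \<theta>1 w by auto
        then show ?thesis
          using mult_mono[of "\<bar>\<theta> w\<bar>" 1, OF _ *(1)] mult_mono[of "\<bar>\<theta> w\<bar>" 1, OF _ *(2)]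
          by (auto simp: A_def S_def abs_mult C_def)
      qed
      define I where "I t = integral {0..q} (\<lambda>s. (vallee_poussin B (t - s) - vallee_poussin e (t - s)) * g s)" for t
      define X where "X t = integral {0..2 * B} (\<lambda>w. A w * cos (w * t))" for t
      define Y where "Y t = integral {0..2 * B} (\<lambda>w. S w * sin (w * t))" for t
      have cosc: "continuous_on UNIV (\<lambda>w. A w * cos (w * t))" "continuous_on UNIV (\<lambda>w. S w * sin (w * t))" for t
        by (auto intro!: continuous_intros AS)
      have I: "I t = X t + Y t" for t
      proof -
        have *: "vallee_poussin B x - vallee_poussin e x = integral {0..2 * B} (\<lambda>w. \<theta> w * cos (w * x))" for x
        proof -
          have "vallee_poussin B x - vallee_poussin e x = integral {0..2 * B} (\<lambda>w. trapezoid B w * cos (w * x))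
              - integral {0..2 * B} (\<lambda>w. trapezoid e w * cos (w * x))"
            using B e eB by (simp add: vallee_poussin_eq_trapezoid[where A = "2 * B"])
          also have "\<dots> = integral {0..2 * B} (\<lambda>w. trapezoid B w * cos (w * x) - trapezoid e w * cos (w * x))"
            using B e by (intro integral_diff[symmetric] integrable_continuous_real continuous_intros trapezoid_continuous)
          finally show ?thesis by (simp add: \<theta>_def left_diff_distrib)
        qed
        have "I t = integral (cbox 0 q) (\<lambda>s. integral (cbox 0 (2 * B)) (\<lambda>w. \<theta> w * cos (w * (t - s)) * g s))"
          unfolding I_def * by simp
        also have "\<dots> = integral (cbox 0 (2 * B)) (\<lambda>w. integral (cbox 0 q) (\<lambda>s. \<theta> w * cos (w * (t - s)) * g s))"
          by (intro integral_swap_continuous)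
            (auto simp: split_beta cbox_Pair_eq intro!: continuous_intros gc continuous_on_compose2[OF \<theta>c[of UNIV]])
        also have "\<dots> = integral {0..2 * B} (\<lambda>w. A w * cos (w * t) + S w * sin (w * t))"
          unfolding cbox_interval
        proof (rule integral_cong)
          fix w
          have "integral {0..q} (\<lambda>s. \<theta> w * cos (w * (t - s)) * g s)
            = integral {0..q} (\<lambda>s. \<theta> w * cos (w * t) * (cos (w * s) * g s) + \<theta> w * sin (w * t) * (sin (w * s) * g s))"
            by (rule integral_cong) (simp add: right_diff_distrib cos_diff distrib_right distrib_left mult_ac)
          also have "\<dots> = integral {0..q} (\<lambda>s. \<theta> w * cos (w * t) * (cos (w * s) * g s)) + integral {0..q} (\<lambda>s. \<theta> w * sin (w * t) * (sin (w * s) * g s))"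
            by (intro integral_add integrable_continuous_real continuous_intros gc1)
          also have "\<dots> = A w * cos (w * t) + S w * sin (w * t)"
            unfolding integral_mult_right by (simp add: A_def S_def)
          finally show "integral {0..q} (\<lambda>s. \<theta> w * cos (w * (t - s)) * g s) = A w * cos (w * t) + S w * sin (w * t)" .
        qed
        also have "\<dots> = X t + Y t"
          unfolding X_def Y_def
          by (intro integral_add integrable_continuous_real continuous_on_subset[OF cosc(1)] continuous_on_subset[OF cosc(2)]) auto
        finally show ?thesis .
      qed
      have XYc: "continuous_on U X" "continuous_on U Y" for U
      proof -
        have "continuous_on UNIV (\<lambda>t. integral (cbox 0 (2 * B)) (\<lambda>w. A w * cos (w * t)))"
          "continuous_on UNIV (\<lambda>t. integral (cbox 0 (2 * B)) (\<lambda>w. S w * sin (w * t)))"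
          by (intro integral_continuous_on_param;
              auto simp: split_beta intro!: continuous_intros continuous_on_compose2[OF AS(1)[of UNIV]] continuous_on_compose2[OF AS(2)[of UNIV]])+
        then show "continuous_on U X" "continuous_on U Y"
          by (auto simp: X_def[abs_def] Y_def[abs_def] intro: continuous_on_subset)
      qed
      have cosm: "cos (t * (- w - w')) = cos (w * t + w' * t)" for t w w' :: real
      proof -
        have "t * (- w - w') = - (w * t + w' * t)" by (simp add: algebra_simps)
        then show ?thesis by (simp only: cos_minus)
      qed
      have cosd: "cos (t * (w - w')) = cos (w * t - w' * t)" for t w w' :: real
        by (simp only: right_diff_distrib mult.commute)
      have pc: "cos (w * t) * cos (w' * t) = (cos (t * (w - w')) + 1 * cos (t * (- w - w'))) / 2"
        and ps: "sin (w * t) * sin (w' * t) = (cos (t * (w - w')) + (- 1) * cos (t * (- w - w'))) / 2" for w w' t :: real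
        unfolding cosm by (simp_all only: cosd cos_times_cos sin_times_sin) simp_all
      have X2: "integral {0..N} (\<lambda>t. (1 - t / N) * (X t)\<^sup>2) \<le> D"
        unfolding X_def D_def
        by (rule fejer_weighted_L2[where \<kappa> = "\<lambda>w t. cos (w * t)", OF _ _ _ _ _ pc])
          (use AS AS_bound N0 B in \<open>auto simp: split_beta intro!: continuous_intros\<close>)
      have Y2: "integral {0..N} (\<lambda>t. (1 - t / N) * (Y t)\<^sup>2) \<le> D"
        unfolding Y_def D_def
        by (rule fejer_weighted_L2[where \<kappa> = "\<lambda>w t. sin (w * t)", OF _ _ _ _ _ ps])
          (use AS AS_bound N0 B in \<open>auto simp: split_beta intro!: continuous_intros\<close>)
      \<comment> \<open>The 4 is a factor 2 from the kernel mass 1/2 and a factor 2 from undoing the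
        damping; the same factors turn the two errors \<epsilon>/8 into \<epsilon>.\<close>
      have gI: "\<bar>f t\<bar> - \<epsilon> \<le> 4 * \<bar>I t\<bar>" if t: "t \<in> {1 / B..N / 2}" for t
      proof -
        have t0: "t \<ge> 0" using t B by (smt (verit) atLeastAtMost_iff divide_pos_pos)
        have qt: "q \<ge> t + 1 / B" using q t N0 by auto
        have vpc: "continuous_on U (\<lambda>s. vallee_poussin b (t - s))" if "b > 0" for b U
          using that by (intro continuous_on_compose2[OF vallee_poussin_continuous[of b UNIV]] continuous_intros) auto
        let ?m = "integral {0..q} (\<lambda>s. vallee_poussin B (t - s))"
        have m: "1 / 2 \<le> ?m" using t qt B by (intro vallee_poussin_mass) auto
        have "I t = integral {0..q} (\<lambda>s. vallee_poussin B (t - s) * (g s - g t) + g t * vallee_poussin B (t - s) - vallee_poussin e (t - s) * g s)"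
          unfolding I_def by (rule integral_cong) (simp add: algebra_simps)
        also have "\<dots> = integral {0..q} (\<lambda>s. vallee_poussin B (t - s) * (g s - g t)) + g t * ?m
            - integral {0..q} (\<lambda>s. vallee_poussin e (t - s) * g s)"
          using B e by (subst integral_diff, (intro integrable_continuous_real continuous_intros vpc gc1; simp)+)
            (subst integral_add, (intro integrable_continuous_real continuous_intros vpc gc1; simp)+, simp)
        finally have Ieq: "I t = integral {0..q} (\<lambda>s. vallee_poussin B (t - s) * (g s - g t)) + g t * ?m
            - integral {0..q} (\<lambda>s. vallee_poussin e (t - s) * g s)" .
        have 1: "\<bar>integral {0..q} (\<lambda>s. vallee_poussin B (t - s) * (g s - g t))\<bar> \<le> \<epsilon> / 8"
        proof -
          have "\<bar>integral {0..q} (\<lambda>s. vallee_poussin B (t - s) * (g s - g t))\<bar> \<le> (15 * pi * (L + M) + 60 * pi * M) / sqrt B"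
            by (rule vallee_poussin_approx) (use B t0 q00 gb L M in simp_all)
          then show ?thesis using err1 unfolding c1_def B(2) by linarith
        qed
        have 2: "\<bar>integral {0..q} (\<lambda>s. vallee_poussin e (t - s) * g s)\<bar> \<le> \<epsilon> / 8"
        proof -
          have "\<bar>integral {0..q} (\<lambda>s. vallee_poussin e (t - s) * g s)\<bar> \<le> (15 + 90 * pi) * (2 * W) * e"
            by (rule vallee_poussin_low) (use e q00 gb in simp_all)
          then show ?thesis using err2 unfolding c2_def by linarith
        qed
        have "\<bar>g t\<bar> * (1 / 2) \<le> \<bar>g t\<bar> * ?m" using m by (intro mult_left_mono) auto
        also have "\<dots> = \<bar>g t * ?m\<bar>" using m by (simp add: abs_mult)
        also have "\<dots> \<le> \<bar>I t\<bar> + \<epsilon> / 8 + \<epsilon> / 8" using Ieq 1 2 by linarith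
        finally have 3: "\<bar>g t\<bar> \<le> 2 * \<bar>I t\<bar> + \<epsilon> / 2" by linarith
        have "d * t \<le> 1 / (2 * N) * N" using d t t0 N0 by (intro mult_mono) auto
        then have "1 / 2 \<le> exp (- d * t)" using exp_ge_add_one_self[of "- d * t"] N0 by simp
        then have "1 / 2 * \<bar>f t\<bar> \<le> \<bar>g t\<bar>" unfolding g_def abs_mult abs_exp_cancel by (intro mult_right_mono) auto
        with 3 show ?thesis by linarith
      qed
      have \<phi>c: "continuous_on {1 / B..N / 2} \<phi>"
        unfolding \<phi>_def[abs_def] using B
        by (intro continuous_intros continuous_on_subset[OF f(1)]) (auto intro: order_trans[rotated])
      have "integral {1 / B..N / 2} \<phi> \<le> integral {1 / B..N / 2} (\<lambda>t. 64 * ((1 - t / N) * (X t)\<^sup>2 + (1 - t / N) * (Y t)\<^sup>2))"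
      proof (intro integral_le integrable_continuous_real \<phi>c)
        show "continuous_on {1 / B..N / 2} (\<lambda>t. 64 * ((1 - t / N) * (X t)\<^sup>2 + (1 - t / N) * (Y t)\<^sup>2))"
          using N0 by (intro continuous_intros XYc) auto
        fix t assume t: "t \<in> {1 / B..N / 2}"
        have "\<phi> t \<le> (4 * \<bar>I t\<bar>)\<^sup>2"
          unfolding \<phi>_def using gI[OF t] by (intro power_mono) auto
        also have "\<dots> = 16 * (X t + Y t)\<^sup>2" by (simp add: I power_mult_distrib)
        also have "\<dots> \<le> 32 * ((X t)\<^sup>2 + (Y t)\<^sup>2)"
          using sum_squares_ge_zero[of "X t - Y t" 0] by (simp add: power2_eq_square algebra_simps)
        also have "\<dots> \<le> 64 * ((1 - t / N) * ((X t)\<^sup>2 + (Y t)\<^sup>2))"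
        proof -
          have "1 / 2 \<le> 1 - t / N" using t N0 by (auto simp: field_simps)
          then have "1 / 2 * ((X t)\<^sup>2 + (Y t)\<^sup>2) \<le> (1 - t / N) * ((X t)\<^sup>2 + (Y t)\<^sup>2)"
            by (intro mult_right_mono) auto
          then show ?thesis by linarith
        qed
        finally show "\<phi> t \<le> 64 * ((1 - t / N) * (X t)\<^sup>2 + (1 - t / N) * (Y t)\<^sup>2)" by (simp add: distrib_left)
      qed
      also have "\<dots> \<le> integral {0..N} (\<lambda>t. 64 * ((1 - t / N) * (X t)\<^sup>2 + (1 - t / N) * (Y t)\<^sup>2))"
        using N0 B by (intro integral_subset_le integrable_continuous_real continuous_intros XYc)
          (auto intro!: add_nonneg_nonneg mult_nonneg_nonneg)
      also have "\<dots> = 64 * (integral {0..N} (\<lambda>t. (1 - t / N) * (X t)\<^sup>2) + integral {0..N} (\<lambda>t. (1 - t / N) * (Y t)\<^sup>2))"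
        using N0 unfolding integral_mult_right
        by (subst integral_add) (auto intro!: integrable_continuous_real continuous_intros XYc)
      also have "\<dots> \<le> 64 * (D + D)" using X2 Y2 by simp
      finally show ?thesis by simp
    qed
    have \<phi>M: "\<phi> t \<le> M\<^sup>2" if "t \<ge> 0" for t
      unfolding \<phi>_def using f(2)[OF that] eps M by (intro power_mono) auto
    have \<phi>lip: "\<bar>\<phi> s - \<phi> t\<bar> \<le> (2 * M * L) * \<bar>s - t\<bar>" if st: "s \<ge> 0" "t \<ge> 0" for s t
    proof -
      let ?p = "max 0 (\<bar>f s\<bar> - \<epsilon>)" and ?r = "max 0 (\<bar>f t\<bar> - \<epsilon>)"
      have "\<phi> s - \<phi> t = (?p + ?r) * (?p - ?r)" by (simp add: \<phi>_def power2_eq_square algebra_simps)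
      then have "\<bar>\<phi> s - \<phi> t\<bar> = \<bar>?p + ?r\<bar> * \<bar>?p - ?r\<bar>" by (simp add: abs_mult)
      also have "\<dots> \<le> (2 * M) * (L * \<bar>s - t\<bar>)"
      proof (intro mult_mono)
        show "\<bar>?p + ?r\<bar> \<le> 2 * M" using f(2)[OF st(1)] f(2)[OF st(2)] eps M by (auto simp: max_def)
        have "\<bar>?p - ?r\<bar> \<le> \<bar>f s - f t\<bar>" by (auto simp: max_def)
        with lip[OF st] show "\<bar>?p - ?r\<bar> \<le> L * \<bar>s - t\<bar>" by linarith
      qed (use M in auto)
      finally show ?thesis by simp
    qed
    have \<phi>bnd: "integral {0..x} \<phi> \<le> M\<^sup>2 * (1 / B) + 128 * D" if x: "x \<ge> 0" for x
    proof -
      define N where "N = 2 * max x (1 / B)"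
      have N: "N \<ge> 2 / B" "x \<le> N / 2" "1 / B \<le> N / 2" "N / 2 \<ge> 0" using x B by (auto simp: N_def max_def)
      have \<phi>i: "\<phi> integrable_on {a..b}" if "a \<ge> 0" for a b
        unfolding \<phi>_def[abs_def] using that
        by (intro integrable_continuous_real continuous_intros continuous_on_subset[OF f(1)]) auto
      have "integral {0..x} \<phi> \<le> integral {0..N / 2} \<phi>"
        using N x by (intro integral_subset_le \<phi>i) (auto simp: \<phi>_def)
      also have "\<dots> = integral {0..1 / B} \<phi> + integral {1 / B..N / 2} \<phi>"
        using N B by (intro Henstock_Kurzweil_Integration.integral_combine[symmetric] \<phi>i) auto
      also have "integral {0..1 / B} \<phi> \<le> integral {0..1 / B} (\<lambda>_. M\<^sup>2)"
        using B by (intro integral_le \<phi>i) (auto intro: \<phi>M)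
      finally show ?thesis using band[OF N(1)] B by simp
    qed
    have "(\<phi> \<longlongrightarrow> 0) at_top"
      by (rule barbalat_nonneg[where L = "2 * M * L", OF _ \<phi>lip \<phi>bnd]) (auto simp: \<phi>_def)
    then show ?thesis unfolding \<phi>_def .
  qed
  show ?thesis
  proof (rule tendstoI)
    fix \<epsilon> :: real assume eps: "\<epsilon> > 0"
    have "\<forall>\<^sub>F t in at_top. (max 0 (\<bar>f t\<bar> - \<epsilon> / 2))\<^sup>2 < (\<epsilon> / 2)\<^sup>2"
      using eps by (intro order_tendstoD(2)[OF key]) auto
    then show "\<forall>\<^sub>F t in at_top. dist (f t) 0 < \<epsilon>"
    proof eventually_elim
      case (elim t)
      then have "max 0 (\<bar>f t\<bar> - \<epsilon> / 2) < \<epsilon> / 2" using eps by (intro power_less_imp_less_base[OF elim]) auto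
      then show ?case by (simp add: max_def split: if_splits)
    qed
  qed
qed

section \<open>Radial wave equation\<close>

definition cont2 :: "(real \<Rightarrow> real \<Rightarrow> real) \<Rightarrow> bool" where
  "cont2 f \<longleftrightarrow> continuous_on UNIV (\<lambda>p. f (fst p) (snd p))"

lemma cont2_compose:
  "cont2 f \<Longrightarrow> continuous_on S p \<Longrightarrow> continuous_on S q \<Longrightarrow> continuous_on S (\<lambda>x. f (p x) (q x))"
  unfolding cont2_def
  using continuous_on_compose2[of UNIV "\<lambda>p. f (fst p) (snd p)" S "\<lambda>x. (p x, q x)"]
  by (auto intro: continuous_on_Pair)

lemma leibniz_real_interval:
  fixes f fx :: "real \<Rightarrow> real \<Rightarrow> real"
  assumes "\<And>x t. t \<in> {a..b} \<Longrightarrow> ((\<lambda>x. f x t) has_real_derivative fx x t) (at x)"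
    and "\<And>x. continuous_on {a..b} (f x)"
    and "continuous_on (UNIV \<times> {a..b}) (\<lambda>p. fx (fst p) (snd p))"
  shows "((\<lambda>x. integral {a..b} (f x)) has_real_derivative integral {a..b} (fx x0)) (at x0)"
  using leibniz_rule_vector_derivative[of UNIV a b f fx x0] assms
  by (auto simp: has_real_derivative_iff_has_vector_derivative split_beta integrable_continuous_real)

lemma nonneg_derivative_mono:
  fixes h :: "real \<Rightarrow> real"
  assumes "a \<le> b" "continuous_on {a..b} h"
    and "\<And>x. a < x \<Longrightarrow> x < b \<Longrightarrow> (h has_real_derivative h' x) (at x)"
    and "\<And>x. a < x \<Longrightarrow> x < b \<Longrightarrow> 0 \<le> h' x"
  shows "h a \<le> h b"
proof (rule DERIV_nonneg_imp_increasing_open[OF assms(1)])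
  show "\<exists>y. DERIV h x :> y \<and> 0 \<le> y" if "a < x" "x < b" for x
    using assms(3,4)[OF that] by blast
qed (use assms in auto)

text \<open>The squared positive part is a C^1 cutoff; products of two such cutoffs are the moving
  weights of \<open>finite_speed_0\<close>.\<close>

lemma max_zero_square_has_derivative:
  "((\<lambda>x::real. (max 0 x)\<^sup>2) has_real_derivative 2 * max 0 x) (at x)"
proof -
  consider "x > 0" | "x < 0" | "x = 0" by linarith
  then show ?thesis
  proof cases
    case 1
    have "((\<lambda>x::real. x\<^sup>2) has_real_derivative 2 * x) (at x)" by (auto intro!: derivative_eq_intros)
    moreover have "\<forall>\<^sub>F y in nhds x. y\<^sup>2 = (max 0 y)\<^sup>2"
      using 1 by (intro eventually_nhds_in_open[of "{0<..}" x, THEN eventually_mono]) auto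
    ultimately show ?thesis using 1 by (subst (asm) DERIV_cong_ev[OF refl _ refl]) auto
  next
    case 2
    have "((\<lambda>x::real. 0) has_real_derivative 0) (at x)" by simp
    moreover have "\<forall>\<^sub>F y in nhds x. 0 = (max 0 y)\<^sup>2"
      using 2 by (intro eventually_nhds_in_open[of "{..<0}" x, THEN eventually_mono]) auto
    ultimately show ?thesis using 2 by (subst (asm) DERIV_cong_ev[OF refl _ refl]) auto
  next
    case 3
    have "((\<lambda>y. ((max 0 y)\<^sup>2 - (max 0 0)\<^sup>2) / (y - 0)) \<longlongrightarrow> 0) (at (0::real))"
    proof (rule Lim_null_comparison[where g = "\<lambda>y. \<bar>y\<bar>"])
      show "\<forall>\<^sub>F y in at (0::real). norm (((max 0 y)\<^sup>2 - (max 0 0)\<^sup>2) / (y - 0)) \<le> \<bar>y\<bar>"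
        by (rule always_eventually) (auto simp: max_def power2_eq_square)
      show "((\<lambda>y. \<bar>y\<bar>) \<longlongrightarrow> 0) (at (0::real))" by (auto intro!: tendsto_eq_intros)
    qed
    then show ?thesis using 3 by (simp add: has_field_derivative_iff)
  qed
qed

text \<open>The time integral from 0 to t, rescaled to the fixed interval [0, 1]: it makes sense for
  t of either sign, and joint continuity and differentiation under the integral apply
  directly.\<close>

definition primitive :: "(real \<Rightarrow> real \<Rightarrow> real) \<Rightarrow> real \<Rightarrow> real \<Rightarrow> real" where
  "primitive f t r = t * integral {0..1} (\<lambda>s. f (t * s) r)"

lemma primitive_cont2:
  assumes "cont2 f"
  shows "cont2 (primitive f)"
proof -
  have "continuous_on UNIV (\<lambda>p::real \<times> real. integral (cbox 0 1) (\<lambda>s. f (fst p * s) (snd p)))"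
    by (intro integral_continuous_on_param)
       (auto simp: split_beta intro!: cont2_compose[OF assms] continuous_intros)
  then show ?thesis unfolding cont2_def primitive_def by (auto intro!: continuous_intros)
qed

lemma primitive_has_derivative:
  assumes f: "cont2 f" "cont2 ft" and f_t: "\<And>t r. ((\<lambda>t. f t r) has_real_derivative ft t r) (at t)"
  shows "((\<lambda>t. primitive f t r) has_real_derivative f t r) (at t)"
proof -
  have d: "((\<lambda>t. f (t * s) r) has_real_derivative ft (t * s) r * s) (at t)" for t s
    by (rule DERIV_chain2[OF f_t]) (auto intro!: derivative_eq_intros)
  have d': "((\<lambda>s. f (t * s) r) has_real_derivative t * ft (t * s) r) (at s within A)" for t s A
    by (rule has_field_derivative_at_within, rule DERIV_chain2[OF f_t, THEN DERIV_cong]) (auto intro!: derivative_eq_intros)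
  have i1: "(\<lambda>s. f (t * s) r) integrable_on {0..1}"
    by (intro integrable_continuous_real cont2_compose[OF f(1)] continuous_intros)
  have i2: "(\<lambda>s. t * (ft (t * s) r * s)) integrable_on {0..1}"
    by (intro integrable_continuous_real cont2_compose[OF f(2)] continuous_intros)
  have "((\<lambda>t. integral {0..1} (\<lambda>s. f (t * s) r)) has_real_derivative integral {0..1} (\<lambda>s. ft (t * s) r * s)) (at t)"
    by (rule leibniz_real_interval[OF d]) (auto intro!: cont2_compose[OF f(1)] cont2_compose[OF f(2)] continuous_intros)
  then have "((\<lambda>t. primitive f t r) has_real_derivative
      integral {0..1} (\<lambda>s. f (t * s) r) + t * integral {0..1} (\<lambda>s. ft (t * s) r * s)) (at t)"
    unfolding primitive_def by (auto intro!: derivative_eq_intros)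
  moreover have "integral {0..1} (\<lambda>s. f (t * s) r) + t * integral {0..1} (\<lambda>s. ft (t * s) r * s)
      = integral {0..1} (\<lambda>s. f (t * s) r + t * (ft (t * s) r * s))"
    using integral_add[OF i1 i2] by simp
  \<comment> \<open>The integrand is the s-derivative of s f(ts).\<close>
  moreover have "((\<lambda>s. f (t * s) r + t * (ft (t * s) r * s)) has_integral 1 * f (t * 1) r - 0 * f (t * 0) r) {0..1}"
    by (rule fundamental_theorem_of_calculus)
      (auto intro!: derivative_eq_intros d' simp flip: has_real_derivative_iff_has_vector_derivative)
  ultimately show ?thesis by (simp add: integral_unique)
qed

lemma primitive_eq_integral:
  assumes f: "cont2 f" "cont2 ft" and f_t: "\<And>t r. ((\<lambda>t. f t r) has_real_derivative ft t r) (at t)" and t: "t \<ge> 0"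
  shows "integral {0..t} (\<lambda>s. f s r) = primitive f t r"
proof -
  have "((\<lambda>s. f s r) has_integral primitive f t r - primitive f 0 r) {0..t}"
    by (rule fundamental_theorem_of_calculus[OF t])
      (use primitive_has_derivative[OF f f_t] in \<open>auto simp: has_real_derivative_iff_has_vector_derivative
        intro: has_vector_derivative_at_within\<close>)
  then show ?thesis by (simp add: integral_unique primitive_def)
qed

text \<open>\<open>\<mu>\<close> is dt/dr along radial light rays, so its two-sided bounds bound the
  propagation speed; the decay of its derivative makes the potential of the frequency equation
  integrable at infinity. Derivatives are posited on r > 0 only, which keeps one-sided derivatives
  at the origin out of the estimates.\<close>

locale radial_geometry =
  fixes \<mu> \<mu>' a :: "real \<Rightarrow> real" and m0 m1 a1 c1 \<rho>1 :: real
  assumes \<mu>_cont: "continuous_on {0..} \<mu>" and a_cont: "continuous_on {0..} a"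
    and m0: "m0 > 0" and \<mu>_lower: "\<And>r. r \<ge> 0 \<Longrightarrow> m0 \<le> \<mu> r" and \<mu>_upper: "\<And>r. r \<ge> 0 \<Longrightarrow> \<mu> r \<le> m1"
    and a_nonneg: "\<And>r. r \<ge> 0 \<Longrightarrow> 0 \<le> a r" and a_upper: "\<And>r. r \<ge> 0 \<Longrightarrow> a r \<le> a1"
    and \<mu>_deriv: "\<And>r. r > 0 \<Longrightarrow> (\<mu> has_real_derivative \<mu>' r) (at r)"
    and \<mu>'_cont: "continuous_on {0<..} \<mu>'"
    and \<mu>'_decay: "\<And>r. r \<ge> \<rho>1 \<Longrightarrow> \<bar>\<mu>' r\<bar> \<le> c1 / r\<^sup>2" and \<rho>1: "\<rho>1 > 0"
begin

lemma \<mu>_pos: "r \<ge> 0 \<Longrightarrow> \<mu> r > 0" using \<mu>_lower[of r] m0 by linarith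
lemma m1_pos: "m1 > 0" using \<mu>_lower[of 0] \<mu>_upper[of 0] m0 by linarith
lemma a1_nonneg: "a1 \<ge> 0" using a_nonneg[of 0] a_upper[of 0] by linarith

lemma \<mu>_comp: "continuous_on S p \<Longrightarrow> (\<And>x. x \<in> S \<Longrightarrow> p x \<ge> 0) \<Longrightarrow> continuous_on S (\<lambda>x. \<mu> (p x))"
  by (rule continuous_on_compose2[OF \<mu>_cont]) auto

lemma a_comp: "continuous_on S p \<Longrightarrow> (\<And>x. x \<in> S \<Longrightarrow> p x \<ge> 0) \<Longrightarrow> continuous_on S (\<lambda>x. a (p x))"
  by (rule continuous_on_compose2[OF a_cont]) auto

text \<open>\<open>lam\<close> stands for n(n+1). The area factor r^2 of the spheres is built in, so
  energies are plain integrals in r.\<close>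

definition edens :: "real \<Rightarrow> (real \<Rightarrow> real \<Rightarrow> real) \<Rightarrow> (real \<Rightarrow> real \<Rightarrow> real) \<Rightarrow> (real \<Rightarrow> real \<Rightarrow> real) \<Rightarrow> real \<Rightarrow> real \<Rightarrow> real" where
  "edens lam u ut ur t r = (\<mu> r * r\<^sup>2 * (ut t r)\<^sup>2 + r\<^sup>2 / \<mu> r * (ur t r)\<^sup>2 + lam * a r * (u t r)\<^sup>2) / 2"

lemma edens_nonneg: "lam \<ge> 0 \<Longrightarrow> r \<ge> 0 \<Longrightarrow> 0 \<le> edens lam u ut ur t r"
  unfolding edens_def using \<mu>_pos[of r] a_nonneg[of r] by auto

lemma edens_continuous:
  assumes "cont2 u" "cont2 ut" "cont2 ur" "continuous_on S p" "continuous_on S q" "\<And>x. x \<in> S \<Longrightarrow> q x \<ge> 0"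
  shows "continuous_on S (\<lambda>x. edens lam u ut ur (p x) (q x))"
proof -
  have "\<And>x. x \<in> S \<Longrightarrow> \<mu> (q x) \<noteq> 0" using \<mu>_pos assms(6) by (metis less_numeral_extra(3))
  then show ?thesis
    unfolding edens_def using assms
    by (intro continuous_intros cont2_compose[of u] cont2_compose[of ut] cont2_compose[of ur] \<mu>_comp a_comp) auto
qed

text \<open>The source \<open>g\<close> and the weight \<eta> are general so that one identity
  serves three purposes: a moving cutoff for finite speed, \<eta> = 1 with g = 0 for conservation,
  and \<eta> = 1 with a static source for the time integral of the wave.\<close>

lemma weighted_energy_identity:
  fixes u ut utt ur urt g \<eta> \<eta>t \<eta>r :: "real \<Rightarrow> real \<Rightarrow> real"
  assumes cont: "cont2 u" "cont2 ut" "cont2 utt" "cont2 ur" "cont2 urt" "cont2 g" "cont2 \<eta>" "cont2 \<eta>t" "cont2 \<eta>r"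
    and u_t: "\<And>t r. ((\<lambda>t. u t r) has_real_derivative ut t r) (at t)"
    and ut_t: "\<And>t r. ((\<lambda>t. ut t r) has_real_derivative utt t r) (at t)"
    and ur_t: "\<And>t r. ((\<lambda>t. ur t r) has_real_derivative urt t r) (at t)"
    and ut_r: "\<And>t r. ((\<lambda>r. ut t r) has_real_derivative urt t r) (at r)"
    and \<eta>_t: "\<And>t r. ((\<lambda>t. \<eta> t r) has_real_derivative \<eta>t t r) (at t)"
    and \<eta>_r: "\<And>t r. ((\<lambda>r. \<eta> t r) has_real_derivative \<eta>r t r) (at r)"
    and pde: "\<And>t r. r > 0 \<Longrightarrow> ((\<lambda>r. r\<^sup>2 / \<mu> r * ur t r) has_real_derivative
        \<mu> r * r\<^sup>2 * (utt t r - g t r) + lam * a r * u t r) (at r)"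
    and R: "R \<ge> 0"
  shows "((\<lambda>t. integral {0..R} (\<lambda>r. \<eta> t r * edens lam u ut ur t r)) has_real_derivative
     integral {0..R} (\<lambda>r. \<eta>t t r * edens lam u ut ur t r - \<eta>r t r * (ut t r * (r\<^sup>2 / \<mu> r * ur t r))
        + \<eta> t r * (\<mu> r * r\<^sup>2 * ut t r * g t r)) + \<eta> t R * (ut t R * (R\<^sup>2 / \<mu> R * ur t R))) (at t)"
proof -
  note cc = cont2_compose[OF cont(1)] cont2_compose[OF cont(2)] cont2_compose[OF cont(3)] cont2_compose[OF cont(4)]
    cont2_compose[OF cont(5)] cont2_compose[OF cont(6)] cont2_compose[OF cont(7)] cont2_compose[OF cont(8)] cont2_compose[OF cont(9)]
  define dE where "dE t r = \<eta>t t r * edens lam u ut ur t r + \<eta> t r * (\<mu> r * r\<^sup>2 * ut t r * utt t r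
      + r\<^sup>2 / \<mu> r * ur t r * urt t r + lam * a r * u t r * ut t r)" for t r
  define F where "F t r = \<eta> t r * (ut t r * (r\<^sup>2 / \<mu> r * ur t r))" for t r
  define dF where "dF t r = \<eta>r t r * (ut t r * (r\<^sup>2 / \<mu> r * ur t r)) + \<eta> t r * (urt t r * (r\<^sup>2 / \<mu> r * ur t r)
      + ut t r * (\<mu> r * r\<^sup>2 * (utt t r - g t r) + lam * a r * u t r))" for t r
  define h where "h t r = \<eta>t t r * edens lam u ut ur t r - \<eta>r t r * (ut t r * (r\<^sup>2 / \<mu> r * ur t r))
        + \<eta> t r * (\<mu> r * r\<^sup>2 * ut t r * g t r)" for t r
  \<comment> \<open>The balance proved next writes the t-derivative of the weighted density as a
    bulk term plus an exact r-derivative of the flux \<open>F\<close>; the flux carries r^2 and so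
    contributes nothing at r = 0.\<close>
  have ne: "\<mu> r \<noteq> 0" if "r \<ge> 0" for r using \<mu>_pos[OF that] by simp
  have eq: "dE t r = h t r + dF t r" for t r
    by (simp add: dE_def h_def dF_def algebra_simps)
  have ec: "continuous_on S (\<lambda>x. edens lam u ut ur (p x) (q x))"
    if "continuous_on S p" "continuous_on S q" "\<And>x. x \<in> S \<Longrightarrow> q x \<ge> 0" for S :: "(real \<times> real) set" and p q
    using edens_continuous[OF cont(1,2,4)] that by blast
  have ec1: "continuous_on S (\<lambda>x. edens lam u ut ur (p x) (q x))"
    if "continuous_on S p" "continuous_on S q" "\<And>x. x \<in> S \<Longrightarrow> q x \<ge> 0" for S :: "real set" and p q
    using edens_continuous[OF cont(1,2,4)] that by blast
  have hc: "continuous_on {0..R} (h t)" for t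
    unfolding h_def by (intro continuous_intros cc ec1 \<mu>_comp a_comp) (auto simp: ne)
  have "((\<lambda>t. integral {0..R} (\<lambda>r. \<eta> t r * edens lam u ut ur t r)) has_real_derivative integral {0..R} (dE t)) (at t)"
  proof (rule leibniz_real_interval)
    fix t r assume r: "r \<in> {0..R}"
    show "((\<lambda>t. \<eta> t r * edens lam u ut ur t r) has_real_derivative dE t r) (at t)"
      unfolding dE_def edens_def using ne[of r] r
      by (auto intro!: derivative_eq_intros u_t ut_t ur_t \<eta>_t simp: algebra_simps add_divide_distrib)
  next
    show "continuous_on {0..R} (\<lambda>r. \<eta> t r * edens lam u ut ur t r)" for t
      by (intro continuous_intros cc ec1) auto
    show "continuous_on (UNIV \<times> {0..R}) (\<lambda>p. dE (fst p) (snd p))"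
      unfolding dE_def by (intro continuous_intros cc ec \<mu>_comp a_comp) (auto simp: ne)
  qed
  moreover have "integral {0..R} (dE t) = integral {0..R} (h t) + F t R"
  proof -
    have "(dF t has_integral F t R - F t 0) {0..R}"
    proof (rule fundamental_theorem_of_calculus_interior[OF R])
      show "continuous_on {0..R} (F t)"
        unfolding F_def by (intro continuous_intros cc \<mu>_comp) (auto simp: ne)
      fix r assume r: "r \<in> {0<..<R}"
      have "(F t has_real_derivative dF t r) (at r)"
        unfolding F_def[abs_def] dF_def
        by (rule DERIV_mult'[OF \<eta>_r DERIV_mult'[OF ut_r pde], THEN DERIV_cong]) (use r in \<open>simp_all add: algebra_simps\<close>)
      then show "(F t has_vector_derivative dF t r) (at r)"
        by (simp add: has_real_derivative_iff_has_vector_derivative)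
    qed
    from has_integral_add[OF integrable_integral[OF integrable_continuous_real[OF hc]] this]
    show ?thesis unfolding eq[abs_def] by (simp add: integral_unique F_def)
  qed
  ultimately show ?thesis unfolding h_def F_def by simp
qed

text \<open>From (u + r u_r)^2 \<ge> 0 the derivative of r u^2 is at least - r^2 u_r^2, which the
  energy density controls. So r u^2 plus a multiple of the energy between the fixed inner radius and
  the running one is nondecreasing; compare with the outer radius R, where u vanishes.\<close>

lemma hardy_bound:
  fixes u ut ur :: "real \<Rightarrow> real \<Rightarrow> real"
  assumes lam: "lam \<ge> 0" and c: "cont2 u" "cont2 ut" "cont2 ur"
    and ur: "\<And>t r. ((\<lambda>r. u t r) has_real_derivative ur t r) (at r)"
    and r: "r \<ge> 0" and R: "r \<le> R" and zero: "u t R = 0"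
  shows "r * (u t r)\<^sup>2 \<le> 2 * m1 * integral {0..R} (edens lam u ut ur t)"
proof -
  let ?e = "edens lam u ut ur"
  have ec: "continuous_on {r..R} (?e t)"
    using r by (intro edens_continuous c continuous_intros) auto
  have ei: "?e t integrable_on {x..y}" if "x \<ge> 0" for x y
    using that by (intro integrable_continuous_real edens_continuous c continuous_intros) auto
  define G where "G x = x * (u t x)\<^sup>2 + 2 * m1 * integral {r..x} (?e t)" for x
  have Gd: "(G has_real_derivative (u t x)\<^sup>2 + x * (2 * u t x * ur t x) + 2 * m1 * ?e t x) (at x)" if "r < x" "x < R" for x
  proof -
    have "((\<lambda>u. integral {r..u} (?e t)) has_vector_derivative ?e t x) (at x within {r..R})"
      using that by (intro integral_has_vector_derivative ec) auto
    then have "((\<lambda>u. integral {r..u} (?e t)) has_real_derivative ?e t x) (at x)"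
      using that by (simp add: has_real_derivative_iff_has_vector_derivative at_within_Icc_at)
    then show ?thesis
      unfolding G_def[abs_def] by (auto intro!: derivative_eq_intros ur simp: power2_eq_square algebra_simps)
  qed
  have "G r \<le> G R"
  proof (rule nonneg_derivative_mono[OF R _ Gd])
    show "continuous_on {r..R} G"
      unfolding G_def using ec
      by (intro continuous_intros cont2_compose[OF c(1)] indefinite_integral_continuous_1 integrable_continuous_real) auto
    fix x assume x: "r < x" "x < R"
    then have x0: "x > 0" using r by simp
    have "x\<^sup>2 * (ur t x)\<^sup>2 = \<mu> x * (x\<^sup>2 / \<mu> x * (ur t x)\<^sup>2)" using \<mu>_pos[of x] x0 by simp
    also have "\<dots> \<le> m1 * (2 * ?e t x)"
    proof (rule mult_mono)
      have gen: "q \<le> 2 * ((p + q + s) / 2)" if "0 \<le> p" "0 \<le> s" for p q s :: real using that by simp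
      show "x\<^sup>2 / \<mu> x * (ur t x)\<^sup>2 \<le> 2 * ?e t x" unfolding edens_def
        using \<mu>_pos[of x] x0 lam a_nonneg[of x] by (intro gen) auto
    qed (use \<mu>_upper[of x] \<mu>_pos[of x] x0 m1_pos in auto)
    finally have "x\<^sup>2 * (ur t x)\<^sup>2 \<le> 2 * m1 * ?e t x" by simp
    moreover have "0 \<le> (u t x + x * ur t x)\<^sup>2" by simp
    ultimately show "0 \<le> (u t x)\<^sup>2 + x * (2 * u t x * ur t x) + 2 * m1 * ?e t x"
      by (simp add: power2_eq_square algebra_simps)
  qed
  then have "r * (u t r)\<^sup>2 \<le> 2 * m1 * integral {r..R} (?e t)" using zero by (simp add: G_def)
  also have "\<dots> \<le> 2 * m1 * integral {0..R} (?e t)"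
    using r m1_pos lam by (intro mult_left_mono integral_subset_le ei) (auto intro: edens_nonneg)
  finally show ?thesis .
qed

text \<open>The index counts time derivatives and \<open>w\<close> is the radial derivative.
  Carrying the whole tower makes each time derivative a solution with a conserved energy of its
  own.\<close>

definition radial_mode :: "real \<Rightarrow> (nat \<Rightarrow> real \<Rightarrow> real \<Rightarrow> real) \<Rightarrow> (nat \<Rightarrow> real \<Rightarrow> real \<Rightarrow> real) \<Rightarrow> bool" where
  "radial_mode lam v w \<longleftrightarrow> (\<forall>n. cont2 (v n)) \<and> (\<forall>n. cont2 (w n)) \<and>
    (\<forall>n t r. ((\<lambda>t. v n t r) has_real_derivative v (Suc n) t r) (at t)) \<and>
    (\<forall>n t r. ((\<lambda>r. v n t r) has_real_derivative w n t r) (at r)) \<and>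
    (\<forall>n t r. ((\<lambda>t. w n t r) has_real_derivative w (Suc n) t r) (at t)) \<and>
    (\<forall>n t r. r > 0 \<longrightarrow> ((\<lambda>r. r\<^sup>2 / \<mu> r * w n t r) has_real_derivative
       \<mu> r * r\<^sup>2 * v (Suc (Suc n)) t r + lam * a r * v n t r) (at r))"

lemma radial_modeD:
  assumes "radial_mode lam v w"
  shows "cont2 (v n)" "cont2 (w n)"
    "((\<lambda>t. v n t r) has_real_derivative v (Suc n) t r) (at t)"
    "((\<lambda>r. v n t r) has_real_derivative w n t r) (at r)"
    "((\<lambda>t. w n t r) has_real_derivative w (Suc n) t r) (at t)"
    "r > 0 \<Longrightarrow> ((\<lambda>r. r\<^sup>2 / \<mu> r * w n t r) has_real_derivative
       \<mu> r * r\<^sup>2 * v (Suc (Suc n)) t r + lam * a r * v n t r) (at r)"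
  using assms unfolding radial_mode_def by auto

end

text \<open>\<open>v 0\<close> and \<open>v 1\<close> at time 0 are the Cauchy data. Vanishing below
  \<open>r0\<close> keeps the source of the frequency equation off the origin; vanishing beyond
  \<open>R0\<close> is where finite propagation starts.\<close>

locale radial_wave = radial_geometry +
  fixes lam :: real and v w :: "nat \<Rightarrow> real \<Rightarrow> real \<Rightarrow> real" and r0 R0 :: real
  assumes lam: "lam \<ge> 0" and mode: "radial_mode lam v w"
    and r0: "0 < r0" "r0 < R0"
    and data: "\<And>r. r \<ge> 0 \<Longrightarrow> r < r0 \<or> r > R0 \<Longrightarrow> v 0 0 r = 0 \<and> v 1 0 r = 0"
begin

lemmas vc = radial_modeD(1)[OF mode] and wc = radial_modeD(2)[OF mode]
lemmas v_t = radial_modeD(3)[OF mode] and v_r = radial_modeD(4)[OF mode] and w_t = radial_modeD(5)[OF mode]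
lemmas v_pde = radial_modeD(6)[OF mode]

section \<open>Finite propagation speed\<close>

definition speed where "speed = 1 / m0"

lemma speed_pos: "speed > 0" using m0 by (simp add: speed_def)

lemma data_w: "r > R0 \<Longrightarrow> w 0 0 r = 0"
proof -
  assume r: "r > R0"
  have "((\<lambda>r. 0) has_real_derivative w 0 0 r) (at r)"
  proof (rule DERIV_cong_ev[THEN iffD1, OF refl _ refl v_r])
    show "\<forall>\<^sub>F x in nhds r. v 0 0 x = 0"
      using r r0 data by (intro eventually_nhds_in_open[of "{R0<..}" r, THEN eventually_mono]) auto
  qed
  then show ?thesis using DERIV_unique DERIV_const by blast
qed

text \<open>Weighted energy with \<eta> = p^2 q^2, where \<open>p\<close> is positive outside the
  outgoing cone of the data and \<open>q\<close> inside an ingoing cone. Both cones move at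
  \<open>speed\<close>, so the loss from \<eta>_t dominates \<eta>_r times the flux, which is at
  most \<open>speed\<close> times the density. The weighted energy starts at 0 and cannot
  grow.\<close>

lemma finite_speed_0:
  assumes t: "t \<ge> 0" and r: "r > R0 + speed * t"
  shows "v 1 t r = 0"
proof -
  \<comment> \<open>With this S the ingoing cutoff \<open>q\<close> equals 1 at (t, r), and it is 0
    at radius S for all positive times, so nothing flows through S.\<close>
  define S where "S = r + speed * t + 1"
  define p where "p t r = max 0 (r - R0 - speed * t)" for t r
  define q where "q t r = max 0 (S - r - speed * t)" for t r
  define \<eta> where "\<eta> t r = (p t r)\<^sup>2 * (q t r)\<^sup>2" for t r
  define \<eta>t where "\<eta>t t r = - speed * (2 * p t r * (q t r)\<^sup>2 + 2 * q t r * (p t r)\<^sup>2)" for t r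
  define \<eta>r where "\<eta>r t r = 2 * p t r * (q t r)\<^sup>2 - 2 * q t r * (p t r)\<^sup>2" for t r
  have pq: "p t r \<ge> 0" "q t r \<ge> 0" for t r by (auto simp: p_def q_def)
  have pc: "cont2 p" "cont2 q" unfolding cont2_def p_def q_def by (auto intro!: continuous_intros)
  have c: "cont2 \<eta>" "cont2 \<eta>t" "cont2 \<eta>r"
    unfolding cont2_def \<eta>_def \<eta>t_def \<eta>r_def
    by (intro continuous_intros cont2_compose[OF pc(1)] cont2_compose[OF pc(2)])+
  have dsq: "((\<lambda>x. (max 0 (h x))\<^sup>2) has_real_derivative 2 * max 0 (h x) * h') (at x)"
    if "(h has_real_derivative h') (at x)" for h h' and x :: real
    using DERIV_chain2[OF max_zero_square_has_derivative that] by simp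
  have \<eta>_t: "((\<lambda>t. \<eta> t r) has_real_derivative \<eta>t t r) (at t)" for t r
    unfolding \<eta>_def \<eta>t_def p_def q_def
    by (rule DERIV_mult'[OF dsq dsq, THEN DERIV_cong]) (auto intro!: derivative_eq_intros simp: algebra_simps)
  have \<eta>_r: "((\<lambda>r. \<eta> t r) has_real_derivative \<eta>r t r) (at r)" for t r
    unfolding \<eta>_def \<eta>r_def p_def q_def
    by (rule DERIV_mult'[OF dsq dsq, THEN DERIV_cong]) (auto intro!: derivative_eq_intros simp: algebra_simps)
  define e where "e = edens lam (v 0) (v 1) (w 0)"
  define Fl where "Fl t r = v 1 t r * (r\<^sup>2 / \<mu> r * w 0 t r)" for t r
  define En where "En t = integral {0..S} (\<lambda>r. \<eta> t r * e t r)" for t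
  have Fl: "\<bar>Fl t r\<bar> \<le> speed * e t r" if "r \<ge> 0" for t r
  proof -
    have "2 * (x * y) \<le> x\<^sup>2 + y\<^sup>2" for x y :: real using sum_squares_bound[of x y] by (simp add: mult.assoc)
    have *: "\<bar>v 1 t r * w 0 t r\<bar> \<le> (\<mu> r * (v 1 t r)\<^sup>2 + (w 0 t r)\<^sup>2 / \<mu> r) / 2"
    proof -
      have "2 * (\<bar>v 1 t r\<bar> * \<mu> r) * \<bar>w 0 t r\<bar> \<le> (\<bar>v 1 t r\<bar> * \<mu> r)\<^sup>2 + \<bar>w 0 t r\<bar>\<^sup>2" by (rule sum_squares_bound)
      then show ?thesis using \<mu>_pos[OF that] by (simp add: field_simps abs_mult power2_eq_square)
    qed
    have "\<bar>Fl t r\<bar> = r\<^sup>2 / \<mu> r * \<bar>v 1 t r * w 0 t r\<bar>"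
      using \<mu>_pos[OF that] by (simp add: Fl_def abs_mult)
    also have "\<dots> \<le> r\<^sup>2 / \<mu> r * ((\<mu> r * (v 1 t r)\<^sup>2 + (w 0 t r)\<^sup>2 / \<mu> r) / 2)"
      using * \<mu>_pos[OF that] by (intro mult_left_mono) auto
    also have "\<dots> = 1 / \<mu> r * ((\<mu> r * r\<^sup>2 * (v 1 t r)\<^sup>2 + r\<^sup>2 / \<mu> r * (w 0 t r)\<^sup>2) / 2)"
      by (simp add: field_simps)
    also have "\<dots> \<le> 1 / \<mu> r * e t r"
      using \<mu>_pos[OF that] lam a_nonneg[OF that] unfolding e_def edens_def by (intro mult_left_mono divide_right_mono) auto
    also have "\<dots> \<le> speed * e t r"
      unfolding speed_def using \<mu>_lower[OF that] m0 lam that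
      by (intro mult_right_mono frac_le edens_nonneg[of lam r] ) (auto simp: e_def intro: edens_nonneg)
    finally show ?thesis .
  qed
  have S0: "S \<ge> 0" unfolding S_def using r r0 t speed_pos by (auto intro!: add_nonneg_nonneg) (smt (verit) mult_nonneg_nonneg)
  have z0: "cont2 (\<lambda>t r. 0)" by (simp add: cont2_def)
  have dEn: "(En has_real_derivative integral {0..S} (\<lambda>r. \<eta>t t r * e t r - \<eta>r t r * Fl t r) + \<eta> t S * Fl t S) (at t)" for t
    using weighted_energy_identity[OF vc[of 0] vc[of "1"] vc[of "2"] wc[of 0] wc[of 1] z0 c, where lam = lam and R = S and t = t]
      v_t[of 0] v_t[of 1] w_t[of 0] v_r[of 1] v_pde[of _ 0] \<eta>_t \<eta>_r S0
    by (simp add: En_def[abs_def] e_def Fl_def numeral_2_eq_2)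
  have "En t \<le> En 0"
  proof (rule DERIV_nonpos_imp_decreasing_open[OF t])
    fix s assume s: "0 < s" "s < t"
    have "\<eta> s S = 0" unfolding \<eta>_def q_def using s speed_pos by simp
    moreover have "integral {0..S} (\<lambda>r. \<eta>t s r * e s r - \<eta>r s r * Fl s r) \<le> integral {0..S} (\<lambda>_. 0)"
    proof (rule integral_le)
      have "continuous_on {0..S} (\<lambda>r. e s r)" unfolding e_def
        by (intro edens_continuous vc wc continuous_intros) auto
      then show "(\<lambda>r. \<eta>t s r * e s r - \<eta>r s r * Fl s r) integrable_on {0..S}"
        unfolding Fl_def
        by (intro integrable_continuous_real continuous_intros cont2_compose[OF c(2)] cont2_compose[OF c(3)] cont2_compose[OF vc] cont2_compose[OF wc] \<mu>_comp)
           (auto, metis \<mu>_pos less_irrefl)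
      fix r assume rr: "r \<in> {0..S}"
      have "\<bar>\<eta>r s r * Fl s r\<bar> \<le> (2 * p s r * (q s r)\<^sup>2 + 2 * q s r * (p s r)\<^sup>2) * (speed * e s r)"
        unfolding abs_mult
      proof (intro mult_mono)
        have "0 \<le> 2 * p s r * (q s r)\<^sup>2" "0 \<le> 2 * q s r * (p s r)\<^sup>2" using pq by auto
        then show "\<bar>\<eta>r s r\<bar> \<le> 2 * p s r * (q s r)\<^sup>2 + 2 * q s r * (p s r)\<^sup>2" unfolding \<eta>r_def by linarith
      qed (use Fl rr pq in auto)
      then show "\<eta>t s r * e s r - \<eta>r s r * Fl s r \<le> 0" unfolding \<eta>t_def by (simp add: algebra_simps abs_le_iff)
    qed auto
    ultimately show "\<exists>y. DERIV En s :> y \<and> y \<le> 0" using dEn[of s] by auto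
  next
    show "continuous_on {0..t} En"
      by (rule DERIV_continuous_on[OF has_field_derivative_at_within[OF dEn]])
  qed
  also have "En 0 = 0"
  proof -
    have "En 0 = integral {0..S} (\<lambda>_. 0)"
      unfolding En_def
    proof (rule integral_cong)
      fix r assume "r \<in> {0..S}"
      then show "\<eta> 0 r * e 0 r = 0"
        using data[of r] data_w[of r] r0 by (cases "r > R0") (auto simp: e_def edens_def \<eta>_def p_def)
    qed
    then show ?thesis by simp
  qed
  finally have le: "En t \<le> 0" .
  have ecc: "continuous_on {0..S} (\<lambda>r. \<eta> t r * e t r)"
    unfolding e_def by (intro continuous_intros edens_continuous vc wc cont2_compose[OF c(1)]) auto
  have nn: "0 \<le> \<eta> t r * e t r" if "r \<in> {0..S}" for r
    using that lam edens_nonneg[of lam r] by (auto simp: \<eta>_def e_def)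
  have rS: "r \<in> {0..S}" using r r0 t speed_pos by (auto simp: S_def) (smt (verit) mult_nonneg_nonneg)+
  have Spos: "S > 0" using rS t speed_pos unfolding S_def by (smt (verit) atLeastAtMost_iff mult_nonneg_nonneg)
  have "En t = 0" using le integral_nonneg[OF integrable_continuous_real[OF ecc] nn] unfolding En_def by linarith
  then have "((\<lambda>r. \<eta> t r * e t r) has_integral 0) (cbox 0 S)"
    using integrable_integral[OF integrable_continuous_real[OF ecc]] by (simp add: En_def)
  then have "\<eta> t r * e t r = 0"
    using has_integral_0_cbox_imp_0[of 0 S "\<lambda>r. \<eta> t r * e t r" r] ecc nn rS Spos by auto
  moreover have "\<eta> t r > 0" using r by (auto simp: \<eta>_def p_def q_def S_def)
  ultimately have "e t r = 0" by simp
  moreover have "r > 0" using r r0 t speed_pos by (smt (verit) mult_nonneg_nonneg)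
  moreover have "0 \<le> \<mu> r * r\<^sup>2 * (v 1 t r)\<^sup>2" "0 \<le> r\<^sup>2 / \<mu> r * (w 0 t r)\<^sup>2" "0 \<le> lam * a r * (v 0 t r)\<^sup>2"
    using \<mu>_pos[of r] a_nonneg[of r] lam \<open>r > 0\<close> by auto
  moreover have "x = 0" if "(x + y + z) / 2 = 0" "0 \<le> x" "0 \<le> y" "0 \<le> z" for x y z :: real
    using that by simp
  ultimately have "\<mu> r * r\<^sup>2 * (v 1 t r)\<^sup>2 = 0" unfolding e_def edens_def by blast
  then show ?thesis using \<mu>_pos[of r] \<open>r > 0\<close> by auto
qed

lemma v_zero:
  assumes "t \<ge> 0" "r > R0 + speed * t"
  shows "v n t r = 0"
  using assms
proof (induction n arbitrary: t r)
  case 0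
  have r: "r > R0" using 0 speed_pos by (smt (verit) mult_nonneg_nonneg)
  show ?case
  proof (cases "t = 0")
    case True
    then show ?thesis using data[of r] r r0 by simp
  next
    case False
    have "v 0 t r = v 0 0 r"
    proof (rule DERIV_isconst2[of 0 t "\<lambda>t. v 0 t r"])
      show "continuous_on {0..t} (\<lambda>t. v 0 t r)" by (intro cont2_compose[OF vc] continuous_intros)
      show "((\<lambda>t. v 0 t r) has_real_derivative 0) (at x)" if "0 < x" "x < t" for x
      proof -
        have "speed * x \<le> speed * t" using that speed_pos by simp
        then have "v 1 x r = 0" using that 0 by (intro finite_speed_0) auto
        then show ?thesis using v_t[of 0 r x] by simp
      qed
    qed (use 0 False in auto)
    then show ?thesis using data[of r] r r0 by simp
  qed
next
  case (Suc n)
  \<comment> \<open>The derivative is taken from the right: at t = 0 the induction hypothesis says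
    nothing about earlier times, whereas the strict inequality persists for slightly later
    ones.\<close>
  have "((\<lambda>t. v n t r) has_real_derivative v (Suc n) t r) (at t within {t..})"
    by (rule has_field_derivative_at_within[OF v_t])
  moreover have "\<forall>\<^sub>F s in at t within {t..}. v n s r = 0"
  proof -
    have "\<forall>\<^sub>F s in nhds t. R0 + speed * s < r"
      using Suc.prems by (intro order_tendstoD(2)[of _ "R0 + speed * t"]) (auto intro!: tendsto_eq_intros filterlim_ident)
    then have "\<forall>\<^sub>F s in at t within {t..}. R0 + speed * s < r \<and> s \<in> {t..}"
      unfolding eventually_at_filter by eventually_elim auto
    then show ?thesis by eventually_elim (use Suc in auto)
  qed
  moreover have "v n t r = 0" using Suc by blast
  ultimately have "((\<lambda>t. 0) has_real_derivative v (Suc n) t r) (at t within {t..})"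
    by (subst (asm) has_field_derivative_cong_eventually[where g = "\<lambda>_. 0"]) auto
  moreover have "((\<lambda>t. 0::real) has_real_derivative 0) (at t within {t..})" by simp
  moreover have "at t within {t..} \<noteq> bot" using trivial_limit_at_right_real[of t] at_within_Ici_at_right[of t] by simp
  ultimately show ?case by (meson has_field_derivative_unique)
qed

lemma w_zero:
  assumes "t \<ge> 0" "r > R0 + speed * t"
  shows "w n t r = 0"
proof -
  have "((\<lambda>r. 0) has_real_derivative w n t r) (at r)"
  proof (rule DERIV_cong_ev[THEN iffD1, OF refl _ refl v_r])
    show "\<forall>\<^sub>F x in nhds r. v n t x = 0"
      using assms v_zero by (intro eventually_nhds_in_open[of "{R0 + speed * t<..}" r, THEN eventually_mono]) auto
  qed
  then show ?thesis using DERIV_unique DERIV_const by blast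
qed

section \<open>Conserved energies and pointwise bounds\<close>

definition energy :: "nat \<Rightarrow> real" where
  "energy n = integral {0..R0 + 1} (edens lam (v n) (v (Suc n)) (w n) 0)"

lemma energy_nonneg: "energy n \<ge> 0"
  unfolding energy_def using lam
  by (intro integral_nonneg integrable_continuous_real edens_continuous vc wc continuous_intros) (auto intro: edens_nonneg)

text \<open>R stays ahead of the wave front up to time t, so the boundary flux vanishes; at time 0
  the integral no longer depends on R.\<close>

lemma energy_conserved:
  assumes t: "t \<ge> 0" and R: "R > R0 + speed * t"
  shows "integral {0..R} (edens lam (v n) (v (Suc n)) (w n) t) = energy n"
proof -
  let ?e = "edens lam (v n) (v (Suc n)) (w n)"
  have RR0: "R > R0" using t R speed_pos by (smt (verit) mult_nonneg_nonneg)
  have c: "cont2 (\<lambda>t r. 0)" "cont2 (\<lambda>t r. 1)" by (simp_all add: cont2_def)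
  have d: "((\<lambda>t. integral {0..R} (?e t)) has_real_derivative v (Suc n) s R * (R\<^sup>2 / \<mu> R * w n s R)) (at s)" for s
    using weighted_energy_identity[OF vc[of n] vc[of "Suc n"] vc[of "Suc (Suc n)"] wc[of n] wc[of "Suc n"] c(1) c(2) c(1) c(1),
        where lam = lam and R = R and t = s] v_t[of n] v_t[of "Suc n"] w_t[of n] v_r[of "Suc n"] v_pde[of _ n] RR0 r0
    by simp
  have "integral {0..R} (?e t) = integral {0..R} (?e 0)"
  proof (cases "t = 0")
    case False
    show ?thesis
    proof (rule DERIV_isconst2[of 0 t "\<lambda>t. integral {0..R} (?e t)"])
      show "continuous_on {0..t} (\<lambda>t. integral {0..R} (?e t))"
        by (rule DERIV_continuous_on[OF has_field_derivative_at_within[OF d]])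
      show "((\<lambda>t. integral {0..R} (?e t)) has_real_derivative 0) (at s)" if "0 < s" "s < t" for s
      proof -
        have "speed * s \<le> speed * t" using that speed_pos by simp
        then have "v (Suc n) s R = 0" using that R by (intro v_zero) auto
        then show ?thesis using d[of s] by simp
      qed
    qed (use t False in auto)
  qed simp
  also have "\<dots> = energy n"
  proof -
    have i: "?e 0 integrable_on {x..y}" if "x \<ge> 0" for x y
      using that by (intro integrable_continuous_real edens_continuous vc wc continuous_intros) auto
    have split: "integral {0..Q} (?e 0) = integral {0..R0} (?e 0)" if "Q \<ge> R0" for Q
    proof -
      have "integral {0..Q} (?e 0) = integral {0..R0} (?e 0) + integral {R0..Q} (?e 0)"
        using that r0 by (intro Henstock_Kurzweil_Integration.integral_combine[symmetric] i) auto
      \<comment> \<open>The data are known to vanish only for r > R0, hence the exceptional point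
        R0.\<close>
      also have "integral {R0..Q} (?e 0) = integral {R0..Q} (\<lambda>_. 0)"
        by (rule integral_spike[of "{R0}"]) (use v_zero[of 0] w_zero[of 0] in \<open>auto simp: edens_def\<close>)
      finally show ?thesis by simp
    qed
    show ?thesis unfolding energy_def using split[of R] split[of "R0 + 1"] RR0 by simp
  qed
  finally show ?thesis .
qed

lemma v_square_bound:
  assumes t: "t \<ge> 0" and r: "r \<ge> 0"
  shows "r * (v n t r)\<^sup>2 \<le> 2 * m1 * energy n"
proof -
  define R where "R = max r (R0 + speed * t + 1)"
  have R: "R \<ge> r" "R > R0 + speed * t" using r by (auto simp: R_def)
  have "r * (v n t r)\<^sup>2 \<le> 2 * m1 * integral {0..R} (edens lam (v n) (v (Suc n)) (w n) t)"
    by (rule hardy_bound[OF lam vc vc wc v_r r R(1)]) (use t R in \<open>intro v_zero\<close>)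
  then show ?thesis using energy_conserved[OF t R(2)] by simp
qed

lemma v_product_bound:
  assumes t: "t \<ge> 0" and r: "r > 0"
  shows "\<bar>v n t r\<bar> * \<bar>v m t r\<bar> \<le> 2 * m1 * sqrt (energy n * energy m) / r"
proof -
  have "(r * (\<bar>v n t r\<bar> * \<bar>v m t r\<bar>))\<^sup>2 = (r * (v n t r)\<^sup>2) * (r * (v m t r)\<^sup>2)"
    by (simp add: power2_eq_square algebra_simps)
  also have "\<dots> \<le> (2 * m1 * energy n) * (2 * m1 * energy m)"
    using r t m1_pos energy_nonneg by (intro mult_mono[OF v_square_bound v_square_bound]) auto
  also have "\<dots> = (2 * m1 * sqrt (energy n * energy m))\<^sup>2"
    using energy_nonneg by (simp add: power_mult_distrib power2_eq_square)
  finally have sq: "(r * (\<bar>v n t r\<bar> * \<bar>v m t r\<bar>))\<^sup>2 \<le> (2 * m1 * sqrt (energy n * energy m))\<^sup>2" .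
  have "r * (\<bar>v n t r\<bar> * \<bar>v m t r\<bar>) \<le> 2 * m1 * sqrt (energy n * energy m)"
    by (rule power2_le_imp_le[OF sq]) (use m1_pos energy_nonneg in simp)
  then show ?thesis using r by (simp add: field_simps)
qed

text \<open>The flux \<open>v y\<close>, \<open>y = r\<^sup>2 v\<^sub>r / \<mu>\<close>, can only decrease at a rate proportional to \<open>r\<close>: this transports
  bounds from a sphere of radius \<open>\<rho>\<close> towards the origin.\<close>

lemma v_square_inward:
  assumes t: "t \<ge> 0" and r: "0 \<le> r" "r \<le> \<rho>"
  shows "(v n t r)\<^sup>2 \<le> (v n t \<rho>)\<^sup>2 + 2 * m1 ^ 3 * sqrt (energy n * energy (n + 2)) * (\<rho> - r)"
proof -
  define k where "k = sqrt (energy n * energy (n + 2))"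
  have k: "k \<ge> 0" using energy_nonneg by (simp add: k_def)
  define y where "y x = x\<^sup>2 / \<mu> x * w n t x" for x
  have yc: "continuous_on {0..b} y" for b
    unfolding y_def using \<mu>_pos by (intro continuous_intros \<mu>_comp cont2_compose[OF wc]) (auto, fastforce)
  have yd: "(y has_real_derivative \<mu> x * x\<^sup>2 * v (Suc (Suc n)) t x + lam * a x * v n t x) (at x)" if "x > 0" for x
    unfolding y_def[abs_def] by (rule v_pde[OF that])
  \<comment> \<open>In the derivative of v y the terms w y and lam a v^2 are nonnegative. The
    remaining term \<mu> r^2 v v_tt is at least - 2 m1^2 k r by \<open>v_product_bound\<close>, and
    integrating from the origin gives - m1^2 k r^2.\<close>
  have vy: "v n t x * y x + m1\<^sup>2 * k * x\<^sup>2 \<ge> 0" if x: "x \<ge> 0" for x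
  proof -
    have "v n t 0 * y 0 + m1\<^sup>2 * k * 0\<^sup>2 \<le> v n t x * y x + m1\<^sup>2 * k * x\<^sup>2"
    proof (rule nonneg_derivative_mono[OF x])
      show "continuous_on {0..x} (\<lambda>x. v n t x * y x + m1\<^sup>2 * k * x\<^sup>2)"
        by (intro continuous_intros yc cont2_compose[OF vc])
      fix z assume z: "0 < z" "z < x"
      show "((\<lambda>x. v n t x * y x + m1\<^sup>2 * k * x\<^sup>2) has_real_derivative
          w n t z * y z + v n t z * (\<mu> z * z\<^sup>2 * v (Suc (Suc n)) t z + lam * a z * v n t z) + m1\<^sup>2 * k * (2 * z)) (at z)"
        by (rule derivative_eq_intros DERIV_mult'[OF v_r yd[OF z(1)]] refl)+ (simp_all add: algebra_simps)
      have "\<bar>\<mu> z * z\<^sup>2 * (v n t z * v (Suc (Suc n)) t z)\<bar> = \<mu> z * z\<^sup>2 * (\<bar>v n t z\<bar> * \<bar>v (Suc (Suc n)) t z\<bar>)"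
        using \<mu>_pos[of z] z by (simp add: abs_mult)
      also have "\<dots> \<le> m1 * z\<^sup>2 * (2 * m1 * k / z)"
        using \<mu>_pos[of z] \<mu>_upper[of z] m1_pos z v_product_bound[OF t z(1), of n "n + 2"] by (intro mult_mono) (auto simp: k_def)
      also have "\<dots> = m1\<^sup>2 * k * (2 * z)" using z by (simp add: power2_eq_square)
      finally have "0 \<le> v n t z * (\<mu> z * z\<^sup>2 * v (Suc (Suc n)) t z) + m1\<^sup>2 * k * (2 * z)"
        by (simp add: abs_le_iff mult_ac)
      moreover have "w n t z * y z = z\<^sup>2 / \<mu> z * (w n t z)\<^sup>2" by (simp add: y_def power2_eq_square)
      then have "0 \<le> w n t z * y z" using \<mu>_pos[of z] z by simp
      moreover have "0 \<le> v n t z * (lam * a z * v n t z)"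
      proof -
        have "0 \<le> (lam * a z) * (v n t z * v n t z)" using lam a_nonneg[of z] z by simp
        then show ?thesis by (simp add: mult_ac)
      qed
      ultimately show "0 \<le> w n t z * y z + v n t z * (\<mu> z * z\<^sup>2 * v (Suc (Suc n)) t z + lam * a z * v n t z) + m1\<^sup>2 * k * (2 * z)"
        by (simp add: distrib_left)
    qed
    then show ?thesis by (simp add: y_def)
  qed
  have "(v n t r)\<^sup>2 + 2 * m1 ^ 3 * k * r \<le> (v n t \<rho>)\<^sup>2 + 2 * m1 ^ 3 * k * \<rho>"
  proof (rule nonneg_derivative_mono[OF r(2)])
    show "continuous_on {r..\<rho>} (\<lambda>x. (v n t x)\<^sup>2 + 2 * m1 ^ 3 * k * x)"
      by (intro continuous_intros cont2_compose[OF vc])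
    fix z assume z: "r < z" "z < \<rho>"
    then have z0: "z > 0" using r by simp
    show "((\<lambda>x. (v n t x)\<^sup>2 + 2 * m1 ^ 3 * k * x) has_real_derivative 2 * v n t z * w n t z + 2 * m1 ^ 3 * k) (at z)"
      by (auto intro!: derivative_eq_intros v_r simp: algebra_simps)
    have "v n t z * w n t z = \<mu> z / z\<^sup>2 * (v n t z * y z)" using \<mu>_pos[of z] z0 by (simp add: y_def)
    also have "\<dots> \<ge> \<mu> z / z\<^sup>2 * (- (m1\<^sup>2 * k * z\<^sup>2))"
      using vy[of z] \<mu>_pos[of z] z0 by (intro mult_left_mono) auto
    also have "\<mu> z / z\<^sup>2 * (- (m1\<^sup>2 * k * z\<^sup>2)) = - (\<mu> z * (m1\<^sup>2 * k))" using z0 by simp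
    also have "\<dots> \<ge> - (m1 * (m1\<^sup>2 * k))"
      using \<mu>_upper[of z] z0 k by (auto intro!: mult_right_mono)
    finally show "0 \<le> 2 * v n t z * w n t z + 2 * m1 ^ 3 * k" by (simp add: power3_eq_cube power2_eq_square)
  qed
  then show ?thesis by (simp add: k_def algebra_simps)
qed

text \<open>The first term is \<open>v_square_bound\<close> on the sphere of radius R, the second
  the loss in \<open>v_square_inward\<close> over a distance of at most R. It depends on conserved
  energies only, hence not on time.\<close>

definition vbound :: "nat \<Rightarrow> real \<Rightarrow> real" where
  "vbound n R = sqrt (2 * m1 * energy n / R + 2 * m1 ^ 3 * sqrt (energy n * energy (n + 2)) * R)"

lemma v_bound:
  assumes "t \<ge> 0" "0 \<le> r" "r \<le> R" "R > 0"
  shows "\<bar>v n t r\<bar> \<le> vbound n R"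
proof -
  have "(v n t R)\<^sup>2 \<le> 2 * m1 * energy n / R"
    using v_square_bound[of t R n] assms by (simp add: field_simps)
  moreover have "2 * m1 ^ 3 * sqrt (energy n * energy (n + 2)) * (R - r) \<le> 2 * m1 ^ 3 * sqrt (energy n * energy (n + 2)) * R"
    using assms m1_pos energy_nonneg by (intro mult_left_mono) auto
  ultimately have "(v n t r)\<^sup>2 \<le> 2 * m1 * energy n / R + 2 * m1 ^ 3 * sqrt (energy n * energy (n + 2)) * R"
    using v_square_inward[of t r R n] assms by linarith
  then show ?thesis unfolding vbound_def by (metis real_sqrt_abs real_sqrt_le_iff)
qed

lemma vbound_nonneg: "R > 0 \<Longrightarrow> vbound n R \<ge> 0"
  using v_bound[of 0 0 R n] by linarith

section \<open>The time integral of the wave, with the static source left by the initial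
  velocity\<close>

lemma primitive_pde:
  assumes r: "r > 0"
  shows "((\<lambda>r. r\<^sup>2 / \<mu> r * primitive (w 0) t r) has_real_derivative
     \<mu> r * r\<^sup>2 * (v 1 t r - v 1 0 r) + lam * a r * primitive (v 0) t r) (at r)"
proof -
  let ?d = "\<lambda>r s. \<mu> r * r\<^sup>2 * v 2 (t * s) r + lam * a r * v 0 (t * s) r"
  have "((\<lambda>r. integral (cbox 0 1) (\<lambda>s. r\<^sup>2 / \<mu> r * w 0 (t * s) r)) has_vector_derivative
      integral (cbox 0 1) (?d r)) (at r within {0<..})"
  proof (rule leibniz_rule_vector_derivative)
    show "((\<lambda>r. r\<^sup>2 / \<mu> r * w 0 (t * s) r) has_vector_derivative ?d x s) (at x within {0<..})" if "x \<in> {0<..}" for x s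
      using v_pde[of x 0 "t * s"] that
      by (auto simp: numeral_2_eq_2 intro: has_vector_derivative_at_within simp flip: has_real_derivative_iff_has_vector_derivative
          intro: has_field_derivative_at_within)
    show "(\<lambda>s. x\<^sup>2 / \<mu> x * w 0 (t * s) x) integrable_on cbox 0 1" for x
      by (intro integrable_continuous continuous_intros cont2_compose[OF wc])
    show "continuous_on ({0<..} \<times> cbox 0 1) (\<lambda>(x, s). ?d x s)"
      by (auto simp: split_beta intro!: continuous_intros cont2_compose[OF vc] \<mu>_comp a_comp)
  qed (use r in auto)
  then have "((\<lambda>r. integral {0..1} (\<lambda>s. r\<^sup>2 / \<mu> r * w 0 (t * s) r)) has_real_derivative integral {0..1} (?d r)) (at r)"
    using r by (simp add: has_real_derivative_iff_has_vector_derivative at_within_open[of r "{0<..}"])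
  then have "((\<lambda>r. t * (r\<^sup>2 / \<mu> r * integral {0..1} (\<lambda>s. w 0 (t * s) r))) has_real_derivative t * integral {0..1} (?d r)) (at r)"
    by (intro DERIV_cmult) simp
  moreover have "t * integral {0..1} (?d r) = \<mu> r * r\<^sup>2 * (v 1 t r - v 1 0 r) + lam * a r * primitive (v 0) t r"
  proof -
    have i: "(\<lambda>s. v n (t * s) r) integrable_on {0..1}" for n
      by (intro integrable_continuous_real continuous_intros cont2_compose[OF vc])
    have d': "((\<lambda>s. v 1 (t * s) r) has_real_derivative v 2 (t * s) r * t) (at s)" for s
    proof -
      have "((\<lambda>t. v 1 t r) has_real_derivative v 2 (t * s) r) (at (t * s))"
        using v_t[of 1 r "t * s"] by (simp add: numeral_2_eq_2)
      then show ?thesis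
        by (rule DERIV_chain2[where f = "\<lambda>t. v 1 t r" and g = "\<lambda>s. t * s"]) (auto intro!: derivative_eq_intros)
    qed
    have "((\<lambda>s. v 2 (t * s) r * t) has_integral v 1 (t * 1) r - v 1 (t * 0) r) {0..1}"
      by (rule fundamental_theorem_of_calculus, simp, rule has_vector_derivative_at_within,
          rule d'[unfolded has_real_derivative_iff_has_vector_derivative])
    from integral_unique[OF this] have "integral {0..1} (\<lambda>s. v 2 (t * s) r) * t = v 1 t r - v 1 0 r"
      unfolding integral_mult_left by simp
    then have "t * integral {0..1} (\<lambda>s. v 2 (t * s) r) = v 1 t r - v 1 0 r" by (simp only: mult.commute)
    moreover have "integral {0..1} (?d r) = \<mu> r * r\<^sup>2 * integral {0..1} (\<lambda>s. v 2 (t * s) r) + lam * a r * integral {0..1} (\<lambda>s. v 0 (t * s) r)"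
      using integral_add[OF integrable_on_mult_right[OF i, of "\<mu> r * r\<^sup>2" 2] integrable_on_mult_right[OF i, of "lam * a r" 0]] by simp
    moreover have "t * (x * p + y * q) = x * (t * p) + y * (t * q)" for x y p q :: real by (simp add: algebra_simps)
    ultimately show ?thesis by (simp only: primitive_def)
  qed
  ultimately show ?thesis unfolding primitive_def by (simp only: mult.left_commute[of t])
qed

text \<open>The time integral \<open>u\<close> of \<open>v\<close> solves the wave equation with the static source \<open>v\<^sub>t(0)\<close>, whose work is the
  exact differential of \<open>\<integral> \<mu> r\<^sup>2 u v\<^sub>t(0)\<close>; the energy of \<open>u\<close> therefore stays bounded.\<close>

lemma primitive_bounded:
  obtains C where "\<And>t r. t \<ge> 0 \<Longrightarrow> r \<ge> 0 \<Longrightarrow> r * (integral {0..t} (\<lambda>s. v 0 s r))\<^sup>2 \<le> C"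
proof -
  define u where "u = primitive (v 0)"
  define ur where "ur = primitive (w 0)"
  have uc: "cont2 u" "cont2 ur" unfolding u_def ur_def by (intro primitive_cont2 vc wc)+
  have u_t: "((\<lambda>t. u t r) has_real_derivative v 0 t r) (at t)" for t r
    unfolding u_def by (rule primitive_has_derivative[OF vc vc v_t])
  have ur_t: "((\<lambda>t. ur t r) has_real_derivative w 0 t r) (at t)" for t r
    unfolding ur_def by (rule primitive_has_derivative[OF wc wc w_t])
  have u_r: "((\<lambda>r. u t r) has_real_derivative ur t r) (at r)" for t r
    unfolding u_def ur_def primitive_def
    by (intro DERIV_cmult leibniz_real_interval v_r)
      (auto intro!: cont2_compose[OF vc] cont2_compose[OF wc] continuous_intros)
  have u0: "u 0 r = 0" "ur 0 r = 0" for r by (simp_all add: u_def ur_def primitive_def)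
  define g where "g t r = v 1 0 r" for t r :: real
  have gc: "cont2 g" unfolding cont2_def g_def by (intro cont2_compose[OF vc] continuous_intros)
  define e where "e = edens lam u (v 0) ur"
  have ei: "e t integrable_on {x..y}" if "x \<ge> 0" for t x y
    unfolding e_def using that by (intro integrable_continuous_real edens_continuous vc uc continuous_intros) auto
  have uz: "u t r = 0" if "t \<ge> 0" "r > R0 + speed * t" for t r
  proof -
    have "u t r = integral {0..t} (\<lambda>s. v 0 s r)"
      unfolding u_def by (rule primitive_eq_integral[OF vc vc v_t that(1), symmetric])
    also have "\<dots> = integral {0..t} (\<lambda>_. 0)"
    proof (rule integral_cong)
      fix s assume s: "s \<in> {0..t}"
      then have "speed * s \<le> speed * t" using speed_pos by simp
      then show "v 0 s r = 0" using s that by (intro v_zero) auto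
    qed
    finally show ?thesis by simp
  qed
  define E0 where "E0 = integral {0..R0 + 1} (e 0)"
  define V1 where "V1 = vbound 1 R0"
  \<comment> \<open>K is read off from |Q| \<le> K sqrt E: the source lives in r \<le> R0 and is at
    most V1 there, while r |u| is at most sqrt(2 m1 R0 E) by \<open>hardy_bound\<close>.\<close>
  define K where "K = m1 * R0 * V1 * sqrt (2 * m1 * R0) * R0"
  have V1: "V1 \<ge> 0" unfolding V1_def using r0 by (intro vbound_nonneg) auto
  have E0: "E0 \<ge> 0" unfolding E0_def e_def using lam
    by (intro integral_nonneg ei[unfolded e_def]) (auto intro: edens_nonneg)
  have main: "r * (u t r)\<^sup>2 \<le> 2 * m1 * (2 * E0 + K\<^sup>2)" if t: "t \<ge> 0" and r: "r \<ge> 0" for t r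
  proof -
    define R where "R = max r (R0 + speed * t + 1)"
    have "0 \<le> speed * t" using t speed_pos by simp
    then have R: "R \<ge> r" "R > R0 + speed * t" "R \<ge> R0 + 1" using r by (auto simp: R_def)
    define En where "En t = integral {0..R} (e t)" for t
    define Q where "Q t = integral {0..R} (\<lambda>r. \<mu> r * r\<^sup>2 * u t r * v 1 0 r)" for t
    have c: "cont2 (\<lambda>t r. 0)" "cont2 (\<lambda>t r. 1)" by (simp_all add: cont2_def)
    have dE: "(En has_real_derivative integral {0..R} (\<lambda>r. \<mu> r * r\<^sup>2 * v 0 s r * v 1 0 r) + v 0 s R * (R\<^sup>2 / \<mu> R * ur s R)) (at s)" for s
      using weighted_energy_identity[OF uc(1) vc[of 0] vc[of "Suc 0"] uc(2) wc[of 0] gc c(2) c(1) c(1),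
        where lam = lam and R = R and t = s] u_t v_t[of 0] ur_t v_r[of 0] primitive_pde[folded u_def ur_def] R r0
      by (simp add: En_def[abs_def] e_def g_def)
    have dQ: "(Q has_real_derivative integral {0..R} (\<lambda>r. \<mu> r * r\<^sup>2 * v 0 s r * v 1 0 r)) (at s)" for s
      unfolding Q_def[abs_def]
    proof (rule leibniz_real_interval)
      show "((\<lambda>x. \<mu> r * r\<^sup>2 * u x r * v 1 0 r) has_real_derivative \<mu> r * r\<^sup>2 * v 0 x r * v 1 0 r) (at x)" for x r
        by (auto intro!: derivative_eq_intros u_t)
    qed (auto intro!: continuous_intros \<mu>_comp cont2_compose[OF vc] cont2_compose[OF uc(1)])
    have "En t - Q t = En 0 - Q 0"
    proof (cases "t = 0")
      case False
      show ?thesis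
      proof (rule DERIV_isconst2[of 0 t "\<lambda>t. En t - Q t"])
        show "continuous_on {0..t} (\<lambda>t. En t - Q t)"
          by (rule DERIV_continuous_on[OF has_field_derivative_at_within[OF DERIV_diff[OF dE dQ]]])
        show "((\<lambda>t. En t - Q t) has_real_derivative 0) (at s)" if "0 < s" "s < t" for s
        proof -
          have "speed * s \<le> speed * t" using that speed_pos by simp
          then have "v 0 s R = 0" using that R by (intro v_zero) auto
          then show ?thesis using DERIV_diff[OF dE[of s] dQ[of s]] by simp
        qed
      qed (use t False in auto)
    qed simp
    moreover have "Q 0 = 0" by (simp add: Q_def u0)
    moreover have "En 0 = E0"
    proof -
      have "En 0 = integral {0..R0 + 1} (e 0) + integral {R0 + 1..R} (e 0)"
        unfolding En_def using R r0 by (intro Henstock_Kurzweil_Integration.integral_combine[symmetric] ei) auto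
      also have "integral {R0 + 1..R} (e 0) = integral {R0 + 1..R} (\<lambda>_. 0)"
        by (rule integral_cong) (use v_zero[of 0 _ 0] in \<open>auto simp: e_def edens_def u0\<close>)
      finally show ?thesis by (simp add: E0_def)
    qed
    ultimately have EQ: "En t = E0 + Q t" by simp
    have En0: "En t \<ge> 0" unfolding En_def e_def using lam
      by (intro integral_nonneg ei[unfolded e_def]) (auto intro: edens_nonneg)
    have hardy: "x * (u t x)\<^sup>2 \<le> 2 * m1 * En t" if "0 \<le> x" "x \<le> R" for x
      unfolding En_def e_def by (rule hardy_bound[OF lam uc(1) vc uc(2) u_r that]) (use t R in \<open>intro uz\<close>)
    have "\<bar>Q t\<bar> \<le> K * sqrt (En t)"
    proof -
      have qc: "continuous_on S (\<lambda>r. \<mu> r * r\<^sup>2 * u t r * v 1 0 r)" if "S \<subseteq> {0..}" for S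
        using that by (intro continuous_intros \<mu>_comp cont2_compose[OF vc] cont2_compose[OF uc(1)]) auto
      have "Q t = integral {0..R0} (\<lambda>r. \<mu> r * r\<^sup>2 * u t r * v 1 0 r) + integral {R0..R} (\<lambda>r. \<mu> r * r\<^sup>2 * u t r * v 1 0 r)"
        unfolding Q_def using R r0 by (intro Henstock_Kurzweil_Integration.integral_combine[symmetric] integrable_continuous_real qc) auto
      also have "integral {R0..R} (\<lambda>r. \<mu> r * r\<^sup>2 * u t r * v 1 0 r) = integral {R0..R} (\<lambda>_. 0)"
        by (rule integral_spike[of "{R0}"]) (use v_zero[of 0 _ 1] in auto)
      also have "norm (integral {0..R0} (\<lambda>r. \<mu> r * r\<^sup>2 * u t r * v 1 0 r) + integral {R0..R} (\<lambda>_. 0)) \<le>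
          (m1 * R0 * V1 * sqrt (2 * m1 * R0) * sqrt (En t)) * (R0 - 0)"
        unfolding integral_0 add_0_right
      proof (rule integral_bound)
        fix x assume x: "x \<in> {0..R0}"
        have "(x * \<bar>u t x\<bar>)\<^sup>2 = x * (x * (u t x)\<^sup>2)" by (simp add: power2_eq_square)
        also have "\<dots> \<le> R0 * (2 * m1 * En t)"
          using x R En0 m1_pos by (intro mult_mono hardy) auto
        also have "\<dots> = (sqrt (2 * m1 * R0) * sqrt (En t))\<^sup>2"
          using m1_pos r0 En0 by (simp add: power_mult_distrib)
        finally have sq: "(x * \<bar>u t x\<bar>)\<^sup>2 \<le> (sqrt (2 * m1 * R0) * sqrt (En t))\<^sup>2" .
        have 1: "x * \<bar>u t x\<bar> \<le> sqrt (2 * m1 * R0) * sqrt (En t)"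
          by (rule power2_le_imp_le[OF sq]) (use m1_pos r0 En0 in simp)
        have "norm (\<mu> x * x\<^sup>2 * u t x * v 1 0 x) = \<mu> x * x * \<bar>v 1 0 x\<bar> * (x * \<bar>u t x\<bar>)"
          using x \<mu>_pos[of x] by (simp add: abs_mult power2_eq_square)
        also have "\<dots> \<le> m1 * R0 * V1 * (sqrt (2 * m1 * R0) * sqrt (En t))"
          using x \<mu>_pos[of x] \<mu>_upper[of x] m1_pos r0 V1 v_bound[of 0 x R0 1]
          by (intro mult_mono[OF _ 1]) (auto simp: V1_def intro!: mult_mono)
        finally show "norm (\<mu> x * x\<^sup>2 * u t x * v 1 0 x) \<le> m1 * R0 * V1 * sqrt (2 * m1 * R0) * sqrt (En t)" by simp
      next
        show "continuous_on {0..R0} (\<lambda>r. \<mu> r * r\<^sup>2 * u t r * v 1 0 r)" by (rule qc) auto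
      qed (use r0 in simp)
      finally show ?thesis by (simp add: K_def mult_ac)
    qed
    then have "En t \<le> E0 + K * sqrt (En t)" using EQ by linarith
    \<comment> \<open>E \<le> E0 + K sqrt E improves itself: half of E is absorbed on the left,
      which leaves a bound independent of time.\<close>
    moreover have "2 * K * sqrt (En t) \<le> K\<^sup>2 + (sqrt (En t))\<^sup>2" by (rule sum_squares_bound)
    ultimately have "En t \<le> 2 * E0 + K\<^sup>2" using En0 by simp
    then have "2 * m1 * En t \<le> 2 * m1 * (2 * E0 + K\<^sup>2)" using m1_pos by simp
    with hardy[of r] r R show ?thesis by linarith
  qed
  show ?thesis
  proof (rule that)
    fix t r :: real assume "t \<ge> 0" "r \<ge> 0"
    then show "r * (integral {0..t} (\<lambda>s. v 0 s r))\<^sup>2 \<le> 2 * m1 * (2 * E0 + K\<^sup>2)"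
      using main[of t r] by (subst primitive_eq_integral[OF vc vc v_t]) (simp_all add: u_def)
  qed
qed

end

section \<open>The radial equation at complex frequency\<close>

lemma inner_complex_cnj: "x \<bullet> y = Re (cnj x * y)" for x y :: complex
  by (simp add: inner_complex_def)

lemma has_derivative_norm_square:
  fixes z :: "real \<Rightarrow> complex"
  assumes "(z has_vector_derivative z') (at x)"
  shows "((\<lambda>x. (norm (z x))\<^sup>2) has_real_derivative 2 * (z x \<bullet> z')) (at x)"
proof -
  have "((\<lambda>x. z x \<bullet> z x) has_vector_derivative z x \<bullet> z' + z' \<bullet> z x) (at x)"
    by (rule bounded_bilinear.has_vector_derivative[OF bounded_bilinear_inner assms assms])
  then show ?thesis
    by (simp add: has_real_derivative_iff_has_vector_derivative power2_norm_eq_inner inner_commute)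
qed

context radial_geometry
begin

text \<open>In the variable s with ds = \<mu> dr, the equation for \<psi> = r A becomes \<psi>_ss =
  (V + \<sigma>^2) \<psi> + r f with this V: a centrifugal term, and a term created by the factor r
  when \<mu> varies.\<close>

definition potential :: "real \<Rightarrow> real \<Rightarrow> real" where
  "potential lam r = lam * a r / (\<mu> r * r\<^sup>2) - \<mu>' r / (\<mu> r ^ 3 * r)"

text \<open>The tail of \<kappa> / r^2 beyond S integrates to \<kappa> / S, which a large S makes
  small against |\<sigma>|. The second term even decays like r^-3; one of its factors 1/r is
  replaced by 1/\<rho>1.\<close>

lemma potential_decay:
  assumes lam: "lam \<ge> 0" and r: "r \<ge> \<rho>1"
  shows "\<mu> r * \<bar>potential lam r\<bar> \<le> m1 * (lam * a1 / m0 + c1 / (m0 ^ 3 * \<rho>1)) / r\<^sup>2"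
proof -
  have r0: "r > 0" using r \<rho>1 by linarith
  have c1: "c1 \<ge> 0" using \<mu>'_decay[of \<rho>1] \<rho>1 by (smt (verit) divide_nonneg_nonneg zero_le_divide_iff zero_less_power)
  have \<mu>: "m0 \<le> \<mu> r" "\<mu> r \<le> m1" using \<mu>_lower[of r] \<mu>_upper[of r] r0 by auto
  have 1: "\<bar>lam * a r / (\<mu> r * r\<^sup>2)\<bar> \<le> lam * a1 / (m0 * r\<^sup>2)"
    unfolding abs_divide abs_mult using lam a_nonneg[of r] a_upper[of r] \<mu> r0 m0
    by (intro frac_le mult_mono) auto
  have 2: "\<bar>\<mu>' r / (\<mu> r ^ 3 * r)\<bar> \<le> (c1 / r\<^sup>2) / (m0 ^ 3 * \<rho>1)"
    unfolding abs_divide abs_mult using \<mu>'_decay[OF r] \<mu> r r0 m0 \<rho>1 c1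
    by (intro frac_le mult_mono) (auto intro!: power_mono)
  have "\<bar>potential lam r\<bar> \<le> lam * a1 / (m0 * r\<^sup>2) + (c1 / r\<^sup>2) / (m0 ^ 3 * \<rho>1)"
    unfolding potential_def using 1 2 by linarith
  also have "\<dots> = (lam * a1 / m0 + c1 / (m0 ^ 3 * \<rho>1)) / r\<^sup>2"
    by (simp add: add_divide_distrib divide_divide_eq_left mult_ac)
  finally have "\<mu> r * \<bar>potential lam r\<bar> \<le> m1 * ((lam * a1 / m0 + c1 / (m0 ^ 3 * \<rho>1)) / r\<^sup>2)"
    using \<mu> m0 m1_pos by (intro mult_mono) auto
  then show ?thesis by simp
qed

lemma potential_continuous: "continuous_on {0<..} (potential lam)"
proof -
  have "\<mu> r \<noteq> 0" if "r > 0" for r using \<mu>_pos[of r] that by simp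
  then show ?thesis
    unfolding potential_def[abs_def]
    by (intro continuous_intros \<mu>_comp a_comp \<mu>'_cont) auto
qed

end

text \<open>Solutions of the radial equation at complex frequency \<open>\<sigma>\<close>: \<open>A\<close> is the amplitude and \<open>P = r\<^sup>2 A' / \<mu>\<close>.\<close>

locale radial_ode = radial_geometry +
  fixes lam :: real and \<sigma> :: complex and A P f :: "real \<Rightarrow> complex" and Rm :: real
  assumes lam: "lam \<ge> 0" and Re_\<sigma>: "Re \<sigma> > 0"
    and AP_cont: "continuous_on {0..Rm} A" "continuous_on {0..Rm} P"
    and A_deriv: "\<And>r. 0 < r \<Longrightarrow> r < Rm \<Longrightarrow> (A has_vector_derivative (\<mu> r / r\<^sup>2) *\<^sub>R P r) (at r)"
    and P_deriv: "\<And>r. 0 < r \<Longrightarrow> r < Rm \<Longrightarrow> (P has_vector_derivative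
        (lam * a r) *\<^sub>R A r + (\<mu> r * r\<^sup>2) *\<^sub>R (\<sigma>\<^sup>2 * A r + f r)) (at r)"
    and P0: "P 0 = 0" and AP_Rm: "A Rm = 0" "P Rm = 0"
begin

text \<open>\<psi> and \<xi> are position and velocity of the one-dimensional problem: \<xi> is the
  derivative of \<psi> with respect to s, ds = \<mu> dr.\<close>

definition "\<psi> r = r *\<^sub>R A r"
definition "\<xi> r = (1 / \<mu> r) *\<^sub>R A r + (1 / r) *\<^sub>R P r"
text \<open>Without potential and source, \<open>Z\<close> and \<open>W\<close> evolve like
  exp(\<sigma> s) and exp(-\<sigma> s): they are the incoming and the outgoing amplitude, and their
  difference recovers 2 \<sigma> \<psi>.\<close>

definition "Z r = \<xi> r + \<sigma> * \<psi> r"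
definition "W r = \<xi> r - \<sigma> * \<psi> r"
text \<open>The radial energy flux at complex frequency. Of the possible sesquilinear fluxes it is
  this one, with \<sigma> inside, that is monotone when Re \<sigma> > 0.\<close>

definition "J r = Re (cnj (\<sigma> * A r) * P r)"

lemma \<psi>_deriv: "0 < r \<Longrightarrow> r < Rm \<Longrightarrow> (\<psi> has_vector_derivative \<mu> r *\<^sub>R \<xi> r) (at r)"
proof -
  assume r: "0 < r" "r < Rm"
  have "(\<psi> has_vector_derivative r *\<^sub>R ((\<mu> r / r\<^sup>2) *\<^sub>R P r) + 1 *\<^sub>R A r) (at r)"
    unfolding \<psi>_def[abs_def]
    by (rule has_vector_derivative_scaleR[OF _ A_deriv[OF r]]) simp
  moreover have "r *\<^sub>R ((\<mu> r / r\<^sup>2) *\<^sub>R P r) + 1 *\<^sub>R A r = \<mu> r *\<^sub>R \<xi> r"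
    using \<mu>_pos[of r] r by (simp add: \<xi>_def scaleR_add_right power2_eq_square)
  ultimately show ?thesis by simp
qed

lemma \<xi>_deriv:
  assumes r: "0 < r" "r < Rm"
  shows "(\<xi> has_vector_derivative \<mu> r *\<^sub>R (potential lam r *\<^sub>R \<psi> r + \<sigma>\<^sup>2 * \<psi> r + r *\<^sub>R f r)) (at r)"
proof -
  have \<mu>0: "\<mu> r > 0" using \<mu>_pos r by simp
  have d1: "((\<lambda>r. 1 / \<mu> r) has_real_derivative - \<mu>' r / (\<mu> r)\<^sup>2) (at r)"
    using \<mu>0 r by (auto intro!: derivative_eq_intros \<mu>_deriv simp: power2_eq_square)
  have d2: "((\<lambda>r. 1 / r) has_real_derivative - 1 / r\<^sup>2) (at r)"
    using r by (auto intro!: derivative_eq_intros simp: power2_eq_square)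
  have "(\<xi> has_vector_derivative
      ((1 / \<mu> r) *\<^sub>R ((\<mu> r / r\<^sup>2) *\<^sub>R P r) + (- \<mu>' r / (\<mu> r)\<^sup>2) *\<^sub>R A r) +
      ((1 / r) *\<^sub>R ((lam * a r) *\<^sub>R A r + (\<mu> r * r\<^sup>2) *\<^sub>R (\<sigma>\<^sup>2 * A r + f r)) + (- 1 / r\<^sup>2) *\<^sub>R P r)) (at r)"
    unfolding \<xi>_def[abs_def]
    by (intro has_vector_derivative_add has_vector_derivative_scaleR A_deriv P_deriv r d1 d2)
  moreover have "((1 / \<mu> r) *\<^sub>R ((\<mu> r / r\<^sup>2) *\<^sub>R P r) + (- \<mu>' r / (\<mu> r)\<^sup>2) *\<^sub>R A r) +
      ((1 / r) *\<^sub>R ((lam * a r) *\<^sub>R A r + (\<mu> r * r\<^sup>2) *\<^sub>R (\<sigma>\<^sup>2 * A r + f r)) + (- 1 / r\<^sup>2) *\<^sub>R P r)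
      = \<mu> r *\<^sub>R (potential lam r *\<^sub>R \<psi> r + \<sigma>\<^sup>2 * \<psi> r + r *\<^sub>R f r)"
  proof -
    have c1: "- \<mu>' r / (\<mu> r)\<^sup>2 + lam * a r / r = \<mu> r * (potential lam r * r)"
      using \<mu>0 r by (simp add: potential_def field_simps power2_eq_square power3_eq_cube)
    have c2: "1 / r * (\<mu> r * r\<^sup>2) = \<mu> r * r" using r by (simp add: power2_eq_square)
    have "((1 / \<mu> r) *\<^sub>R ((\<mu> r / r\<^sup>2) *\<^sub>R P r) + (- \<mu>' r / (\<mu> r)\<^sup>2) *\<^sub>R A r) +
      ((1 / r) *\<^sub>R ((lam * a r) *\<^sub>R A r + (\<mu> r * r\<^sup>2) *\<^sub>R (\<sigma>\<^sup>2 * A r + f r)) + (- 1 / r\<^sup>2) *\<^sub>R P r)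
      = (- \<mu>' r / (\<mu> r)\<^sup>2 + lam * a r / r) *\<^sub>R A r + (1 / r * (\<mu> r * r\<^sup>2)) *\<^sub>R (\<sigma>\<^sup>2 * A r + f r)"
      using \<mu>0 by (simp add: scaleR_add_right scaleR_add_left scaleR_diff_left)
    also have "\<dots> = \<mu> r *\<^sub>R (potential lam r *\<^sub>R \<psi> r + \<sigma>\<^sup>2 * \<psi> r + r *\<^sub>R f r)"
      unfolding c1 c2 by (simp add: \<psi>_def scaleR_add_right)
    finally show ?thesis .
  qed
  ultimately show ?thesis by simp
qed

lemma Z_deriv:
  assumes r: "0 < r" "r < Rm"
  shows "(Z has_vector_derivative \<mu> r *\<^sub>R (\<sigma> * Z r + (potential lam r *\<^sub>R \<psi> r + r *\<^sub>R f r))) (at r)"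
proof -
  have "(Z has_vector_derivative \<mu> r *\<^sub>R (potential lam r *\<^sub>R \<psi> r + \<sigma>\<^sup>2 * \<psi> r + r *\<^sub>R f r) + \<sigma> * (\<mu> r *\<^sub>R \<xi> r)) (at r)"
    unfolding Z_def[abs_def]
    by (intro has_vector_derivative_add \<xi>_deriv r has_vector_derivative_mult_right \<psi>_deriv)
  then show ?thesis by (simp add: Z_def algebra_simps power2_eq_square)
qed

lemma W_deriv:
  assumes r: "0 < r" "r < Rm"
  shows "(W has_vector_derivative \<mu> r *\<^sub>R (- \<sigma> * W r + (potential lam r *\<^sub>R \<psi> r + r *\<^sub>R f r))) (at r)"
proof -
  have "(W has_vector_derivative \<mu> r *\<^sub>R (potential lam r *\<^sub>R \<psi> r + \<sigma>\<^sup>2 * \<psi> r + r *\<^sub>R f r) - \<sigma> * (\<mu> r *\<^sub>R \<xi> r)) (at r)"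
    unfolding W_def[abs_def]
    by (intro has_vector_derivative_diff \<xi>_deriv r has_vector_derivative_mult_right \<psi>_deriv)
  then show ?thesis by (simp add: W_def algebra_simps power2_eq_square)
qed

text \<open>Since (\<sigma> x) \<bullet> x = Re \<sigma> |x|^2, the contributions of P, of the
  angular term and of \<sigma>^2 A are all nonnegative. Only the forcing can make J
  decrease.\<close>

lemma J_deriv:
  assumes r: "0 < r" "r < Rm"
  obtains J' where "(J has_real_derivative J') (at r)" "J' \<ge> - (norm \<sigma> * (\<mu> r * r\<^sup>2 * norm (A r) * norm (f r)))"
proof -
  have \<mu>0: "\<mu> r > 0" using \<mu>_pos r by simp
  define A' where "A' = (\<mu> r / r\<^sup>2) *\<^sub>R P r"
  define P' where "P' = (lam * a r) *\<^sub>R A r + (\<mu> r * r\<^sup>2) *\<^sub>R (\<sigma>\<^sup>2 * A r + f r)"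
  have "((\<lambda>r. (\<sigma> * A r) \<bullet> P r) has_vector_derivative (\<sigma> * A r) \<bullet> P' + (\<sigma> * A') \<bullet> P r) (at r)"
    unfolding A'_def P'_def
    by (intro bounded_bilinear.has_vector_derivative[OF bounded_bilinear_inner] has_vector_derivative_mult_right A_deriv P_deriv r)
  then have d: "(J has_real_derivative (\<sigma> * A r) \<bullet> P' + (\<sigma> * A') \<bullet> P r) (at r)"
    unfolding J_def[abs_def] by (simp add: has_real_derivative_iff_has_vector_derivative inner_complex_cnj)
  have inn: "(\<sigma> * x) \<bullet> x = Re \<sigma> * (norm x)\<^sup>2" for x :: complex
    unfolding cmod_power2 by (simp add: inner_complex_def power2_eq_square algebra_simps)
  have 1: "(\<sigma> * A') \<bullet> P r \<ge> 0"
    unfolding A'_def using Re_\<sigma> \<mu>0 r by (simp add: inn)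
  have 2: "(\<sigma> * A r) \<bullet> ((lam * a r) *\<^sub>R A r) \<ge> 0"
    using Re_\<sigma> lam a_nonneg[of r] r by (simp add: inn)
  have 3: "(\<sigma> * A r) \<bullet> (\<sigma>\<^sup>2 * A r) \<ge> 0"
    using inn[of "\<sigma> * A r"] Re_\<sigma> by (simp add: inner_commute power2_eq_square mult.assoc)
  have "\<bar>(\<sigma> * A r) \<bullet> f r\<bar> \<le> norm (\<sigma> * A r) * norm (f r)" by (rule Cauchy_Schwarz_ineq2)
  then have "(\<sigma> * A r) \<bullet> f r \<ge> - (norm \<sigma> * norm (A r) * norm (f r))" by (simp add: norm_mult)
  then have "(\<mu> r * r\<^sup>2) * ((\<sigma> * A r) \<bullet> f r) \<ge> (\<mu> r * r\<^sup>2) * (- (norm \<sigma> * norm (A r) * norm (f r)))"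
    using \<mu>0 by (intro mult_left_mono) auto
  moreover have "(\<mu> r * r\<^sup>2) * ((\<sigma> * A r) \<bullet> (\<sigma>\<^sup>2 * A r)) \<ge> 0" using 3 \<mu>0 by simp
  ultimately have "(\<sigma> * A r) \<bullet> P' \<ge> (\<mu> r * r\<^sup>2) * (- (norm \<sigma> * norm (A r) * norm (f r)))"
    unfolding P'_def using 2 by (simp add: inner_add_right algebra_simps)
  then show ?thesis using 1 d that by (simp add: mult_ac)
qed

text \<open>By polarisation the right-hand side is (\<sigma> \<psi>) \<bullet> \<xi>, which exceeds
  J by r Re \<sigma> |A|^2 / \<mu>.\<close>

lemma J_le_ZW:
  assumes r: "0 < r"
  shows "J r \<le> ((norm (Z r))\<^sup>2 - (norm (W r))\<^sup>2) / 4"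
proof -
  have "((norm (Z r))\<^sup>2 - (norm (W r))\<^sup>2) / 4 = (\<sigma> * \<psi> r) \<bullet> \<xi> r"
    unfolding Z_def W_def power2_norm_eq_inner by (simp add: inner_add inner_diff inner_commute algebra_simps)
  also have "\<dots> = (r / \<mu> r) * ((\<sigma> * A r) \<bullet> A r) + (\<sigma> * A r) \<bullet> P r"
    unfolding \<psi>_def \<xi>_def using r by (simp add: inner_add_right mult_scaleR_right)
  also have "(\<sigma> * A r) \<bullet> A r = Re \<sigma> * (norm (A r))\<^sup>2"
    unfolding cmod_power2 by (simp add: inner_complex_def power2_eq_square algebra_simps)
  finally show ?thesis using Re_\<sigma> \<mu>_pos[of r] r by (simp add: J_def inner_complex_cnj)
qed

lemma continuous_interior:
  "continuous_on {x..Rm} \<psi>" "continuous_on {x..Rm} \<xi>" "continuous_on {x..Rm} Z" "continuous_on {x..Rm} W" if "x > 0" for x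
proof -
  have *: "continuous_on {x..Rm} A" "continuous_on {x..Rm} P"
    using that by (auto intro: continuous_on_subset[OF AP_cont(1)] continuous_on_subset[OF AP_cont(2)])
  have "\<mu> y \<noteq> 0" if "y \<ge> x" for y using \<mu>_pos[of y] that \<open>x > 0\<close> by simp
  then show "continuous_on {x..Rm} \<psi>" "continuous_on {x..Rm} \<xi>"
    unfolding \<psi>_def[abs_def] \<xi>_def[abs_def] using that by (auto intro!: continuous_intros * \<mu>_comp)
  then show "continuous_on {x..Rm} Z" "continuous_on {x..Rm} W"
    unfolding Z_def[abs_def] W_def[abs_def] by (auto intro!: continuous_intros)
qed

text \<open>Variation of constants in the stable direction of each amplitude: \<open>Z\<close> is
  integrated inward from Rm, where it vanishes, and \<open>W\<close> outward from S. Both errors are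
  at most (\<kappa>/S) m + 1 with m the maximum of |\<psi>|.\<close>

lemma exterior_bound:
  assumes S: "S > 0" "S < Rm" and \<kappa>: "\<kappa> \<ge> 0" "\<kappa> / S \<le> norm \<sigma> / 4"
    and pot: "\<And>r. r \<ge> S \<Longrightarrow> \<mu> r * \<bar>potential lam r\<bar> \<le> \<kappa> / r\<^sup>2"
    and force: "\<And>r. S < r \<Longrightarrow> r < Rm \<Longrightarrow> \<mu> r * r * norm (f r) * Rm \<le> 1"
  shows "norm (Z S) \<le> norm (W S) / 4 + 3 / 2"
proof -
  obtain x0 where x0: "x0 \<in> {S..Rm}" and x0_max: "\<And>x. x \<in> {S..Rm} \<Longrightarrow> norm (\<psi> x) \<le> norm (\<psi> x0)"
  proof -
    have "\<exists>x\<in>{S..Rm}. \<forall>y\<in>{S..Rm}. norm (\<psi> y) \<le> norm (\<psi> x)"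
      by (rule continuous_attains_sup) (use S in \<open>auto intro!: continuous_on_norm continuous_interior(1)\<close>)
    then show ?thesis using that by blast
  qed
  define m where "m = norm (\<psi> x0)"
  define s where "s x = integral {S..x} \<mu>" for x
  have \<mu>c: "continuous_on {S..Rm} \<mu>" using S by (intro \<mu>_comp continuous_intros) auto
  have s_cont: "continuous_on {S..Rm} s"
    unfolding s_def by (intro indefinite_integral_continuous_1 integrable_continuous_real \<mu>c)
  have s_deriv: "(s has_vector_derivative \<mu> x) (at x)" if "S < x" "x < Rm" for x
    using integral_has_vector_derivative[OF \<mu>c, of x] that
    by (simp add: s_def[abs_def] at_within_Icc_at)
  have s_mono: "s x \<le> s y" if "S \<le> x" "x \<le> y" "y \<le> Rm" for x y
    unfolding s_def using that S \<mu>_pos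
    by (intro integral_subset_le integrable_continuous_real continuous_on_subset[OF \<mu>c]) (auto simp: less_imp_le)
  have s_S: "s S = 0" by (simp add: s_def)
  define h where "h x = \<mu> x *\<^sub>R (potential lam x *\<^sub>R \<psi> x + x *\<^sub>R f x)" for x
  have h: "norm (h x) \<le> \<kappa> * m / x\<^sup>2 + 1 / Rm" if x: "S < x" "x < Rm" for x
  proof -
    have \<mu>0: "\<mu> x > 0" using \<mu>_pos x S by simp
    have "norm (h x) \<le> \<mu> x * (\<bar>potential lam x\<bar> * norm (\<psi> x) + x * norm (f x))"
      unfolding h_def using x S \<mu>0 norm_triangle_ineq[of "potential lam x *\<^sub>R \<psi> x" "x *\<^sub>R f x"] by simp
    also have "\<dots> = (\<mu> x * \<bar>potential lam x\<bar>) * norm (\<psi> x) + \<mu> x * x * norm (f x)" by (simp add: algebra_simps)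
    also have "\<dots> \<le> (\<kappa> / x\<^sup>2) * m + 1 / Rm"
    proof (intro add_mono mult_mono pot)
      show "norm (\<psi> x) \<le> m" unfolding m_def using x by (intro x0_max) auto
      show "\<mu> x * x * norm (f x) \<le> 1 / Rm" using force[OF x] S by (simp add: field_simps)
    qed (use x \<kappa> S in auto)
    finally show ?thesis by simp
  qed
  \<comment> \<open>An antiderivative of the bound on the norm of \<open>h\<close>, so that the mean
    value inequality integrates it.\<close>
  define \<phi> where "\<phi> x = x / Rm - \<kappa> * m / x" for x
  have \<phi>_deriv: "(\<phi> has_vector_derivative \<kappa> * m / x\<^sup>2 + 1 / Rm) (at x)" if "S < x" for x
    unfolding \<phi>_def[abs_def] has_real_derivative_iff_has_vector_derivative[symmetric] using that S
    by (auto intro!: derivative_eq_intros simp: power2_eq_square)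
  have \<phi>_cont: "continuous_on {x..y} \<phi>" if "x > 0" for x y
    unfolding \<phi>_def using S that by (intro continuous_intros) auto
  have m0': "m \<ge> 0" by (simp add: m_def)
  have \<phi>_diff: "\<phi> y - \<phi> x \<le> \<kappa> / S * m + 1" if "S \<le> x" "x \<le> y" "y \<le> Rm" for x y
  proof -
    have "\<kappa> * m / x \<le> \<kappa> * m / S" using that S \<kappa> m0' by (intro divide_left_mono) auto
    moreover have "0 \<le> \<kappa> * m / y" using that S \<kappa> m0' by auto
    moreover have "y / Rm \<le> 1" "0 \<le> x / Rm" using that S by auto
    ultimately show ?thesis by (simp add: \<phi>_def)
  qed
  have exp_deriv: "((\<lambda>x. exp (c * of_real (s x))) has_vector_derivative of_real (\<mu> x) * (c * exp (c * of_real (s x)))) (at x)"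
    if "S < x" "x < Rm" for x and c :: complex
  proof -
    have "((\<lambda>z. exp (c * z)) has_field_derivative c * exp (c * of_real (s x))) (at (of_real (s x)))"
      by (auto intro!: derivative_eq_intros)
    from field_vector_diff_chain_at[OF has_vector_derivative_of_real[OF s_deriv[OF that, folded has_real_derivative_iff_has_vector_derivative]] this]
    show ?thesis by (simp add: o_def)
  qed
  have exp_cont: "continuous_on T (\<lambda>x. exp (c * of_real (s x)))" if "T \<subseteq> {S..Rm}" for c :: complex and T
    by (intro continuous_intros continuous_on_subset[OF s_cont that])
  have Z_bound: "norm (Z x) \<le> \<kappa> / S * m + 1" if x: "S \<le> x" "x \<le> Rm" for x
  proof (cases "x = Rm")
    case True
    then show ?thesis using AP_Rm \<kappa> S m0' by (simp add: Z_def \<xi>_def \<psi>_def)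
  next
    case False
    let ?E = "\<lambda>x. exp (- \<sigma> * of_real (s x))"
    \<comment> \<open>The exponential in the comparison function is frozen at x, where it is largest
      on [x, Rm]; only \<phi> remains to be differentiated.\<close>
    have "norm (?E Rm * Z Rm - ?E x * Z x) \<le> exp (- Re \<sigma> * s x) * \<phi> Rm - exp (- Re \<sigma> * s x) * \<phi> x"
    proof (rule differentiable_bound_general[of x Rm "\<lambda>x. ?E x * Z x" "\<lambda>y. exp (- Re \<sigma> * s x) * \<phi> y"])
      show "continuous_on {x..Rm} (\<lambda>x. ?E x * Z x)"
        using x S by (intro continuous_intros exp_cont continuous_on_subset[OF continuous_interior(3)[OF S(1)]]) auto
      show "continuous_on {x..Rm} (\<lambda>y. exp (- Re \<sigma> * s x) * \<phi> y)"
        using x S by (intro continuous_intros \<phi>_cont) auto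
      fix y assume y: "x < y" "y < Rm"
      have y': "S < y" "0 < y" using x y S by auto
      show "((\<lambda>x. ?E x * Z x) has_vector_derivative ?E y * h y) (at y)"
      proof -
        have "((\<lambda>x. ?E x * Z x) has_vector_derivative
            ?E y * (\<mu> y *\<^sub>R (\<sigma> * Z y + (potential lam y *\<^sub>R \<psi> y + y *\<^sub>R f y))) + of_real (\<mu> y) * (- \<sigma> * ?E y) * Z y) (at y)"
          by (intro has_vector_derivative_mult exp_deriv Z_deriv y y')
        then show ?thesis by (simp add: h_def algebra_simps scaleR_conv_of_real)
      qed
      show "((\<lambda>y. exp (- Re \<sigma> * s x) * \<phi> y) has_vector_derivative exp (- Re \<sigma> * s x) * (\<kappa> * m / y\<^sup>2 + 1 / Rm)) (at y)"
        by (intro has_vector_derivative_mult_right \<phi>_deriv y')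
      have "s x \<le> s y" using x y by (intro s_mono) auto
      then have "exp (- Re \<sigma> * s y) \<le> exp (- Re \<sigma> * s x)" using Re_\<sigma> by simp
      then show "norm (?E y * h y) \<le> exp (- Re \<sigma> * s x) * (\<kappa> * m / y\<^sup>2 + 1 / Rm)"
        unfolding norm_mult using h[OF y'(1) y(2)] by (intro mult_mono) (auto simp: norm_exp_eq_Re)
    qed (use x False in auto)
    moreover have "Z Rm = 0" using AP_Rm by (simp add: Z_def \<xi>_def \<psi>_def)
    ultimately have "exp (- Re \<sigma> * s x) * norm (Z x) \<le> exp (- Re \<sigma> * s x) * (\<phi> Rm - \<phi> x)"
      by (simp add: norm_mult norm_exp_eq_Re right_diff_distrib)
    then have "norm (Z x) \<le> \<phi> Rm - \<phi> x" by simp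
    with \<phi>_diff[of x Rm] x show ?thesis by simp
  qed
  have W_bound: "norm (W x) \<le> norm (W S) + (\<kappa> / S * m + 1)" if x: "S \<le> x" "x \<le> Rm" for x
  proof (cases "x = S")
    case True
    then show ?thesis using \<kappa> S m0' by simp
  next
    case False
    let ?E = "\<lambda>x. exp (\<sigma> * of_real (s x))"
    have "norm (?E x * W x - ?E S * W S) \<le> exp (Re \<sigma> * s x) * \<phi> x - exp (Re \<sigma> * s x) * \<phi> S"
    proof (rule differentiable_bound_general[of S x "\<lambda>x. ?E x * W x" "\<lambda>y. exp (Re \<sigma> * s x) * \<phi> y"])
      show "continuous_on {S..x} (\<lambda>x. ?E x * W x)"
        using x S by (intro continuous_intros exp_cont continuous_on_subset[OF continuous_interior(4)[OF S(1)]]) auto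
      show "continuous_on {S..x} (\<lambda>y. exp (Re \<sigma> * s x) * \<phi> y)"
        using x S by (intro continuous_intros \<phi>_cont) auto
      fix y assume y: "S < y" "y < x"
      have y': "y < Rm" "0 < y" using x y S by auto
      show "((\<lambda>x. ?E x * W x) has_vector_derivative ?E y * h y) (at y)"
      proof -
        have "((\<lambda>x. ?E x * W x) has_vector_derivative
            ?E y * (\<mu> y *\<^sub>R (- \<sigma> * W y + (potential lam y *\<^sub>R \<psi> y + y *\<^sub>R f y))) + of_real (\<mu> y) * (\<sigma> * ?E y) * W y) (at y)"
          by (intro has_vector_derivative_mult exp_deriv W_deriv y y')
        then show ?thesis by (simp add: h_def algebra_simps scaleR_conv_of_real)
      qed
      show "((\<lambda>y. exp (Re \<sigma> * s x) * \<phi> y) has_vector_derivative exp (Re \<sigma> * s x) * (\<kappa> * m / y\<^sup>2 + 1 / Rm)) (at y)"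
        by (intro has_vector_derivative_mult_right \<phi>_deriv y)
      have "s y \<le> s x" using x y by (intro s_mono) auto
      then have "exp (Re \<sigma> * s y) \<le> exp (Re \<sigma> * s x)" using Re_\<sigma> by simp
      then show "norm (?E y * h y) \<le> exp (Re \<sigma> * s x) * (\<kappa> * m / y\<^sup>2 + 1 / Rm)"
        unfolding norm_mult using h[OF y(1) y'(1)] by (intro mult_mono) (auto simp: norm_exp_eq_Re)
    qed (use x False in auto)
    moreover have "norm (?E x * W x) \<le> norm (?E x * W x - ?E S * W S) + norm (?E S * W S)"
      using norm_triangle_ineq[of "?E x * W x - ?E S * W S" "?E S * W S"] by simp
    ultimately have "exp (Re \<sigma> * s x) * norm (W x) \<le> exp (Re \<sigma> * s x) * (\<phi> x - \<phi> S) + norm (W S)"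
      by (simp add: norm_mult norm_exp_eq_Re right_diff_distrib s_S)
    also have "norm (W S) \<le> exp (Re \<sigma> * s x) * norm (W S)"
      using s_mono[of S x] s_S x Re_\<sigma> by (simp add: mult_ge1_I mult_le_cancel_right1)
    finally have "exp (Re \<sigma> * s x) * norm (W x) \<le> exp (Re \<sigma> * s x) * (\<phi> x - \<phi> S + norm (W S))"
      by (simp add: distrib_left)
    then have "norm (W x) \<le> \<phi> x - \<phi> S + norm (W S)" by simp
    with \<phi>_diff[of S x] x show ?thesis by simp
  qed
  \<comment> \<open>The maximum m is bounded in turn through Z - W = 2 \<sigma> \<psi>. Because
    \<kappa>/S \<le> |\<sigma>|/4, the share of the potential is absorbed.\<close>
  have "2 * (norm \<sigma> * m) = norm (Z x0 - W x0)"
    by (simp add: Z_def W_def m_def norm_mult flip: mult_2)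
  also have "\<dots> \<le> norm (Z x0) + norm (W x0)" by (rule norm_triangle_ineq4)
  also have "\<dots> \<le> (\<kappa> / S * m + 1) + (norm (W S) + (\<kappa> / S * m + 1))"
    using x0 by (intro add_mono Z_bound W_bound) auto
  finally have 1: "2 * (norm \<sigma> * m) \<le> norm (W S) + 2 * (\<kappa> / S * m) + 2" by simp
  have 2: "\<kappa> / S * m \<le> norm \<sigma> / 4 * m" using \<kappa> m0' by (intro mult_right_mono) auto
  have 3: "norm (Z S) \<le> \<kappa> / S * m + 1" using S by (intro Z_bound) auto
  have "z \<le> x / 4 + 3 / 2" if "2 * y \<le> x + 2 * k + 2" "4 * k \<le> y" "z \<le> k + 1" "0 \<le> x" for x y z k :: real
    using that by simp
  from this[OF 1 _ 3] show ?thesis using 2 by (simp add: mult.commute)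
qed

text \<open>J vanishes at the origin because P does; integrating \<open>J_deriv\<close> outward
  leaves the work of the forcing.\<close>

lemma J_lower:
  assumes S: "S \<ge> 0" "S \<le> Rm" and \<Gamma>: "\<And>r. 0 < r \<Longrightarrow> r < S \<Longrightarrow> \<mu> r * r\<^sup>2 * norm (A r) * norm (f r) \<le> \<Gamma>"
  shows "- (norm \<sigma> * \<Gamma> * S) \<le> J S"
proof -
  define J' where "J' r = (SOME J'. (J has_real_derivative J') (at r) \<and> J' \<ge> - (norm \<sigma> * (\<mu> r * r\<^sup>2 * norm (A r) * norm (f r))))" for r
  have J': "(J has_real_derivative J' r) (at r) \<and> J' r \<ge> - (norm \<sigma> * (\<mu> r * r\<^sup>2 * norm (A r) * norm (f r)))"
    if "0 < r" "r < Rm" for r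
    unfolding J'_def by (rule someI_ex) (meson J_deriv[OF that])
  have "J 0 + norm \<sigma> * \<Gamma> * 0 \<le> J S + norm \<sigma> * \<Gamma> * S"
  proof (rule nonneg_derivative_mono[OF S(1)])
    show "continuous_on {0..S} (\<lambda>r. J r + norm \<sigma> * \<Gamma> * r)"
      unfolding J_def[abs_def] using S
      by (intro continuous_intros continuous_on_subset[OF AP_cont(1)] continuous_on_subset[OF AP_cont(2)]) auto
    fix r assume r: "0 < r" "r < S"
    then have r': "r < Rm" using S by simp
    show "((\<lambda>r. J r + norm \<sigma> * \<Gamma> * r) has_real_derivative J' r + norm \<sigma> * \<Gamma>) (at r)"
      using J'[OF r(1) r'] by (auto intro!: derivative_eq_intros)
    have "norm \<sigma> * (\<mu> r * r\<^sup>2 * norm (A r) * norm (f r)) \<le> norm \<sigma> * \<Gamma>"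
      using \<Gamma>[OF r] by (intro mult_left_mono) auto
    then show "0 \<le> J' r + norm \<sigma> * \<Gamma>" using J'[OF r(1) r'] by linarith
  qed
  then show ?thesis by (simp add: J_def P0)
qed

text \<open>Gronwall run inward from S: exp(G r) (N + H) is nondecreasing. It stops at \<rho> > 0,
  since the potential is singular at the origin.\<close>

lemma interior_growth:
  assumes \<rho>: "0 < \<rho>" "S \<le> Rm" and G: "G \<ge> 1"
    and G_bound: "\<And>r. \<rho> < r \<Longrightarrow> r < S \<Longrightarrow> \<mu> r * (1 + \<bar>potential lam r\<bar> + (norm \<sigma>)\<^sup>2) + 1 \<le> G"
    and H: "\<And>r. \<rho> < r \<Longrightarrow> r < S \<Longrightarrow> (\<mu> r * r * norm (f r))\<^sup>2 \<le> H" "H \<ge> 0"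
    and x: "\<rho> \<le> x" "x \<le> S"
  shows "(norm (\<psi> x))\<^sup>2 + (norm (\<xi> x))\<^sup>2 \<le> exp (G * S) * ((norm (\<psi> S))\<^sup>2 + (norm (\<xi> S))\<^sup>2 + H)"
proof -
  define N where "N r = (norm (\<psi> r))\<^sup>2 + (norm (\<xi> r))\<^sup>2" for r
  define \<xi>' where "\<xi>' r = \<mu> r *\<^sub>R (potential lam r *\<^sub>R \<psi> r + \<sigma>\<^sup>2 * \<psi> r + r *\<^sub>R f r)" for r
  have "exp (G * x) * (N x + H) \<le> exp (G * S) * (N S + H)"
  proof (rule nonneg_derivative_mono[OF x(2)])
    have "continuous_on {x..S} \<psi>" "continuous_on {x..S} \<xi>"
      using \<rho> x continuous_interior(1,2)[of x] by (auto intro: continuous_on_subset)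
    then show "continuous_on {x..S} (\<lambda>r. exp (G * r) * (N r + H))"
      unfolding N_def by (intro continuous_intros)
    fix r assume r: "x < r" "r < S"
    have r': "0 < r" "r < Rm" "\<rho> < r" using r x \<rho> by auto
    have \<mu>0: "\<mu> r > 0" using \<mu>_pos r' by simp
    have dN: "(N has_real_derivative 2 * (\<psi> r \<bullet> (\<mu> r *\<^sub>R \<xi> r)) + 2 * (\<xi> r \<bullet> \<xi>' r)) (at r)"
      unfolding N_def[abs_def] \<xi>'_def
      by (intro DERIV_add has_derivative_norm_square \<psi>_deriv \<xi>_deriv r')
    show "((\<lambda>r. exp (G * r) * (N r + H)) has_real_derivative
        exp (G * r) * (2 * (\<psi> r \<bullet> (\<mu> r *\<^sub>R \<xi> r)) + 2 * (\<xi> r \<bullet> \<xi>' r)) + exp (G * r) * G * (N r + H)) (at r)"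
      by (rule DERIV_mult'[THEN DERIV_cong]) (auto intro!: derivative_eq_intros dN)
    define q where "q = norm (\<psi> r) * norm (\<xi> r)"
    have q: "2 * q \<le> N r" unfolding q_def N_def using sum_squares_bound[of "norm (\<psi> r)" "norm (\<xi> r)"] by simp
    have q0: "q \<ge> 0" by (simp add: q_def)
    have i1: "\<bar>\<psi> r \<bullet> (\<mu> r *\<^sub>R \<xi> r)\<bar> \<le> \<mu> r * q"
      using Cauchy_Schwarz_ineq2[of "\<psi> r" "\<mu> r *\<^sub>R \<xi> r"] \<mu>0 by (simp add: q_def mult_ac)
    have "norm (\<xi>' r) \<le> \<mu> r * ((\<bar>potential lam r\<bar> + (norm \<sigma>)\<^sup>2) * norm (\<psi> r) + r * norm (f r))"
    proof -
      have "norm (potential lam r *\<^sub>R \<psi> r + \<sigma>\<^sup>2 * \<psi> r + r *\<^sub>R f r)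
          \<le> norm (potential lam r *\<^sub>R \<psi> r) + norm (\<sigma>\<^sup>2 * \<psi> r) + norm (r *\<^sub>R f r)"
        by (meson norm_triangle_ineq order_trans add_right_mono)
      also have "\<dots> = (\<bar>potential lam r\<bar> + (norm \<sigma>)\<^sup>2) * norm (\<psi> r) + r * norm (f r)"
        using r' by (simp add: norm_mult norm_power algebra_simps)
      finally show ?thesis unfolding \<xi>'_def using \<mu>0 by simp
    qed
    then have "norm (\<xi> r) * norm (\<xi>' r) \<le> norm (\<xi> r) * (\<mu> r * ((\<bar>potential lam r\<bar> + (norm \<sigma>)\<^sup>2) * norm (\<psi> r) + r * norm (f r)))"
      by (intro mult_left_mono) auto
    also have "\<dots> = \<mu> r * (\<bar>potential lam r\<bar> + (norm \<sigma>)\<^sup>2) * q + norm (\<xi> r) * (\<mu> r * r * norm (f r))"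
      by (simp add: q_def algebra_simps)
    finally have i2: "\<bar>\<xi> r \<bullet> \<xi>' r\<bar> \<le> \<mu> r * (\<bar>potential lam r\<bar> + (norm \<sigma>)\<^sup>2) * q + norm (\<xi> r) * (\<mu> r * r * norm (f r))"
      using Cauchy_Schwarz_ineq2[of "\<xi> r" "\<xi>' r"] by linarith
    have i3: "2 * (norm (\<xi> r) * (\<mu> r * r * norm (f r))) \<le> N r + H"
    proof -
      have "2 * norm (\<xi> r) * (\<mu> r * r * norm (f r)) \<le> (norm (\<xi> r))\<^sup>2 + (\<mu> r * r * norm (f r))\<^sup>2" by (rule sum_squares_bound)
      moreover have "(norm (\<xi> r))\<^sup>2 \<le> N r" by (simp add: N_def)
      moreover have "2 * norm (\<xi> r) * (\<mu> r * r * norm (f r)) = 2 * (norm (\<xi> r) * (\<mu> r * r * norm (f r)))" by simp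
      ultimately show ?thesis using H(1)[OF r'(3) r(2)] by linarith
    qed
    have N0: "N r \<ge> 0" by (simp add: N_def)
    have i4: "\<mu> r * (1 + \<bar>potential lam r\<bar> + (norm \<sigma>)\<^sup>2) * (2 * q) \<le> (G - 1) * N r"
      using G_bound[OF r'(3) r(2)] q q0 G by (intro mult_mono) auto
    have "\<mu> r * (1 + \<bar>potential lam r\<bar> + (norm \<sigma>)\<^sup>2) * (2 * q) = 2 * (\<mu> r * q) + 2 * (\<mu> r * (\<bar>potential lam r\<bar> + (norm \<sigma>)\<^sup>2) * q)"
      by (simp add: algebra_simps)
    then have "- (2 * (\<psi> r \<bullet> (\<mu> r *\<^sub>R \<xi> r)) + 2 * (\<xi> r \<bullet> \<xi>' r)) \<le> (G - 1) * N r + (N r + H)"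
      using i1 i2 i3 i4 by linarith
    also have "\<dots> \<le> G * (N r + H)" using G H(2) mult_right_mono[of 1 G H] by (simp add: algebra_simps)
    finally have "0 \<le> (2 * (\<psi> r \<bullet> (\<mu> r *\<^sub>R \<xi> r)) + 2 * (\<xi> r \<bullet> \<xi>' r)) + G * (N r + H)" by linarith
    then have "0 \<le> exp (G * r) * ((2 * (\<psi> r \<bullet> (\<mu> r *\<^sub>R \<xi> r)) + 2 * (\<xi> r \<bullet> \<xi>' r)) + G * (N r + H))" by simp
    then show "0 \<le> exp (G * r) * (2 * (\<psi> r \<bullet> (\<mu> r *\<^sub>R \<xi> r)) + 2 * (\<xi> r \<bullet> \<xi>' r)) + exp (G * r) * G * (N r + H)"
      by (simp add: algebra_simps)
  qed
  moreover have "1 * N x \<le> exp (G * x) * (N x + H)"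
    using G x \<rho> H(2) by (intro mult_mono) (auto simp: N_def)
  ultimately show ?thesis by (simp add: N_def)
qed

end

lemma quadratic_self_bound:
  fixes x L :: real
  assumes "x\<^sup>2 \<le> L * (x + 1)" "x \<ge> 0" "L \<ge> 0"
  shows "x \<le> L + 1"
proof (rule ccontr)
  assume "\<not> x \<le> L + 1"
  then have "x > L + 1" by simp
  then have "(L + 1) * x \<le> x * x" using assms by (intro mult_right_mono) auto
  moreover have "L * (x + 1) < (L + 1) * x" using \<open>x > L + 1\<close> by (simp add: algebra_simps)
  ultimately show False using assms(1) by (simp add: power2_eq_square)
qed

text \<open>A predicate, so that one constant C is visibly uniform over the frequency, the solution
  and Rm. The forcing is split into a source \<open>f1\<close> of fixed size and support and a
  remainder \<open>b\<close>, which will come from cutting the Laplace integral at a finite time and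
  need only be small compared with the domain.\<close>

definition (in radial_geometry) ode_bounded :: "real \<Rightarrow> real \<Rightarrow> real \<Rightarrow> real \<Rightarrow> real \<Rightarrow> real \<Rightarrow> real \<Rightarrow> real \<Rightarrow> real \<Rightarrow> bool" where
  "ode_bounded lam e0 Bs F1 \<rho> r0 R0 S C \<longleftrightarrow> (\<forall>\<sigma> A P f f1 b Rm r.
      radial_ode \<mu> \<mu>' a m0 m1 a1 c1 \<rho>1 lam \<sigma> A P f Rm \<longrightarrow> e0 \<le> norm \<sigma> \<longrightarrow> norm \<sigma> \<le> Bs \<longrightarrow>
      S < Rm \<longrightarrow> (\<forall>r. f r = f1 r + b r) \<longrightarrow> (\<forall>r\<ge>0. r < r0 \<or> r > R0 \<longrightarrow> f1 r = 0) \<longrightarrow>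
      (\<forall>r\<ge>0. norm (f1 r) \<le> F1) \<longrightarrow>
      (\<forall>r. S < r \<longrightarrow> r < Rm \<longrightarrow> \<mu> r * r * norm (b r) * Rm \<le> 1) \<longrightarrow>
      (\<forall>r. 0 < r \<longrightarrow> r \<le> S \<longrightarrow> \<mu> r * r\<^sup>2 * norm (A r) * norm (b r) \<le> 1) \<longrightarrow>
      (\<forall>r. 0 < r \<longrightarrow> r \<le> S \<longrightarrow> norm (b r) \<le> 1) \<longrightarrow> \<rho> \<le> r \<longrightarrow> r \<le> S \<longrightarrow> norm (A r) \<le> C)"

text \<open>Outgoing solutions: beyond \<open>S\<close> the incoming amplitude \<open>Z\<close> is at most a quarter of the outgoing amplitude \<open>W\<close>, so
  the outgoing flux \<open>\<bar>W\<bar>\<^sup>2\<close> is controlled by the work of the source, which is only linear in \<open>W\<close>.\<close>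

lemma (in radial_geometry) ode_bounded_exists:
  assumes lam: "lam \<ge> 0" and e0: "e0 > 0" and Bs: "Bs > 0" and F1: "F1 \<ge> 0"
    and \<rho>: "0 < \<rho>" "\<rho> \<le> r0" "r0 < R0"
  obtains S C where "S \<ge> S1" "S > R0" "S \<ge> 1" "ode_bounded lam e0 Bs F1 \<rho> r0 R0 S C"
proof -
  define \<kappa> where "\<kappa> = m1 * (lam * a1 / m0 + c1 / (m0 ^ 3 * \<rho>1))"
  have c1: "c1 \<ge> 0" using \<mu>'_decay[of \<rho>1] \<rho>1 by (smt (verit) divide_nonneg_nonneg zero_le_divide_iff zero_less_power)
  have \<kappa>: "\<kappa> \<ge> 0" unfolding \<kappa>_def using m1_pos lam a1_nonneg m0 c1 \<rho>1 by simp
  \<comment> \<open>The last entry yields \<kappa>/S \<le> e0/4 \<le> |\<sigma>|/4, the smallness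
    that \<open>exterior_bound\<close> asks for; \<rho>1 places everything beyond S in the range of
    \<open>potential_decay\<close>.\<close>
  define S where "S = Max {S1, R0 + 1, 1, \<rho>1, 4 * \<kappa> / e0}"
  have S: "S \<ge> S1" "S \<ge> R0 + 1" "S \<ge> 1" "S \<ge> \<rho>1" "S \<ge> 4 * \<kappa> / e0" by (auto simp: S_def)
  have \<kappa>S: "\<kappa> / S \<le> e0 / 4" using S e0 by (simp add: field_simps)
  have "bounded (potential lam ` {\<rho>..S})"
    using \<rho> by (intro compact_imp_bounded compact_continuous_image continuous_on_subset[OF potential_continuous]) auto
  then obtain Vm where Vm: "\<And>r. r \<in> {\<rho>..S} \<Longrightarrow> \<bar>potential lam r\<bar> \<le> Vm" by (force simp: bounded_iff)
  have Vm0: "Vm \<ge> 0" using Vm[of \<rho>] \<rho> S by fastforce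
  define G where "G = m1 * (1 + Vm + Bs\<^sup>2) + 1"
  have G1: "G \<ge> 1" unfolding G_def using m1_pos Vm0 by simp
  define H where "H = (m1 * S * (F1 + 1))\<^sup>2"
  define c where "c = sqrt (exp (G * S) * (1 / e0\<^sup>2 + 1 + H))"
  have H0: "H \<ge> 0" by (simp add: H_def)
  have c0: "c \<ge> 0" using H0 by (simp add: c_def)
  define D where "D = m1 * R0\<^sup>2 * F1 * c / \<rho>"
  have D0: "D \<ge> 0" unfolding D_def using m1_pos F1 c0 \<rho> by simp
  define M where "M = Bs * S * (D + 1)"
  have M0: "M \<ge> 0" unfolding M_def using Bs S D0 by simp
  define L where "L = 5 * M + 6"
  define C where "C = c * (L + 2) / \<rho>"
  show ?thesis
  proof (rule that[of S C])
    show "S \<ge> S1" "S > R0" "S \<ge> 1" using S by auto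
    show "ode_bounded lam e0 Bs F1 \<rho> r0 R0 S C"
      unfolding ode_bounded_def
    proof (intro allI impI)
    fix \<sigma> A P f f1 b Rm r
    assume ode: "radial_ode \<mu> \<mu>' a m0 m1 a1 c1 \<rho>1 lam \<sigma> A P f Rm"
      and \<sigma>: "e0 \<le> norm \<sigma>" "norm \<sigma> \<le> Bs" and Rm: "S < Rm"
      and f': "\<forall>r. f r = f1 r + b r" and f1z': "\<forall>r\<ge>0. r < r0 \<or> r > R0 \<longrightarrow> f1 r = 0"
      and f1F': "\<forall>r\<ge>0. norm (f1 r) \<le> F1"
      and b1': "\<forall>r. S < r \<longrightarrow> r < Rm \<longrightarrow> \<mu> r * r * norm (b r) * Rm \<le> 1"
      and b2': "\<forall>r. 0 < r \<longrightarrow> r \<le> S \<longrightarrow> \<mu> r * r\<^sup>2 * norm (A r) * norm (b r) \<le> 1"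
      and b3': "\<forall>r. 0 < r \<longrightarrow> r \<le> S \<longrightarrow> norm (b r) \<le> 1" and r: "\<rho> \<le> r" "r \<le> S"
    note f = f'[rule_format] and f1z = f1z'[rule_format] and f1F = f1F'[rule_format]
      and b1 = b1'[rule_format] and b2 = b2'[rule_format] and b3 = b3'[rule_format]
    interpret O: radial_ode \<mu> \<mu>' a m0 m1 a1 c1 \<rho>1 lam \<sigma> A P f Rm by (rule ode)
    have S0: "S > 0" using S by simp
    define X where "X = norm (O.W S)"
    have X0: "X \<ge> 0" by (simp add: X_def)
    have ZX: "norm (O.Z S) \<le> X / 4 + 3 / 2"
      unfolding X_def
    proof (rule O.exterior_bound[OF S0 Rm \<kappa>])
      show "\<kappa> / S \<le> norm \<sigma> / 4" using \<kappa>S \<sigma> by simp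
      show "\<mu> r * \<bar>potential lam r\<bar> \<le> \<kappa> / r\<^sup>2" if "r \<ge> S" for r
        unfolding \<kappa>_def using that S by (intro potential_decay lam) auto
      show "\<mu> r * r * norm (f r) * Rm \<le> 1" if "S < r" "r < Rm" for r
        using b1[OF that] f1z[of r] that S \<rho> by (simp add: f)
    qed
    have NS: "(norm (O.\<psi> S))\<^sup>2 + (norm (O.\<xi> S))\<^sup>2 \<le> (1 / e0\<^sup>2 + 1) * (X + 1)\<^sup>2"
    proof -
      have "2 * (norm \<sigma> * norm (O.\<psi> S)) = norm (O.Z S - O.W S)"
        by (simp add: O.Z_def O.W_def norm_mult flip: mult_2)
      also have "\<dots> \<le> norm (O.Z S) + X" unfolding X_def by (rule norm_triangle_ineq4)
      finally have "norm \<sigma> * norm (O.\<psi> S) \<le> X + 1" using ZX X0 by linarith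
      moreover have "e0 * norm (O.\<psi> S) \<le> norm \<sigma> * norm (O.\<psi> S)" using \<sigma> by (intro mult_right_mono) auto
      ultimately have "norm (O.\<psi> S) \<le> (X + 1) / e0" using e0 by (simp add: field_simps)
      then have 1: "(norm (O.\<psi> S))\<^sup>2 \<le> ((X + 1) / e0)\<^sup>2" by (intro power_mono) auto
      have "2 * norm (O.\<xi> S) = norm (O.Z S + O.W S)"
        by (simp add: O.Z_def O.W_def flip: mult_2)
      also have "\<dots> \<le> norm (O.Z S) + X" unfolding X_def by (rule norm_triangle_ineq)
      finally have "norm (O.\<xi> S) \<le> X + 1" using ZX X0 by linarith
      then have 2: "(norm (O.\<xi> S))\<^sup>2 \<le> (X + 1)\<^sup>2" by (intro power_mono) auto
      show ?thesis using 1 2 by (simp add: power_divide algebra_simps)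
    qed
    have A_bound: "norm (A x) \<le> c * (X + 1) / \<rho>" if x: "\<rho> \<le> x" "x \<le> S" for x
    proof -
      have "(norm (O.\<psi> x))\<^sup>2 + (norm (O.\<xi> x))\<^sup>2 \<le> exp (G * S) * ((norm (O.\<psi> S))\<^sup>2 + (norm (O.\<xi> S))\<^sup>2 + H)"
      proof (rule O.interior_growth[OF \<rho>(1) _ G1 _ _ H0 x])
        show "S \<le> Rm" using Rm by simp
        fix y assume y: "\<rho> < y" "y < S"
        have \<mu>y: "0 < \<mu> y" "\<mu> y \<le> m1" using \<mu>_pos[of y] \<mu>_upper[of y] y \<rho> by auto
        have "(norm \<sigma>)\<^sup>2 \<le> Bs\<^sup>2" using \<sigma> by (intro power_mono) auto
        then show "\<mu> y * (1 + \<bar>potential lam y\<bar> + (norm \<sigma>)\<^sup>2) + 1 \<le> G"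
          unfolding G_def using \<mu>y Vm[of y] y by (intro add_mono mult_mono) auto
        have "norm (f y) \<le> F1 + 1"
          unfolding f using norm_triangle_ineq[of "f1 y" "b y"] f1F[of y] b3[of y] y \<rho> by auto
        then have "\<mu> y * y * norm (f y) \<le> m1 * S * (F1 + 1)"
          using \<mu>y y \<rho> S0 m1_pos by (intro mult_mono) auto
        then show "(\<mu> y * y * norm (f y))\<^sup>2 \<le> H" unfolding H_def using \<mu>y y \<rho> by (intro power_mono) auto
      qed
      also have "\<dots> \<le> exp (G * S) * ((1 / e0\<^sup>2 + 1) * (X + 1)\<^sup>2 + H * (X + 1)\<^sup>2)"
      proof (intro mult_left_mono add_mono NS)
        have "1 \<le> (X + 1)\<^sup>2" using X0 by simp
        then show "H \<le> H * (X + 1)\<^sup>2" using H0 mult_left_mono[of 1 "(X + 1)\<^sup>2" H] by simp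
      qed auto
      also have "\<dots> = (c * (X + 1))\<^sup>2"
      proof -
        have "c\<^sup>2 = exp (G * S) * (1 / e0\<^sup>2 + 1 + H)" using H0 by (simp add: c_def)
        then show ?thesis unfolding power_mult_distrib by (simp only: distrib_left distrib_right mult.assoc)
      qed
      finally have "(norm (O.\<psi> x))\<^sup>2 \<le> (c * (X + 1))\<^sup>2"
        using zero_le_power2[of "norm (O.\<xi> x)"] by linarith
      from power2_le_imp_le[OF this] have "norm (O.\<psi> x) \<le> c * (X + 1)" using c0 X0 by simp
      then have "x * norm (A x) \<le> c * (X + 1)" using x \<rho> by (simp add: O.\<psi>_def)
      moreover have "\<rho> * norm (A x) \<le> x * norm (A x)" using x by (intro mult_right_mono) auto
      ultimately show ?thesis using \<rho> by (simp add: field_simps)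
    qed
    \<comment> \<open>The work is linear in the outgoing amplitude X, because \<open>A_bound\<close>
      is and \<open>f1\<close> is confined to [r0, R0]. Against this, J S is at most (|Z S|^2 -
      X^2)/4, so X^2 is bounded by a linear function of X.\<close>
    have "- (norm \<sigma> * (D * (X + 1) + 1) * S) \<le> O.J S"
    proof (rule O.J_lower)
      fix y assume y: "0 < y" "y < S"
      have \<mu>y: "0 < \<mu> y" "\<mu> y \<le> m1" using \<mu>_pos[of y] \<mu>_upper[of y] y by auto
      have "\<mu> y * y\<^sup>2 * norm (A y) * norm (f y) \<le> \<mu> y * y\<^sup>2 * norm (A y) * (norm (f1 y) + norm (b y))"
        unfolding f using \<mu>y by (intro mult_left_mono norm_triangle_ineq) auto
      also have "\<dots> = \<mu> y * y\<^sup>2 * norm (A y) * norm (f1 y) + \<mu> y * y\<^sup>2 * norm (A y) * norm (b y)"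
        by (simp add: distrib_left)
      also have "\<dots> \<le> D * (X + 1) + 1"
      proof (intro add_mono b2)
        show "\<mu> y * y\<^sup>2 * norm (A y) * norm (f1 y) \<le> D * (X + 1)"
        proof (cases "y < r0 \<or> y > R0")
          case True
          then show ?thesis using f1z[of y] y D0 X0 by simp
        next
          case False
          then have "\<mu> y * y\<^sup>2 * norm (A y) * norm (f1 y) \<le> m1 * R0\<^sup>2 * (c * (X + 1) / \<rho>) * F1"
            using \<mu>y m1_pos y \<rho> c0 X0 S f1F[of y] A_bound[of y] by (intro mult_mono power_mono) auto
          then show ?thesis by (simp add: D_def mult_ac)
        qed
      qed (use y in auto)
      finally show "\<mu> y * y\<^sup>2 * norm (A y) * norm (f y) \<le> D * (X + 1) + 1" .
    qed (use S0 Rm in auto)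
    moreover have "norm \<sigma> * (D * (X + 1) + 1) * S \<le> M * (X + 1)"
    proof -
      have "norm \<sigma> * (D * (X + 1) + 1) * S \<le> Bs * ((D + 1) * (X + 1)) * S"
        using \<sigma> D0 X0 S0 Bs by (intro mult_right_mono mult_mono) (auto simp: algebra_simps)
      then show ?thesis by (simp add: M_def mult_ac)
    qed
    moreover have "O.J S \<le> ((norm (O.Z S))\<^sup>2 - X\<^sup>2) / 4" unfolding X_def by (rule O.J_le_ZW[OF S0])
    moreover have "(norm (O.Z S))\<^sup>2 \<le> X\<^sup>2 / 8 + 9 / 2"
    proof -
      have "(norm (O.Z S))\<^sup>2 \<le> (X / 4 + 3 / 2)\<^sup>2" using ZX by (intro power_mono) auto
      moreover have "0 \<le> (X / 4 - 3 / 2)\<^sup>2" by simp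
      ultimately show ?thesis by (simp add: power2_eq_square algebra_simps)
    qed
    moreover have "x \<le> 5 * m + 6" if "- p \<le> J" "p \<le> m" "J \<le> (z - x) / 4" "z \<le> x / 8 + 9 / 2" "0 \<le> m" for x z J p m :: real
      using that by simp
    moreover have "0 \<le> M * (X + 1)" using M0 X0 by simp
    ultimately have "X\<^sup>2 \<le> 5 * (M * (X + 1)) + 6" by blast
    also have "\<dots> \<le> L * (X + 1)" using X0 by (simp add: L_def algebra_simps)
    finally have "X \<le> L + 1" using X0 M0 by (intro quadratic_self_bound) (auto simp: L_def)
    then have "c * (X + 1) / \<rho> \<le> C" unfolding C_def using c0 \<rho> by (intro divide_right_mono mult_left_mono) auto
    with A_bound[OF r] show "norm (A r) \<le> C" by linarith
    qed
  qed
qed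

text \<open>The remainder from the time cutoff carries exp(-dq) and at most two factors growing
  linearly in q, such as the radius Rm of the wave front.\<close>

lemma exp_decay_beats_square:
  fixes d M :: real
  assumes "d > 0"
  shows "\<forall>\<^sub>F q in at_top. exp (- d * q) * (M * (1 + q)\<^sup>2) \<le> 1"
proof -
  have "((\<lambda>q. (d * q) ^ 2 / exp (d * q)) \<longlongrightarrow> 0) at_top"
    using assms by (intro filterlim_compose[OF tendsto_power_div_exp_0] filterlim_tendsto_pos_mult_at_top[OF tendsto_const _ filterlim_ident])
  then have "((\<lambda>q. \<bar>M\<bar> * 4 / d\<^sup>2 * ((d * q) ^ 2 / exp (d * q))) \<longlongrightarrow> \<bar>M\<bar> * 4 / d\<^sup>2 * 0) at_top"
    by (intro tendsto_intros)
  then have "\<forall>\<^sub>F q in at_top. \<bar>M\<bar> * 4 / d\<^sup>2 * ((d * q) ^ 2 / exp (d * q)) < 1"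
    by (rule order_tendstoD(2)) simp
  moreover have "\<forall>\<^sub>F q in at_top. (1::real) \<le> q" by (rule eventually_ge_at_top)
  ultimately show ?thesis
  proof eventually_elim
    case (elim q)
    have "(1 + q)\<^sup>2 \<le> (2 * q)\<^sup>2" using elim by (intro power_mono) auto
    then have "M * (1 + q)\<^sup>2 \<le> \<bar>M\<bar> * (2 * q)\<^sup>2" by (intro mult_mono) auto
    then have "exp (- d * q) * (M * (1 + q)\<^sup>2) \<le> exp (- d * q) * (\<bar>M\<bar> * (2 * q)\<^sup>2)" by simp
    also have "\<dots> = \<bar>M\<bar> * 4 / d\<^sup>2 * ((d * q) ^ 2 / exp (d * q))"
      using assms by (simp add: exp_minus field_simps power2_eq_square)
    finally show ?case using elim by linarith
  qed
qed

context radial_wave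
begin

text \<open>C is chosen before \<open>d\<close>; only the cutoff time from which the bound holds
  depends on \<open>d\<close>. The transform cut at q solves the radial equation exactly, the cut
  being paid for by a boundary source.\<close>

lemma laplace_bounded:
  assumes r: "r > 0" and e: "0 < e" "e < B"
  obtains C where "\<And>d. 0 < d \<Longrightarrow> d \<le> 1 \<Longrightarrow> \<forall>\<^sub>F q in at_top. \<forall>\<omega>. e \<le> \<omega> \<longrightarrow> \<omega> \<le> B \<longrightarrow>
      norm (integral {0..q} (\<lambda>s. exp (- Complex d \<omega> * of_real s) * of_real (v 0 s r))) \<le> C"
proof -
  define \<rho> where "\<rho> = min r0 r"
  have \<rho>: "0 < \<rho>" "\<rho> \<le> r0" "r0 < R0" "\<rho> \<le> r" using r0 r by (auto simp: \<rho>_def)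
  define Bs where "Bs = B + 1"
  have Bs: "Bs > 0" using e by (simp add: Bs_def)
  define F1 where "F1 = vbound 1 R0 + Bs * vbound 0 R0"
  have R00: "R0 > 0" using r0 by simp
  have F1: "F1 \<ge> 0" unfolding F1_def using vbound_nonneg[OF R00] Bs by (simp add: add_nonneg_nonneg)
  obtain S C where S: "S \<ge> r" "S > R0" "S \<ge> 1" and bounded: "ode_bounded lam e Bs F1 \<rho> r0 R0 S C"
    using ode_bounded_exists[OF lam e(1) Bs F1 \<rho>(1-3)] by blast
  have S0: "S > 0" using S by simp
  \<comment> \<open>A bound for v at every positive radius: \<open>v_bound\<close> up to S, and the
    Hardy estimate beyond, where r \<ge> S \<ge> 1.\<close>
  define k where "k n = vbound n S + sqrt (2 * m1 * energy n)" for n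
  have k0: "k n \<ge> 0" for n unfolding k_def using vbound_nonneg[OF S0] m1_pos energy_nonneg by (simp add: add_nonneg_nonneg)
  have vk: "\<bar>v n t x\<bar> \<le> k n" if "t \<ge> 0" "x > 0" for n t x
  proof (cases "x \<le> S")
    case True
    have "0 \<le> sqrt (2 * m1 * energy n)" using m1_pos energy_nonneg by simp
    moreover have "\<bar>v n t x\<bar> \<le> vbound n S" using True that S0 by (intro v_bound) auto
    ultimately show ?thesis unfolding k_def by linarith
  next
    case False
    have "1 * (v n t x)\<^sup>2 \<le> x * (v n t x)\<^sup>2" using False S by (intro mult_right_mono) auto
    then have "(v n t x)\<^sup>2 \<le> 2 * m1 * energy n" using v_square_bound[of t x n] that by simp
    then have "\<bar>v n t x\<bar> \<le> sqrt (2 * m1 * energy n)" by (metis real_sqrt_abs real_sqrt_le_iff)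
    then show ?thesis using vbound_nonneg[OF S0, of n] by (simp add: k_def)
  qed
  define Kb where "Kb = k 1 + Bs * k 0"
  have Kb: "Kb \<ge> 0" unfolding Kb_def using k0 Bs by (simp add: add_nonneg_nonneg)
  define T1 where "T1 = S + R0 + speed + 1"
  have T1: "T1 > 0" using S0 R00 speed_pos by (simp add: T1_def)
  \<comment> \<open>Large enough for all three smallness conditions that \<open>ode_bounded\<close>
    puts on the remainder; each of them reduces to M exp(-dq) (1 + q)^2 \<le> 1.\<close>
  define M where "M = Kb * (m1 * T1\<^sup>2 + m1 * S\<^sup>2 * k 0 + 1)"
  show ?thesis
  proof (rule that[of C])
    fix d :: real assume d: "0 < d" "d \<le> 1"
    have "\<forall>\<^sub>F q in at_top. exp (- d * q) * (M * (1 + q)\<^sup>2) \<le> 1" by (rule exp_decay_beats_square[OF d(1)])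
    moreover have "\<forall>\<^sub>F q in at_top. (0::real) \<le> q" by (rule eventually_ge_at_top)
    ultimately show "\<forall>\<^sub>F q in at_top. \<forall>\<omega>. e \<le> \<omega> \<longrightarrow> \<omega> \<le> B \<longrightarrow>
        norm (integral {0..q} (\<lambda>s. exp (- Complex d \<omega> * of_real s) * of_real (v 0 s r))) \<le> C"
    proof eventually_elim
      case (elim q)
      show ?case
      proof (intro allI impI)
        fix \<omega> assume \<omega>: "e \<le> \<omega>" "\<omega> \<le> B"
        define \<sigma> where "\<sigma> = Complex d \<omega>"
        have Re\<sigma>: "Re \<sigma> = d" by (simp add: \<sigma>_def)
        have n\<sigma>: "e \<le> norm \<sigma>" "norm \<sigma> \<le> Bs"
          using abs_Im_le_cmod[of \<sigma>] cmod_le[of \<sigma>] \<omega> d e by (auto simp: \<sigma>_def Bs_def)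
        define E where "E s = exp (- \<sigma> * of_real s)" for s :: real
        have Ec: "continuous_on U (\<lambda>x. E (p x))" if "continuous_on U p" for U :: "'b::topological_space set" and p
          unfolding E_def using that by (intro continuous_intros)
        have Ed: "(E has_vector_derivative - \<sigma> * E s) (at s within U)" for s U
          unfolding E_def[abs_def]
          by (rule has_vector_derivative_real_field) (auto intro!: derivative_eq_intros)
        have En: "norm (E s) = exp (- d * s)" for s
          by (simp add: E_def norm_exp_eq_Re Re\<sigma>)
        define A where "A x = integral {0..q} (\<lambda>s. E s * of_real (v 0 s x))" for x
        define P where "P x = integral {0..q} (\<lambda>s. E s * of_real (x\<^sup>2 / \<mu> x * w 0 s x))" for x
        \<comment> \<open>Integrating exp(-\<sigma> t) v_tt by parts twice leaves boundary terms:
          those at time q form \<open>b\<close>, those at time 0 form \<open>f1\<close>.\<close>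
        define b where "b x = E q * (of_real (v 1 q x) + \<sigma> * of_real (v 0 q x))" for x
        define f1 where "f1 x = - (of_real (v 1 0 x) + \<sigma> * of_real (v 0 0 x))" for x
        define f where "f x = f1 x + b x" for x
        \<comment> \<open>Ahead of the wave front at time q, so A and P vanish there exactly; it
          grows only linearly in q.\<close>
        define Rm where "Rm = S + R0 + speed * q + 1"
        have Rm: "S < Rm" "R0 + speed * q < Rm" "0 < Rm"
        proof -
          have "0 \<le> speed * q" using speed_pos elim by simp
          then show "S < Rm" "R0 + speed * q < Rm" "0 < Rm" unfolding Rm_def using S0 R00 by linarith+
        qed
        have RmT: "Rm \<le> T1 * (1 + q)"
          using S0 R00 speed_pos elim by (auto simp: Rm_def T1_def algebra_simps intro!: add_nonneg_nonneg)
        have ne: "\<mu> x \<noteq> 0" if "x \<ge> 0" for x using \<mu>_pos[OF that] by simp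
        have vanish: "v 0 s Rm = 0" "w 0 s Rm = 0" if "s \<in> {0..q}" for s
        proof -
          have "speed * s \<le> speed * q" using that speed_pos by simp
          then have "Rm > R0 + speed * s" using Rm by linarith
          then show "v 0 s Rm = 0" "w 0 s Rm = 0" using that by (auto intro: v_zero w_zero)
        qed
        have ode: "radial_ode \<mu> \<mu>' a m0 m1 a1 c1 \<rho>1 lam \<sigma> A P f Rm"
        proof unfold_locales
          show "Re \<sigma> > 0" using d Re\<sigma> by simp
          have "continuous_on {0..Rm} (\<lambda>x. integral (cbox 0 q) (\<lambda>s. E s * of_real (v 0 s x)))"
            by (rule integral_continuous_on_param) (auto simp: split_beta intro!: continuous_intros Ec cont2_compose[OF vc])
          then show "continuous_on {0..Rm} A" by (simp add: A_def[abs_def])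
          have "continuous_on {0..Rm} (\<lambda>x. integral (cbox 0 q) (\<lambda>s. E s * of_real (x\<^sup>2 / \<mu> x * w 0 s x)))"
            by (rule integral_continuous_on_param) (auto simp: split_beta ne intro!: continuous_intros Ec cont2_compose[OF wc] \<mu>_comp)
          then show "continuous_on {0..Rm} P" by (simp add: P_def[abs_def])
          show "P 0 = 0" by (simp add: P_def)
          have "A Rm = integral {0..q} (\<lambda>_. 0)" "P Rm = integral {0..q} (\<lambda>_. 0)"
            unfolding A_def P_def by (rule integral_cong; simp add: vanish)+
          then show "A Rm = 0" "P Rm = 0" by simp_all
        next
          fix x assume x: "0 < x" "x < Rm"
          have "(A has_vector_derivative integral (cbox 0 q) (\<lambda>s. E s * of_real (w 0 s x))) (at x within UNIV)"
            unfolding A_def[abs_def] cbox_interval[symmetric]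
          proof (rule leibniz_rule_vector_derivative)
            show "((\<lambda>x. E s * of_real (v 0 s x)) has_vector_derivative E s * of_real (w 0 s x)) (at x within UNIV)" for x s
              by (intro has_vector_derivative_mult_right has_vector_derivative_of_real v_r)
            show "(\<lambda>s. E s * of_real (v 0 s x)) integrable_on cbox 0 q" for x
              by (intro integrable_continuous continuous_intros Ec cont2_compose[OF vc])
            show "continuous_on (UNIV \<times> cbox 0 q) (\<lambda>(x, s). E s * of_real (w 0 s x))"
              by (auto simp: split_beta intro!: continuous_intros Ec cont2_compose[OF wc])
          qed auto
          moreover have "integral (cbox 0 q) (\<lambda>s. E s * of_real (w 0 s x)) = (\<mu> x / x\<^sup>2) *\<^sub>R P x"
            unfolding P_def integral_cmul[symmetric] cbox_interval using x ne[of x]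
            by (intro integral_cong) (simp add: scaleR_conv_of_real)
          ultimately show "(A has_vector_derivative (\<mu> x / x\<^sup>2) *\<^sub>R P x) (at x)" by simp
          let ?D = "\<lambda>x s. E s * of_real (\<mu> x * x\<^sup>2 * v (Suc (Suc 0)) s x + lam * a x * v 0 s x)"
          have "(P has_vector_derivative integral (cbox 0 q) (?D x)) (at x within {0<..})"
            unfolding P_def[abs_def] cbox_interval[symmetric]
          proof (rule leibniz_rule_vector_derivative)
            show "((\<lambda>x. E s * of_real (x\<^sup>2 / \<mu> x * w 0 s x)) has_vector_derivative ?D y s) (at y within {0<..})" if "y \<in> {0<..}" for y s
              using that by (intro has_vector_derivative_mult_right has_vector_derivative_of_real has_field_derivative_at_within[OF v_pde]) auto
            show "(\<lambda>s. E s * of_real (x\<^sup>2 / \<mu> x * w 0 s x)) integrable_on cbox 0 q" for x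
              by (intro integrable_continuous continuous_intros Ec cont2_compose[OF wc])
            show "continuous_on ({0<..} \<times> cbox 0 q) (\<lambda>(x, s). ?D x s)"
              by (auto simp: split_beta intro!: continuous_intros Ec cont2_compose[OF vc] \<mu>_comp a_comp)
          qed (use x in auto)
          then have Pd: "(P has_vector_derivative integral {0..q} (?D x)) (at x)"
            using x by (simp add: at_within_open[of x "{0<..}"])
          have i: "(\<lambda>s. E s * of_real (v n s x)) integrable_on {0..q}" for n
            by (intro integrable_continuous_real continuous_intros Ec cont2_compose[OF vc])
          have "((\<lambda>s. E s * (of_real (v 2 s x) + \<sigma> * of_real (v 1 s x)) + (- \<sigma> * E s) * (of_real (v 1 s x) + \<sigma> * of_real (v 0 s x))) has_integral
              E q * (of_real (v 1 q x) + \<sigma> * of_real (v 0 q x)) - E 0 * (of_real (v 1 0 x) + \<sigma> * of_real (v 0 0 x))) {0..q}"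
          proof (rule fundamental_theorem_of_calculus[OF elim(2)])
            fix s assume "s \<in> {0..q}"
            have vd: "((\<lambda>s. of_real (v n s x)) has_vector_derivative complex_of_real (v (Suc n) s x)) (at s within {0..q})" for n
              by (intro has_vector_derivative_of_real has_field_derivative_at_within[OF v_t])
            show "((\<lambda>s. E s * (of_real (v 1 s x) + \<sigma> * of_real (v 0 s x))) has_vector_derivative
                E s * (of_real (v 2 s x) + \<sigma> * of_real (v 1 s x)) + (- \<sigma> * E s) * (of_real (v 1 s x) + \<sigma> * of_real (v 0 s x))) (at s within {0..q})"
              using vd[of 1] vd[of 0]
              by (intro has_vector_derivative_mult has_vector_derivative_add has_vector_derivative_mult_right Ed)
                (simp_all add: numeral_2_eq_2)
          qed
          moreover have "(\<lambda>s. E s * (of_real (v 2 s x) + \<sigma> * of_real (v 1 s x)) + (- \<sigma> * E s) * (of_real (v 1 s x) + \<sigma> * of_real (v 0 s x)))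
              = (\<lambda>s. E s * of_real (v 2 s x) - \<sigma>\<^sup>2 * (E s * of_real (v 0 s x)))"
            by (auto simp: algebra_simps power2_eq_square)
          moreover have "E 0 = 1" by (simp add: E_def)
          ultimately have "integral {0..q} (\<lambda>s. E s * of_real (v 2 s x) - \<sigma>\<^sup>2 * (E s * of_real (v 0 s x))) = f x"
            by (simp add: integral_unique f_def f1_def b_def)
          moreover have "integral {0..q} (\<lambda>s. E s * of_real (v 2 s x) - \<sigma>\<^sup>2 * (E s * of_real (v 0 s x)))
              = integral {0..q} (\<lambda>s. E s * of_real (v 2 s x)) - \<sigma>\<^sup>2 * A x"
            using integral_diff[OF i[of 2] integrable_on_mult_right[OF i[of 0], of "\<sigma>\<^sup>2"]]
            by (simp only: A_def integral_mult_right)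
          ultimately have v2: "integral {0..q} (\<lambda>s. E s * of_real (v 2 s x)) = \<sigma>\<^sup>2 * A x + f x"
            by (simp add: diff_eq_eq)
          have "integral {0..q} (?D x) = integral {0..q} (\<lambda>s. (lam * a x) *\<^sub>R (E s * of_real (v 0 s x)) + (\<mu> x * x\<^sup>2) *\<^sub>R (E s * of_real (v 2 s x)))"
            by (intro integral_cong) (simp add: scaleR_conv_of_real algebra_simps numeral_2_eq_2)
          also have "\<dots> = (lam * a x) *\<^sub>R A x + (\<mu> x * x\<^sup>2) *\<^sub>R (\<sigma>\<^sup>2 * A x + f x)"
            unfolding A_def v2[unfolded A_def, symmetric] integral_cmul[symmetric]
            by (intro integral_add integrable_cmul i)
          finally show "(P has_vector_derivative (lam * a x) *\<^sub>R A x + (\<mu> x * x\<^sup>2) *\<^sub>R (\<sigma>\<^sup>2 * A x + f x)) (at x)"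
            using Pd by simp
        qed (rule lam)
        have nv: "norm (of_real (v 1 t x) + \<sigma> * of_real (v 0 t x)) \<le> p + Bs * p'"
          if "\<bar>v 1 t x\<bar> \<le> p" "\<bar>v 0 t x\<bar> \<le> p'" for t x p p'
        proof -
          have "norm (of_real (v 1 t x) + \<sigma> * of_real (v 0 t x)) \<le> \<bar>v 1 t x\<bar> + norm \<sigma> * \<bar>v 0 t x\<bar>"
            by (rule order_trans[OF norm_triangle_ineq]) (simp add: norm_mult)
          also have "\<dots> \<le> p + Bs * p'" using that n\<sigma> Bs by (intro add_mono mult_mono) auto
          finally show ?thesis .
        qed
        have nb: "norm (b x) \<le> exp (- d * q) * Kb" if "x > 0" for x
          unfolding b_def norm_mult En Kb_def using that elim by (intro mult_left_mono nv vk) auto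
        have q2: "1 \<le> (1 + q)\<^sup>2" "q \<le> (1 + q)\<^sup>2" using elim by (auto simp: power2_eq_square algebra_simps)
        have small: "exp (- d * q) * (Kb * z) \<le> 1" if "z \<le> (m1 * T1\<^sup>2 + m1 * S\<^sup>2 * k 0 + 1) * (1 + q)\<^sup>2" for z
        proof -
          have "Kb * z \<le> Kb * ((m1 * T1\<^sup>2 + m1 * S\<^sup>2 * k 0 + 1) * (1 + q)\<^sup>2)" using that Kb by (intro mult_left_mono)
          also have "\<dots> = M * (1 + q)\<^sup>2" by (simp add: M_def)
          finally have "exp (- d * q) * (Kb * z) \<le> exp (- d * q) * (M * (1 + q)\<^sup>2)" by simp
          with elim show ?thesis by linarith
        qed
        have pos: "0 \<le> m1 * T1\<^sup>2 * (1 + q)\<^sup>2" "0 \<le> m1 * S\<^sup>2 * k 0 * (1 + q)\<^sup>2" "0 \<le> (1 + q)\<^sup>2"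
          using m1_pos k0 by auto
        have "norm (A r) \<le> C"
        proof (rule bounded[unfolded ode_bounded_def, rule_format, OF ode n\<sigma> Rm(1) f_def])
          show "f1 x = 0" if "x \<ge> 0" "x < r0 \<or> x > R0" for x
            using data[OF that] by (simp add: f1_def)
          show "norm (f1 x) \<le> F1" if "x \<ge> 0" for x
          proof (cases "x > R0")
            case True
            then show ?thesis using data[of x] that F1 by (simp add: f1_def)
          next
            case False
            show ?thesis unfolding f1_def norm_minus_cancel F1_def
              using that False R00 by (intro nv v_bound) auto
          qed
          show "\<mu> x * x * norm (b x) * Rm \<le> 1" if x: "S < x" "x < Rm" for x
          proof -
            have x0: "x > 0" using x S0 by simp
            have "\<mu> x * x * norm (b x) * Rm \<le> m1 * Rm * (exp (- d * q) * Kb) * Rm"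
              using \<mu>_pos[of x] \<mu>_upper[of x] x x0 Rm nb[OF x0] m1_pos Kb by (intro mult_mono) auto
            also have "\<dots> = exp (- d * q) * (Kb * (m1 * Rm\<^sup>2))" by (simp add: power2_eq_square)
            also have "\<dots> \<le> 1"
            proof (rule small)
              have "Rm\<^sup>2 \<le> (T1 * (1 + q))\<^sup>2" using RmT Rm by (intro power_mono) auto
              then have "m1 * Rm\<^sup>2 \<le> m1 * T1\<^sup>2 * (1 + q)\<^sup>2"
                using m1_pos by (simp add: power_mult_distrib)
              then show "m1 * Rm\<^sup>2 \<le> (m1 * T1\<^sup>2 + m1 * S\<^sup>2 * k 0 + 1) * (1 + q)\<^sup>2"
                unfolding distrib_right mult_1 using pos by linarith
            qed
            finally show ?thesis .
          qed
          show "\<mu> x * x\<^sup>2 * norm (A x) * norm (b x) \<le> 1" if x: "0 < x" "x \<le> S" for x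
          proof -
            have "norm (A x) \<le> k 0 * (q - 0)"
              unfolding A_def
            proof (rule integral_bound[OF elim(2)])
              show "continuous_on {0..q} (\<lambda>s. E s * of_real (v 0 s x))"
                by (intro continuous_intros Ec cont2_compose[OF vc])
              show "norm (E s * of_real (v 0 s x)) \<le> k 0" if s: "s \<in> {0..q}" for s
              proof -
                have "norm (E s * of_real (v 0 s x)) \<le> 1 * k 0"
                  unfolding norm_mult En norm_of_real using s d x vk[of s x 0] by (intro mult_mono) auto
                then show ?thesis by simp
              qed
            qed
            then have "\<mu> x * x\<^sup>2 * norm (A x) * norm (b x) \<le> m1 * S\<^sup>2 * (k 0 * q) * (exp (- d * q) * Kb)"
              using \<mu>_pos[of x] \<mu>_upper[of x] x nb[OF x(1)] m1_pos k0[of 0] elim by (intro mult_mono) (auto intro!: power_mono)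
            also have "\<dots> = exp (- d * q) * (Kb * (m1 * S\<^sup>2 * k 0 * q))" by simp
            also have "\<dots> \<le> 1"
            proof (rule small)
              have "m1 * S\<^sup>2 * k 0 * q \<le> m1 * S\<^sup>2 * k 0 * (1 + q)\<^sup>2" using q2 m1_pos k0 by (intro mult_left_mono) auto
              then show "m1 * S\<^sup>2 * k 0 * q \<le> (m1 * T1\<^sup>2 + m1 * S\<^sup>2 * k 0 + 1) * (1 + q)\<^sup>2"
                unfolding distrib_right mult_1 using pos by linarith
            qed
            finally show ?thesis .
          qed
          show "norm (b x) \<le> 1" if x: "0 < x" "x \<le> S" for x
          proof -
            have "norm (b x) \<le> exp (- d * q) * (Kb * 1)" using nb[OF x(1)] by simp
            also have "\<dots> \<le> 1"
              by (rule small) (unfold distrib_right mult_1, use q2 pos in linarith)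
            finally show ?thesis .
          qed
        qed (use \<rho> S in auto)
        then show "norm (integral {0..q} (\<lambda>s. exp (- Complex d \<omega> * of_real s) * of_real (v 0 s r))) \<le> C"
          by (simp add: A_def E_def \<sigma>_def)
      qed
    qed
  qed
qed

text \<open>The primitive is controlled only with a factor r, so the bound for it degenerates at the
  origin; \<open>v_square_inward\<close> later brings decay to r = 0 from positive radii.\<close>

theorem radial_wave_decay:
  assumes r: "r > 0"
  shows "((\<lambda>t. v 0 t r) \<longlongrightarrow> 0) at_top"
proof -
  obtain W where W: "\<And>t x. t \<ge> 0 \<Longrightarrow> x \<ge> 0 \<Longrightarrow> x * (integral {0..t} (\<lambda>s. v 0 s x))\<^sup>2 \<le> W"
    by (rule primitive_bounded) blast
  show ?thesis
  proof (rule tauberian_tendsto_zero[where M = "vbound 0 r" and L = "vbound 1 r" and W = "sqrt (W / r)"])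
    show "continuous_on {0..} (\<lambda>t. v 0 t r)" by (intro cont2_compose[OF vc] continuous_intros)
    show "\<bar>v 0 s r\<bar> \<le> vbound 0 r" if "s \<ge> 0" for s using that r by (intro v_bound) auto
    show "vbound 1 r \<ge> 0" using r by (rule vbound_nonneg)
    show "\<bar>v 0 s r - v 0 t r\<bar> \<le> vbound 1 r * \<bar>s - t\<bar>" if "s \<ge> 0" "t \<ge> 0" for s t
    proof -
      have "norm (v 0 s r - v 0 t r) \<le> vbound 1 r * norm (s - t)"
      proof (rule field_differentiable_bound[of "{0..}" "\<lambda>t. v 0 t r" "\<lambda>t. v 1 t r"])
        show "((\<lambda>t. v 0 t r) has_field_derivative v 1 z r) (at z within {0..})" for z
          using v_t[of 0 r z] by (simp add: has_field_derivative_at_within)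
        show "norm (v 1 z r) \<le> vbound 1 r" if "z \<in> {0..}" for z using that r v_bound[of z r r 1] by simp
      qed (use that in auto)
      then show ?thesis by simp
    qed
    show "\<bar>integral {0..s} (\<lambda>t. v 0 t r)\<bar> \<le> sqrt (W / r)" if "s \<ge> 0" for s
    proof -
      have "(integral {0..s} (\<lambda>t. v 0 t r))\<^sup>2 \<le> W / r" using W[of s r] that r by (simp add: field_simps)
      then show ?thesis by (metis real_sqrt_abs real_sqrt_le_iff)
    qed
    fix e B :: real assume e: "0 < e" "e < B"
    obtain C where C: "\<And>d. 0 < d \<Longrightarrow> d \<le> 1 \<Longrightarrow> \<forall>\<^sub>F q in at_top. \<forall>\<omega>. e \<le> \<omega> \<longrightarrow> \<omega> \<le> B \<longrightarrow>
        norm (integral {0..q} (\<lambda>s. exp (- Complex d \<omega> * of_real s) * of_real (v 0 s r))) \<le> C"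
      by (rule laplace_bounded[OF r e]) blast
    have eq: "integral {0..q} (\<lambda>s. cos (\<omega> * s) * (exp (- d * s) * v 0 s r)) =
        Re (integral {0..q} (\<lambda>s. exp (- Complex d \<omega> * of_real s) * of_real (v 0 s r)))"
      "integral {0..q} (\<lambda>s. sin (\<omega> * s) * (exp (- d * s) * v 0 s r)) =
        - Im (integral {0..q} (\<lambda>s. exp (- Complex d \<omega> * of_real s) * of_real (v 0 s r)))" for q d \<omega>
    proof -
      have i: "(\<lambda>s. exp (- Complex d \<omega> * of_real s) * complex_of_real (v 0 s r)) integrable_on {0..q}"
        by (intro integrable_continuous_real continuous_intros cont2_compose[OF vc])
      have "integral {0..q} (\<lambda>s. cos (\<omega> * s) * (exp (- d * s) * v 0 s r)) =
          integral {0..q} (Re \<circ> (\<lambda>s. exp (- Complex d \<omega> * of_real s) * of_real (v 0 s r)))"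
        by (rule integral_cong) (simp add: Re_exp)
      then show "integral {0..q} (\<lambda>s. cos (\<omega> * s) * (exp (- d * s) * v 0 s r)) =
        Re (integral {0..q} (\<lambda>s. exp (- Complex d \<omega> * of_real s) * of_real (v 0 s r)))"
        using integral_linear[OF i bounded_linear_Re] by simp
      have "integral {0..q} (\<lambda>s. sin (\<omega> * s) * (exp (- d * s) * v 0 s r)) =
          integral {0..q} (\<lambda>s. - (Im \<circ> (\<lambda>s. exp (- Complex d \<omega> * of_real s) * of_real (v 0 s r))) s)"
        by (rule integral_cong) (simp add: Im_exp)
      then show "integral {0..q} (\<lambda>s. sin (\<omega> * s) * (exp (- d * s) * v 0 s r)) =
        - Im (integral {0..q} (\<lambda>s. exp (- Complex d \<omega> * of_real s) * of_real (v 0 s r)))"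
        using integral_linear[OF i bounded_linear_Im] by (simp only: integral_neg)
    qed
    show "\<exists>C. \<forall>d. 0 < d \<longrightarrow> d \<le> 1 \<longrightarrow> (\<exists>q0. \<forall>q\<ge>q0. \<forall>w. e \<le> w \<longrightarrow> w \<le> B \<longrightarrow>
        \<bar>integral {0..q} (\<lambda>s. cos (w * s) * (exp (- d * s) * v 0 s r))\<bar> \<le> C \<and>
        \<bar>integral {0..q} (\<lambda>s. sin (w * s) * (exp (- d * s) * v 0 s r))\<bar> \<le> C)"
      unfolding eq abs_minus_cancel
    proof (rule exI[of _ C], intro allI impI)
      fix d :: real assume "0 < d" "d \<le> 1"
      then obtain q0 where q0: "\<And>q \<omega>. q \<ge> q0 \<Longrightarrow> e \<le> \<omega> \<Longrightarrow> \<omega> \<le> B \<Longrightarrow>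
          norm (integral {0..q} (\<lambda>s. exp (- Complex d \<omega> * of_real s) * of_real (v 0 s r))) \<le> C"
        using C[of d] unfolding eventually_at_top_linorder by blast
      show "\<exists>q0. \<forall>q\<ge>q0. \<forall>\<omega>. e \<le> \<omega> \<longrightarrow> \<omega> \<le> B \<longrightarrow>
          \<bar>Re (integral {0..q} (\<lambda>s. exp (- Complex d \<omega> * of_real s) * of_real (v 0 s r)))\<bar> \<le> C \<and>
          \<bar>Im (integral {0..q} (\<lambda>s. exp (- Complex d \<omega> * of_real s) * of_real (v 0 s r)))\<bar> \<le> C"
        by (intro exI[of _ q0] allI impI conjI order_trans[OF abs_Re_le_cmod] order_trans[OF abs_Im_le_cmod] q0)
    qed
  qed
qed

end

section \<open>Legendre polynomials\<close>

text \<open>(1 - x^2) p'' - 2 x p', the spherical Laplacian on functions of the height x;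
  \<open>pCons 0\<close> is multiplication by x.\<close>

definition legendre_op :: "real poly \<Rightarrow> real poly" where
  "legendre_op p = pderiv (pderiv p) - pCons 0 (pCons 0 (pderiv (pderiv p))) - smult 2 (pCons 0 (pderiv p))"

definition legendre_eig :: "nat \<Rightarrow> real" where
  "legendre_eig n = real n * (real n + 1)"

definition legendre_eigenpoly :: "nat \<Rightarrow> real poly \<Rightarrow> bool" where
  "legendre_eigenpoly n p \<longleftrightarrow> legendre_op p = smult (- legendre_eig n) p"

lemma legendre_eig_nonneg: "legendre_eig n \<ge> 0" by (simp add: legendre_eig_def)

lemma legendre_eig_ge_2: "n \<noteq> 0 \<Longrightarrow> legendre_eig n \<ge> 2"
proof -
  assume "n \<noteq> 0"
  then have "real n \<ge> 1" by simp
  then have "1 * (1 + 1) \<le> real n * (real n + 1)" by (intro mult_mono) auto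
  then show ?thesis by (simp add: legendre_eig_def)
qed

lemma legendre_eig_strict_mono: "m < n \<Longrightarrow> legendre_eig m < legendre_eig n"
  unfolding legendre_eig_def by (intro mult_strict_mono) auto

lemma poly_legendre_op:
  "poly (legendre_op p) x = (1 - x\<^sup>2) * poly (pderiv (pderiv p)) x - 2 * x * poly (pderiv p) x"
  by (simp add: legendre_op_def algebra_simps power2_eq_square)

lemma legendre_op_add: "legendre_op (p + q) = legendre_op p + legendre_op q"
  by (rule poly_eqI) (simp add: legendre_op_def pderiv_add coeff_pCons smult_add_right algebra_simps split: nat.split)

lemma legendre_op_smult: "legendre_op (smult c p) = smult c (legendre_op p)"
  by (rule poly_eqI) (simp add: legendre_op_def pderiv_smult coeff_pCons algebra_simps split: nat.split)

lemma legendre_op_0: "legendre_op 0 = 0" by (simp add: legendre_op_def)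

lemma legendre_op_diff: "legendre_op (p - q) = legendre_op p - legendre_op q"
  using legendre_op_add[of p "smult (-1) q"] legendre_op_smult[of "-1" q] by simp

lemma legendre_op_sum: "legendre_op (\<Sum>i\<in>A. p i) = (\<Sum>i\<in>A. legendre_op (p i))"
  by (induction A rule: infinite_finite_induct) (auto simp: legendre_op_0 legendre_op_add)

lemma coeff_legendre_op:
  "coeff (legendre_op p) k = (real k + 2) * (real k + 1) * coeff p (k + 2) - real k * (real k + 1) * coeff p k"
proof -
  consider "k = 0" | "k = 1" | j where "k = Suc (Suc j)" by (metis One_nat_def not0_implies_Suc)
  then show ?thesis
    by cases (simp_all add: legendre_op_def coeff_pderiv coeff_pCons algebra_simps numeral_2_eq_2)
qed

lemma smult_right_sum: "smult c (\<Sum>i\<in>A. p i) = (\<Sum>i\<in>A. smult c (p i))"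
  by (induction A rule: infinite_finite_induct) (auto simp: smult_add_right)

text \<open>The leading coefficient shows that adding the eigenvalue of degree N + 1 to the operator
  lowers the degree of q. Decompose the result by induction and divide each part by its gap to that
  eigenvalue; what q has beyond these parts is an eigenfunction for the new eigenvalue.\<close>

lemma legendre_decomposition:
  assumes "degree q \<le> N"
  shows "\<exists>e. (\<forall>n. legendre_eigenpoly n (e n)) \<and> q = (\<Sum>n\<le>N. e n)"
  using assms
proof (induction N arbitrary: q)
  case 0
  then have "pderiv q = 0" by (simp add: pderiv_eq_0_iff)
  then have "legendre_eigenpoly n (if n = 0 then q else 0)" for n
    by (simp add: legendre_eigenpoly_def legendre_op_def legendre_eig_def)
  then show ?case by (intro exI[of _ "\<lambda>n. if n = 0 then q else 0"]) auto
next
  case (Suc N)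
  let ?L = "legendre_eig (Suc N)"
  have "degree (legendre_op q + smult ?L q) \<le> N"
  proof (rule degree_le, intro allI impI)
    fix k assume k: "N < k"
    show "coeff (legendre_op q + smult ?L q) k = 0"
    proof (cases "k = Suc N")
      case True
      then show ?thesis using Suc.prems coeff_eq_0[of q "k + 2"]
        by (simp add: coeff_legendre_op legendre_eig_def)
    next
      case False
      then show ?thesis using k Suc.prems by (simp add: coeff_legendre_op coeff_eq_0)
    qed
  qed
  from Suc.IH[OF this] obtain e where e: "\<And>n. legendre_eigenpoly n (e n)"
    and sum: "legendre_op q + smult ?L q = (\<Sum>n\<le>N. e n)" by blast
  define d where "d n = smult (1 / (?L - legendre_eig n)) (e n)" for n
  define e' where "e' n = (if n \<le> N then d n else if n = Suc N then q - (\<Sum>n\<le>N. d n) else 0)" for n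
  have de: "e n = smult ?L (d n) - smult (legendre_eig n) (d n)" if "n \<le> N" for n
  proof -
    have "?L - legendre_eig n \<noteq> 0" using legendre_eig_strict_mono[of n "Suc N"] that by simp
    then show ?thesis by (simp add: d_def flip: smult_diff_left diff_divide_distrib)
  qed
  have dd: "legendre_op (d n) = smult (- legendre_eig n) (d n)" for n
    using e[of n] by (simp add: d_def legendre_eigenpoly_def legendre_op_smult mult.commute)
  have "legendre_op (q - (\<Sum>n\<le>N. d n)) = ((\<Sum>n\<le>N. e n) - smult ?L q) - (\<Sum>n\<le>N. smult (- legendre_eig n) (d n))"
    unfolding legendre_op_diff legendre_op_sum dd using sum by (simp add: algebra_simps)
  also have "(\<Sum>n\<le>N. e n) = (\<Sum>n\<le>N. smult ?L (d n) - smult (legendre_eig n) (d n))"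
    by (intro sum.cong refl de) auto
  also have "(\<Sum>n\<le>N. smult ?L (d n) - smult (legendre_eig n) (d n)) - smult ?L q - (\<Sum>n\<le>N. smult (- legendre_eig n) (d n))
      = smult (- ?L) (q - (\<Sum>n\<le>N. d n))"
    by (simp add: sum_subtractf sum_negf smult_diff_right smult_right_sum)
  finally have "legendre_eigenpoly n (e' n)" for n
    using dd by (auto simp: e'_def legendre_eigenpoly_def legendre_op_0)
  moreover have "q = (\<Sum>n\<le>Suc N. e' n)" by (simp add: e'_def)
  ultimately show ?case by blast
qed

lemma legendre_eigenpoly_ode:
  assumes "legendre_eigenpoly n p"
  shows "(1 - x\<^sup>2) * poly (pderiv (pderiv p)) x = 2 * x * poly (pderiv p) x - legendre_eig n * poly p x"
  using assms poly_legendre_op[of p x] by (simp add: legendre_eigenpoly_def)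

text \<open>Sonin's function g = p^2 + (1 - x^2) p'^2 / \<lambda>, \<lambda> the eigenvalue, has
  derivative 2 x p'^2 / \<lambda>, so it increases on [0, 1]; it dominates p^2 and agrees with it at
  1.\<close>

lemma legendre_eigenpoly_bound_right:
  assumes p: "legendre_eigenpoly n p" and n: "n \<noteq> 0" and x: "0 \<le> x" "x \<le> 1"
  shows "(poly p x)\<^sup>2 \<le> (poly p 1)\<^sup>2"
proof -
  let ?l = "legendre_eig n"
  have l: "?l > 0" using legendre_eig_ge_2[OF n] by simp
  define g where "g x = (poly p x)\<^sup>2 + (1 - x\<^sup>2) * (poly (pderiv p) x)\<^sup>2 / ?l" for x
  have "(g has_real_derivative 2 * y * (poly (pderiv p) y)\<^sup>2 / ?l) (at y)" for y
  proof -
    have "(g has_real_derivative 2 * poly p y * poly (pderiv p) y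
        + (- 2 * y * (poly (pderiv p) y)\<^sup>2 + 2 * poly (pderiv p) y * ((1 - y\<^sup>2) * poly (pderiv (pderiv p)) y)) / ?l) (at y)"
      unfolding g_def[abs_def] using l by (auto intro!: derivative_eq_intros poly_DERIV simp: field_simps)
    also have "2 * poly p y * poly (pderiv p) y
        + (- 2 * y * (poly (pderiv p) y)\<^sup>2 + 2 * poly (pderiv p) y * ((1 - y\<^sup>2) * poly (pderiv (pderiv p)) y)) / ?l
        = 2 * y * (poly (pderiv p) y)\<^sup>2 / ?l"
      unfolding legendre_eigenpoly_ode[OF p] using l by (simp add: field_simps power2_eq_square)
    finally show ?thesis .
  qed
  then have "g x \<le> g 1"
    using x l by (intro DERIV_nonneg_imp_nondecreasing[OF x(2)]) fastforce
  moreover have "x\<^sup>2 \<le> 1" using x by (simp add: power_le_one)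
  then have "(poly p x)\<^sup>2 \<le> g x" using l by (simp add: g_def)
  ultimately show ?thesis by (simp add: g_def)
qed

text \<open>For n > 0 the preceding bound annihilates p on [0, 1]. For n = 0 the polynomial (1 -
  x^2) p' is constant and vanishes at 1, so p is constant.\<close>

lemma legendre_eigenpoly_unique_zero:
  assumes p: "legendre_eigenpoly n p" and zero: "poly p 1 = 0"
  shows "p = 0"
proof (cases "n = 0")
  case True
  have "poly (pderiv ([:1, 0, -1:] * pderiv p)) x = poly (legendre_op p) x" for x
    unfolding pderiv_mult poly_legendre_op by (simp add: pderiv_pCons power2_eq_square algebra_simps)
  then have "pderiv ([:1, 0, -1:] * pderiv p) = legendre_op p" using poly_eq_poly_eq_iff by blast
  then have "pderiv ([:1, 0, -1:] * pderiv p) = 0" using p True by (simp add: legendre_eigenpoly_def legendre_eig_def)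
  then obtain c where c: "[:1, 0, -1:] * pderiv p = [:c:]"
    using degree_eq_zeroE pderiv_eq_0_iff by metis
  have "poly ([:1, 0, -1:] * pderiv p) 1 = 0" by simp
  then have "c = 0" unfolding c by simp
  then have "pderiv p = 0" using c by (metis mult_eq_0_iff pCons_0_0 pCons_eq_0_iff zero_neq_one)
  then obtain b where "p = [:b:]" using degree_eq_zeroE pderiv_eq_0_iff by metis
  then show ?thesis using zero by simp
next
  case False
  have "poly p x = 0" if "x \<in> {0..1}" for x
    using legendre_eigenpoly_bound_right[OF p False, of x] that zero by simp
  then have "{0..1} \<subseteq> {x. poly p x = 0}" by auto
  moreover have "infinite {0..1::real}" by (simp add: infinite_Icc)
  ultimately show ?thesis using poly_roots_finite finite_subset by blast
qed

lemma legendre_eigenpoly_diff: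
  "legendre_eigenpoly n p \<Longrightarrow> legendre_eigenpoly n q \<Longrightarrow> legendre_eigenpoly n (smult a p - smult b q)"
  by (simp add: legendre_eigenpoly_def legendre_op_diff legendre_op_smult smult_diff_right mult.commute)

lemma legendre_eigenpoly_reflect:
  assumes "legendre_eigenpoly n p"
  shows "legendre_eigenpoly n (pcompose p [:0, -1:])"
proof -
  have "poly (legendre_op (pcompose p [:0, -1:])) x = poly (smult (- legendre_eig n) (pcompose p [:0, -1:])) x" for x
  proof -
    have "poly (legendre_op (pcompose p [:0, -1:])) x = poly (legendre_op p) (- x)"
      unfolding poly_legendre_op
      by (simp add: pderiv_pcompose pderiv_pCons pderiv_minus pderiv_mult pderiv_smult poly_pcompose)
    also have "\<dots> = - legendre_eig n * poly p (- x)" using assms by (simp add: legendre_eigenpoly_def)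
    finally show ?thesis by (simp add: poly_pcompose)
  qed
  then show ?thesis unfolding legendre_eigenpoly_def using poly_eq_poly_eq_iff by blast
qed

text \<open>The reflected polynomial is an eigenpolynomial too, hence proportional to p by
  uniqueness; evaluation at -1 gives p(-1)^2 = p(1)^2. So the bound on [0, 1] also covers
  [-1, 0].\<close>

lemma legendre_eigenpoly_bound:
  assumes p: "legendre_eigenpoly n p" and n: "n \<noteq> 0" and x: "- 1 \<le> x" "x \<le> 1"
  shows "\<bar>poly p x\<bar> \<le> \<bar>poly p 1\<bar>"
proof -
  define r where "r = pcompose p [:0, -1:]"
  have r: "legendre_eigenpoly n r" unfolding r_def by (rule legendre_eigenpoly_reflect[OF p])
  have rp: "poly r y = poly p (- y)" for y by (simp add: r_def poly_pcompose)
  have "smult (poly p 1) r - smult (poly r 1) p = 0"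
    by (rule legendre_eigenpoly_unique_zero[OF legendre_eigenpoly_diff[OF r p]]) simp
  then have "poly (smult (poly p 1) r - smult (poly r 1) p) (-1) = 0" by simp
  then have "(poly p 1)\<^sup>2 = (poly p (- 1))\<^sup>2" by (simp add: rp power2_eq_square)
  moreover have "(poly p x)\<^sup>2 \<le> (poly p 1)\<^sup>2" if "0 \<le> x"
    using legendre_eigenpoly_bound_right[OF p n that x(2)] .
  moreover have "(poly p x)\<^sup>2 \<le> (poly p (- 1))\<^sup>2" if "x \<le> 0"
    using legendre_eigenpoly_bound_right[OF r n, of "- x"] that x by (simp add: rp)
  ultimately show ?thesis by (metis linear power2_le_iff_abs_le abs_ge_zero power2_abs)
qed

text \<open>Normalised by the value 1 at x = 1. The default 0 is itself an eigenpolynomial, so the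
  results below need no case in which the normalisation fails.\<close>

definition legendre_P :: "nat \<Rightarrow> real poly" where
  "legendre_P n = (if \<exists>p. legendre_eigenpoly n p \<and> poly p 1 = 1
     then SOME p. legendre_eigenpoly n p \<and> poly p 1 = 1 else 0)"

lemma legendre_P_cases: "legendre_P n = 0 \<or> poly (legendre_P n) 1 = 1"
  and legendre_P_eigen: "legendre_eigenpoly n (legendre_P n)"
proof -
  consider "legendre_P n = 0" | "legendre_eigenpoly n (legendre_P n) \<and> poly (legendre_P n) 1 = 1"
    unfolding legendre_P_def using someI_ex[of "\<lambda>p. legendre_eigenpoly n p \<and> poly p 1 = 1"] by fastforce
  then show "legendre_P n = 0 \<or> poly (legendre_P n) 1 = 1" "legendre_eigenpoly n (legendre_P n)"
    by (cases; simp add: legendre_eigenpoly_def legendre_op_0)+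
qed

lemma legendre_eigenpoly_eq_P:
  assumes p: "legendre_eigenpoly n p"
  shows "p = smult (poly p 1) (legendre_P n)"
proof (cases "poly p 1 = 0")
  case True
  then show ?thesis using legendre_eigenpoly_unique_zero[OF p] by simp
next
  case False
  have "legendre_eigenpoly n (smult (1 / poly p 1) p)"
    using p by (simp add: legendre_eigenpoly_def legendre_op_smult mult.commute)
  moreover have "poly (smult (1 / poly p 1) p) 1 = 1" using False by simp
  ultimately have ex: "\<exists>p. legendre_eigenpoly n p \<and> poly p 1 = 1" by blast
  then have "poly (legendre_P n) 1 = 1" unfolding legendre_P_def using someI_ex[OF ex] by simp
  then have "poly (smult 1 p - smult (poly p 1) (legendre_P n)) 1 = 0" by simp
  from legendre_eigenpoly_unique_zero[OF legendre_eigenpoly_diff[OF p legendre_P_eigen] this]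
  show ?thesis by simp
qed

lemma legendre_P_0: "legendre_P 0 = 1"
proof -
  have "legendre_eigenpoly 0 1" by (simp add: legendre_eigenpoly_def legendre_op_def legendre_eig_def)
  from legendre_eigenpoly_eq_P[OF this] show ?thesis by simp
qed

lemma legendre_P_bound:
  assumes "- 1 \<le> x" "x \<le> 1"
  shows "\<bar>poly (legendre_P n) x\<bar> \<le> 1"
proof (cases "n = 0")
  case False
  show ?thesis using legendre_eigenpoly_bound[OF legendre_P_eigen False assms] legendre_P_cases[of n] by auto
qed (simp add: legendre_P_0)

text \<open>The product of p and q is, up to the difference of eigenvalues, the derivative of (1 -
  x^2) times their Wronskian, which vanishes at both ends.\<close>

lemma legendre_orthogonal:
  assumes p: "legendre_eigenpoly n p" and q: "legendre_eigenpoly m q" and ne: "n \<noteq> m"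
  shows "integral {-1..1} (\<lambda>x. poly p x * poly q x) = 0"
proof -
  let ?c = "legendre_eig m - legendre_eig n"
  define F where "F x = (1 - x\<^sup>2) * (poly (pderiv p) x * poly q x - poly p x * poly (pderiv q) x)" for x :: real
  have "((\<lambda>x. ?c * (poly p x * poly q x)) has_integral F 1 - F (-1)) {-1..1}"
  proof (rule fundamental_theorem_of_calculus)
    fix x :: real
    have "(F has_real_derivative ((1 - x\<^sup>2) * poly (pderiv (pderiv p)) x - 2 * x * poly (pderiv p) x) * poly q x
        - poly p x * ((1 - x\<^sup>2) * poly (pderiv (pderiv q)) x - 2 * x * poly (pderiv q) x)) (at x)"
      unfolding F_def[abs_def] by (auto intro!: derivative_eq_intros poly_DERIV simp: algebra_simps)
    also have "((1 - x\<^sup>2) * poly (pderiv (pderiv p)) x - 2 * x * poly (pderiv p) x) * poly q x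
        - poly p x * ((1 - x\<^sup>2) * poly (pderiv (pderiv q)) x - 2 * x * poly (pderiv q) x) = ?c * (poly p x * poly q x)"
      unfolding legendre_eigenpoly_ode[OF p] legendre_eigenpoly_ode[OF q] by (simp add: algebra_simps)
    finally show "(F has_vector_derivative ?c * (poly p x * poly q x)) (at x within {-1..1})"
      by (simp add: has_real_derivative_iff_has_vector_derivative has_vector_derivative_at_within)
  qed simp
  then have "?c * integral {-1..1} (\<lambda>x. poly p x * poly q x) = 0"
    by (simp add: integral_unique F_def flip: integral_mult_right)
  moreover have "?c \<noteq> 0" using ne legendre_eig_strict_mono[of n m] legendre_eig_strict_mono[of m n] by (metis diff_gt_0_iff_gt less_irrefl nat_neq_iff right_minus_eq)
  ultimately show ?thesis by simp
qed

text \<open>The slope of P on [0, 1) is at most the eigenvalue \<lambda>, so P stays above 1/2 on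
  the last stretch of length 1/(2 \<lambda>) before x = 1; this alone gives 1/(8 \<lambda>).\<close>

lemma legendre_P_norm_lower:
  assumes n: "n \<noteq> 0" and P: "legendre_P n \<noteq> 0"
  shows "1 / (8 * legendre_eig n) \<le> integral {-1..1} (\<lambda>x. (poly (legendre_P n) x)\<^sup>2)"
proof -
  let ?l = "legendre_eig n" and ?P = "legendre_P n"
  have l: "?l \<ge> 2" by (rule legendre_eig_ge_2[OF n])
  have P1: "poly ?P 1 = 1" using P legendre_P_cases[of n] by simp
  have d1: "poly (pderiv ?P) x \<le> ?l" if x: "0 \<le> x" "x < 1" for x
  proof -
    \<comment> \<open>By the Legendre equation F' = \<lambda> (1 - P) \<ge> 0, and F vanishes at 1.
      So F \<le> 0, and cancelling 1 - x bounds the slope.\<close>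
    define F where "F x = (1 - x\<^sup>2) * poly (pderiv ?P) x - ?l * (1 - x)" for x :: real
    have "F x \<le> F 1"
    proof (rule DERIV_nonneg_imp_nondecreasing[where f = F])
      show "x \<le> 1" using x by simp
      fix y assume y: "x \<le> y" "y \<le> 1"
      have "(F has_real_derivative ((1 - y\<^sup>2) * poly (pderiv (pderiv ?P)) y - 2 * y * poly (pderiv ?P) y) + ?l) (at y)"
        unfolding F_def[abs_def] by (auto intro!: derivative_eq_intros poly_DERIV simp: algebra_simps)
      moreover have "((1 - y\<^sup>2) * poly (pderiv (pderiv ?P)) y - 2 * y * poly (pderiv ?P) y) + ?l = ?l * (1 - poly ?P y)"
        unfolding legendre_eigenpoly_ode[OF legendre_P_eigen] by (simp add: algebra_simps)
      moreover have "0 \<le> ?l * (1 - poly ?P y)" using l legendre_P_bound[of y n] x y by (intro mult_nonneg_nonneg) auto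
      ultimately show "\<exists>z. (F has_real_derivative z) (at y) \<and> 0 \<le> z" by metis
    qed
    then have "(1 - x) * ((1 + x) * poly (pderiv ?P) x) \<le> (1 - x) * ?l"
      by (simp add: F_def power2_eq_square algebra_simps)
    then have *: "(1 + x) * poly (pderiv ?P) x \<le> ?l" using x by (simp add: mult_le_cancel_left)
    show ?thesis
    proof (cases "poly (pderiv ?P) x \<le> 0")
      case False
      then have "1 * poly (pderiv ?P) x \<le> (1 + x) * poly (pderiv ?P) x" using x by (intro mult_right_mono) auto
      with * show ?thesis by simp
    qed (use l in auto)
  qed
  have low: "poly ?P x \<ge> 1 / 2" if x: "1 - 1 / (2 * ?l) \<le> x" "x \<le> 1" for x
  proof -
    have "1 / (2 * ?l) \<le> 1 / 4" using l by (intro divide_left_mono) auto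
    then have x0: "0 \<le> x" using x by linarith
    have "poly ?P 1 - ?l * 1 \<le> poly ?P x - ?l * x"
    proof (rule DERIV_nonpos_imp_decreasing_open[where f = "\<lambda>x. poly ?P x - ?l * x", OF x(2)])
      fix y assume y: "x < y" "y < 1"
      have "((\<lambda>x. poly ?P x - ?l * x) has_real_derivative poly (pderiv ?P) y - ?l) (at y)"
        by (auto intro!: derivative_eq_intros poly_DERIV)
      then show "\<exists>z. ((\<lambda>x. poly ?P x - ?l * x) has_real_derivative z) (at y) \<and> z \<le> 0"
        using d1[of y] x0 y by force
    qed (intro continuous_intros)
    moreover have "?l * (1 - x) \<le> ?l * (1 / (2 * ?l))" using x l by (intro mult_left_mono) auto
    ultimately show ?thesis using P1 l by (simp add: algebra_simps)
  qed
  have l4: "1 / (2 * ?l) \<le> 1" using l by simp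
  have "1 / (8 * ?l) = integral {1 - 1 / (2 * ?l)..1} (\<lambda>x. (1 / 2)\<^sup>2)"
    using l by (simp add: power2_eq_square)
  also have "\<dots> \<le> integral {1 - 1 / (2 * ?l)..1} (\<lambda>x. (poly ?P x)\<^sup>2)"
    using low by (intro integral_le integrable_continuous_real continuous_intros power_mono) auto
  also have "\<dots> \<le> integral {-1..1} (\<lambda>x. (poly ?P x)\<^sup>2)"
    using l4 by (intro integral_subset_le integrable_continuous_real continuous_intros) auto
  finally show ?thesis .
qed

section \<open>Legendre coefficients of the peaked kernel\<close>

definition peak :: "nat \<Rightarrow> real poly" where "peak N = [:1/2, 1/2:] ^ N"

lemma poly_peak: "poly (peak N) x = ((1 + x) / 2) ^ N"
  by (simp add: peak_def poly_power add_divide_distrib)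

lemma integral_peak: "integral {-1..1} (poly (peak N)) = 2 / (real N + 1)"
proof -
  have "((\<lambda>x. poly (peak N) x) has_integral 2 / (real N + 1) * ((1 + 1) / 2) ^ Suc N - 2 / (real N + 1) * ((1 + (-1)) / 2) ^ Suc N) {-1..1}"
  proof (rule fundamental_theorem_of_calculus)
    fix x :: real
    have "((\<lambda>x. (1 + x) / 2) has_real_derivative 1 / 2) (at x)" by (auto intro!: derivative_eq_intros)
    then have "((\<lambda>x. 2 / (real N + 1) * ((1 + x) / 2) ^ Suc N) has_real_derivative
        2 / (real N + 1) * ((1 + real N) * (1 / 2 * ((1 + x) / 2) ^ N))) (at x)"
      by (intro DERIV_cmult DERIV_power_Suc)
    also have "2 / (real N + 1) * ((1 + real N) * (1 / 2 * ((1 + x) / 2) ^ N)) = poly (peak N) x"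
    proof -
      have "2 / (real N + 1) * ((1 + real N) * (1 / 2 * z)) = z" for z :: real by (simp add: field_simps)
      then show ?thesis by (simp add: poly_peak)
    qed
    finally show "((\<lambda>x. 2 / (real N + 1) * ((1 + x) / 2) ^ Suc N) has_vector_derivative poly (peak N) x) (at x within {-1..1})"
      by (simp add: has_real_derivative_iff_has_vector_derivative has_vector_derivative_at_within)
  qed simp
  then show ?thesis by (simp add: integral_unique)
qed

text \<open>The projection on P_n is at most the mass 2/(N+1) of the peak, because |P_n| \<le> 1;
  divide by the norm bound 1/(8 \<lambda>). The added 1 covers n = 0. The point is the common factor
  1/(N+1), which the normalisation of the kernel cancels.\<close>

lemma peak_expansion:
  obtains \<beta> where "peak N = (\<Sum>n\<le>N. smult (\<beta> n) (legendre_P n))" "\<beta> 0 = 1 / (real N + 1)"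
    "\<And>n. n \<le> N \<Longrightarrow> \<bar>\<beta> n\<bar> \<le> 16 * (legendre_eig n + 1) / (real N + 1)"
proof -
  have "degree (peak N) \<le> N" unfolding peak_def
    using degree_power_le[of "[:1/2, 1/2::real:]" N] by simp
  from legendre_decomposition[OF this] obtain e where e: "\<And>n. legendre_eigenpoly n (e n)" and sum: "peak N = (\<Sum>n\<le>N. e n)" by blast
  define \<beta> where "\<beta> n = poly (e n) 1" for n
  have eP: "e n = smult (\<beta> n) (legendre_P n)" for n unfolding \<beta>_def by (rule legendre_eigenpoly_eq_P[OF e])
  have peak_sum: "peak N = (\<Sum>n\<le>N. smult (\<beta> n) (legendre_P n))" using sum by (simp add: eP[symmetric])
  have proj: "integral {-1..1} (\<lambda>x. poly (peak N) x * poly (legendre_P m) x) = \<beta> m * integral {-1..1} (\<lambda>x. (poly (legendre_P m) x)\<^sup>2)"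
    if m: "m \<le> N" for m
  proof -
    have "integral {-1..1} (\<lambda>x. poly (peak N) x * poly (legendre_P m) x)
        = integral {-1..1} (\<lambda>x. \<Sum>n\<le>N. \<beta> n * (poly (legendre_P n) x * poly (legendre_P m) x))"
      unfolding peak_sum by (simp add: poly_sum sum_distrib_right mult.assoc)
    also have "\<dots> = (\<Sum>n\<le>N. integral {-1..1} (\<lambda>x. \<beta> n * (poly (legendre_P n) x * poly (legendre_P m) x)))"
      by (intro integral_sum integrable_continuous_real continuous_intros) auto
    also have "\<dots> = (\<Sum>n\<le>N. if n = m then \<beta> m * integral {-1..1} (\<lambda>x. (poly (legendre_P m) x)\<^sup>2) else 0)"
      by (intro sum.cong) (auto simp: power2_eq_square legendre_orthogonal[OF legendre_P_eigen legendre_P_eigen])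
    finally show ?thesis using m by simp
  qed
  have \<beta>0: "\<beta> 0 = 1 / (real N + 1)"
    using proj[of 0] integral_peak[of N] by (simp add: legendre_P_0)
  have "\<bar>\<beta> n\<bar> \<le> 16 * (legendre_eig n + 1) / (real N + 1)" if n: "n \<le> N" for n
  proof (cases "n = 0")
    case True
    then show ?thesis using \<beta>0 by (simp add: legendre_eig_def field_simps)
  next
    case False
    let ?l = "legendre_eig n"
    have l: "?l \<ge> 2" by (rule legendre_eig_ge_2[OF False])
    show ?thesis
    proof (cases "legendre_P n = 0")
      case True
      then have "\<beta> n = 0" using eP[of n] by (simp add: \<beta>_def)
      then show ?thesis using l by simp
    next
      case P: False
      have "\<bar>\<beta> n\<bar> * (1 / (8 * ?l)) \<le> \<bar>\<beta> n\<bar> * integral {-1..1} (\<lambda>x. (poly (legendre_P n) x)\<^sup>2)"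
        by (intro mult_left_mono legendre_P_norm_lower[OF False P]) auto
      also have "\<dots> = \<bar>integral {-1..1} (\<lambda>x. poly (peak N) x * poly (legendre_P n) x)\<bar>"
        unfolding proj[OF n] by (simp add: abs_mult integral_nonneg integrable_continuous_real continuous_intros)
      also have "\<dots> \<le> integral {-1..1} (poly (peak N))"
      proof -
        have "norm (integral {-1..1} (\<lambda>x. poly (peak N) x * poly (legendre_P n) x)) \<le> integral {-1..1} (poly (peak N))"
        proof (rule integral_norm_bound_integral)
          fix x :: real assume x: "x \<in> {-1..1}"
          have "0 \<le> poly (peak N) x" unfolding poly_peak using x by simp
          then have "\<bar>poly (peak N) x\<bar> * \<bar>poly (legendre_P n) x\<bar> \<le> poly (peak N) x * 1"
            using legendre_P_bound[of x n] x by (intro mult_mono) auto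
          then show "norm (poly (peak N) x * poly (legendre_P n) x) \<le> poly (peak N) x" by (simp add: abs_mult)
        qed (intro integrable_continuous_real continuous_intros)+
        then show ?thesis by simp
      qed
      also have "\<dots> = 2 / (real N + 1)" by (rule integral_peak)
      finally have "\<bar>\<beta> n\<bar> \<le> 16 * ?l / (real N + 1)" using l by (simp add: field_simps)
      also have "\<dots> \<le> 16 * (?l + 1) / (real N + 1)" by (intro divide_right_mono) auto
      finally show ?thesis .
    qed
  qed
  with peak_sum \<beta>0 show ?thesis by (rule that)
qed

section \<open>Smooth functions and the sphere\<close>

abbreviation smooth :: "('a::euclidean_space \<Rightarrow> 'b::real_normed_vector) \<Rightarrow> bool" where
  "smooth f \<equiv> smooth_on UNIV f"

definition pd :: "'a::euclidean_space \<Rightarrow> ('a \<Rightarrow> 'b::real_normed_vector) \<Rightarrow> 'a \<Rightarrow> 'b" where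
  "pd b f x = frechet_derivative f (at x) b"

text \<open>\<open>pd_list\<close> applies the last entry of the list first, so a derivative already
  taken is appended at the end.\<close>

lemma pd_list_pd: "pd_list bs (pd b f) = pd_list (bs @ [b]) f"
  by (induction bs) (simp_all add: pd_def[abs_def])

lemma smooth_pd: "smooth f \<Longrightarrow> b \<in> Basis \<Longrightarrow> smooth (pd b f)"
  unfolding smooth_on_def pd_list_pd by simp

lemma smooth_differentiable: "smooth f \<Longrightarrow> f differentiable (at x)"
  unfolding smooth_on_def by (drule spec[of _ "[]"]) simp

text \<open>Coinduction: a class of differentiable functions closed under partial derivatives
  consists of smooth functions. The closure proofs below come down to guessing the class.\<close>

lemma smooth_coinduct:
  assumes X: "f \<in> X" and diff: "\<And>f x. f \<in> X \<Longrightarrow> f differentiable (at x)"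
    and closed: "\<And>f b. f \<in> X \<Longrightarrow> b \<in> Basis \<Longrightarrow> pd b f \<in> X"
  shows "smooth f"
proof -
  have "pd_list bs f \<in> X" if "set bs \<subseteq> Basis" for bs
    using that
  proof (induction bs)
    case (Cons b bs)
    then have "pd b (pd_list bs f) \<in> X" by (intro closed) auto
    then show ?case by (simp add: pd_def[abs_def])
  qed (simp add: X)
  then show ?thesis unfolding smooth_on_def using diff by blast
qed

lemma pd_eq: "(f has_derivative f') (at x) \<Longrightarrow> pd b f x = f' b"
  unfolding pd_def using frechet_derivative_at by metis

lemma smooth_has_derivative_frechet: "smooth f \<Longrightarrow> (f has_derivative (\<lambda>h. pd h f x)) (at x)"
  unfolding pd_def using smooth_differentiable frechet_derivative_works by blast

lemma smooth_has_derivative: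
  assumes "smooth f"
  shows "(f has_derivative (\<lambda>h. \<Sum>b\<in>Basis. (h \<bullet> b) *\<^sub>R pd b f x)) (at x)"
proof -
  note d = smooth_has_derivative_frechet[OF assms, of x]
  interpret bounded_linear "\<lambda>h. pd h f x" by (rule has_derivative_bounded_linear[OF d])
  have "pd h f x = (\<Sum>b\<in>Basis. (h \<bullet> b) *\<^sub>R pd b f x)" for h
  proof -
    have "pd h f x = pd (\<Sum>b\<in>Basis. (h \<bullet> b) *\<^sub>R b) f x" by (simp only: euclidean_representation)
    also have "\<dots> = (\<Sum>b\<in>Basis. (h \<bullet> b) *\<^sub>R pd b f x)" by (simp only: sum scaleR)
    finally show ?thesis .
  qed
  then have "(\<lambda>h. pd h f x) = (\<lambda>h. \<Sum>b\<in>Basis. (h \<bullet> b) *\<^sub>R pd b f x)" by (rule ext)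
  with d show ?thesis by (simp only:)
qed

lemma smooth_continuous: "smooth f \<Longrightarrow> continuous_on S f"
  by (intro continuous_at_imp_continuous_on ballI differentiable_imp_continuous_within smooth_differentiable)

lemma smooth_add:
  fixes f g :: "'a::euclidean_space \<Rightarrow> 'b::real_normed_vector"
  assumes "smooth f" "smooth g"
  shows "smooth (\<lambda>x. f x + g x)" and "pd b (\<lambda>x. f x + g x) = (\<lambda>x. pd b f x + pd b g x)"
proof -
  have pda: "pd b (\<lambda>x. f x + g x) = (\<lambda>x. pd b f x + pd b g x)" if "smooth f" "smooth g" for f g :: "'a \<Rightarrow> 'b" and b
  proof
    fix x
    show "pd b (\<lambda>x. f x + g x) x = pd b f x + pd b g x"
      by (rule pd_eq[OF has_derivative_add[OF smooth_has_derivative_frechet[OF that(1)] smooth_has_derivative_frechet[OF that(2)]]])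
  qed
  show "pd b (\<lambda>x. f x + g x) = (\<lambda>x. pd b f x + pd b g x)" by (rule pda[OF assms])
  show "smooth (\<lambda>x. f x + g x)"
  proof (rule smooth_coinduct[where X = "{\<lambda>x. f x + g x |f g. smooth f \<and> smooth g}"])
    fix h :: "'a \<Rightarrow> 'b" and x assume "h \<in> {\<lambda>x. f x + g x |f g. smooth f \<and> smooth g}"
    then obtain f g where "h = (\<lambda>x. f x + g x)" "smooth f" "smooth g" by blast
    then show "h differentiable (at x)" using differentiable_add[OF smooth_differentiable smooth_differentiable] by blast
  next
    fix h :: "'a \<Rightarrow> 'b" and b :: 'a assume "h \<in> {\<lambda>x. f x + g x |f g. smooth f \<and> smooth g}" and b: "b \<in> Basis"
    then obtain f g where fg: "h = (\<lambda>x. f x + g x)" "smooth f" "smooth g" by blast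
    show "pd b h \<in> {\<lambda>x. f x + g x |f g. smooth f \<and> smooth g}"
      unfolding fg(1) pda[OF fg(2,3)] using smooth_pd[OF fg(2) b] smooth_pd[OF fg(3) b]
      by (intro CollectI exI[of _ "pd b f"] exI[of _ "pd b g"]) simp
  qed (use assms in blast)
qed

lemma smooth_linear:
  fixes f :: "'a::euclidean_space \<Rightarrow> 'b::real_normed_vector" and L :: "'b \<Rightarrow> 'c::real_normed_vector"
  assumes f: "smooth f" and L: "bounded_linear L"
  shows "smooth (\<lambda>x. L (f x))" and "pd b (\<lambda>x. L (f x)) = (\<lambda>x. L (pd b f x))"
proof -
  have pdL: "pd b (\<lambda>x. L (f x)) = (\<lambda>x. L (pd b f x))" if "smooth f" for f :: "'a \<Rightarrow> 'b" and b
    by (rule ext, rule pd_eq, rule bounded_linear.has_derivative[OF L smooth_has_derivative_frechet[OF that]])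
  show "pd b (\<lambda>x. L (f x)) = (\<lambda>x. L (pd b f x))" by (rule pdL[OF f])
  show "smooth (\<lambda>x. L (f x))"
  proof (rule smooth_coinduct[where X = "{\<lambda>x. L (f x) |f. smooth f}"])
    fix h :: "'a \<Rightarrow> 'c" and x assume "h \<in> {\<lambda>x. L (f x) |f. smooth f}"
    then obtain f where f: "h = (\<lambda>x. L (f x))" "smooth f" by blast
    show "h differentiable (at x)"
      unfolding f(1) by (rule differentiableI[OF bounded_linear.has_derivative[OF L smooth_has_derivative_frechet[OF f(2)]]])
  next
    fix h :: "'a \<Rightarrow> 'c" and b :: 'a assume "h \<in> {\<lambda>x. L (f x) |f. smooth f}" and b: "b \<in> Basis"
    then obtain f where f: "h = (\<lambda>x. L (f x))" "smooth f" by blast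
    show "pd b h \<in> {\<lambda>x. L (f x) |f. smooth f}"
      unfolding f(1) pdL[OF f(2)] using smooth_pd[OF f(2) b] by (intro CollectI exI[of _ "pd b f"]) simp
  qed (use f in blast)
qed

lemma smooth_const: "smooth (\<lambda>x. c)"
proof (rule smooth_coinduct[where X = "range (\<lambda>c x. c)"])
  show "pd b f \<in> range (\<lambda>c x. c)" if "f \<in> range (\<lambda>c x. c)" for f :: "'a \<Rightarrow> 'b" and b
    using that by (auto simp: pd_def[abs_def] intro!: exI[of _ 0])
qed auto

text \<open>The Leibniz rule leaves an undifferentiated remainder, so the class closed under partial
  derivatives is that of all (x \<bullet> c) f + g with f and g smooth.\<close>

lemma smooth_inner_scale:
  fixes f :: "'a::euclidean_space \<Rightarrow> 'b::real_normed_vector"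
  assumes f: "smooth f"
  shows "smooth (\<lambda>x. (x \<bullet> c) *\<^sub>R f x)"
proof -
  have pds: "pd b (\<lambda>x. (x \<bullet> c) *\<^sub>R f x + g x) = (\<lambda>x. (x \<bullet> c) *\<^sub>R pd b f x + ((b \<bullet> c) *\<^sub>R f x + pd b g x))"
    if "smooth f" "smooth g" for f g :: "'a \<Rightarrow> 'b" and b
  proof
    fix x
    have "((\<lambda>x. (x \<bullet> c) *\<^sub>R f x + g x) has_derivative (\<lambda>h. (x \<bullet> c) *\<^sub>R pd h f x + (h \<bullet> c) *\<^sub>R f x + pd h g x)) (at x)"
      by (intro has_derivative_add has_derivative_scaleR smooth_has_derivative_frechet that)
        (auto intro!: derivative_eq_intros)
    from pd_eq[OF this] show "pd b (\<lambda>x. (x \<bullet> c) *\<^sub>R f x + g x) x = (x \<bullet> c) *\<^sub>R pd b f x + ((b \<bullet> c) *\<^sub>R f x + pd b g x)"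
      by (simp add: add.assoc)
  qed
  have "smooth (\<lambda>x. (x \<bullet> c) *\<^sub>R f x + (\<lambda>x. 0) x)"
  proof (rule smooth_coinduct[where X = "{\<lambda>x. (x \<bullet> c) *\<^sub>R f x + g x |f g. smooth f \<and> smooth g}"])
    fix h :: "'a \<Rightarrow> 'b" and x assume "h \<in> {\<lambda>x. (x \<bullet> c) *\<^sub>R f x + g x |f g. smooth f \<and> smooth g}"
    then obtain f g where h: "h = (\<lambda>x. (x \<bullet> c) *\<^sub>R f x + g x)" and fg: "smooth f" "smooth g" by blast
    have "((\<lambda>x. (x \<bullet> c) *\<^sub>R f x + g x) has_derivative (\<lambda>h. (x \<bullet> c) *\<^sub>R pd h f x + (h \<bullet> c) *\<^sub>R f x + pd h g x)) (at x)"
      by (intro has_derivative_add has_derivative_scaleR smooth_has_derivative_frechet fg)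
        (auto intro!: derivative_eq_intros)
    then show "h differentiable (at x)" unfolding h by (rule differentiableI)
  next
    fix h :: "'a \<Rightarrow> 'b" and b :: 'a assume "h \<in> {\<lambda>x. (x \<bullet> c) *\<^sub>R f x + g x |f g. smooth f \<and> smooth g}" and b: "b \<in> Basis"
    then obtain f g where fg: "h = (\<lambda>x. (x \<bullet> c) *\<^sub>R f x + g x)" "smooth f" "smooth g" by blast
    have "smooth (\<lambda>x. (b \<bullet> c) *\<^sub>R f x + pd b g x)"
      by (intro smooth_add smooth_linear[OF fg(2) bounded_linear_scaleR_right] smooth_pd fg b)
    then show "pd b h \<in> {\<lambda>x. (x \<bullet> c) *\<^sub>R f x + g x |f g. smooth f \<and> smooth g}"
      unfolding fg(1) pds[OF fg(2,3)] using smooth_pd[OF fg(2) b]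
      by (intro CollectI exI[of _ "pd b f"] exI[of _ "\<lambda>x. (b \<bullet> c) *\<^sub>R f x + pd b g x"]) auto
  qed (use f smooth_const[of "0::'b"] in \<open>intro CollectI exI[of _ f] exI[of _ "\<lambda>_. 0"], simp\<close>)
  then show ?thesis by simp
qed

section \<open>Derivatives in space-time and in the polar chart\<close>

type_synonym pt = "real \<times> (real^3)"

definition Dt :: "(pt \<Rightarrow> 'b::real_normed_vector) \<Rightarrow> pt \<Rightarrow> 'b" where "Dt = pd (1, 0)"
definition Dx :: "3 \<Rightarrow> (pt \<Rightarrow> 'b::real_normed_vector) \<Rightarrow> pt \<Rightarrow> 'b" where "Dx i = pd (0, axis i 1)"

lemma Basis_pt: "(1, 0) \<in> (Basis :: pt set)" "(0, axis i 1) \<in> (Basis :: pt set)"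
  by (auto simp: Basis_prod_def Basis_vec_def)

lemma smooth_Dt: "smooth f \<Longrightarrow> smooth (Dt f)"
  and smooth_Dx: "smooth f \<Longrightarrow> smooth (Dx i f)"
  unfolding Dt_def Dx_def by (auto intro: smooth_pd Basis_pt)

definition grad :: "real^3 \<Rightarrow> (pt \<Rightarrow> 'b::real_normed_vector) \<Rightarrow> pt \<Rightarrow> 'b" where
  "grad n f p = (\<Sum>i\<in>UNIV. (n $ i) *\<^sub>R Dx i f p)"

lemma smooth_has_derivative_pt:
  fixes f :: "pt \<Rightarrow> 'b::real_normed_vector"
  assumes "smooth f"
  shows "(f has_derivative (\<lambda>h. fst h *\<^sub>R Dt f p + grad (snd h) f p)) (at p)"
proof -
  have "(\<Sum>b\<in>Basis. (h \<bullet> b) *\<^sub>R pd b f p) = fst h *\<^sub>R Dt f p + grad (snd h) f p" for h :: pt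
  proof -
    have "(\<Sum>b\<in>Basis. (h \<bullet> b) *\<^sub>R pd b f p) =
        (\<Sum>b\<in>(\<lambda>u. (u, 0)) ` (Basis :: real set). (h \<bullet> b) *\<^sub>R pd b f p) + (\<Sum>b\<in>(\<lambda>v. (0, v)) ` (Basis :: (real^3) set). (h \<bullet> b) *\<^sub>R pd b f p)"
      unfolding Basis_prod_def by (rule sum.union_disjoint) auto
    also have "(\<Sum>b\<in>(\<lambda>u. (u, 0)) ` (Basis :: real set). (h \<bullet> b) *\<^sub>R pd b f p) = fst h *\<^sub>R Dt f p"
      by (simp add: Dt_def inner_prod_def)
    also have "(\<Sum>b\<in>(\<lambda>v. (0, v)) ` (Basis :: (real^3) set). (h \<bullet> b) *\<^sub>R pd b f p) = (\<Sum>b\<in>Basis. (snd h \<bullet> b) *\<^sub>R pd (0, b) f p)"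
      by (subst sum.reindex) (auto simp: inj_on_def inner_prod_def)
    also have "\<dots> = (\<Sum>i\<in>UNIV. (snd h \<bullet> axis i 1) *\<^sub>R pd (0, axis i 1) f p)"
    proof -
      have eq: "(Basis :: (real^3) set) = range (\<lambda>i. axis i 1)" by (auto simp: Basis_vec_def)
      have inj: "inj (\<lambda>i::3. axis i (1::real))" by (auto simp: inj_on_def axis_eq_axis)
      show ?thesis unfolding eq by (subst sum.reindex[OF inj]) simp
    qed
    finally show ?thesis by (simp add: grad_def Dx_def inner_axis)
  qed
  then show ?thesis using smooth_has_derivative[OF assms, of p] by simp
qed

lemma smooth_curve:
  fixes f :: "pt \<Rightarrow> 'b::real_normed_vector" and x :: "real \<Rightarrow> real^3"
  assumes f: "smooth f" and x: "(x has_vector_derivative x') (at s)"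
  shows "((\<lambda>s. f (t, x s)) has_vector_derivative grad x' f (t, x s)) (at s)"
proof -
  have "((\<lambda>s. (t, x s)) has_derivative (\<lambda>h. (0, h *\<^sub>R x'))) (at s)"
    using x unfolding has_vector_derivative_def by (intro has_derivative_Pair has_derivative_const) auto
  from has_derivative_compose[OF this smooth_has_derivative_pt[OF f]]
  show ?thesis unfolding has_vector_derivative_def
    by (simp add: grad_def scaleR_sum_right)
qed

lemma smooth_time_curve:
  fixes f :: "pt \<Rightarrow> 'b::real_normed_vector"
  assumes f: "smooth f"
  shows "((\<lambda>t. f (t, x)) has_vector_derivative Dt f (t, x)) (at t)"
proof -
  have "((\<lambda>s. (s, x)) has_derivative (\<lambda>h. (h, 0))) (at t)"
    by (intro has_derivative_Pair has_derivative_const has_derivative_ident)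
  from has_derivative_compose[OF this smooth_has_derivative_pt[OF f]]
  show ?thesis unfolding has_vector_derivative_def by (simp add: grad_def)
qed

definition e_th :: "real \<Rightarrow> real \<Rightarrow> real^3" where
  "e_th th ph = vector [cos th * cos ph, cos th * sin ph, - sin th]"
definition e_ph :: "real \<Rightarrow> real^3" where "e_ph ph = vector [- sin ph, cos ph, 0]"
definition e_rho :: "real \<Rightarrow> real^3" where "e_rho ph = vector [cos ph, sin ph, 0]"

lemma vec3_has_vector_derivative:
  fixes x :: "real \<Rightarrow> real^3"
  assumes "((\<lambda>s. x s $ 1) has_real_derivative x' $ 1) (at s)" "((\<lambda>s. x s $ 2) has_real_derivative x' $ 2) (at s)"
    "((\<lambda>s. x s $ 3) has_real_derivative x' $ 3) (at s)"
  shows "(x has_vector_derivative x') (at s)"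
  unfolding has_vector_derivative_def has_derivative_componentwise_within[of x]
proof
  fix b :: "real^3" assume "b \<in> Basis"
  then obtain i where b: "b = axis i 1" by (auto simp: Basis_vec_def)
  have "((\<lambda>s. x s $ i) has_real_derivative x' $ i) (at s)" using assms exhaust_3[of i] by auto
  moreover have "(\<lambda>h. h *\<^sub>R x' \<bullet> axis i 1) = times (x' $ i)" by (auto simp: inner_axis)
  ultimately show "((\<lambda>s. x s \<bullet> b) has_derivative (\<lambda>h. h *\<^sub>R x' \<bullet> b)) (at s)"
    unfolding b has_field_derivative_def by (simp add: inner_axis)
qed

lemma sph_derivs:
  "((\<lambda>r. sph r th ph) has_vector_derivative sph 1 th ph) (at r)"
  "((\<lambda>th. sph r th ph) has_vector_derivative r *\<^sub>R e_th th ph) (at th)"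
  "((\<lambda>ph. sph r th ph) has_vector_derivative (r * sin th) *\<^sub>R e_ph ph) (at ph)"
  "((\<lambda>th. e_th th ph) has_vector_derivative - sph 1 th ph) (at th)"
  "((\<lambda>ph. e_ph ph) has_vector_derivative - e_rho ph) (at ph)"
  by (rule vec3_has_vector_derivative; auto simp: sph_def e_th_def e_ph_def e_rho_def vector_3 intro!: derivative_eq_intros)+

text \<open>\<open>m\<close> contracts the derivative taken first, \<open>n\<close> the second. This
  order is maintained in all formulas, so symmetry of second derivatives is never invoked
  here.\<close>

definition hess :: "real^3 \<Rightarrow> real^3 \<Rightarrow> (pt \<Rightarrow> 'b::real_normed_vector) \<Rightarrow> pt \<Rightarrow> 'b" where
  "hess m n f p = (\<Sum>i\<in>UNIV. (m $ i) *\<^sub>R grad n (Dx i f) p)"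

lemma grad_curve:
  fixes f :: "pt \<Rightarrow> 'b::real_normed_vector" and x m :: "real \<Rightarrow> real^3"
  assumes f: "smooth f" and x: "(x has_vector_derivative x') (at s)" and m: "(m has_vector_derivative m') (at s)"
  shows "((\<lambda>s. grad (m s) f (t, x s)) has_vector_derivative hess (m s) x' f (t, x s) + grad m' f (t, x s)) (at s)"
proof -
  have mi: "((\<lambda>s. m s $ i) has_real_derivative m' $ i) (at s)" for i
    using bounded_linear.has_vector_derivative[OF bounded_linear_vec_nth m]
    by (simp add: has_real_derivative_iff_has_vector_derivative)
  have "((\<lambda>s. \<Sum>i\<in>UNIV. (m s $ i) *\<^sub>R Dx i f (t, x s)) has_vector_derivative
      (\<Sum>i\<in>UNIV. (m s $ i) *\<^sub>R grad x' (Dx i f) (t, x s) + (m' $ i) *\<^sub>R Dx i f (t, x s))) (at s)"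
    by (intro has_vector_derivative_sum has_vector_derivative_scaleR mi smooth_curve smooth_Dx f x)
  then show ?thesis by (simp add: grad_def[of "_ s"] grad_def[of m'] grad_def[of "m _"] hess_def sum.distrib)
qed

lemma grad_scale: "grad (c *\<^sub>R n) f p = c *\<^sub>R grad n f p"
  by (simp add: grad_def scaleR_sum_right)

text \<open>The \<theta>-derivative of sin \<theta> times the \<theta>-derivative of f, in Cartesian
  derivatives. It carries sin \<theta> times its share of the spherical Laplacian and so remains
  regular at the poles.\<close>

definition lap_th :: "(pt \<Rightarrow> 'b::real_normed_vector) \<Rightarrow> real \<Rightarrow> real \<Rightarrow> real \<Rightarrow> real \<Rightarrow> 'b" where
  "lap_th f t r th ph = cos th *\<^sub>R grad (r *\<^sub>R e_th th ph) f (t, sph r th ph)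
     + sin th *\<^sub>R (hess (r *\<^sub>R e_th th ph) (r *\<^sub>R e_th th ph) f (t, sph r th ph) + grad (r *\<^sub>R (- sph 1 th ph)) f (t, sph r th ph))"

text \<open>The second \<phi>-derivative divided by sin \<theta>, with the division already carried
  out: one factor sin \<theta> of the \<phi>-tangent is dropped.\<close>

definition lap_ph :: "(pt \<Rightarrow> 'b::real_normed_vector) \<Rightarrow> real \<Rightarrow> real \<Rightarrow> real \<Rightarrow> real \<Rightarrow> 'b" where
  "lap_ph f t r th ph = hess (r *\<^sub>R e_ph ph) ((r * sin th) *\<^sub>R e_ph ph) f (t, sph r th ph) + grad (r *\<^sub>R (- e_rho ph)) f (t, sph r th ph)"

lemma chart_derivs:
  fixes f :: "pt \<Rightarrow> 'b::real_normed_vector"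
  assumes f: "smooth f"
  shows "((\<lambda>r. f (t, sph r th ph)) has_vector_derivative grad (sph 1 th ph) f (t, sph r th ph)) (at r)"
    and "((\<lambda>r. grad (sph 1 th ph) f (t, sph r th ph)) has_vector_derivative hess (sph 1 th ph) (sph 1 th ph) f (t, sph r th ph)) (at r)"
    and "((\<lambda>th. f (t, sph r th ph)) has_vector_derivative grad (r *\<^sub>R e_th th ph) f (t, sph r th ph)) (at th)"
    and "((\<lambda>th. sin th *\<^sub>R grad (r *\<^sub>R e_th th ph) f (t, sph r th ph)) has_vector_derivative lap_th f t r th ph) (at th)"
    and "((\<lambda>ph. f (t, sph r th ph)) has_vector_derivative sin th *\<^sub>R grad (r *\<^sub>R e_ph ph) f (t, sph r th ph)) (at ph)"
    and "((\<lambda>ph. grad (r *\<^sub>R e_ph ph) f (t, sph r th ph)) has_vector_derivative lap_ph f t r th ph) (at ph)"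
proof -
  show "((\<lambda>r. f (t, sph r th ph)) has_vector_derivative grad (sph 1 th ph) f (t, sph r th ph)) (at r)"
    by (rule smooth_curve[OF f sph_derivs(1)])
  show "((\<lambda>r. grad (sph 1 th ph) f (t, sph r th ph)) has_vector_derivative hess (sph 1 th ph) (sph 1 th ph) f (t, sph r th ph)) (at r)"
    using grad_curve[OF f sph_derivs(1) has_vector_derivative_const] by (simp add: grad_def)
  show "((\<lambda>th. f (t, sph r th ph)) has_vector_derivative grad (r *\<^sub>R e_th th ph) f (t, sph r th ph)) (at th)"
    by (rule smooth_curve[OF f sph_derivs(2)])
  have g: "((\<lambda>th. grad (r *\<^sub>R e_th th ph) f (t, sph r th ph)) has_vector_derivative
      hess (r *\<^sub>R e_th th ph) (r *\<^sub>R e_th th ph) f (t, sph r th ph) + grad (r *\<^sub>R (- sph 1 th ph)) f (t, sph r th ph)) (at th)"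
    by (rule grad_curve[OF f sph_derivs(2)], rule bounded_linear.has_vector_derivative[OF bounded_linear_scaleR_right sph_derivs(4)])
  have "((\<lambda>th. sin th *\<^sub>R grad (r *\<^sub>R e_th th ph) f (t, sph r th ph)) has_vector_derivative
      sin th *\<^sub>R (hess (r *\<^sub>R e_th th ph) (r *\<^sub>R e_th th ph) f (t, sph r th ph) + grad (r *\<^sub>R (- sph 1 th ph)) f (t, sph r th ph))
      + cos th *\<^sub>R grad (r *\<^sub>R e_th th ph) f (t, sph r th ph)) (at th)"
    by (rule has_vector_derivative_scaleR[OF _ g]) (auto intro!: derivative_eq_intros)
  then show "((\<lambda>th. sin th *\<^sub>R grad (r *\<^sub>R e_th th ph) f (t, sph r th ph)) has_vector_derivative lap_th f t r th ph) (at th)"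
    by (simp add: lap_th_def add.commute)
  show "((\<lambda>ph. f (t, sph r th ph)) has_vector_derivative sin th *\<^sub>R grad (r *\<^sub>R e_ph ph) f (t, sph r th ph)) (at ph)"
    using smooth_curve[OF f sph_derivs(3)] by (simp add: grad_scale mult.commute)
  show "((\<lambda>ph. grad (r *\<^sub>R e_ph ph) f (t, sph r th ph)) has_vector_derivative lap_ph f t r th ph) (at ph)"
    unfolding lap_ph_def
    by (rule grad_curve[OF f sph_derivs(3)], rule bounded_linear.has_vector_derivative[OF bounded_linear_scaleR_right sph_derivs(5)])
qed

text \<open>The sum of the squares of the three rotation fields x_i d_j - x_j d_i. Its coefficients
  are polynomials in x, so unlike the chart expression it is smooth at the poles and at the
  origin.\<close>

definition sphere_lap :: "(pt \<Rightarrow> real) \<Rightarrow> pt \<Rightarrow> real" where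
  "sphere_lap f p = (\<Sum>i\<in>UNIV. \<Sum>j\<in>UNIV. (snd p $ j)\<^sup>2 * Dx i (Dx i f) p)
     - (\<Sum>i\<in>UNIV. \<Sum>j\<in>UNIV. snd p $ i * snd p $ j * Dx j (Dx i f) p) - 2 * (\<Sum>i\<in>UNIV. snd p $ i * Dx i f p)"

text \<open>Kept apart as a polynomial identity in real variables, with trigonometry reduced to the
  two circle relations; the second derivatives h12 and h21 remain independent.\<close>

lemma chart_algebra:
  fixes S C s c r d1 d2 d3 h11 h12 h13 h21 h22 h23 h31 h32 h33 :: real
  assumes "S\<^sup>2 + C\<^sup>2 = 1" "s\<^sup>2 + c\<^sup>2 = 1"
  shows "C * (r * (C * c) * d1 + r * (C * s) * d2 + r * (- S) * d3)
    + S * ((r * (C * c) * (r * (C * c) * h11 + r * (C * s) * h12 + r * (- S) * h13)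
          + r * (C * s) * (r * (C * c) * h21 + r * (C * s) * h22 + r * (- S) * h23)
          + r * (- S) * (r * (C * c) * h31 + r * (C * s) * h32 + r * (- S) * h33))
          + (r * (- (S * c)) * d1 + r * (- (S * s)) * d2 + r * (- C) * d3))
    + ((r * (- s) * (r * S * (- s) * h11 + r * S * c * h12 + r * S * 0 * h13)
          + r * c * (r * S * (- s) * h21 + r * S * c * h22 + r * S * 0 * h23)
          + r * 0 * (r * S * (- s) * h31 + r * S * c * h32 + r * S * 0 * h33))
       + (r * (- c) * d1 + r * (- s) * d2 + r * 0 * d3))
    = S * (((r * S * c)\<^sup>2 * h11 + (r * S * s)\<^sup>2 * h11 + (r * C)\<^sup>2 * h11
          + ((r * S * c)\<^sup>2 * h22 + (r * S * s)\<^sup>2 * h22 + (r * C)\<^sup>2 * h22)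
          + ((r * S * c)\<^sup>2 * h33 + (r * S * s)\<^sup>2 * h33 + (r * C)\<^sup>2 * h33))
       - ((r * S * c) * (r * S * c) * h11 + (r * S * c) * (r * S * s) * h12 + (r * S * c) * (r * C) * h13
         + ((r * S * s) * (r * S * c) * h21 + (r * S * s) * (r * S * s) * h22 + (r * S * s) * (r * C) * h23)
         + ((r * C) * (r * S * c) * h31 + (r * C) * (r * S * s) * h32 + (r * C) * (r * C) * h33))
       - 2 * ((r * S * c) * d1 + (r * S * s) * d2 + (r * C) * d3))"
  using assms by algebra

lemma chart_nth:
  "sph r th ph $ 1 = r * sin th * cos ph" "sph r th ph $ 2 = r * sin th * sin ph" "sph r th ph $ 3 = r * cos th"
  "e_th th ph $ 1 = cos th * cos ph" "e_th th ph $ 2 = cos th * sin ph" "e_th th ph $ 3 = - sin th"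
  "e_ph ph $ 1 = - sin ph" "e_ph ph $ 2 = cos ph" "e_ph ph $ 3 = 0"
  "e_rho ph $ 1 = cos ph" "e_rho ph $ 2 = sin ph" "e_rho ph $ 3 = 0"
  by (simp_all add: sph_def e_th_def e_ph_def e_rho_def)

lemma sphere_lap_chart: "lap_th f t r th ph + lap_ph f t r th ph = sin th * sphere_lap f (t, sph r th ph)"
proof -
  have trig: "(sin th)\<^sup>2 + (cos th)\<^sup>2 = 1" "(sin ph)\<^sup>2 + (cos ph)\<^sup>2 = 1" by simp_all
  show ?thesis
    unfolding lap_th_def lap_ph_def sphere_lap_def hess_def grad_def sum_3
    unfolding chart_nth vector_scaleR_component vector_uminus_component
      real_scaleR_def snd_conv mult_1 minus_zero
    by (rule chart_algebra[OF trig])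
qed

section \<open>Integration over the sphere in the polar chart\<close>

definition sbox :: "(real \<times> real) set" where "sbox = cbox (0, 0) (pi, 2 * pi)"

lemma sbox_mem: "q \<in> sbox \<longleftrightarrow> fst q \<in> {0..pi} \<and> snd q \<in> {0..2 * pi}"
  by (cases q) (auto simp: sbox_def cbox_Pair_eq)

lemma sbox_integral_th_first:
  assumes "continuous_on UNIV (\<lambda>q. f (fst q) (snd q))"
  shows "integral sbox (\<lambda>q. f (fst q) (snd q)) = integral {0..pi} (\<lambda>th. integral {0..2 * pi} (\<lambda>ph. f th ph :: real))"
  unfolding sbox_def
  using integral_prod_continuous[of "0::real" "0::real" pi "2 * pi" "\<lambda>q. f (fst q) (snd q)"] assms
  by (auto intro: continuous_on_subset)

lemma sbox_integral_ph_first: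
  assumes "continuous_on UNIV (\<lambda>q. f (fst q) (snd q))"
  shows "integral sbox (\<lambda>q. f (fst q) (snd q)) = integral {0..2 * pi} (\<lambda>ph. integral {0..pi} (\<lambda>th. f th ph :: real))"
  unfolding sbox_integral_th_first[OF assms]
  using integral_swap_continuous[of 0 0 pi "2 * pi" f] assms
  by (auto simp: split_beta intro: continuous_on_subset)

lemma sph_axis: "sph r th ph = (r * sin th * cos ph) *\<^sub>R axis 1 1 + (r * sin th * sin ph) *\<^sub>R axis 2 1 + (r * cos th) *\<^sub>R axis 3 1"
  by (simp add: vec_eq_iff forall_3 sph_def axis_def)

lemma sph_continuous:
  fixes S :: "'a::t2_space set"
  shows "continuous_on S p \<Longrightarrow> continuous_on S q \<Longrightarrow> continuous_on S s \<Longrightarrow> continuous_on S (\<lambda>x. sph (p x) (q x) (s x))"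
  unfolding sph_axis by (intro continuous_intros)

lemma e_axis:
  "e_th th ph = (cos th * cos ph) *\<^sub>R axis 1 1 + (cos th * sin ph) *\<^sub>R axis 2 1 + (- sin th) *\<^sub>R axis 3 1"
  "e_ph ph = (- sin ph) *\<^sub>R axis 1 1 + cos ph *\<^sub>R axis 2 1" "e_rho ph = cos ph *\<^sub>R axis 1 1 + sin ph *\<^sub>R axis 2 1"
  by (simp_all add: vec_eq_iff forall_3 e_th_def e_ph_def e_rho_def axis_def)

lemma e_continuous:
  fixes S :: "'a::t2_space set"
  shows "continuous_on S q \<Longrightarrow> continuous_on S s \<Longrightarrow> continuous_on S (\<lambda>x. e_th (q x) (s x))"
    "continuous_on S s \<Longrightarrow> continuous_on S (\<lambda>x. e_ph (s x))" "continuous_on S s \<Longrightarrow> continuous_on S (\<lambda>x. e_rho (s x))"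
  unfolding e_axis by (intro continuous_intros; assumption)+

lemma smooth_comp_continuous:
  fixes f :: "pt \<Rightarrow> 'b::real_normed_vector"
  assumes "smooth f" "continuous_on S p" "continuous_on S x"
  shows "continuous_on S (\<lambda>q. f (p q, x q))"
  by (rule continuous_on_compose2[OF smooth_continuous[OF assms(1), of UNIV]]) (auto intro: continuous_on_Pair assms)

lemma grad_continuous:
  fixes f :: "pt \<Rightarrow> 'b::real_normed_vector"
  assumes "smooth f" "continuous_on S m" "continuous_on S p" "continuous_on S x"
  shows "continuous_on S (\<lambda>q. grad (m q) f (p q, x q))"
  unfolding grad_def using assms
  by (intro continuous_intros smooth_comp_continuous smooth_Dx continuous_on_component)

lemma hess_continuous:
  fixes f :: "pt \<Rightarrow> 'b::real_normed_vector"
  assumes "smooth f" "continuous_on S m" "continuous_on S n" "continuous_on S p" "continuous_on S x"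
  shows "continuous_on S (\<lambda>q. hess (m q) (n q) f (p q, x q))"
  unfolding hess_def using assms
  by (intro continuous_intros grad_continuous smooth_Dx continuous_on_component)

text \<open>Integration by parts in both angles: sin \<theta> removes the boundary terms at the
  poles, periodicity those in \<phi>. The two functions have separate times and radii so that f on a
  sphere of radius r can be tested against a kernel on the unit sphere.\<close>

lemma sphere_half_green:
  fixes f g :: "pt \<Rightarrow> real"
  assumes f: "smooth f" and g: "smooth g"
  shows "integral sbox (\<lambda>q. sin (fst q) * sphere_lap f (t, sph r (fst q) (snd q)) * g (t', sph r' (fst q) (snd q))) =
    - integral sbox (\<lambda>q. sin (fst q) * (grad (r *\<^sub>R e_th (fst q) (snd q)) f (t, sph r (fst q) (snd q)) * grad (r' *\<^sub>R e_th (fst q) (snd q)) g (t', sph r' (fst q) (snd q))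
      + grad (r *\<^sub>R e_ph (snd q)) f (t, sph r (fst q) (snd q)) * grad (r' *\<^sub>R e_ph (snd q)) g (t', sph r' (fst q) (snd q))))"
proof -
  define fth where "fth th ph = grad (r *\<^sub>R e_th th ph) f (t, sph r th ph)" for th ph
  define fph where "fph th ph = grad (r *\<^sub>R e_ph ph) f (t, sph r th ph)" for th ph
  define gth where "gth th ph = grad (r' *\<^sub>R e_th th ph) g (t', sph r' th ph)" for th ph
  define gph where "gph th ph = grad (r' *\<^sub>R e_ph ph) g (t', sph r' th ph)" for th ph
  define G where "G th ph = g (t', sph r' th ph)" for th ph
  define Lth where "Lth th ph = lap_th f t r th ph" for th ph
  define Lph where "Lph th ph = lap_ph f t r th ph" for th ph
  note ci = continuous_intros grad_continuous hess_continuous smooth_comp_continuous sph_continuous e_continuous f g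
  have fthc: "continuous_on UNIV (\<lambda>q. fth (fst q) (snd q))" unfolding fth_def by (intro ci)
  have fphc: "continuous_on UNIV (\<lambda>q. fph (fst q) (snd q))" unfolding fph_def by (intro ci)
  have gthc: "continuous_on UNIV (\<lambda>q. gth (fst q) (snd q))" unfolding gth_def by (intro ci)
  have gphc: "continuous_on UNIV (\<lambda>q. gph (fst q) (snd q))" unfolding gph_def by (intro ci)
  have Gc: "continuous_on UNIV (\<lambda>q. G (fst q) (snd q))" unfolding G_def by (intro ci)
  have Lthc: "continuous_on UNIV (\<lambda>q. Lth (fst q) (snd q))" unfolding Lth_def lap_th_def by (intro ci)
  have Lphc: "continuous_on UNIV (\<lambda>q. Lph (fst q) (snd q))" unfolding Lph_def lap_ph_def by (intro ci)
  define H1 where "H1 th ph = Lth th ph * G th ph + sin th * fth th ph * gth th ph" for th ph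
  define H2 where "H2 th ph = Lph th ph * G th ph + fph th ph * (sin th * gph th ph)" for th ph
  have H1c: "continuous_on UNIV (\<lambda>q. H1 (fst q) (snd q))" and H2c: "continuous_on UNIV (\<lambda>q. H2 (fst q) (snd q))"
    unfolding H1_def H2_def by (intro continuous_intros fthc fphc gthc gphc Gc Lthc Lphc)+
  have "integral {0..pi} (\<lambda>th. H1 th ph) = 0" for ph
  proof -
    have "((\<lambda>th. H1 th ph) has_integral sin pi * fth pi ph * G pi ph - sin 0 * fth 0 ph * G 0 ph) {0..pi}"
    proof (rule fundamental_theorem_of_calculus)
      fix th
      have "((\<lambda>th. (sin th * fth th ph) * G th ph) has_real_derivative (sin th * fth th ph) * gth th ph + Lth th ph * G th ph) (at th)"
        using DERIV_mult'[of "\<lambda>th. sin th * fth th ph" "Lth th ph" th UNIV "\<lambda>th. G th ph" "gth th ph"]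
          chart_derivs(4)[OF f, where r = r and t = t and th = th and ph = ph] chart_derivs(3)[OF g, where r = r' and t = t' and th = th and ph = ph]
        by (simp add: has_real_derivative_iff_has_vector_derivative fth_def Lth_def G_def gth_def)
      then show "((\<lambda>th. sin th * fth th ph * G th ph) has_vector_derivative H1 th ph) (at th within {0..pi})"
        by (simp add: H1_def has_real_derivative_iff_has_vector_derivative has_vector_derivative_at_within add.commute)
    qed simp
    then show ?thesis by (simp add: integral_unique)
  qed
  then have 1: "integral sbox (\<lambda>q. H1 (fst q) (snd q)) = 0"
    unfolding sbox_integral_ph_first[OF H1c] by simp
  have "integral {0..2 * pi} (\<lambda>ph. H2 th ph) = 0" for th
  proof -
    have "((\<lambda>ph. H2 th ph) has_integral fph th (2 * pi) * G th (2 * pi) - fph th 0 * G th 0) {0..2 * pi}"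
    proof (rule fundamental_theorem_of_calculus)
      fix ph
      have "((\<lambda>ph. fph th ph * G th ph) has_real_derivative fph th ph * (sin th * gph th ph) + Lph th ph * G th ph) (at ph)"
        using DERIV_mult'[of "\<lambda>ph. fph th ph" "Lph th ph" ph UNIV "\<lambda>ph. G th ph" "sin th * gph th ph"]
          chart_derivs(6)[OF f, where r = r and t = t and th = th and ph = ph] chart_derivs(5)[OF g, where r = r' and t = t' and th = th and ph = ph]
        by (simp add: has_real_derivative_iff_has_vector_derivative fph_def Lph_def G_def gph_def)
      then show "((\<lambda>ph. fph th ph * G th ph) has_vector_derivative H2 th ph) (at ph within {0..2 * pi})"
        by (simp add: H2_def has_real_derivative_iff_has_vector_derivative has_vector_derivative_at_within add.commute)
    qed simp
    moreover have "fph th (2 * pi) * G th (2 * pi) = fph th 0 * G th 0"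
      by (simp add: fph_def G_def sph_def e_ph_def)
    ultimately show ?thesis by (simp add: integral_unique)
  qed
  then have 2: "integral sbox (\<lambda>q. H2 (fst q) (snd q)) = 0"
    unfolding sbox_integral_th_first[OF H2c] by simp
  have int: "(\<lambda>q. h (fst q) (snd q)) integrable_on sbox" if "continuous_on UNIV (\<lambda>q. h (fst q) (snd q))" for h :: "real \<Rightarrow> real \<Rightarrow> real"
    unfolding sbox_def by (rule integrable_continuous[OF continuous_on_subset[OF that]]) simp
  define I1 where "I1 th ph = sin th * sphere_lap f (t, sph r th ph) * G th ph" for th ph
  define I2 where "I2 th ph = sin th * (fth th ph * gth th ph + fph th ph * gph th ph)" for th ph
  have eq: "H1 th ph + H2 th ph = I1 th ph + I2 th ph" for th ph
  proof -
    have "H1 th ph + H2 th ph = (Lth th ph + Lph th ph) * G th ph + I2 th ph"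
      by (simp add: H1_def H2_def I2_def algebra_simps)
    also have "Lth th ph + Lph th ph = sin th * sphere_lap f (t, sph r th ph)"
      unfolding Lth_def Lph_def by (rule sphere_lap_chart)
    finally show ?thesis by (simp add: I1_def)
  qed
  have I2c: "continuous_on UNIV (\<lambda>q. I2 (fst q) (snd q))"
    unfolding I2_def by (intro continuous_intros fthc fphc gthc gphc)
  have "I1 th ph = H1 th ph + H2 th ph - I2 th ph" for th ph using eq by simp
  then have "integral sbox (\<lambda>q. I1 (fst q) (snd q)) = integral sbox (\<lambda>q. (H1 (fst q) (snd q) + H2 (fst q) (snd q)) - I2 (fst q) (snd q))" by simp
  also have "\<dots> = (integral sbox (\<lambda>q. H1 (fst q) (snd q)) + integral sbox (\<lambda>q. H2 (fst q) (snd q))) - integral sbox (\<lambda>q. I2 (fst q) (snd q))"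
    by (subst integral_diff, intro integrable_add int H1c H2c, intro int I2c, subst integral_add, intro int H1c, intro int H2c, rule refl)
  finally show ?thesis using 1 2 by (simp add: I1_def I2_def G_def fth_def gth_def fph_def gph_def)
qed

text \<open>Self-adjointness: the right-hand side of \<open>sphere_half_green\<close> is symmetric
  in the two functions.\<close>

lemma sphere_green:
  fixes f g :: "pt \<Rightarrow> real"
  assumes f: "smooth f" and g: "smooth g"
  shows "integral sbox (\<lambda>q. sphere_lap f (t, sph r (fst q) (snd q)) * (g (t', sph r' (fst q) (snd q)) * sin (fst q))) =
    integral sbox (\<lambda>q. f (t, sph r (fst q) (snd q)) * (sphere_lap g (t', sph r' (fst q) (snd q)) * sin (fst q)))"
  using sphere_half_green[OF f g, of t r t' r'] sphere_half_green[OF g f, of t' r' t r] by (simp add: mult_ac)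

text \<open>The surface factor sin \<theta> is part of the weight \<kappa>, not of this
  integral.\<close>

definition smean :: "(real \<times> real \<Rightarrow> real) \<Rightarrow> (pt \<Rightarrow> real) \<Rightarrow> real \<Rightarrow> real \<Rightarrow> real" where
  "smean \<kappa> f t r = integral sbox (\<lambda>q. f (t, sph r (fst q) (snd q)) * \<kappa> q)"

definition smean_r :: "(real \<times> real \<Rightarrow> real) \<Rightarrow> (pt \<Rightarrow> real) \<Rightarrow> real \<Rightarrow> real \<Rightarrow> real" where
  "smean_r \<kappa> f t r = integral sbox (\<lambda>q. grad (sph 1 (fst q) (snd q)) f (t, sph r (fst q) (snd q)) * \<kappa> q)"

definition smean_rr :: "(real \<times> real \<Rightarrow> real) \<Rightarrow> (pt \<Rightarrow> real) \<Rightarrow> real \<Rightarrow> real \<Rightarrow> real" where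
  "smean_rr \<kappa> f t r = integral sbox (\<lambda>q. hess (sph 1 (fst q) (snd q)) (sph 1 (fst q) (snd q)) f (t, sph r (fst q) (snd q)) * \<kappa> q)"

lemma sbox_integral_cont2:
  fixes h :: "real \<Rightarrow> real \<Rightarrow> real \<times> real \<Rightarrow> real"
  assumes "continuous_on UNIV (\<lambda>z. h (fst (fst z)) (snd (fst z)) (snd z))"
  shows "cont2 (\<lambda>t r. integral sbox (h t r))"
  unfolding cont2_def sbox_def
  by (rule integral_continuous_on_param) (auto simp: split_beta intro: continuous_on_subset[OF assms])

lemma sbox_leibniz:
  fixes h h' :: "real \<Rightarrow> real \<times> real \<Rightarrow> real"
  assumes "\<And>s q. ((\<lambda>s. h s q) has_real_derivative h' s q) (at s)"
    and "\<And>s. continuous_on UNIV (h s)" and "continuous_on UNIV (\<lambda>z. h' (fst z) (snd z))"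
  shows "((\<lambda>s. integral sbox (h s)) has_real_derivative integral sbox (h' s)) (at s)"
proof -
  have "((\<lambda>s. integral sbox (h s)) has_vector_derivative integral sbox (h' s)) (at s within UNIV)"
    unfolding sbox_def
    by (rule leibniz_rule_vector_derivative)
      (use assms(1) integrable_continuous[OF continuous_on_subset[OF assms(2) subset_UNIV]] continuous_on_subset[OF assms(3) subset_UNIV]
        in \<open>auto simp: has_real_derivative_iff_has_vector_derivative split_beta\<close>)
  then show ?thesis by (simp add: has_real_derivative_iff_has_vector_derivative)
qed

context
  fixes \<kappa> :: "real \<times> real \<Rightarrow> real" and f :: "pt \<Rightarrow> real"
  assumes \<kappa>: "continuous_on UNIV \<kappa>" and f: "smooth f"
begin

lemmas \<kappa>_comp = continuous_on_compose2[OF \<kappa>, OF _ subset_UNIV]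
lemmas smean_cont = continuous_intros grad_continuous hess_continuous smooth_comp_continuous sph_continuous \<kappa>_comp

lemma smean_cont2: "cont2 (smean \<kappa> f)" "cont2 (smean_r \<kappa> f)"
  unfolding smean_def[abs_def] smean_r_def[abs_def]
  by (rule sbox_integral_cont2, intro smean_cont f)+

lemma smean_t: "((\<lambda>t. smean \<kappa> f t r) has_real_derivative smean \<kappa> (Dt f) t r) (at t)"
  unfolding smean_def
proof (rule sbox_leibniz)
  show "((\<lambda>t. f (t, sph r (fst q) (snd q)) * \<kappa> q) has_real_derivative Dt f (t, sph r (fst q) (snd q)) * \<kappa> q) (at t)" for t q
    using smooth_time_curve[OF f] by (intro DERIV_cmult_right) (simp add: has_real_derivative_iff_has_vector_derivative)
qed (intro smean_cont f smooth_Dt)+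

lemma smean_has_r: "((\<lambda>r. smean \<kappa> f t r) has_real_derivative smean_r \<kappa> f t r) (at r)"
  unfolding smean_def smean_r_def
proof (rule sbox_leibniz)
  show "((\<lambda>r. f (t, sph r (fst q) (snd q)) * \<kappa> q) has_real_derivative grad (sph 1 (fst q) (snd q)) f (t, sph r (fst q) (snd q)) * \<kappa> q) (at r)" for r q
    using chart_derivs(1)[OF f] by (intro DERIV_cmult_right) (simp add: has_real_derivative_iff_has_vector_derivative)
qed (intro smean_cont f)+

lemma smean_r_has_r: "((\<lambda>r. smean_r \<kappa> f t r) has_real_derivative smean_rr \<kappa> f t r) (at r)"
  unfolding smean_r_def smean_rr_def
proof (rule sbox_leibniz)
  show "((\<lambda>r. grad (sph 1 (fst q) (snd q)) f (t, sph r (fst q) (snd q)) * \<kappa> q) has_real_derivative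
      hess (sph 1 (fst q) (snd q)) (sph 1 (fst q) (snd q)) f (t, sph r (fst q) (snd q)) * \<kappa> q) (at r)" for r q
    using chart_derivs(2)[OF f] by (intro DERIV_cmult_right) (simp add: has_real_derivative_iff_has_vector_derivative)
qed (intro smean_cont f)+

text \<open>The t-derivative of the radial derivative, in that order. Agreement with the opposite
  order is obtained later from \<open>mixed_partials\<close>.\<close>

definition smean_rt :: "real \<Rightarrow> real \<Rightarrow> real" where
  "smean_rt t r = integral sbox (\<lambda>q. (\<Sum>i\<in>UNIV. sph 1 (fst q) (snd q) $ i * Dt (Dx i f) (t, sph r (fst q) (snd q))) * \<kappa> q)"

lemma smean_rt_cont2: "cont2 smean_rt"
  unfolding smean_rt_def[abs_def]
  by (rule sbox_integral_cont2, intro smean_cont f smooth_Dt smooth_Dx continuous_on_component)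

lemma smean_r_has_t: "((\<lambda>t. smean_r \<kappa> f t r) has_real_derivative smean_rt t r) (at t)"
  unfolding smean_r_def smean_rt_def
proof (rule sbox_leibniz)
  show "((\<lambda>t. grad (sph 1 (fst q) (snd q)) f (t, sph r (fst q) (snd q)) * \<kappa> q) has_real_derivative
      (\<Sum>i\<in>UNIV. sph 1 (fst q) (snd q) $ i * Dt (Dx i f) (t, sph r (fst q) (snd q))) * \<kappa> q) (at t)" for t q
    unfolding grad_def real_scaleR_def using smooth_time_curve[OF smooth_Dx[OF f]]
    by (intro DERIV_cmult_right DERIV_sum DERIV_cmult) (simp add: has_real_derivative_iff_has_vector_derivative)
qed (intro smean_cont f smooth_Dt smooth_Dx continuous_on_component)+

end

section \<open>Spherical modes\<close>

lemma smooth_cmult: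
  fixes f :: "'a::euclidean_space \<Rightarrow> real"
  assumes "smooth f" shows "smooth (\<lambda>x. c * f x)"
  using smooth_linear(1)[OF assms bounded_linear_mult_right[of c]] .

lemma smooth_diff:
  fixes f g :: "'a::euclidean_space \<Rightarrow> real"
  assumes "smooth f" "smooth g" shows "smooth (\<lambda>x. f x - g x)"
  using smooth_add(1)[OF assms(1) smooth_cmult[OF assms(2), of "-1"]] by simp

lemma smooth_sum:
  fixes f :: "'i \<Rightarrow> 'a::euclidean_space \<Rightarrow> real"
  assumes "\<And>i. i \<in> A \<Longrightarrow> smooth (f i)" shows "smooth (\<lambda>x. \<Sum>i\<in>A. f i x)"
  using assms by (induction A rule: infinite_finite_induct) (auto intro: smooth_const smooth_add)

lemma smooth_coord:
  fixes f :: "pt \<Rightarrow> real"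
  assumes "smooth f" shows "smooth (\<lambda>p. snd p $ j * f p)"
proof -
  have "p \<bullet> (0, axis j 1) = snd p $ j" for p :: pt by (simp add: inner_prod_def inner_axis)
  then show ?thesis using smooth_inner_scale[OF assms, of "(0, axis j 1)"] by simp
qed

lemma smooth_sphere_lap:
  assumes "smooth f" shows "smooth (sphere_lap f)"
proof -
  have "smooth (\<lambda>p. (\<Sum>i\<in>UNIV. \<Sum>j\<in>UNIV. snd p $ j * (snd p $ j * Dx i (Dx i f) p))
     - (\<Sum>i\<in>UNIV. \<Sum>j\<in>UNIV. snd p $ i * (snd p $ j * Dx j (Dx i f) p)) - 2 * (\<Sum>i\<in>UNIV. snd p $ i * Dx i f p))"
    by (intro smooth_diff smooth_sum smooth_cmult smooth_coord smooth_Dx assms)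
  then show ?thesis unfolding sphere_lap_def[abs_def] by (simp add: power2_eq_square mult.assoc)
qed

text \<open>The field r d/dr. Unlike the radial derivative itself it preserves smoothness at the
  origin.\<close>

definition rad :: "(pt \<Rightarrow> real) \<Rightarrow> pt \<Rightarrow> real" where
  "rad f p = (\<Sum>i\<in>UNIV. snd p $ i * Dx i f p)"

lemma smooth_rad: "smooth f \<Longrightarrow> smooth (rad f)"
  unfolding rad_def[abs_def] by (intro smooth_sum smooth_coord smooth_Dx)

lemma sph_scale: "sph r th ph = r *\<^sub>R sph 1 th ph"
  by (simp add: vec_eq_iff forall_3 sph_def)

lemma rad_sph: "rad f (t, sph r th ph) = r * grad (sph 1 th ph) f (t, sph r th ph)"
proof -
  have "sph r th ph $ i = r * sph 1 th ph $ i" for i by (subst sph_scale) simp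
  then show ?thesis by (simp add: rad_def grad_def sum_distrib_left mult.assoc)
qed

lemma norm_sph: "norm (sph r th ph) = \<bar>r\<bar>"
proof -
  have "(norm (sph r th ph))\<^sup>2 = (r * sin th * cos ph)\<^sup>2 + (r * sin th * sin ph)\<^sup>2 + (r * cos th)\<^sup>2"
    unfolding power2_norm_eq_inner inner_vec_def sum_3 chart_nth by (simp add: power2_eq_square)
  also have "\<dots> = r\<^sup>2"
    using sin_cos_squared_add[of th] sin_cos_squared_add[of ph] by algebra
  finally show ?thesis using real_sqrt_abs[of r] real_sqrt_abs[of "norm (sph r th ph)"] by simp
qed

definition zonal :: "real poly \<Rightarrow> real^3 \<Rightarrow> pt \<Rightarrow> real" where
  "zonal P \<omega> p = poly P (\<omega> \<bullet> snd p)"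

lemma zonal_has_derivative:
  "(zonal P \<omega> has_derivative (\<lambda>h. (\<omega> \<bullet> snd h) * zonal (pderiv P) \<omega> p)) (at p)"
proof -
  have "((\<lambda>p. \<omega> \<bullet> snd p) has_derivative (\<lambda>h. \<omega> \<bullet> snd h)) (at p)"
    by (auto intro!: derivative_eq_intros)
  from has_derivative_compose[OF this poly_DERIV[unfolded has_field_derivative_def]]
  show ?thesis unfolding zonal_def[abs_def] by (simp add: mult.commute)
qed

lemma smooth_zonal: "smooth (zonal P \<omega>)"
proof -
  have "smooth (\<lambda>p. 1 * zonal P \<omega> p)"
  proof (rule smooth_coinduct[where X = "{\<lambda>p. c * zonal Q \<omega> p |c Q. True}"])
    fix f :: "pt \<Rightarrow> real" and x assume "f \<in> {\<lambda>p. c * zonal Q \<omega> p |c Q. True}"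
    then obtain c Q where f: "f = (\<lambda>p. c * zonal Q \<omega> p)" by blast
    have d: "(f has_derivative (\<lambda>h. c * ((\<omega> \<bullet> snd h) * zonal (pderiv Q) \<omega> p))) (at p)" for p
      unfolding f by (rule has_derivative_mult_right[OF zonal_has_derivative])
    then show "f differentiable (at x)" by (blast intro: differentiableI)
    fix b :: pt
    have "pd b f = (\<lambda>p. (c * (\<omega> \<bullet> snd b)) * zonal (pderiv Q) \<omega> p)"
      by (rule ext, subst pd_eq[OF d]) simp
    then show "pd b f \<in> {\<lambda>p. c * zonal Q \<omega> p |c Q. True}" by blast
  qed blast
  then show ?thesis by simp
qed

lemma Dx_zonal: "Dx i (zonal P \<omega>) = (\<lambda>p. \<omega> $ i * zonal (pderiv P) \<omega> p)"
  unfolding Dx_def by (rule ext, subst pd_eq[OF zonal_has_derivative]) (simp add: inner_axis)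

lemma Dx_Dx_zonal: "Dx j (Dx i (zonal P \<omega>)) = (\<lambda>p. \<omega> $ i * (\<omega> $ j * zonal (pderiv (pderiv P)) \<omega> p))"
  unfolding Dx_zonal unfolding Dx_def
  by (rule ext, subst pd_eq[OF has_derivative_mult_right[OF zonal_has_derivative]]) (simp add: inner_axis)

lemma sphere_lap_zonal:
  assumes \<omega>: "norm \<omega> = 1" and x: "norm x = 1"
  shows "sphere_lap (zonal P \<omega>) (t, x) = poly (legendre_op P) (\<omega> \<bullet> x)"
proof -
  have o: "\<omega> $ 1 * \<omega> $ 1 + \<omega> $ 2 * \<omega> $ 2 + \<omega> $ 3 * \<omega> $ 3 = 1"
    using \<omega> by (simp add: norm_eq_1 inner_vec_def sum_3)
  have xx: "x $ 1 * x $ 1 + x $ 2 * x $ 2 + x $ 3 * x $ 3 = 1"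
    using x by (simp add: norm_eq_1 inner_vec_def sum_3)
  have z: "\<omega> \<bullet> x = \<omega> $ 1 * x $ 1 + \<omega> $ 2 * x $ 2 + \<omega> $ 3 * x $ 3" by (simp add: inner_vec_def sum_3)
  define p1 where "p1 = poly (pderiv P) (\<omega> \<bullet> x)"
  define p2 where "p2 = poly (pderiv (pderiv P)) (\<omega> \<bullet> x)"
  have "sphere_lap (zonal P \<omega>) (t, x) = (1 - (\<omega> \<bullet> x)\<^sup>2) * p2 - 2 * (\<omega> \<bullet> x) * p1"
    unfolding sphere_lap_def Dx_Dx_zonal unfolding Dx_zonal zonal_def snd_conv unfolding p1_def[symmetric] p2_def[symmetric]
    unfolding z sum_3 using o xx by algebra
  then show ?thesis by (simp add: poly_legendre_op p1_def p2_def)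
qed

definition zkernel :: "real poly \<Rightarrow> real^3 \<Rightarrow> real \<times> real \<Rightarrow> real" where
  "zkernel P \<omega> q = poly P (\<omega> \<bullet> sph 1 (fst q) (snd q)) * sin (fst q)"

lemma zkernel_continuous: "continuous_on UNIV (zkernel P \<omega>)"
  unfolding zkernel_def[abs_def] by (intro continuous_intros sph_continuous)

lemma inner_sph_bounds: "norm \<omega> = 1 \<Longrightarrow> - 1 \<le> \<omega> \<bullet> sph 1 th ph \<and> \<omega> \<bullet> sph 1 th ph \<le> 1"
  using Cauchy_Schwarz_ineq2[of \<omega> "sph 1 th ph"] by (simp add: norm_sph abs_le_iff)

lemma zkernel_bound:
  assumes "norm \<omega> = 1" shows "\<bar>zkernel (legendre_P n) \<omega> q\<bar> \<le> 1"
proof -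
  have "\<bar>zkernel (legendre_P n) \<omega> q\<bar> \<le> 1 * 1"
    unfolding zkernel_def abs_mult
    using legendre_P_bound inner_sph_bounds[OF assms] by (intro mult_mono) auto
  then show ?thesis by simp
qed

text \<open>Self-adjointness moves the Laplacian onto the zonal kernel, which is an
  eigenfunction.\<close>

lemma smean_sphere_lap:
  assumes f: "smooth f" and P: "legendre_eigenpoly n P" and \<omega>: "norm \<omega> = 1"
  shows "smean (zkernel P \<omega>) (sphere_lap f) t r = - legendre_eig n * smean (zkernel P \<omega>) f t r"
proof -
  have "smean (zkernel P \<omega>) (sphere_lap f) t r = integral sbox (\<lambda>q. sphere_lap f (t, sph r (fst q) (snd q)) *
      (zonal P \<omega> (0, sph 1 (fst q) (snd q)) * sin (fst q)))"
    by (simp add: smean_def zkernel_def zonal_def)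
  also have "\<dots> = integral sbox (\<lambda>q. f (t, sph r (fst q) (snd q)) * (sphere_lap (zonal P \<omega>) (0, sph 1 (fst q) (snd q)) * sin (fst q)))"
    by (rule sphere_green[OF f smooth_zonal])
  also have "\<dots> = integral sbox (\<lambda>q. - legendre_eig n * (f (t, sph r (fst q) (snd q)) * zkernel P \<omega> q))"
    using P by (simp add: sphere_lap_zonal[OF \<omega>] norm_sph legendre_eigenpoly_def zkernel_def mult_ac)
  finally show ?thesis by (simp only: smean_def integral_mult_right)
qed

text \<open>The operator 1 - \<Delta>: under the n-th zonal mean it becomes the factor 1 + n(n+1),
  so each application to the data gains one power of decay in the mode number.\<close>

definition lam1 :: "(pt \<Rightarrow> real) \<Rightarrow> pt \<Rightarrow> real" where "lam1 f p = f p - sphere_lap f p"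

lemma smooth_lam1: "smooth f \<Longrightarrow> smooth (lam1 f)"
  unfolding lam1_def[abs_def] by (intro smooth_diff smooth_sphere_lap)

lemma smooth_funpow:
  fixes D :: "(pt \<Rightarrow> real) \<Rightarrow> pt \<Rightarrow> real"
  shows "(\<And>f. smooth f \<Longrightarrow> smooth (D f)) \<Longrightarrow> smooth f \<Longrightarrow> smooth ((D ^^ k) f)"
  by (induction k) auto

lemma smean_integrable:
  fixes f :: "pt \<Rightarrow> real"
  assumes "continuous_on UNIV \<kappa>" "smooth f"
  shows "(\<lambda>q. f (t, sph r (fst q) (snd q)) * \<kappa> q :: real) integrable_on sbox"
proof -
  have "continuous_on UNIV (\<lambda>q. f (t, sph r (fst q) (snd q)) * \<kappa> q)"
    by (intro continuous_on_mult smooth_comp_continuous[OF assms(2)] sph_continuous assms(1) continuous_on_const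
        continuous_on_fst continuous_on_snd continuous_on_id)
  then show ?thesis unfolding sbox_def by (rule integrable_continuous[OF continuous_on_subset]) simp
qed

lemma smean_lam1:
  assumes f: "smooth f" and P: "legendre_eigenpoly n P" and \<omega>: "norm \<omega> = 1"
  shows "smean (zkernel P \<omega>) (lam1 f) t r = (1 + legendre_eig n) * smean (zkernel P \<omega>) f t r"
proof -
  have "smean (zkernel P \<omega>) (lam1 f) t r = smean (zkernel P \<omega>) f t r - smean (zkernel P \<omega>) (sphere_lap f) t r"
    unfolding smean_def lam1_def left_diff_distrib
    by (intro integral_diff smean_integrable zkernel_continuous f smooth_sphere_lap)
  then show ?thesis using smean_sphere_lap[OF assms] by (simp add: algebra_simps)
qed

lemma smean_lam1_power:
  assumes f: "smooth f" and P: "legendre_eigenpoly n P" and \<omega>: "norm \<omega> = 1"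
  shows "smean (zkernel P \<omega>) ((lam1 ^^ k) f) t r = (1 + legendre_eig n) ^ k * smean (zkernel P \<omega>) f t r"
proof (induction k)
  case (Suc k)
  then show ?case using smean_lam1[OF smooth_funpow[OF smooth_lam1 f] P \<omega>, where t = t and r = r] by simp
qed simp

lemma content_sbox: "measure lborel (cbox (0, 0) (pi, 2 * pi :: real)) = 2 * pi\<^sup>2"
  by (simp add: content_Pair power2_eq_square)

text \<open>2 pi^2 is the area of the parameter box, not of the sphere: the surface factor is inside
  \<kappa> and hence inside M.\<close>

lemma smean_abs_bound:
  assumes \<kappa>: "continuous_on UNIV \<kappa>" "\<And>q. \<bar>\<kappa> q\<bar> \<le> M" and f: "smooth f"
    and B: "\<And>x. norm x = \<bar>r\<bar> \<Longrightarrow> \<bar>f (t, x)\<bar> \<le> B"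
  shows "\<bar>smean \<kappa> f t r\<bar> \<le> B * M * (2 * pi\<^sup>2)"
proof -
  have B0: "B \<ge> 0" using B[of "sph r 0 0"] norm_sph[of r 0 0] by fastforce
  have M0: "M \<ge> 0" using \<kappa>(2)[of 0] by linarith
  have "norm (smean \<kappa> f t r) \<le> B * M * measure lborel (cbox (0, 0) (pi, 2 * pi :: real))"
    unfolding smean_def sbox_def
  proof (rule integrable_bound)
    show "(\<lambda>q. f (t, sph r (fst q) (snd q)) * \<kappa> q) integrable_on cbox (0, 0) (pi, 2 * pi)"
      using smean_integrable[OF \<kappa>(1) f] by (simp add: sbox_def)
    show "0 \<le> B * M" using B0 M0 by simp
    fix q
    have "\<bar>f (t, sph r (fst q) (snd q))\<bar> * \<bar>\<kappa> q\<bar> \<le> B * M"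
      using B \<kappa>(2) B0 by (intro mult_mono) (auto simp: norm_sph)
    then show "norm (f (t, sph r (fst q) (snd q)) * \<kappa> q) \<le> B * M" by (simp add: abs_mult)
  qed
  then show ?thesis by (simp add: content_sbox)
qed

lemma smean_rad: "smean \<kappa> (rad f) t r = r * smean_r \<kappa> f t r"
  unfolding smean_def smean_r_def rad_sph mult.assoc by (simp only: integral_mult_right)

text \<open>Write y as an integral of z from a base point, differentiate under the integral in t,
  and the resulting formula for yt can be differentiated in r. No second r-derivative of y is
  involved.\<close>

lemma mixed_partials:
  fixes y z yt zt :: "real \<Rightarrow> real \<Rightarrow> real"
  assumes y_r: "\<And>t r. r > l \<Longrightarrow> ((\<lambda>r. y t r) has_real_derivative z t r) (at r)"
    and y_t: "\<And>t r. r > l \<Longrightarrow> ((\<lambda>t. y t r) has_real_derivative yt t r) (at t)"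
    and z_t: "\<And>t r. r > l \<Longrightarrow> ((\<lambda>t. z t r) has_real_derivative zt t r) (at t)"
    and zc: "continuous_on (UNIV \<times> {l<..}) (\<lambda>p. z (fst p) (snd p))" "continuous_on (UNIV \<times> {l<..}) (\<lambda>p. zt (fst p) (snd p))"
    and r: "r > l"
  shows "((\<lambda>r. yt t r) has_real_derivative zt t r) (at r)"
proof -
  \<comment> \<open>A base point strictly between l and r keeps the interval of integration inside
    the region where the hypotheses hold.\<close>
  define c where "c = (l + r) / 2"
  have c: "l < c" "c < r" using r by (auto simp: c_def)
  have zc1: "continuous_on {c..d} (z t)" "continuous_on {c..d} (zt t)" for d t
  proof -
    have p: "continuous_on {c..d} (Pair t)" by (rule continuous_on_Pair[OF continuous_on_const continuous_on_id])
    have q: "Pair t ` {c..d} \<subseteq> UNIV \<times> {l<..}" using c(1) by auto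
    show "continuous_on {c..d} (z t)" "continuous_on {c..d} (zt t)"
      using continuous_on_compose2[OF zc(1) p q] continuous_on_compose2[OF zc(2) p q] by simp_all
  qed
  have yint: "y t x = y t c + integral {c..x} (z t)" if "c \<le> x" for t x
  proof -
    have "(z t has_integral y t x - y t c) {c..x}"
    proof (rule fundamental_theorem_of_calculus[OF that])
      fix s assume "s \<in> {c..x}"
      then have "(y t has_real_derivative z t s) (at s)" using y_r c by simp
      then show "(y t has_vector_derivative z t s) (at s within {c..x})"
        unfolding has_real_derivative_iff_has_vector_derivative by (rule has_vector_derivative_at_within)
    qed
    then show ?thesis by (simp add: integral_unique)
  qed
  have ytint: "yt t x = yt t c + integral {c..x} (zt t)" if x: "c \<le> x" for x
  proof -
    have "((\<lambda>t. integral {c..x} (z t)) has_real_derivative integral {c..x} (zt t)) (at t)"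
    proof (rule leibniz_real_interval)
      show "continuous_on (UNIV \<times> {c..x}) (\<lambda>p. zt (fst p) (snd p))"
        by (rule continuous_on_subset[OF zc(2)]) (use c in auto)
    qed (use z_t c zc1 in auto)
    then have "((\<lambda>t. y t c + integral {c..x} (z t)) has_real_derivative yt t c + integral {c..x} (zt t)) (at t)"
      using y_t c by (intro DERIV_add) auto
    then have "((\<lambda>t. y t x) has_real_derivative yt t c + integral {c..x} (zt t)) (at t)"
      using yint[OF x] by simp
    moreover have "((\<lambda>t. y t x) has_real_derivative yt t x) (at t)" using y_t x c by simp
    ultimately show ?thesis by (rule DERIV_unique[symmetric])
  qed
  have "((\<lambda>x. integral {c..x} (zt t)) has_vector_derivative zt t r) (at r within {c..r + 1})"
    using c by (intro integral_has_vector_derivative zc1) auto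
  then have "((\<lambda>x. integral {c..x} (zt t)) has_real_derivative zt t r) (at r)"
    using c by (simp add: has_real_derivative_iff_has_vector_derivative at_within_Icc_at)
  from DERIV_add[OF DERIV_const[of "yt t c"] this]
  have d: "((\<lambda>x. yt t c + integral {c..x} (zt t)) has_real_derivative zt t r) (at r)" by simp
  have ev: "\<forall>\<^sub>F x in nhds r. yt t c + integral {c..x} (zt t) = yt t x"
  proof (rule eventually_mono[OF eventually_nhds_in_open[of "{c<..}" r]])
    show "yt t c + integral {c..x} (zt t) = yt t x" if "x \<in> {c<..}" for x
      by (rule ytint[symmetric]) (use that in simp)
  qed (use c in auto)
  show ?thesis by (rule iffD1[OF DERIV_cong_ev[OF refl ev refl] d])
qed

text \<open>The last assumption is the wave equation multiplied by \<open>r\<^sup>2 K / T\<close>, with \<open>\<mu> = K T\<close> and \<open>a = K / T\<close>.\<close>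

locale wave_solution = radial_geometry +
  fixes F :: "pt \<Rightarrow> real" and r0 R0 :: real
  assumes F: "smooth F" and r0: "0 < r0" "r0 < R0"
    and F_data: "\<And>x. norm x < r0 \<or> norm x > R0 \<Longrightarrow> F (0, x) = 0 \<and> Dt F (0, x) = 0"
    and F_wave: "\<And>t r th ph. r > 0 \<Longrightarrow> sin th \<noteq> 0 \<Longrightarrow>
      \<mu> r * r\<^sup>2 * Dt (Dt F) (t, sph r th ph) =
        r\<^sup>2 / \<mu> r * hess (sph 1 th ph) (sph 1 th ph) F (t, sph r th ph)
        + (2 * r / \<mu> r - r\<^sup>2 * \<mu>' r / (\<mu> r)\<^sup>2) * grad (sph 1 th ph) F (t, sph r th ph)
        + a r * sphere_lap F (t, sph r th ph)"
begin

definition mode_v :: "nat \<Rightarrow> real^3 \<Rightarrow> nat \<Rightarrow> real \<Rightarrow> real \<Rightarrow> real" where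
  "mode_v n \<omega> k = smean (zkernel (legendre_P n) \<omega>) ((Dt ^^ k) F)"

definition mode_w :: "nat \<Rightarrow> real^3 \<Rightarrow> nat \<Rightarrow> real \<Rightarrow> real \<Rightarrow> real" where
  "mode_w n \<omega> k = smean_r (zkernel (legendre_P n) \<omega>) ((Dt ^^ k) F)"

lemma smooth_Dt_pow: "smooth ((Dt ^^ k) F)"
  by (rule smooth_funpow[OF smooth_Dt F])

lemma mode_basic:
  "cont2 (mode_v n \<omega> k)" "cont2 (mode_w n \<omega> k)"
  "((\<lambda>t. mode_v n \<omega> k t r) has_real_derivative mode_v n \<omega> (Suc k) t r) (at t)"
  "((\<lambda>r. mode_v n \<omega> k t r) has_real_derivative mode_w n \<omega> k t r) (at r)"
proof -
  show "cont2 (mode_v n \<omega> k)" "cont2 (mode_w n \<omega> k)"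
    unfolding mode_v_def mode_w_def by (intro smean_cont2 zkernel_continuous smooth_Dt_pow)+
  show "((\<lambda>t. mode_v n \<omega> k t r) has_real_derivative mode_v n \<omega> (Suc k) t r) (at t)"
    unfolding mode_v_def using smean_t[OF zkernel_continuous smooth_Dt_pow] by simp
  show "((\<lambda>r. mode_v n \<omega> k t r) has_real_derivative mode_w n \<omega> k t r) (at r)"
    unfolding mode_v_def mode_w_def by (rule smean_has_r[OF zkernel_continuous smooth_Dt_pow])
qed

text \<open>Differentiating the mean of the radial derivative in t yields the mean of Dt Dx, while
  the tower requires Dx Dt; \<open>mixed_partials\<close> identifies the two after
  averaging.\<close>

lemma mode_w_t: "((\<lambda>t. mode_w n \<omega> k t r) has_real_derivative mode_w n \<omega> (Suc k) t r) (at t)"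
proof -
  let ?q = "smean_rt (zkernel (legendre_P n) \<omega>) ((Dt ^^ k) F)"
  have q: "((\<lambda>t. mode_w n \<omega> k t r) has_real_derivative ?q t r) (at t)" for t r
    unfolding mode_w_def by (rule smean_r_has_t[OF zkernel_continuous smooth_Dt_pow])
  have "((\<lambda>r. mode_v n \<omega> (Suc k) t r) has_real_derivative ?q t r) (at r)"
  proof (rule mixed_partials[where l = "r - 1" and t = t and y = "mode_v n \<omega> k" and yt = "mode_v n \<omega> (Suc k)" and z = "mode_w n \<omega> k" and zt = ?q])
    show "continuous_on (UNIV \<times> {r - 1<..}) (\<lambda>p. mode_w n \<omega> k (fst p) (snd p))"
      using mode_basic(2)[of n \<omega> k] unfolding cont2_def by (rule continuous_on_subset) simp
    show "continuous_on (UNIV \<times> {r - 1<..}) (\<lambda>p. ?q (fst p) (snd p))"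
      using smean_rt_cont2[OF zkernel_continuous smooth_Dt_pow] unfolding cont2_def by (rule continuous_on_subset) simp
  qed (use mode_basic q in auto)
  then have "?q t r = mode_w n \<omega> (Suc k) t r" using mode_basic(4) DERIV_unique by blast
  then show ?thesis using q[where t = t and r = r] by simp
qed

lemma mode_pde_0:
  assumes \<omega>: "norm \<omega> = 1" and r: "r > 0"
  shows "((\<lambda>r. r\<^sup>2 / \<mu> r * mode_w n \<omega> 0 t r) has_real_derivative
    \<mu> r * r\<^sup>2 * mode_v n \<omega> 2 t r + legendre_eig n * a r * mode_v n \<omega> 0 t r) (at r)"
proof -
  let ?\<kappa> = "zkernel (legendre_P n) \<omega>"
  let ?rr = "smean_rr ?\<kappa> F t r"
  have \<mu>0: "\<mu> r > 0" using \<mu>_pos r by simp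
  have "((\<lambda>r. mode_w n \<omega> 0 t r) has_real_derivative ?rr) (at r)"
    unfolding mode_w_def using smean_r_has_r[OF zkernel_continuous F] by simp
  then have "((\<lambda>r. r\<^sup>2 / \<mu> r * mode_w n \<omega> 0 t r) has_real_derivative
      r\<^sup>2 / \<mu> r * ?rr + (2 * r / \<mu> r - r\<^sup>2 * \<mu>' r / (\<mu> r)\<^sup>2) * mode_w n \<omega> 0 t r) (at r)"
    using \<mu>0 r by (auto intro!: derivative_eq_intros \<mu>_deriv simp: field_simps power2_eq_square)
  moreover have "r\<^sup>2 / \<mu> r * ?rr + (2 * r / \<mu> r - r\<^sup>2 * \<mu>' r / (\<mu> r)\<^sup>2) * mode_w n \<omega> 0 t r
      = \<mu> r * r\<^sup>2 * mode_v n \<omega> 2 t r + legendre_eig n * a r * mode_v n \<omega> 0 t r"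
  proof -
    define c1 where "c1 = r\<^sup>2 / \<mu> r"
    define c2 where "c2 = 2 * r / \<mu> r - r\<^sup>2 * \<mu>' r / (\<mu> r)\<^sup>2"
    define c3 where "c3 = \<mu> r * r\<^sup>2"
    let ?x = "\<lambda>q. sph r (fst q) (snd q)" and ?n = "\<lambda>q. sph 1 (fst q) (snd q)"
    define I1 where "I1 q = hess (?n q) (?n q) F (t, ?x q) * ?\<kappa> q" for q
    define I2 where "I2 q = grad (?n q) F (t, ?x q) * ?\<kappa> q" for q
    define I3 where "I3 q = Dt (Dt F) (t, ?x q) * ?\<kappa> q" for q
    define I4 where "I4 q = sphere_lap F (t, ?x q) * ?\<kappa> q" for q
    have i: "I1 integrable_on sbox" "I2 integrable_on sbox"
      unfolding I1_def[abs_def] I2_def[abs_def] sbox_def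
      by (intro integrable_continuous continuous_on_mult hess_continuous grad_continuous sph_continuous
          continuous_intros F continuous_on_subset[OF zkernel_continuous]; simp)+
    have i': "I3 integrable_on sbox" "I4 integrable_on sbox"
      unfolding I3_def[abs_def] I4_def[abs_def] by (intro smean_integrable zkernel_continuous smooth_Dt smooth_sphere_lap F)+
    \<comment> \<open>The wave equation is available only off the poles; on them the kernel
      vanishes, so the averaged identity holds for every q.\<close>
    have pt: "c1 * I1 q + c2 * I2 q = c3 * I3 q - a r * I4 q" for q
    proof (cases "sin (fst q) = 0")
      case True
      then show ?thesis by (simp add: I1_def I2_def I3_def I4_def zkernel_def)
    next
      case False
      have "c3 * I3 q = (c3 * Dt (Dt F) (t, ?x q)) * ?\<kappa> q" by (simp add: I3_def)
      also have "c3 * Dt (Dt F) (t, ?x q) = c1 * hess (?n q) (?n q) F (t, ?x q) + c2 * grad (?n q) F (t, ?x q) + a r * sphere_lap F (t, ?x q)"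
        unfolding c1_def c2_def c3_def by (rule F_wave[OF r False])
      finally show ?thesis by (simp add: I1_def I2_def I4_def algebra_simps)
    qed
    have "c1 * integral sbox I1 + c2 * integral sbox I2 = integral sbox (\<lambda>q. c1 * I1 q + c2 * I2 q)"
      using integral_add[OF integrable_on_mult_right[OF i(1), of c1] integrable_on_mult_right[OF i(2), of c2]] by simp
    also have "\<dots> = c3 * integral sbox I3 - a r * integral sbox I4"
      unfolding pt using integral_diff[OF integrable_on_mult_right[OF i'(1), of c3] integrable_on_mult_right[OF i'(2), of "a r"]] by simp
    finally have "c1 * ?rr + c2 * mode_w n \<omega> 0 t r = c3 * mode_v n \<omega> 2 t r - a r * smean ?\<kappa> (sphere_lap F) t r"
      by (simp add: smean_rr_def mode_w_def smean_r_def mode_v_def smean_def I1_def[abs_def] I2_def[abs_def] I3_def[abs_def] I4_def[abs_def] numeral_2_eq_2)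
    then show ?thesis
      unfolding smean_sphere_lap[OF F legendre_P_eigen \<omega>] c1_def c2_def c3_def by (simp add: mode_v_def mult_ac)
  qed
  ultimately show ?thesis by simp
qed

text \<open>The equation is differentiated in time after averaging: \<open>mixed_partials\<close> is
  applied to the flux r^2 w / \<mu>, so the time derivative never has to be commuted with the
  spatial operators acting on F.\<close>

lemma mode_pde:
  assumes \<omega>: "norm \<omega> = 1" and r: "r > 0"
  shows "((\<lambda>r. r\<^sup>2 / \<mu> r * mode_w n \<omega> k t r) has_real_derivative
    \<mu> r * r\<^sup>2 * mode_v n \<omega> (Suc (Suc k)) t r + legendre_eig n * a r * mode_v n \<omega> k t r) (at r)"
  using r
proof (induction k arbitrary: t r)
  case 0
  then show ?case using mode_pde_0[OF \<omega>] by (simp add: numeral_2_eq_2)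
next
  case (Suc k)
  note vcomp = cont2_compose[OF mode_basic(1)]
  show ?case
  proof (rule mixed_partials[where l = 0 and t = t and y = "\<lambda>t r. r\<^sup>2 / \<mu> r * mode_w n \<omega> k t r" and yt = "\<lambda>t r. r\<^sup>2 / \<mu> r * mode_w n \<omega> (Suc k) t r"
        and zt = "\<lambda>t r. \<mu> r * r\<^sup>2 * mode_v n \<omega> (Suc (Suc (Suc k))) t r + legendre_eig n * a r * mode_v n \<omega> (Suc k) t r"
        and z = "\<lambda>t r. \<mu> r * r\<^sup>2 * mode_v n \<omega> (Suc (Suc k)) t r + legendre_eig n * a r * mode_v n \<omega> k t r"])
    show "((\<lambda>t. r\<^sup>2 / \<mu> r * mode_w n \<omega> k t r) has_real_derivative r\<^sup>2 / \<mu> r * mode_w n \<omega> (Suc k) t r) (at t)" for t r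
      by (intro DERIV_cmult mode_w_t)
    show "((\<lambda>t. \<mu> r * r\<^sup>2 * mode_v n \<omega> (Suc (Suc k)) t r + legendre_eig n * a r * mode_v n \<omega> k t r) has_real_derivative
        \<mu> r * r\<^sup>2 * mode_v n \<omega> (Suc (Suc (Suc k))) t r + legendre_eig n * a r * mode_v n \<omega> (Suc k) t r) (at t)" for t r
      by (intro DERIV_add DERIV_cmult mode_basic(3))
    show "continuous_on (UNIV \<times> {0<..}) (\<lambda>p. \<mu> (snd p) * (snd p)\<^sup>2 * mode_v n \<omega> (Suc (Suc k)) (fst p) (snd p) + legendre_eig n * a (snd p) * mode_v n \<omega> k (fst p) (snd p))"
      "continuous_on (UNIV \<times> {0<..}) (\<lambda>p. \<mu> (snd p) * (snd p)\<^sup>2 * mode_v n \<omega> (Suc (Suc (Suc k))) (fst p) (snd p) + legendre_eig n * a (snd p) * mode_v n \<omega> (Suc k) (fst p) (snd p))"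
      by (intro continuous_intros vcomp \<mu>_comp a_comp; auto)+
  qed (use Suc in auto)
qed

lemma mode_radial_wave:
  assumes \<omega>: "norm \<omega> = 1"
  shows "radial_wave \<mu> \<mu>' a m0 m1 a1 c1 \<rho>1 (legendre_eig n) (mode_v n \<omega>) (mode_w n \<omega>) r0 R0"
proof (rule radial_wave.intro[OF radial_geometry_axioms], rule radial_wave_axioms.intro)
  show "radial_mode (legendre_eig n) (mode_v n \<omega>) (mode_w n \<omega>)"
    unfolding radial_mode_def by (intro conjI allI impI mode_basic mode_w_t mode_pde[OF \<omega>])
  fix r assume r: "0 \<le> r" "r < r0 \<or> R0 < r"
  have z: "F (0, sph r th ph) = 0 \<and> Dt F (0, sph r th ph) = 0" for th ph
    using F_data[of "sph r th ph"] r by (simp add: norm_sph)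
  then show "mode_v n \<omega> 0 0 r = 0 \<and> mode_v n \<omega> 1 0 r = 0"
    by (simp add: mode_v_def smean_def)
qed (use r0 legendre_eig_nonneg in auto)

text \<open>Apply 1 - \<Delta> three times to G and bound the result trivially on a compact ball;
  the mean gains the third power of the eigenvalue factor, uniformly in \<omega>.\<close>

lemma smean_data_decay:
  assumes G: "smooth G"
  shows "\<exists>C\<ge>0. \<forall>n \<omega> r. norm \<omega> = 1 \<longrightarrow> 0 \<le> r \<longrightarrow> r \<le> R \<longrightarrow>
      \<bar>smean (zkernel (legendre_P n) \<omega>) G 0 r\<bar> \<le> C / (1 + legendre_eig n) ^ 3"
proof -
  let ?H = "(lam1 ^^ 3) G"
  have H: "smooth ?H" by (rule smooth_funpow[OF smooth_lam1 G])
  have "bounded ((\<lambda>x. ?H (0, x)) ` cball 0 R)"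
    by (intro compact_imp_bounded compact_continuous_image smooth_comp_continuous[OF H] continuous_intros compact_cball)
  then obtain B where B: "\<And>x. norm x \<le> R \<Longrightarrow> \<bar>?H (0, x)\<bar> \<le> B" by (force simp: bounded_iff)
  define C where "C = max 0 B * 1 * (2 * pi\<^sup>2)"
  show ?thesis
  proof (intro exI[of _ C] conjI allI impI)
    fix n :: nat and \<omega> :: "real^3" and r :: real assume \<omega>: "norm \<omega> = 1" and r: "0 \<le> r" "r \<le> R"
    have "\<bar>smean (zkernel (legendre_P n) \<omega>) ?H 0 r\<bar> \<le> C"
      unfolding C_def
      by (rule smean_abs_bound[OF zkernel_continuous zkernel_bound[OF \<omega>] H]) (use B r in \<open>auto simp: le_max_iff_disj\<close>)
    then have "(1 + legendre_eig n) ^ 3 * \<bar>smean (zkernel (legendre_P n) \<omega>) G 0 r\<bar> \<le> C"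
      unfolding smean_lam1_power[OF G legendre_P_eigen \<omega>] abs_mult using legendre_eig_nonneg[of n] by simp
    then show "\<bar>smean (zkernel (legendre_P n) \<omega>) G 0 r\<bar> \<le> C / (1 + legendre_eig n) ^ 3"
      using legendre_eig_nonneg[of n] by (simp add: field_simps)
  qed (simp add: C_def)
qed

text \<open>The energy of the locale \<open>radial_wave\<close>, restated for all n and \<omega> at
  once so that its decay can be estimated before any mode is interpreted.\<close>

definition menergy :: "nat \<Rightarrow> real^3 \<Rightarrow> nat \<Rightarrow> real" where
  "menergy n \<omega> k = integral {0..R0 + 1} (edens (legendre_eig n) (mode_v n \<omega> k) (mode_v n \<omega> (Suc k)) (mode_w n \<omega> k) 0)"

text \<open>With l = 1 + n(n+1), squares of O(l^-3) data are O(l^-6), and the angular term has an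
  extra factor of at most l. The exponent 4 is a common weakening whose square root is the integer
  power used later.\<close>

lemma menergy_decay:
  obtains C where "C \<ge> 0" "\<And>n \<omega>. norm \<omega> = 1 \<Longrightarrow> menergy n \<omega> k \<le> C / (1 + legendre_eig n) ^ 4"
proof -
  obtain C1 where C1: "C1 \<ge> 0" "\<forall>n \<omega> r. norm \<omega> = 1 \<longrightarrow> 0 \<le> r \<longrightarrow> r \<le> R0 + 1 \<longrightarrow>
      \<bar>mode_v n \<omega> k 0 r\<bar> \<le> C1 / (1 + legendre_eig n) ^ 3"
    using smean_data_decay[OF smooth_Dt_pow[of k], of "R0 + 1", folded mode_v_def] by (elim exE conjE)
  obtain C2 where C2: "C2 \<ge> 0" "\<forall>n \<omega> r. norm \<omega> = 1 \<longrightarrow> 0 \<le> r \<longrightarrow> r \<le> R0 + 1 \<longrightarrow>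
      \<bar>mode_v n \<omega> (Suc k) 0 r\<bar> \<le> C2 / (1 + legendre_eig n) ^ 3"
    using smean_data_decay[OF smooth_Dt_pow[of "Suc k"], of "R0 + 1", folded mode_v_def] by (elim exE conjE)
  \<comment> \<open>The radial derivative enters the energy only through r w, which is the mean of
    the smooth function \<open>rad\<close>, so the same decay lemma applies to it.\<close>
  obtain C3 where C3: "C3 \<ge> 0" "\<forall>n \<omega> r. norm \<omega> = 1 \<longrightarrow> 0 \<le> r \<longrightarrow> r \<le> R0 + 1 \<longrightarrow>
      \<bar>r * mode_w n \<omega> k 0 r\<bar> \<le> C3 / (1 + legendre_eig n) ^ 3"
    using smean_data_decay[OF smooth_rad[OF smooth_Dt_pow[of k]], of "R0 + 1", unfolded smean_rad, folded mode_w_def] by (elim exE conjE)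
  define D where "D = (m1 * (R0 + 1)\<^sup>2 * C2\<^sup>2 + C3\<^sup>2 / m0 + a1 * C1\<^sup>2) / 2"
  have D: "D \<ge> 0" unfolding D_def using m1_pos m0 a1_nonneg by simp
  show ?thesis
  proof (rule that[of "D * (R0 + 1)"])
    show "0 \<le> D * (R0 + 1)" using D r0 by simp
    fix n and \<omega> :: "real^3" assume \<omega>: "norm \<omega> = 1"
    define l where "l = 1 + legendre_eig n"
    have l: "l \<ge> 1" using legendre_eig_nonneg by (simp add: l_def)
    have sq: "x\<^sup>2 \<le> c\<^sup>2 / l ^ 6" if "\<bar>x\<bar> \<le> c / l ^ 3" for x c
    proof -
      have "\<bar>x\<bar>\<^sup>2 \<le> (c / l ^ 3)\<^sup>2" using that by (intro power_mono) auto
      then show ?thesis by (simp add: power_divide flip: power_mult)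
    qed
    have l64: "1 / l ^ 6 \<le> 1 / l ^ 4" using l by (intro divide_left_mono power_increasing) auto
    have l54: "l / l ^ 6 \<le> 1 / l ^ 4"
    proof -
      have "l ^ 4 * l \<le> l ^ 4 * l ^ 2" using l by (intro mult_left_mono) (auto simp: power2_eq_square)
      then have "l * l ^ 4 \<le> l ^ 6" by (simp add: mult.commute flip: power_add)
      then show ?thesis using l by (simp add: field_simps)
    qed
    have e: "edens (legendre_eig n) (mode_v n \<omega> k) (mode_v n \<omega> (Suc k)) (mode_w n \<omega> k) 0 r \<le> D / l ^ 4" if r: "r \<in> {0..R0 + 1}" for r
    proof -
      have \<mu>r: "m0 \<le> \<mu> r" "\<mu> r \<le> m1" "\<mu> r > 0" using \<mu>_lower \<mu>_upper \<mu>_pos r by auto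
      have 1: "\<mu> r * r\<^sup>2 * (mode_v n \<omega> (Suc k) 0 r)\<^sup>2 \<le> m1 * (R0 + 1)\<^sup>2 * (C2\<^sup>2 / l ^ 6)"
        using \<mu>r m1_pos r sq[OF C2(2)[rule_format, OF \<omega>, of r n, folded l_def]] by (intro mult_mono power_mono) auto
      have "r\<^sup>2 / \<mu> r * (mode_w n \<omega> k 0 r)\<^sup>2 = (r * mode_w n \<omega> k 0 r)\<^sup>2 / \<mu> r" by (simp add: power_mult_distrib)
      also have "\<dots> \<le> (C3\<^sup>2 / l ^ 6) / m0"
        using \<mu>r m0 r sq[OF C3(2)[rule_format, OF \<omega>, of r n, folded l_def]] l by (intro frac_le) auto
      finally have 2: "r\<^sup>2 / \<mu> r * (mode_w n \<omega> k 0 r)\<^sup>2 \<le> (C3\<^sup>2 / l ^ 6) / m0" .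
      have "legendre_eig n * a r * (mode_v n \<omega> k 0 r)\<^sup>2 \<le> l * a1 * (C1\<^sup>2 / l ^ 6)"
        using r a_nonneg[of r] a_upper[of r] a1_nonneg l legendre_eig_nonneg[of n] sq[OF C1(2)[rule_format, OF \<omega>, of r n, folded l_def]]
        by (intro mult_mono) (auto simp: l_def)
      then have 3: "legendre_eig n * a r * (mode_v n \<omega> k 0 r)\<^sup>2 \<le> a1 * C1\<^sup>2 * (l / l ^ 6)" by (simp add: mult_ac)
      have "edens (legendre_eig n) (mode_v n \<omega> k) (mode_v n \<omega> (Suc k)) (mode_w n \<omega> k) 0 r
          \<le> (m1 * (R0 + 1)\<^sup>2 * C2\<^sup>2 * (1 / l ^ 6) + C3\<^sup>2 / m0 * (1 / l ^ 6) + a1 * C1\<^sup>2 * (l / l ^ 6)) / 2"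
        unfolding edens_def using 1 2 3 by (intro divide_right_mono add_mono) (simp_all add: mult_ac)
      also have "\<dots> \<le> (m1 * (R0 + 1)\<^sup>2 * C2\<^sup>2 * (1 / l ^ 4) + C3\<^sup>2 / m0 * (1 / l ^ 4) + a1 * C1\<^sup>2 * (1 / l ^ 4)) / 2"
        using l64 l54 m1_pos m0 a1_nonneg by (intro divide_right_mono add_mono mult_left_mono) auto
      also have "\<dots> = D / l ^ 4" by (simp add: D_def add_divide_distrib)
      finally show ?thesis .
    qed
    have "menergy n \<omega> k \<le> integral {0..R0 + 1} (\<lambda>_. D / l ^ 4)"
      unfolding menergy_def using e
      by (intro integral_le integrable_continuous_real edens_continuous mode_basic continuous_intros) auto
    also have "\<dots> = D * (R0 + 1) / l ^ 4" using r0 by simp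
    finally show "menergy n \<omega> k \<le> D * (R0 + 1) / (1 + legendre_eig n) ^ 4" by (simp add: l_def)
  qed
qed

end

section \<open>Reconstruction from the modes and uniform decay\<close>

lemma smean_kernel_diff:
  assumes "continuous_on UNIV \<kappa>" "continuous_on UNIV \<kappa>'" "smooth f"
  shows "smean (\<lambda>q. \<kappa> q - \<kappa>' q) f t r = smean \<kappa> f t r - smean \<kappa>' f t r"
  unfolding smean_def right_diff_distrib
  by (rule integral_diff[OF smean_integrable[OF assms(1,3)] smean_integrable[OF assms(2,3)]])

lemma smean_zkernel_sum:
  assumes f: "smooth f"
  shows "smean (zkernel (\<Sum>n\<in>A. smult (b n) (P n)) \<omega>) f t r = (\<Sum>n\<in>A. b n * smean (zkernel (P n) \<omega>) f t r)"
proof (cases "finite A")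
  case True
  have "smean (zkernel (\<Sum>n\<in>A. smult (b n) (P n)) \<omega>) f t r
      = integral sbox (\<lambda>q. \<Sum>n\<in>A. b n * (f (t, sph r (fst q) (snd q)) * zkernel (P n) \<omega> q))"
    unfolding smean_def zkernel_def poly_sum poly_smult sum_distrib_left sum_distrib_right by (simp only: mult_ac)
  also have "\<dots> = (\<Sum>n\<in>A. integral sbox (\<lambda>q. b n * (f (t, sph r (fst q) (snd q)) * zkernel (P n) \<omega> q)))"
    by (intro integral_sum True integrable_on_mult_right smean_integrable zkernel_continuous f)
  finally show ?thesis by (simp add: smean_def)
qed (simp add: smean_def zkernel_def)

lemma sphere_lap_const: "sphere_lap (\<lambda>p. c) = (\<lambda>p. 0)"
proof -
  have D: "Dx i (\<lambda>p. c) = (\<lambda>p. 0)" for i and c :: real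
    unfolding Dx_def by (rule ext) (simp add: pd_eq[OF has_derivative_const])
  show ?thesis unfolding sphere_lap_def[abs_def] D by simp
qed

text \<open>For n > 0 the Laplacian of a constant is 0 while the eigenvalue is not, so the mean of
  the kernel vanishes for every \<omega>.\<close>

lemma smean_zkernel_legendre_1:
  assumes "norm \<omega> = 1"
  shows "smean (zkernel (legendre_P n) \<omega>) (\<lambda>p. 1) t r = (if n = 0 then 4 * pi else 0)"
proof (cases "n = 0")
  case True
  have c: "continuous_on UNIV (\<lambda>q::real \<times> real. sin (fst q))" by (intro continuous_intros)
  have "(sin has_integral (- cos pi) - (- cos 0)) {0..pi}"
    by (rule fundamental_theorem_of_calculus)
      (auto intro!: derivative_eq_intros simp flip: has_real_derivative_iff_has_vector_derivative)
  then have s: "integral {0..pi} sin = 2" by (simp add: integral_unique)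
  have "integral sbox (\<lambda>q. sin (fst q)) = integral {0..pi} (\<lambda>th. integral {0..2 * pi} (\<lambda>ph. sin th))"
    by (rule sbox_integral_th_first[OF c])
  also have "\<dots> = integral {0..pi} (\<lambda>th. 2 * pi * sin th)" by simp
  also have "\<dots> = 4 * pi" using s by (simp add: integral_mult_right)
  finally show ?thesis using True by (simp add: smean_def zkernel_def legendre_P_0)
next
  case False
  have "legendre_eig n * smean (zkernel (legendre_P n) \<omega>) (\<lambda>p. 1) t r = 0"
    using smean_sphere_lap[OF smooth_const[of "1::real"] legendre_P_eigen assms, of n t r]
    unfolding sphere_lap_const by (simp add: smean_def)
  then show ?thesis using legendre_eig_ge_2[OF False] False by simp
qed

text \<open>Only the n = 0 term of the Legendre expansion survives. This gives the mass of the
  kernel at every \<omega> without rotating the sphere.\<close>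

lemma smean_peak_1:
  assumes "norm \<omega> = 1"
  shows "smean (zkernel (peak N) \<omega>) (\<lambda>p. 1) t r = 4 * pi / (real N + 1)"
proof -
  obtain b where b: "peak N = (\<Sum>n\<le>N. smult (b n) (legendre_P n))" "b 0 = 1 / (real N + 1)"
    by (rule peak_expansion)
  have "smean (zkernel (peak N) \<omega>) (\<lambda>p. 1) t r = (\<Sum>n\<le>N. b n * (if n = 0 then 4 * pi else 0))"
    unfolding b(1) smean_zkernel_sum[OF smooth_const] smean_zkernel_legendre_1[OF assms] ..
  also have "\<dots> = (\<Sum>n\<le>N. if n = 0 then b 0 * (4 * pi) else 0)" by (rule sum.cong) auto
  finally show ?thesis by (simp add: b(2))
qed

text \<open>The normalised kernels \<open>(N + 1) / (4 \<pi>) ((1 + \<omega> \<bullet> x) / 2)\<^sup>N\<close> are an approximate identity at \<open>\<omega>\<close>.\<close>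

lemma peak_reconstruction_bound:
  fixes f :: "pt \<Rightarrow> real"
  assumes f: "smooth f" and \<omega>: "norm \<omega> = 1"
    and S: "\<And>N. (real N + 1) / (4 * pi) * \<bar>smean (zkernel (peak N) \<omega>) f t r\<bar> \<le> S"
  shows "\<bar>f (t, r *\<^sub>R \<omega>)\<bar> \<le> S"
proof (rule field_le_epsilon)
  fix e :: real assume e: "e > 0"
  define c where "c = f (t, r *\<^sub>R \<omega>)"
  have fc: "continuous_on UNIV (\<lambda>x. f (t, r *\<^sub>R x))"
    by (intro smooth_comp_continuous[OF f] continuous_intros)
  then obtain d where d: "d > 0" "\<And>x. dist x \<omega> < d \<Longrightarrow> dist (f (t, r *\<^sub>R x)) c < e"
    using e unfolding continuous_on_iff c_def by force
  have "bounded ((\<lambda>x. f (t, r *\<^sub>R x)) ` cball 0 1)"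
    by (intro compact_imp_bounded compact_continuous_image continuous_on_subset[OF fc] compact_cball) auto
  then obtain B where B: "\<And>x. norm x \<le> 1 \<Longrightarrow> \<bar>f (t, r *\<^sub>R x)\<bar> \<le> B" by (force simp: bounded_iff)
  have B0: "B \<ge> 0" using B[of 0] by simp
  \<comment> \<open>At distance at least d from \<omega> on the unit sphere, \<omega> \<bullet> x
    \<le> 1 - d^2/2, so the base of the power is at most 1 - d^2/4.\<close>
  define q where "q = max 0 (1 - d\<^sup>2 / 4)"
  have q: "0 \<le> q" "q < 1" using d(1) by (auto simp: q_def)
  have close: "\<bar>f (t, r *\<^sub>R x) - c\<bar> * ((1 + \<omega> \<bullet> x) / 2) ^ N \<le> e * ((1 + \<omega> \<bullet> x) / 2) ^ N + 2 * B * q ^ N"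
    if x: "norm x = 1" for x N
  proof -
    define y where "y = (1 + \<omega> \<bullet> x) / 2"
    have "\<bar>\<omega> \<bullet> x\<bar> \<le> 1" using Cauchy_Schwarz_ineq2[of \<omega> x] \<omega> x by simp
    then have y: "y \<ge> 0" by (auto simp: y_def abs_le_iff)
    have "\<bar>f (t, r *\<^sub>R x) - c\<bar> * y ^ N \<le> e * y ^ N + 2 * B * q ^ N"
    proof (cases "dist x \<omega> < d")
      case True
      then have "\<bar>f (t, r *\<^sub>R x) - c\<bar> \<le> e" using d(2)[OF True] by (simp add: dist_real_def)
      then have "\<bar>f (t, r *\<^sub>R x) - c\<bar> * y ^ N \<le> e * y ^ N" using y by (intro mult_right_mono) auto
      moreover have "0 \<le> 2 * B * q ^ N" using B0 q by simp
      ultimately show ?thesis by linarith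
    next
      case False
      then have "d\<^sup>2 \<le> (norm (x - \<omega>))\<^sup>2" using d(1) by (intro power_mono) (auto simp: dist_norm)
      also have "\<dots> = 2 - 2 * (\<omega> \<bullet> x)"
        using x \<omega> by (simp add: power2_norm_eq_inner inner_diff inner_commute norm_eq_1)
      finally have "y \<le> q" by (simp add: y_def q_def le_max_iff_disj field_simps)
      then have yq: "y ^ N \<le> q ^ N" using y by (intro power_mono)
      have "\<bar>f (t, r *\<^sub>R x)\<bar> \<le> B" "\<bar>c\<bar> \<le> B" unfolding c_def using B x \<omega> by auto
      then have "\<bar>f (t, r *\<^sub>R x) - c\<bar> \<le> 2 * B" by linarith
      then have "\<bar>f (t, r *\<^sub>R x) - c\<bar> * y ^ N \<le> 2 * B * q ^ N" using y yq B0 by (intro mult_mono) auto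
      moreover have "0 \<le> e * y ^ N" using e y by simp
      ultimately show ?thesis by linarith
    qed
    then show ?thesis by (simp add: y_def)
  qed
  have main: "\<bar>c\<bar> \<le> S + e + B * pi * ((real N + 1) * q ^ N)" for N
  proof -
    let ?k = "zkernel (peak N) \<omega>" and ?g = "\<lambda>q. f (t, sph r (fst q) (snd q))"
    have i1: "(\<lambda>p. ?g p * ?k p) integrable_on sbox" by (rule smean_integrable[OF zkernel_continuous f])
    have i2: "?k integrable_on sbox" using smean_integrable[OF zkernel_continuous smooth_const[of "1::real"]] by simp
    have mass: "integral sbox ?k = 4 * pi / (real N + 1)" using smean_peak_1[OF \<omega>, of N 0 0] by (simp add: smean_def)
    have i3: "(\<lambda>p. 2 * B * q ^ N) integrable_on sbox" unfolding sbox_def by (rule integrable_const)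
    have "norm (integral sbox (\<lambda>p. ?g p * ?k p - c * ?k p)) \<le> integral sbox (\<lambda>p. e * ?k p + 2 * B * q ^ N)"
    proof (rule integral_norm_bound_integral)
      show "(\<lambda>p. ?g p * ?k p - c * ?k p) integrable_on sbox"
        by (intro integrable_diff integrable_on_mult_right i1 i2)
      show "(\<lambda>p. e * ?k p + 2 * B * q ^ N) integrable_on sbox"
        by (intro integrable_add integrable_on_mult_right i2 i3)
      fix p assume p: "p \<in> sbox"
      let ?x = "sph 1 (fst p) (snd p)"
      have s: "0 \<le> sin (fst p)" "sin (fst p) \<le> 1" using p by (auto simp: sbox_mem intro: sin_ge_zero)
      have cl: "\<bar>?g p - c\<bar> * ((1 + \<omega> \<bullet> ?x) / 2) ^ N \<le> e * ((1 + \<omega> \<bullet> ?x) / 2) ^ N + 2 * B * q ^ N"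
        using close[of ?x N] sph_scale[of r "fst p" "snd p"] by (simp add: norm_sph)
      have k: "?k p = ((1 + \<omega> \<bullet> ?x) / 2) ^ N * sin (fst p)" by (simp add: zkernel_def poly_peak)
      have "?k p \<ge> 0" unfolding k using s inner_sph_bounds[OF \<omega>, of "fst p" "snd p"] by simp
      then have "\<bar>?g p * ?k p - c * ?k p\<bar> = \<bar>?g p - c\<bar> * ((1 + \<omega> \<bullet> ?x) / 2) ^ N * sin (fst p)"
        unfolding left_diff_distrib[symmetric] abs_mult[of _ "?k p"] by (simp add: k mult.assoc)
      also have "\<dots> \<le> (e * ((1 + \<omega> \<bullet> ?x) / 2) ^ N + 2 * B * q ^ N) * sin (fst p)"
        by (rule mult_right_mono[OF cl s(1)])
      also have "\<dots> = e * ?k p + 2 * B * q ^ N * sin (fst p)" by (simp add: k distrib_right)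
      also have "\<dots> \<le> e * ?k p + 2 * B * q ^ N * 1" using s B0 q by (intro add_left_mono mult_left_mono) auto
      finally show "norm (?g p * ?k p - c * ?k p) \<le> e * ?k p + 2 * B * q ^ N" by simp
    qed
    also have "integral sbox (\<lambda>p. e * ?k p + 2 * B * q ^ N) = e * (4 * pi / (real N + 1)) + 2 * B * q ^ N * (2 * pi\<^sup>2)"
    proof -
      have "integral sbox (\<lambda>p. 2 * B * q ^ N) = 2 * B * q ^ N * (2 * pi\<^sup>2)"
        unfolding sbox_def integral_const using content_sbox by simp
      then show ?thesis
        using integral_add[OF integrable_on_mult_right[OF i2, of e] i3] mass by simp
    qed
    also have "integral sbox (\<lambda>p. ?g p * ?k p - c * ?k p) = smean ?k f t r - c * (4 * pi / (real N + 1))"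
      using integral_diff[OF i1 integrable_on_mult_right[OF i2, of c]] mass by (simp add: smean_def)
    finally have le: "\<bar>smean ?k f t r - c * (4 * pi / (real N + 1))\<bar> \<le> e * (4 * pi / (real N + 1)) + 2 * B * q ^ N * (2 * pi\<^sup>2)" by (simp only: real_norm_def)
    define z where "z = (real N + 1) / (4 * pi)"
    have z: "z > 0" "z * (4 * pi / (real N + 1)) = 1" by (auto simp: z_def)
    have "\<bar>z * smean ?k f t r - c\<bar> = z * \<bar>smean ?k f t r - c * (4 * pi / (real N + 1))\<bar>"
    proof -
      have "z * (smean ?k f t r - c * (4 * pi / (real N + 1))) = z * smean ?k f t r - c * (z * (4 * pi / (real N + 1)))"
        by (simp only: right_diff_distrib mult.left_commute)
      then have "z * smean ?k f t r - c = z * (smean ?k f t r - c * (4 * pi / (real N + 1)))"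
        unfolding z(2) by (simp only: mult_1_right)
      then show ?thesis using z(1) by (simp add: abs_mult)
    qed
    also have "\<dots> \<le> z * (e * (4 * pi / (real N + 1)) + 2 * B * q ^ N * (2 * pi\<^sup>2))" using le z(1) by (intro mult_left_mono) auto
    also have "\<dots> = e * (z * (4 * pi / (real N + 1))) + B * pi * ((real N + 1) * q ^ N)"
    proof -
      have "z * (2 * B * q ^ N * (2 * pi\<^sup>2)) = B * pi * ((real N + 1) * q ^ N)" by (simp add: z_def power2_eq_square)
      then show ?thesis by (simp only: distrib_left mult.left_commute)
    qed
    also have "\<dots> = e + B * pi * ((real N + 1) * q ^ N)" unfolding z(2) by (simp only: mult_1_right)
    finally have "\<bar>z * smean ?k f t r - c\<bar> \<le> e + B * pi * ((real N + 1) * q ^ N)" .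
    moreover have "\<bar>z * smean ?k f t r\<bar> \<le> S" using S[of N] z(1) by (simp add: abs_mult z_def)
    ultimately show ?thesis by linarith
  qed
  \<comment> \<open>The normalisation costs a factor N + 1 away from \<omega>, which the geometric
    decay q^N overcomes.\<close>
  have "(\<lambda>N. real N * q ^ N + q ^ N) \<longlonglongrightarrow> 0 + 0"
    using powser_times_n_limit_0[of q] q by (intro tendsto_add LIMSEQ_power_zero) auto
  then have "(\<lambda>N. S + e + B * pi * ((real N + 1) * q ^ N)) \<longlonglongrightarrow> S + e + B * pi * 0"
    by (intro tendsto_intros) (simp add: distrib_right)
  then have "\<bar>c\<bar> \<le> S + e + B * pi * 0"
    by (rule LIMSEQ_le_const) (use main in blast)
  then show "\<bar>f (t, r *\<^sub>R \<omega>)\<bar> \<le> S + e" by (simp add: c_def)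
qed

lemma summable_legendre_eig: "summable (\<lambda>n. 1 / (1 + legendre_eig n))"
proof (rule summable_comparison_test)
  have "summable (\<lambda>n. inverse (real (Suc n) ^ 2))"
    using inverse_power_summable[of 2, where 'a = real] by (subst summable_Suc_iff) auto
  then show "summable (\<lambda>n. 2 * inverse (real (Suc n) ^ 2))" by (rule summable_mult)
  have "1 / (1 + legendre_eig n) \<le> 2 * inverse (real (Suc n) ^ 2)" for n
  proof -
    have "real (Suc n) ^ 2 \<le> 2 * (1 + legendre_eig n)" by (simp add: legendre_eig_def power2_eq_square algebra_simps)
    then show ?thesis using legendre_eig_nonneg[of n] by (simp add: divide_simps del: of_nat_Suc)
  qed
  then show "\<exists>N. \<forall>n\<ge>N. norm (1 / (1 + legendre_eig n)) \<le> 2 * inverse (real (Suc n) ^ 2)"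
    using legendre_eig_nonneg by simp
qed

lemma polar_unit:
  fixes x :: "real^3"
  obtains \<omega> where "norm \<omega> = 1" "x = norm x *\<^sub>R \<omega>"
proof (cases "x = 0")
  case True
  then show ?thesis using that[of "axis 1 1"] by simp
next
  case False
  then show ?thesis using that[of "(1 / norm x) *\<^sub>R x"] by simp
qed

lemma weighted_mode_le:
  assumes "\<bar>v\<bar> \<le> C / (1 + legendre_eig n)\<^sup>2"
  shows "(1 + legendre_eig n) * \<bar>v\<bar> \<le> C * (1 / (1 + legendre_eig n))"
proof -
  define l where "l = 1 + legendre_eig n"
  have l: "l > 0" using legendre_eig_nonneg[of n] by (simp add: l_def)
  have "l * \<bar>v\<bar> \<le> l * (C / l\<^sup>2)" using assms l by (intro mult_left_mono) (auto simp: l_def)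
  also have "\<dots> = C * (1 / l)" using l by (simp add: power2_eq_square)
  finally show ?thesis by (simp add: l_def)
qed

context wave_solution
begin

text \<open>The factor (N+1)/(4 pi) of the kernel meets the coefficient bound 16 (1 + n(n+1)) /
  (N+1): N cancels, and 4/pi with one power of the eigenvalue factor remains.\<close>

lemma F_le_mode_sum:
  assumes \<omega>: "norm \<omega> = 1"
    and S: "\<And>N. 4 / pi * (\<Sum>n\<le>N. (1 + legendre_eig n) * \<bar>mode_v n \<omega> 0 t r\<bar>) \<le> S"
  shows "\<bar>F (t, r *\<^sub>R \<omega>)\<bar> \<le> S"
proof (rule peak_reconstruction_bound[OF F \<omega>])
  fix N
  obtain b where b: "peak N = (\<Sum>n\<le>N. smult (b n) (legendre_P n))"
    "\<And>n. n \<le> N \<Longrightarrow> \<bar>b n\<bar> \<le> 16 * (legendre_eig n + 1) / (real N + 1)"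
    by (rule peak_expansion) blast
  have "\<bar>smean (zkernel (peak N) \<omega>) F t r\<bar> = \<bar>\<Sum>n\<le>N. b n * mode_v n \<omega> 0 t r\<bar>"
    unfolding b(1) smean_zkernel_sum[OF F] by (simp add: mode_v_def)
  also have "\<dots> \<le> (\<Sum>n\<le>N. \<bar>b n * mode_v n \<omega> 0 t r\<bar>)" by (rule sum_abs)
  also have "\<dots> \<le> (\<Sum>n\<le>N. 16 / (real N + 1) * ((1 + legendre_eig n) * \<bar>mode_v n \<omega> 0 t r\<bar>))"
  proof (rule sum_mono)
    fix n assume "n \<in> {..N}"
    then have "\<bar>b n\<bar> * \<bar>mode_v n \<omega> 0 t r\<bar> \<le> 16 * (legendre_eig n + 1) / (real N + 1) * \<bar>mode_v n \<omega> 0 t r\<bar>"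
      using b(2) by (intro mult_right_mono) auto
    then show "\<bar>b n * mode_v n \<omega> 0 t r\<bar> \<le> 16 / (real N + 1) * ((1 + legendre_eig n) * \<bar>mode_v n \<omega> 0 t r\<bar>)"
      by (simp add: abs_mult algebra_simps add_divide_distrib)
  qed
  finally have "\<bar>smean (zkernel (peak N) \<omega>) F t r\<bar> \<le> 16 / (real N + 1) * (\<Sum>n\<le>N. (1 + legendre_eig n) * \<bar>mode_v n \<omega> 0 t r\<bar>)"
    by (simp only: sum_distrib_left)
  then have "(real N + 1) / (4 * pi) * \<bar>smean (zkernel (peak N) \<omega>) F t r\<bar>
      \<le> (real N + 1) / (4 * pi) * (16 / (real N + 1) * (\<Sum>n\<le>N. (1 + legendre_eig n) * \<bar>mode_v n \<omega> 0 t r\<bar>))"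
    by (intro mult_left_mono) auto
  also have "\<dots> = 4 / pi * (\<Sum>n\<le>N. (1 + legendre_eig n) * \<bar>mode_v n \<omega> 0 t r\<bar>)" by simp
  also have "\<dots> \<le> S" by (rule S)
  finally show "(real N + 1) / (4 * pi) * \<bar>smean (zkernel (peak N) \<omega>) F t r\<bar> \<le> S" .
qed

text \<open>The two quantities bounded here are exactly those entering \<open>vbound\<close> for the
  undifferentiated mode; one constant is made to serve both.\<close>

lemma mode_energies:
  shows "\<exists>C\<ge>0. \<forall>n \<omega>. norm \<omega> = 1 \<longrightarrow> menergy n \<omega> 0 \<le> C / (1 + legendre_eig n) ^ 4 \<and>
    sqrt (menergy n \<omega> 0 * menergy n \<omega> 2) \<le> C / (1 + legendre_eig n) ^ 4"
proof -
  obtain A where A: "A \<ge> 0" "\<And>n \<omega>. norm \<omega> = 1 \<Longrightarrow> menergy n \<omega> 0 \<le> A / (1 + legendre_eig n) ^ 4"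
    by (rule menergy_decay[of 0]) blast
  obtain B where B: "B \<ge> 0" "\<And>n \<omega>. norm \<omega> = 1 \<Longrightarrow> menergy n \<omega> 2 \<le> B / (1 + legendre_eig n) ^ 4"
    by (rule menergy_decay[of 2]) blast
  show ?thesis
  proof (intro exI[of _ "A + B"] conjI allI impI)
    show "0 \<le> A + B" using A B by simp
    fix n and \<omega> :: "real^3" assume \<omega>: "norm \<omega> = 1"
    interpret m: radial_wave \<mu> \<mu>' a m0 m1 a1 c1 \<rho>1 "legendre_eig n" "mode_v n \<omega>" "mode_w n \<omega>" r0 R0
      by (rule mode_radial_wave[OF \<omega>])
    have en: "m.energy k = menergy n \<omega> k" for k unfolding m.energy_def menergy_def ..
    have nn: "menergy n \<omega> k \<ge> 0" for k using m.energy_nonneg[of k] en by simp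
    define l where "l = (1 + legendre_eig n) ^ 4"
    have l: "l > 0" using legendre_eig_nonneg[of n] by (simp add: l_def)
    have "A / l \<le> (A + B) / l" "B / l \<le> (A + B) / l" using A B l by (auto intro!: divide_right_mono)
    then have e: "menergy n \<omega> 0 \<le> (A + B) / l" "menergy n \<omega> 2 \<le> (A + B) / l"
      using A(2)[OF \<omega>, of n] B(2)[OF \<omega>, of n] unfolding l_def by linarith+
    show "menergy n \<omega> 0 \<le> (A + B) / (1 + legendre_eig n) ^ 4" using e by (simp add: l_def)
    have "menergy n \<omega> 0 * menergy n \<omega> 2 \<le> ((A + B) / l)\<^sup>2"
      unfolding power2_eq_square using e nn A B l by (intro mult_mono) auto
    then have "sqrt (menergy n \<omega> 0 * menergy n \<omega> 2) \<le> (A + B) / l"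
      using A B l by (intro real_le_lsqrt) auto
    then show "sqrt (menergy n \<omega> 0 * menergy n \<omega> 2) \<le> (A + B) / (1 + legendre_eig n) ^ 4" by (simp add: l_def)
  qed
qed

text \<open>The square of \<open>vbound\<close> is linear in quantities of order l^-4, with l = 1 +
  n(n+1), hence the exponent 2.\<close>

lemma mode_bound:
  assumes R: "R > 0"
  shows "\<exists>C\<ge>0. \<forall>n \<omega> t r. norm \<omega> = 1 \<longrightarrow> 0 \<le> t \<longrightarrow> 0 \<le> r \<longrightarrow> r \<le> R \<longrightarrow>
    \<bar>mode_v n \<omega> 0 t r\<bar> \<le> C / (1 + legendre_eig n)\<^sup>2"
proof -
  obtain E where E: "E \<ge> 0" "\<And>n \<omega>. norm \<omega> = 1 \<Longrightarrow> menergy n \<omega> 0 \<le> E / (1 + legendre_eig n) ^ 4 \<and>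
    sqrt (menergy n \<omega> 0 * menergy n \<omega> 2) \<le> E / (1 + legendre_eig n) ^ 4" using mode_energies by auto
  define C where "C = sqrt (2 * m1 * E / R + 2 * m1 ^ 3 * E * R)"
  have Cn: "2 * m1 * E / R + 2 * m1 ^ 3 * E * R \<ge> 0" using m1_pos E(1) R by simp
  show ?thesis
  proof (intro exI[of _ C] conjI allI impI)
    show "C \<ge> 0" using Cn by (simp add: C_def)
    fix n and \<omega> :: "real^3" and t r :: real assume \<omega>: "norm \<omega> = 1" and t: "0 \<le> t" and r: "0 \<le> r" "r \<le> R"
    interpret m: radial_wave \<mu> \<mu>' a m0 m1 a1 c1 \<rho>1 "legendre_eig n" "mode_v n \<omega>" "mode_w n \<omega>" r0 R0
      by (rule mode_radial_wave[OF \<omega>])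
    have en: "m.energy k = menergy n \<omega> k" for k unfolding m.energy_def menergy_def ..
    define l where "l = 1 + legendre_eig n"
    have l: "l > 0" using legendre_eig_nonneg[of n] by (simp add: l_def)
    have e: "menergy n \<omega> 0 \<le> E / l ^ 4" "sqrt (menergy n \<omega> 0 * menergy n \<omega> 2) \<le> E / l ^ 4"
      using E(2)[OF \<omega>] by (auto simp: l_def)
    have "2 * m1 * menergy n \<omega> 0 / R + 2 * m1 ^ 3 * sqrt (menergy n \<omega> 0 * menergy n \<omega> 2) * R
        \<le> 2 * m1 * (E / l ^ 4) / R + 2 * m1 ^ 3 * (E / l ^ 4) * R"
      using e m1_pos R by (intro add_mono divide_right_mono mult_right_mono mult_left_mono) auto
    also have "\<dots> = (C / l\<^sup>2)\<^sup>2"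
      unfolding C_def power_divide real_sqrt_pow2[OF Cn] using l R by (simp add: field_simps flip: power_mult)
    finally have "m.vbound 0 R \<le> C / l\<^sup>2"
      unfolding m.vbound_def en add_0 using \<open>C \<ge> 0\<close> l by (intro real_le_lsqrt) auto
    then show "\<bar>mode_v n \<omega> 0 t r\<bar> \<le> C / (1 + legendre_eig n)\<^sup>2"
      using m.v_bound[of t r R 0] t r R unfolding l_def by linarith
  qed
qed

text \<open>Decay at finitely many positive radii suffices: \<open>v_square_inward\<close> carries
  it from each grid radius to the stretch just inside, including the origin, with a loss
  proportional to the mesh and uniform in time.\<close>

lemma mode_decay_uniform_r:
  assumes \<omega>: "norm \<omega> = 1" and R: "R > 0" and e: "e > 0"
  shows "\<forall>\<^sub>F t in at_top. \<forall>r\<in>{0..R}. \<bar>mode_v n \<omega> 0 t r\<bar> \<le> e"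
proof -
  interpret m: radial_wave \<mu> \<mu>' a m0 m1 a1 c1 \<rho>1 "legendre_eig n" "mode_v n \<omega>" "mode_w n \<omega>" r0 R0
    by (rule mode_radial_wave[OF \<omega>])
  define c where "c = 2 * m1 ^ 3 * sqrt (m.energy 0 * m.energy (0 + 2))"
  have c: "c \<ge> 0" unfolding c_def using m1_pos m.energy_nonneg by simp
  \<comment> \<open>The mesh R/M makes the inward loss at most e^2/2; together with (e/2)^2 from the
    grid point it stays below e^2.\<close>
  obtain M :: nat where M: "real M > 2 * c * R / e\<^sup>2" using reals_Archimedean2 by blast
  then have M': "real M > 0" using c R e by (smt (verit) divide_nonneg_nonneg mult_nonneg_nonneg zero_le_power2)
  have cM: "c * (R / M) \<le> e\<^sup>2 / 2" using M M' e by (simp add: field_simps)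
  \<comment> \<open>Each r uses the next grid radius strictly outside it. For r = R this has index M
    + 1, one step beyond R.\<close>
  define \<rho> where "\<rho> j = R / M * real j" for j :: nat
  have \<rho>: "\<rho> j > 0" if "j \<ge> 1" for j using that R M' by (simp add: \<rho>_def)
  have "\<forall>\<^sub>F t in at_top. \<bar>mode_v n \<omega> 0 t (\<rho> j)\<bar> < e / 2" if "j \<in> {1..M + 1}" for j
  proof -
    have "e / 2 > 0" "1 \<le> j" using e that by auto
    then show ?thesis using m.radial_wave_decay[OF \<rho>, of j] unfolding tendsto_iff dist_real_def diff_0_right by blast
  qed
  then have "\<forall>\<^sub>F t in at_top. \<forall>j\<in>{1..M + 1}. \<bar>mode_v n \<omega> 0 t (\<rho> j)\<bar> < e / 2"
    by (intro eventually_ball_finite) auto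
  then show ?thesis using eventually_ge_at_top[of "0::real"]
  proof eventually_elim
    case (elim t)
    show ?case
    proof
      fix r assume r: "r \<in> {0..R}"
      define j where "j = nat \<lfloor>r * M / R\<rfloor> + 1"
      have f: "real (nat \<lfloor>r * M / R\<rfloor>) \<le> r * M / R" "r * M / R < real j"
      proof -
        have "0 \<le> \<lfloor>r * M / R\<rfloor>" using r R M' by simp
        then have n: "real (nat \<lfloor>r * M / R\<rfloor>) = of_int \<lfloor>r * M / R\<rfloor>" by simp
        show "real (nat \<lfloor>r * M / R\<rfloor>) \<le> r * M / R" unfolding n by (rule of_int_floor_le)
        have "r * M / R < of_int \<lfloor>r * M / R\<rfloor> + 1" by (rule real_of_int_floor_add_one_gt)
        then show "r * M / R < real j" unfolding j_def of_nat_add n by (simp only: of_nat_1)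
      qed
      have "r * M / R \<le> M" using r R M' by (simp add: field_simps)
      then have "real j \<le> M + 1" using f(1) by (simp add: j_def)
      then have j: "j \<in> {1..M + 1}" by (simp add: j_def)
      have "r \<le> \<rho> j" using f(2) R M' by (simp add: \<rho>_def field_simps)
      moreover have "\<rho> j - r \<le> R / M"
      proof -
        have "\<rho> j = R / M * real (nat \<lfloor>r * M / R\<rfloor>) + R / M" by (simp add: \<rho>_def j_def distrib_left)
        moreover have "R / M * real (nat \<lfloor>r * M / R\<rfloor>) \<le> R / M * (r * M / R)" using f(1) R M' by (intro mult_left_mono) auto
        moreover have "R / M * (r * M / R) = r" using R M' by simp
        ultimately show ?thesis by linarith
      qed
      ultimately have "(mode_v n \<omega> 0 t r)\<^sup>2 \<le> (mode_v n \<omega> 0 t (\<rho> j))\<^sup>2 + c * (R / M)"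
        using m.v_square_inward[of t r "\<rho> j" 0] elim(2) r mult_left_mono[OF _ c, of "\<rho> j - r" "R / M"] unfolding c_def by fastforce
      moreover have "(mode_v n \<omega> 0 t (\<rho> j))\<^sup>2 \<le> (e / 2)\<^sup>2"
        using elim(1) j by (intro abs_le_square_iff[THEN iffD1]) (use e in force)
      moreover have "(e / 2)\<^sup>2 + e\<^sup>2 / 2 \<le> e\<^sup>2" by (simp add: power2_eq_square)
      ultimately have "(mode_v n \<omega> 0 t r)\<^sup>2 \<le> e\<^sup>2" using cM by linarith
      then show "\<bar>mode_v n \<omega> 0 t r\<bar> \<le> e" using e abs_le_square_iff[of "mode_v n \<omega> 0 t r" e] by simp
    qed
  qed
qed

text \<open>The modes weighted by 1 + n(n+1) are summable uniformly in time and direction. Besides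
  being a bound, this is what makes the modes equicontinuous in \<omega>.\<close>

lemma F_bounded:
  assumes R: "R > 0"
  shows "\<exists>B\<ge>0. \<forall>t\<ge>0. \<forall>x. norm x \<le> R \<longrightarrow> \<bar>F (t, x)\<bar> \<le> B"
proof -
  obtain C where C: "C \<ge> 0" "\<And>n \<omega> t r. norm \<omega> = 1 \<Longrightarrow> 0 \<le> t \<Longrightarrow> 0 \<le> r \<Longrightarrow> r \<le> R \<Longrightarrow>
    \<bar>mode_v n \<omega> 0 t r\<bar> \<le> C / (1 + legendre_eig n)\<^sup>2" using mode_bound[OF R] by auto
  let ?s = "\<lambda>n. 1 / (1 + legendre_eig n)"
  show ?thesis
  proof (intro exI[of _ "4 / pi * (C * suminf ?s)"] conjI allI impI)
    have "suminf ?s \<ge> 0" using legendre_eig_nonneg by (intro suminf_nonneg summable_legendre_eig) simp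
    then show "4 / pi * (C * suminf ?s) \<ge> 0" using C(1) by simp
    fix t :: real and x :: "real^3" assume t: "t \<ge> 0" and x: "norm x \<le> R"
    obtain \<omega> where \<omega>: "norm \<omega> = 1" "x = norm x *\<^sub>R \<omega>" by (rule polar_unit)
    have "\<bar>F (t, norm x *\<^sub>R \<omega>)\<bar> \<le> 4 / pi * (C * suminf ?s)"
    proof (rule F_le_mode_sum[OF \<omega>(1)])
      fix N
      have "(\<Sum>n\<le>N. (1 + legendre_eig n) * \<bar>mode_v n \<omega> 0 t (norm x)\<bar>) \<le> (\<Sum>n\<le>N. C * ?s n)"
        by (intro sum_mono weighted_mode_le C(2)) (use \<omega> t x in auto)
      also have "\<dots> = C * (\<Sum>n\<le>N. ?s n)" by (simp only: sum_distrib_left)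
      also have "\<dots> \<le> C * suminf ?s"
        using C(1) legendre_eig_nonneg by (intro mult_left_mono sum_le_suminf summable_legendre_eig) auto
      finally show "4 / pi * (\<Sum>n\<le>N. (1 + legendre_eig n) * \<bar>mode_v n \<omega> 0 t (norm x)\<bar>) \<le> 4 / pi * (C * suminf ?s)"
        by (intro mult_left_mono) auto
    qed
    then show "\<bar>F (t, x)\<bar> \<le> 4 / pi * (C * suminf ?s)" using \<omega>(2) by simp
  qed
qed

text \<open>Directions are handled by compactness of the sphere: close directions have uniformly
  close kernels, and F is bounded, so a finite net of directions suffices.\<close>

lemma mode_decay_uniform:
  assumes R: "R > 0" and e: "e > 0"
  shows "\<forall>\<^sub>F t in at_top. \<forall>\<omega>. norm \<omega> = 1 \<longrightarrow> (\<forall>r\<in>{0..R}. \<bar>mode_v n \<omega> 0 t r\<bar> \<le> e)"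
proof -
  obtain B where B: "B \<ge> 0" "\<And>t x. t \<ge> 0 \<Longrightarrow> norm x \<le> R \<Longrightarrow> \<bar>F (t, x)\<bar> \<le> B" using F_bounded[OF R] by auto
  \<comment> \<open>A kernel change of at most \<eta> alters the mean by at most B \<eta> 2 pi^2
    \<le> e/2; B + 1 in place of B keeps the denominator positive.\<close>
  define \<eta> where "\<eta> = e / (4 * pi\<^sup>2 * (B + 1))"
  have \<eta>: "\<eta> > 0" using e B(1) by (simp add: \<eta>_def)
  have B\<eta>: "B * \<eta> * (2 * pi\<^sup>2) \<le> e / 2"
  proof -
    have "B * \<eta> * (2 * pi\<^sup>2) \<le> (B + 1) * \<eta> * (2 * pi\<^sup>2)" using \<eta> by (intro mult_right_mono) auto
    also have "\<dots> = e / 2"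
    proof -
      have "B + 1 \<noteq> 0" using B(1) by simp
      then show ?thesis unfolding \<eta>_def by (simp add: divide_simps)
    qed
    finally show ?thesis .
  qed
  have "uniformly_continuous_on {-1..1} (poly (legendre_P n))"
    by (intro compact_uniformly_continuous continuous_intros compact_Icc)
  then obtain \<delta> where \<delta>: "\<delta> > 0" "\<And>x y. x \<in> {-1..1} \<Longrightarrow> y \<in> {-1..1} \<Longrightarrow> dist y x < \<delta> \<Longrightarrow>
      dist (poly (legendre_P n) y) (poly (legendre_P n) x) < \<eta>"
    unfolding uniformly_continuous_on_def using \<eta> by metis
  obtain A where A: "A \<subseteq> sphere 0 1" "finite A" "sphere 0 1 \<subseteq> (\<Union>c\<in>A. ball (c :: real^3) \<delta>)"
    by (rule compactE_image[of "sphere (0 :: real^3) 1" "sphere 0 1" "\<lambda>c. ball c \<delta>"]) (use \<delta>(1) in auto)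
  have "\<forall>\<^sub>F t in at_top. \<forall>\<omega>\<in>A. \<forall>r\<in>{0..R}. \<bar>mode_v n \<omega> 0 t r\<bar> \<le> e / 2"
    using A(1) e by (intro eventually_ball_finite[OF A(2)] ballI mode_decay_uniform_r R) auto
  then show ?thesis using eventually_ge_at_top[of "0::real"]
  proof eventually_elim
    case (elim t)
    show ?case
    proof (intro allI impI ballI)
      fix \<omega> :: "real^3" and r assume \<omega>: "norm \<omega> = 1" and r: "r \<in> {0..R}"
      then obtain c where c: "c \<in> A" "dist c \<omega> < \<delta>" using A(3) by force
      then have c1: "norm c = 1" using A(1) by auto
      let ?k = "\<lambda>q. zkernel (legendre_P n) \<omega> q - zkernel (legendre_P n) c q"
      have "\<bar>?k q\<bar> \<le> \<eta>" for q
      proof -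
        let ?x = "sph 1 (fst q) (snd q)"
        have "dist (\<omega> \<bullet> ?x) (c \<bullet> ?x) \<le> norm (\<omega> - c) * norm ?x"
          unfolding dist_real_def inner_diff_left[symmetric] by (rule Cauchy_Schwarz_ineq2)
        also have "\<dots> < \<delta>" using c(2) by (simp add: norm_sph dist_norm norm_minus_commute)
        finally have "dist (\<omega> \<bullet> ?x) (c \<bullet> ?x) < \<delta>" .
        then have "\<bar>poly (legendre_P n) (\<omega> \<bullet> ?x) - poly (legendre_P n) (c \<bullet> ?x)\<bar> \<le> \<eta>"
          using \<delta>(2)[of "c \<bullet> ?x" "\<omega> \<bullet> ?x"] inner_sph_bounds[OF \<omega>] inner_sph_bounds[OF c1] by (simp add: dist_real_def)
        then have "\<bar>poly (legendre_P n) (\<omega> \<bullet> ?x) - poly (legendre_P n) (c \<bullet> ?x)\<bar> * \<bar>sin (fst q)\<bar> \<le> \<eta> * 1"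
          using \<eta> by (intro mult_mono) auto
        then show ?thesis by (simp add: zkernel_def abs_mult flip: left_diff_distrib)
      qed
      then have "\<bar>smean ?k F t r\<bar> \<le> B * \<eta> * (2 * pi\<^sup>2)"
        by (intro smean_abs_bound[OF _ _ F] continuous_on_diff zkernel_continuous B(2)) (use r elim(2) in auto)
      then have "\<bar>mode_v n \<omega> 0 t r - mode_v n c 0 t r\<bar> \<le> e / 2"
        using B\<eta> smean_kernel_diff[OF zkernel_continuous zkernel_continuous F, of "legendre_P n" \<omega> "legendre_P n" c t r]
        by (simp add: mode_v_def)
      moreover have "\<bar>mode_v n c 0 t r\<bar> \<le> e / 2" using elim(1) c(1) r by blast
      ultimately show "\<bar>mode_v n \<omega> 0 t r\<bar> \<le> e" by linarith
    qed
  qed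
qed

text \<open>Dominated convergence for the mode series: the tail is small uniformly in time by
  \<open>mode_bound\<close>, and finitely many modes decay uniformly in direction and
  radius.\<close>

theorem wave_decay:
  assumes R: "R > 0" and e: "e > 0"
  shows "\<forall>\<^sub>F t in at_top. \<forall>x. norm x \<le> R \<longrightarrow> \<bar>F (t, x)\<bar> \<le> e"
proof -
  obtain C where C: "C \<ge> 0" "\<And>n \<omega> t r. norm \<omega> = 1 \<Longrightarrow> 0 \<le> t \<Longrightarrow> 0 \<le> r \<Longrightarrow> r \<le> R \<Longrightarrow>
    \<bar>mode_v n \<omega> 0 t r\<bar> \<le> C / (1 + legendre_eig n)\<^sup>2" using mode_bound[OF R] by auto
  let ?s = "\<lambda>n. 1 / (1 + legendre_eig n)"
  define d where "d = e * pi / 8"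
  have d: "d > 0" "4 / pi * (d + d) = e" using e by (auto simp: d_def field_simps)
  have dC: "d / (C + 1) > 0" using d C(1) by simp
  obtain M where M: "norm (\<Sum>i. ?s (i + M)) < d / (C + 1)"
    using suminf_exist_split[OF dC summable_legendre_eig] by blast
  have tail: "C * (\<Sum>i<k. ?s (i + M)) \<le> d" for k
  proof -
    have "(\<Sum>i<k. ?s (i + M)) \<le> (\<Sum>i. ?s (i + M))"
      using legendre_eig_nonneg by (intro sum_le_suminf summable_ignore_initial_segment summable_legendre_eig) auto
    also have "\<dots> \<le> d / (C + 1)" using M by simp
    finally have "C * (\<Sum>i<k. ?s (i + M)) \<le> C * (d / (C + 1))" using C(1) by (intro mult_left_mono)
    also have "\<dots> \<le> (C + 1) * (d / (C + 1))" using dC by (intro mult_right_mono) auto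
    also have "\<dots> = d" using C(1) by simp
    finally show ?thesis .
  qed
  \<comment> \<open>The weight 1 + n(n+1) is divided out and each of the first M modes receives an
    equal share of d; M + 1 avoids a division by 0.\<close>
  define e1 where "e1 n = d / (real M + 1) / (1 + legendre_eig n)" for n
  have e1: "e1 n > 0" for n using d legendre_eig_nonneg[of n] by (simp add: e1_def)
  have "\<forall>\<^sub>F t in at_top. \<forall>n\<in>{..<M}. \<forall>\<omega>. norm \<omega> = 1 \<longrightarrow> (\<forall>r\<in>{0..R}. \<bar>mode_v n \<omega> 0 t r\<bar> \<le> e1 n)"
    by (intro eventually_ball_finite ballI mode_decay_uniform R e1) simp
  then show ?thesis using eventually_ge_at_top[of "0::real"]
  proof eventually_elim
    case (elim t)
    show ?case
    proof (intro allI impI)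
      fix x :: "real^3" assume x: "norm x \<le> R"
      obtain \<omega> where \<omega>: "norm \<omega> = 1" "x = norm x *\<^sub>R \<omega>" by (rule polar_unit)
      define u where "u n = (1 + legendre_eig n) * \<bar>mode_v n \<omega> 0 t (norm x)\<bar>" for n
      have u0: "u n \<ge> 0" for n using legendre_eig_nonneg[of n] by (simp add: u_def)
      have uC: "u n \<le> C * ?s n" for n
        unfolding u_def by (intro weighted_mode_le C(2)) (use \<omega> elim(2) x in auto)
      have uM: "u n \<le> d / (real M + 1)" if "n < M" for n
      proof -
        have "\<bar>mode_v n \<omega> 0 t (norm x)\<bar> \<le> e1 n" using elim(1) that \<omega> x by simp
        then have "u n \<le> (1 + legendre_eig n) * e1 n"
          unfolding u_def using legendre_eig_nonneg[of n] by (intro mult_left_mono) auto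
        also have "\<dots> = d / (real M + 1)" using legendre_eig_nonneg[of n] by (simp add: e1_def)
        finally show ?thesis .
      qed
      have "\<bar>F (t, norm x *\<^sub>R \<omega>)\<bar> \<le> e"
      proof (rule F_le_mode_sum[OF \<omega>(1)])
        fix N
        have split: "(\<Sum>n<M + k. u n) = (\<Sum>n<M. u n) + (\<Sum>i<k. u (i + M))" for k
          by (induction k) (simp_all add: add.commute)
        have "(\<Sum>n\<le>N. u n) \<le> (\<Sum>n<M + Suc N. u n)" using u0 by (intro sum_mono2) auto
        also have "\<dots> \<le> (\<Sum>n<M. d / (real M + 1)) + (\<Sum>i<Suc N. C * ?s (i + M))"
          unfolding split using uM uC by (intro add_mono sum_mono) auto
        also have "(\<Sum>i<Suc N. C * ?s (i + M)) \<le> d" using tail[of "Suc N"] by (simp only: sum_distrib_left)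
        also have "(\<Sum>n<M. d / (real M + 1)) \<le> d" using d(1) by (simp add: field_simps)
        finally have "(\<Sum>n\<le>N. u n) \<le> d + d" by simp
        then have "4 / pi * (\<Sum>n\<le>N. u n) \<le> 4 / pi * (d + d)" by (intro mult_left_mono) auto
        then show "4 / pi * (\<Sum>n\<le>N. (1 + legendre_eig n) * \<bar>mode_v n \<omega> 0 t (norm x)\<bar>) \<le> e"
          unfolding d(2) u_def .
      qed
      then show "\<bar>F (t, x)\<bar> \<le> e" using \<omega>(2) by simp
    qed
  qed
qed

end

section \<open>The wave equation of a particle-like geometry\<close>

text \<open>The tower of one-sided derivatives on the half-line is turned into what the radial
  locale uses: a two-sided derivative at positive points, with a continuous extension to 0.\<close>

lemma smooth_halfline_derivative:
  assumes "smooth_halfline f"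
  shows "\<exists>f'. continuous_on {0..} f \<and> continuous_on {0..} f' \<and> (\<forall>x>0. (f has_real_derivative f' x) (at x))"
proof -
  obtain D where D: "\<And>x. x \<ge> 0 \<Longrightarrow> D 0 x = f x"
    "\<And>n x. x \<ge> 0 \<Longrightarrow> (D n has_real_derivative D (Suc n) x) (at x within {0..})"
    using assms unfolding smooth_halfline_def by blast
  have c: "continuous_on {0..} (D n)" for n
    by (rule DERIV_continuous_on) (use D(2) in auto)
  show ?thesis
  proof (intro exI[of _ "D 1"] conjI allI impI c)
    show "continuous_on {0..} f" using c[of 0] continuous_on_cong[OF refl, of "{0..}" "D 0" f] D(1) by simp
    fix x :: real assume x: "x > 0"
    then have w: "at x within {0..} = at x" by (intro at_within_interior) simp
    have d: "(D 0 has_real_derivative D 1 x) (at x)" using D(2)[of x 0] x unfolding w by simp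
    have ev: "\<forall>\<^sub>F y in nhds x. D 0 y = f y"
      by (rule eventually_mono[OF eventually_nhds_in_open[of "{0<..}" x]]) (use x D(1) in auto)
    show "(f has_real_derivative D 1 x) (at x)" by (rule iffD1[OF DERIV_cong_ev[OF refl ev refl] d])
  qed
qed

text \<open>Compactness up to some b, and closeness to the limit 1 beyond it, where f lies between
  1/2 and 3/2.\<close>

lemma positive_halfline_bounds:
  fixes f :: "real \<Rightarrow> real"
  assumes c: "continuous_on {0..} f" and pos: "\<And>r. r \<ge> 0 \<Longrightarrow> f r > 0" and lim: "(f \<longlongrightarrow> 1) at_top"
  obtains m M where "m > 0" "\<And>r. r \<ge> 0 \<Longrightarrow> m \<le> f r" "\<And>r. r \<ge> 0 \<Longrightarrow> f r \<le> M"
proof -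
  have "\<forall>\<^sub>F r in at_top. dist (f r) 1 < 1 / 2" by (rule tendstoD[OF lim]) simp
  then obtain B where B: "\<And>r. r \<ge> B \<Longrightarrow> \<bar>f r - 1\<bar> < 1 / 2" unfolding eventually_at_top_linorder dist_real_def by blast
  define b where "b = max B 0"
  have cb: "continuous_on {0..b} f" by (rule continuous_on_subset[OF c]) auto
  have ne: "{0..b} \<noteq> {}" by (simp add: b_def)
  obtain x where x: "x \<in> {0..b}" "\<And>y. y \<in> {0..b} \<Longrightarrow> f x \<le> f y"
    using continuous_attains_inf[OF compact_Icc ne cb] by blast
  obtain z where z: "z \<in> {0..b}" "\<And>y. y \<in> {0..b} \<Longrightarrow> f y \<le> f z"
    using continuous_attains_sup[OF compact_Icc ne cb] by blast
  show ?thesis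
  proof (rule that[of "min (f x) (1 / 2)" "max (f z) (3 / 2)"])
    show "min (f x) (1 / 2) > 0" using pos x(1) by simp
    fix r :: real assume r: "r \<ge> 0"
    show "min (f x) (1 / 2) \<le> f r"
    proof (cases "r \<le> b")
      case False
      then have "\<bar>f r - 1\<bar> < 1 / 2" by (intro B) (simp add: b_def)
      then show ?thesis by (auto simp: abs_less_iff min_le_iff_disj)
    qed (use x(2)[of r] r in simp)
    show "f r \<le> max (f z) (3 / 2)"
    proof (cases "r \<le> b")
      case False
      then have "\<bar>f r - 1\<bar> < 1 / 2" by (intro B) (simp add: b_def)
      then show ?thesis by (auto simp: abs_less_iff le_max_iff_disj)
    qed (use z(2)[of r] r in simp)
  qed
qed

lemma bigo_inverse_tendsto_1:
  assumes "(\<lambda>r. f r - 1) \<in> O[at_top](\<lambda>r::real. 1 / r)"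
  shows "(f \<longlongrightarrow> (1 :: real)) at_top"
proof -
  have "((\<lambda>r::real. 1 / r) \<longlongrightarrow> 0) at_top"
    by (intro tendsto_divide_0[OF tendsto_const] filterlim_at_top_imp_at_infinity filterlim_ident)
  from tendsto_norm_zero[OF this] have z: "((\<lambda>r::real. \<bar>1 / r\<bar>) \<longlongrightarrow> 0) at_top" by simp
  obtain c where c: "\<forall>\<^sub>F r in at_top. norm (f r - 1) \<le> c * norm (1 / r)" using landau_o.bigE[OF assms] by blast
  have "((\<lambda>r. f r - 1) \<longlongrightarrow> 0) at_top"
    by (rule Lim_null_comparison[OF c]) (use tendsto_mult_right_zero[OF z, of c] in simp)
  then show ?thesis by (simp add: LIM_zero_iff)
qed

lemma particle_like_radial_geometry:
  assumes "particle_like T K"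
  obtains m0 m1 a1 c1 \<rho>1 where
    "radial_geometry (\<lambda>r. K r * T r) (\<lambda>r. K r * T r * (deriv T r / T r + deriv K r / K r)) (\<lambda>r. K r / T r) m0 m1 a1 c1 \<rho>1"
proof -
  have sT: "smooth_halfline T" and sK: "smooth_halfline K" and pos: "\<And>r. r \<ge> 0 \<Longrightarrow> T r > 0" "\<And>r. r \<ge> 0 \<Longrightarrow> K r > 0"
    and bT: "(\<lambda>r. T r - 1) \<in> O[at_top](\<lambda>r. 1 / r)" and bK: "(\<lambda>r. K r - 1) \<in> O[at_top](\<lambda>r. 1 / r)"
    and bd: "(\<lambda>r. deriv T r / T r + deriv K r / K r) \<in> O[at_top](\<lambda>r. 1 / r ^ 2)"
    using assms unfolding particle_like_def by auto
  obtain T' where cT: "continuous_on {0..} T" "continuous_on {0..} T'" "\<forall>x>0. (T has_real_derivative T' x) (at x)"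
    using smooth_halfline_derivative[OF sT] by (elim exE conjE)
  obtain K' where cK: "continuous_on {0..} K" "continuous_on {0..} K'" "\<forall>x>0. (K has_real_derivative K' x) (at x)"
    using smooth_halfline_derivative[OF sK] by (elim exE conjE)
  have dT: "deriv T x = T' x" and dK: "deriv K x = K' x" if "x > 0" for x
    using cT(3)[rule_format, OF that] cK(3)[rule_format, OF that] by (auto intro: DERIV_imp_deriv)
  note lT = bigo_inverse_tendsto_1[OF bT] and lK = bigo_inverse_tendsto_1[OF bK]
  have cm: "continuous_on {0..} (\<lambda>r. K r * T r)" by (intro continuous_on_mult cT(1) cK(1))
  have ca: "continuous_on {0..} (\<lambda>r. K r / T r)" by (intro continuous_on_divide cT(1) cK(1)) (use pos in force)
  obtain m0 m1 where m: "m0 > 0" "\<And>r. r \<ge> 0 \<Longrightarrow> m0 \<le> K r * T r" "\<And>r. r \<ge> 0 \<Longrightarrow> K r * T r \<le> m1"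
    by (rule positive_halfline_bounds[OF cm]) (use pos tendsto_mult[OF lK lT] in auto)
  obtain a0 a1 where a: "\<And>r. r \<ge> 0 \<Longrightarrow> K r / T r \<le> a1"
    by (rule positive_halfline_bounds[OF ca]) (use pos tendsto_divide[OF lK lT] in auto)
  obtain c where c: "c > 0" "\<forall>\<^sub>F r in at_top. norm (deriv T r / T r + deriv K r / K r) \<le> c * norm (1 / r ^ 2)"
    using landau_o.bigE[OF bd] by blast
  then obtain B where B: "\<And>r. r \<ge> B \<Longrightarrow> \<bar>deriv T r / T r + deriv K r / K r\<bar> \<le> c * (1 / r ^ 2)"
    unfolding eventually_at_top_linorder by auto
  show ?thesis
  proof (rule that[of m0 m1 a1 "m1 * c" "max B 1"], unfold_locales)
    \<comment> \<open>T'/T + K'/K is the logarithmic derivative of \<mu> = K T, so the assumed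
      O(1/r^2) on it becomes the decay of \<mu>'.\<close>
    have mu': "K r * T r * (deriv T r / T r + deriv K r / K r) = K' r * T r + T' r * K r" if "r > 0" for r
      using pos[of r] that by (simp add: dT dK field_simps)
    show "((\<lambda>r. K r * T r) has_real_derivative K r * T r * (deriv T r / T r + deriv K r / K r)) (at r)" if "r > 0" for r
      unfolding mu'[OF that] by (rule DERIV_mult[OF cK(3)[rule_format] cT(3)[rule_format]]) (use that in auto)
    have "continuous_on {0<..} (\<lambda>r. K' r * T r + T' r * K r)"
      by (intro continuous_intros continuous_on_subset[OF cT(1)] continuous_on_subset[OF cK(1)]
          continuous_on_subset[OF cT(2)] continuous_on_subset[OF cK(2)]) auto
    then show "continuous_on {0<..} (\<lambda>r. K r * T r * (deriv T r / T r + deriv K r / K r))"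
      by (rule continuous_on_eq) (use mu' in simp)
    have m1: "m1 \<ge> 0" using m(1) m(2)[of 0] m(3)[of 0] by simp
    fix r assume r: "r \<ge> max B 1"
    then have "\<bar>K r * T r\<bar> * \<bar>deriv T r / T r + deriv K r / K r\<bar> \<le> m1 * (c * (1 / r ^ 2))"
      using m1 m(3)[of r] pos[of r] B[of r] by (intro mult_mono) (auto simp: abs_mult)
    then show "\<bar>K r * T r * (deriv T r / T r + deriv K r / K r)\<bar> \<le> m1 * c / r\<^sup>2" by (simp add: abs_mult)
  qed (use cm ca m a pos in \<open>auto intro: less_imp_le\<close>)
qed

section \<open>From the complex equation to its real components\<close>

lemma linear_commutes:
  fixes f :: "pt \<Rightarrow> 'b::real_normed_vector" and L :: "'b \<Rightarrow> 'c::real_normed_vector"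
  assumes f: "smooth f" and L: "bounded_linear L"
  shows "Dt (\<lambda>p. L (f p)) = (\<lambda>p. L (Dt f p))" and "Dx i (\<lambda>p. L (f p)) = (\<lambda>p. L (Dx i f p))"
    and "grad n (\<lambda>p. L (f p)) p = L (grad n f p)" and "hess m n (\<lambda>p. L (f p)) p = L (hess m n f p)"
proof -
  interpret L: bounded_linear L by (rule L)
  show 1: "Dt (\<lambda>p. L (f p)) = (\<lambda>p. L (Dt f p))" unfolding Dt_def by (rule smooth_linear(2)[OF f L])
  have D: "Dx i (\<lambda>p. L (f p)) = (\<lambda>p. L (Dx i f p))" if "smooth f" for i and f :: "pt \<Rightarrow> 'b"
    unfolding Dx_def by (rule smooth_linear(2)[OF that L])
  show "Dx i (\<lambda>p. L (f p)) = (\<lambda>p. L (Dx i f p))" by (rule D[OF f])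
  have G: "grad n (\<lambda>p. L (f p)) p = L (grad n f p)" if "smooth f" for n p and f :: "pt \<Rightarrow> 'b"
    unfolding grad_def D[OF that] by (simp add: L.sum L.scaleR)
  show "grad n (\<lambda>p. L (f p)) p = L (grad n f p)" by (rule G[OF f])
  show "hess m n (\<lambda>p. L (f p)) p = L (hess m n f p)"
    unfolding hess_def D[OF f] by (simp add: L.sum L.scaleR G[OF smooth_Dx[OF f]])
qed

lemma linear_commutes_lap:
  fixes f :: "pt \<Rightarrow> 'b::real_normed_vector" and L :: "'b \<Rightarrow> 'c::real_normed_vector"
  assumes f: "smooth f" and L: "bounded_linear L"
  shows "lap_th (\<lambda>p. L (f p)) t r th ph = L (lap_th f t r th ph)" "lap_ph (\<lambda>p. L (f p)) t r th ph = L (lap_ph f t r th ph)"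
proof -
  interpret L: bounded_linear L by (rule L)
  show "lap_th (\<lambda>p. L (f p)) t r th ph = L (lap_th f t r th ph)" "lap_ph (\<lambda>p. L (f p)) t r th ph = L (lap_ph f t r th ph)"
    by (simp_all add: lap_th_def lap_ph_def linear_commutes[OF f L] L.add L.scaleR)
qed

text \<open>For smooth f the nested derivatives in the chart really exist, so each
  \<open>vector_derivative\<close> takes its intended value. The second \<phi>-derivative is sin
  \<theta> times \<open>lap_ph\<close>, which lowers the singular factor to 1 / sin
  \<theta>.\<close>

lemma wave_op_smooth:
  fixes \<zeta> :: "real \<Rightarrow> real^3 \<Rightarrow> complex"
  assumes f: "smooth f" and f_def: "f = (\<lambda>p. \<zeta> (fst p) (snd p))" and th: "sin th \<noteq> 0"
  shows "wave_op T K \<zeta> t r th ph =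
    - ((T r)\<^sup>2 *\<^sub>R Dt (Dt f) (t, sph r th ph)) + (1 / (K r)\<^sup>2) *\<^sub>R hess (sph 1 th ph) (sph 1 th ph) f (t, sph r th ph)
    + (2 / ((K r)\<^sup>2 * r) - (1 / (K r)\<^sup>2) * (deriv T r / T r + deriv K r / K r)) *\<^sub>R grad (sph 1 th ph) f (t, sph r th ph)
    + (1 / r\<^sup>2) *\<^sub>R ((1 / sin th) *\<^sub>R (lap_th f t r th ph + lap_ph f t r th ph))"
proof -
  have z: "\<zeta> s x = f (s, x)" for s x by (simp add: f_def)
  note vd = vector_derivative_at
  have tt: "vector_derivative (\<lambda>s. vector_derivative (\<lambda>s'. \<zeta> s' x) (at s)) (at t) = Dt (Dt f) (t, x)" for t x
    unfolding z vd[OF smooth_time_curve[OF f]] by (rule vd[OF smooth_time_curve[OF smooth_Dt[OF f]]])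
  have r1: "vector_derivative (\<lambda>\<rho>. \<zeta> t (sph \<rho> th ph)) (at r) = grad (sph 1 th ph) f (t, sph r th ph)" for r
    unfolding z by (rule vd[OF chart_derivs(1)[OF f]])
  have rr: "vector_derivative (\<lambda>\<rho>. vector_derivative (\<lambda>\<rho>'. \<zeta> t (sph \<rho>' th ph)) (at \<rho>)) (at r)
      = hess (sph 1 th ph) (sph 1 th ph) f (t, sph r th ph)"
    unfolding r1 by (rule vd[OF chart_derivs(2)[OF f]])
  have a: "vector_derivative (\<lambda>a. of_real (sin a) * vector_derivative (\<lambda>a'. \<zeta> t (sph r a' ph)) (at a)) (at th) = lap_th f t r th ph"
    unfolding z vd[OF chart_derivs(3)[OF f]] scaleR_conv_of_real[symmetric] by (rule vd[OF chart_derivs(4)[OF f]])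
  have b: "vector_derivative (\<lambda>b. vector_derivative (\<lambda>b'. \<zeta> t (sph r th b')) (at b)) (at ph) = sin th *\<^sub>R lap_ph f t r th ph"
    unfolding z vd[OF chart_derivs(5)[OF f]]
    by (rule vd, rule bounded_linear.has_vector_derivative[OF bounded_linear_scaleR_right chart_derivs(6)[OF f]])
  have s: "(1 / (sin th)\<^sup>2) *\<^sub>R (sin th *\<^sub>R lap_ph f t r th ph) = (1 / sin th) *\<^sub>R lap_ph f t r th ph"
    using th by (simp add: power2_eq_square)
  show ?thesis
    unfolding wave_op_def Let_def tt rr a b unfolding r1 scaleR_conv_of_real[symmetric] minus_mult_left[symmetric]
    unfolding s scaleR_add_right ..
qed

text \<open>The coefficients are real, so any real-linear functional passes through the equation; it
  will be applied with the real and the imaginary part.\<close>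

lemma wave_op_component:
  fixes \<zeta> :: "real \<Rightarrow> real^3 \<Rightarrow> complex" and L :: "complex \<Rightarrow> real"
  assumes f: "smooth f" and f_def: "f = (\<lambda>p. \<zeta> (fst p) (snd p))" and L: "bounded_linear L"
    and pos: "T r > 0" "K r > 0" "r > 0" and th: "sin th \<noteq> 0" and eq: "wave_op T K \<zeta> t r th ph = 0"
  shows "K r * T r * r\<^sup>2 * Dt (Dt (\<lambda>p. L (f p))) (t, sph r th ph) =
        r\<^sup>2 / (K r * T r) * hess (sph 1 th ph) (sph 1 th ph) (\<lambda>p. L (f p)) (t, sph r th ph)
        + (2 * r / (K r * T r) - r\<^sup>2 * (K r * T r * (deriv T r / T r + deriv K r / K r)) / (K r * T r)\<^sup>2)
            * grad (sph 1 th ph) (\<lambda>p. L (f p)) (t, sph r th ph)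
        + K r / T r * sphere_lap (\<lambda>p. L (f p)) (t, sph r th ph)"
proof -
  interpret L: bounded_linear L by (rule L)
  let ?F = "\<lambda>p. L (f p)"
  define q where "q = deriv T r / T r + deriv K r / K r"
  define u where "u = Dt (Dt ?F) (t, sph r th ph)"
  define h where "h = hess (sph 1 th ph) (sph 1 th ph) ?F (t, sph r th ph)"
  define g where "g = grad (sph 1 th ph) ?F (t, sph r th ph)"
  define l where "l = sphere_lap ?F (t, sph r th ph)"
  have lap: "L (lap_th f t r th ph + lap_ph f t r th ph) = sin th * l"
    unfolding L.add linear_commutes_lap[OF f L, symmetric] l_def by (rule sphere_lap_chart)
  have "L (wave_op T K \<zeta> t r th ph) = - ((T r)\<^sup>2 * u) + 1 / (K r)\<^sup>2 * h + (2 / ((K r)\<^sup>2 * r) - 1 / (K r)\<^sup>2 * q) * g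
      + 1 / r\<^sup>2 * (1 / sin th * (sin th * l))"
    unfolding wave_op_smooth[OF f f_def th] L.add[of _ "_ *\<^sub>R (_ *\<^sub>R _)"] L.scaleR[of "1 / r\<^sup>2"] L.scaleR[of "1 / sin th"] lap
    unfolding L.add linear_neg[OF L.linear] L.scaleR q_def u_def h_def g_def linear_commutes[OF f L] linear_commutes(1)[OF smooth_Dt[OF f] L]
    by simp
  then have "- ((T r)\<^sup>2 * u) + 1 / (K r)\<^sup>2 * h + (2 / ((K r)\<^sup>2 * r) - 1 / (K r)\<^sup>2 * q) * g + 1 / r\<^sup>2 * l = 0"
    using th by (simp add: eq L.zero)
  then have u: "(T r)\<^sup>2 * u = 1 / (K r)\<^sup>2 * h + (2 / ((K r)\<^sup>2 * r) - 1 / (K r)\<^sup>2 * q) * g + 1 / r\<^sup>2 * l" by linarith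
  have "K r * T r * r\<^sup>2 * u = r\<^sup>2 * K r / T r * ((T r)\<^sup>2 * u)" using pos by (simp add: power2_eq_square)
  also have "\<dots> = r\<^sup>2 / (K r * T r) * h + (2 * r / (K r * T r) - r\<^sup>2 * (K r * T r * q) / (K r * T r)\<^sup>2) * g + K r / T r * l"
    unfolding u using pos by (simp add: field_simps power2_eq_square)
  finally show ?thesis unfolding u_def h_def g_def l_def q_def .
qed

theorem mainTheorem12:
  fixes T K :: "real \<Rightarrow> real"
    and \<zeta> :: "real \<Rightarrow> real^3 \<Rightarrow> complex"
    and Z0a Z0b :: "real^3 \<Rightarrow> complex"
  assumes geom: "particle_like T K"
    and data_smooth: "smooth_on UNIV Z0a" "smooth_on UNIV Z0b"
    and data_supp: "\<exists>C. compact C \<and> 0 \<notin> C \<and> (\<forall>x. x \<notin> C \<longrightarrow> Z0a x = 0 \<and> Z0b x = 0)"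
    and sol_smooth: "smooth_on UNIV (\<lambda>p :: real \<times> (real^3). \<zeta> (fst p) (snd p))"
    and sol_supp: "\<forall>t. \<exists>C. compact C \<and> (\<forall>x. x \<notin> C \<longrightarrow> \<zeta> t x = 0)"
    and eq: "\<forall>t r th ph. r > 0 \<and> sin th \<noteq> 0 \<longrightarrow> wave_op T K \<zeta> t r th ph = 0"
    and bc: "\<forall>t th ph. ((\<lambda>\<rho>. \<zeta> t (sph \<rho> th ph)) has_vector_derivative 0) (at 0 within {0..})"
    and init0: "\<forall>x. \<zeta> 0 x = Z0a x"
    and init1: "\<forall>x. \<i> * vector_derivative (\<lambda>s. \<zeta> s x) (at 0) = Z0b x"
  shows "\<forall>R>0. \<forall>\<epsilon>>0. eventually (\<lambda>t. \<forall>x::real^3. norm x \<le> R \<longrightarrow> norm (\<zeta> t x) \<le> \<epsilon>) at_top"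
proof (intro allI impI)
  fix R \<epsilon> :: real assume R: "R > 0" and \<epsilon>: "\<epsilon> > 0"
  define f where "f = (\<lambda>p :: pt. \<zeta> (fst p) (snd p))"
  have f: "smooth f" using sol_smooth by (simp add: f_def)
  obtain m0 m1 a1 c1 \<rho>1 where geo:
    "radial_geometry (\<lambda>r. K r * T r) (\<lambda>r. K r * T r * (deriv T r / T r + deriv K r / K r)) (\<lambda>r. K r / T r) m0 m1 a1 c1 \<rho>1"
    by (rule particle_like_radial_geometry[OF geom])
  have pos: "T r > 0" "K r > 0" if "r > 0" for r using geom that unfolding particle_like_def by auto
  obtain C where C: "compact C" "0 \<notin> C" "\<And>x. x \<notin> C \<Longrightarrow> Z0a x = 0 \<and> Z0b x = 0" using data_supp by blast
  obtain r0 where r0: "r0 > 0" "\<And>x. x \<in> C \<Longrightarrow> r0 \<le> norm x"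
    using separate_point_closed[OF compact_imp_closed[OF C(1)] C(2)] by auto
  obtain B where B: "\<And>x. x \<in> C \<Longrightarrow> norm x \<le> B" using compact_imp_bounded[OF C(1)] by (auto simp: bounded_iff)
  \<comment> \<open>The maximum with r0 + 1 secures r0 < R0 even when the support C of the data is
    empty.\<close>
  define R0 where "R0 = max B (r0 + 1)"
  have data: "f (0, x) = 0 \<and> Dt f (0, x) = 0" if "norm x < r0 \<or> norm x > R0" for x
  proof -
    have "x \<notin> C" using that r0(2)[of x] B[of x] by (auto simp: R0_def)
    then have "\<zeta> 0 x = 0" "vector_derivative (\<lambda>s. \<zeta> s x) (at 0) = 0" using C(3)[of x] init0 init1[rule_format, of x] by auto
    moreover have "vector_derivative (\<lambda>s. \<zeta> s x) (at 0) = Dt f (0, x)"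
      using vector_derivative_at[OF smooth_time_curve[OF f, of x 0]] by (simp add: f_def)
    ultimately show ?thesis by (simp add: f_def)
  qed
  \<comment> \<open>All of the theory above is for real waves; the claim is proved for a general
    real-linear functional so that the real and imaginary parts share one argument, each taking half
    of \<epsilon>.\<close>
  have comp: "\<forall>\<^sub>F t in at_top. \<forall>x. norm x \<le> R \<longrightarrow> \<bar>L (f (t, x))\<bar> \<le> \<epsilon> / 2" if L: "bounded_linear L" for L :: "complex \<Rightarrow> real"
  proof -
    interpret L: bounded_linear L by (rule L)
    interpret wave_solution "\<lambda>r. K r * T r" "\<lambda>r. K r * T r * (deriv T r / T r + deriv K r / K r)" "\<lambda>r. K r / T r" m0 m1 a1 c1 \<rho>1
      "\<lambda>p. L (f p)" r0 R0
    proof (rule wave_solution.intro[OF geo], rule wave_solution_axioms.intro)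
      show "smooth (\<lambda>p. L (f p))" by (rule smooth_linear(1)[OF f L])
      show "0 < r0" "r0 < R0" using r0(1) by (auto simp: R0_def)
      show "L (f (0, x)) = 0 \<and> Dt (\<lambda>p. L (f p)) (0, x) = 0" if "norm x < r0 \<or> R0 < norm x" for x
        using data[OF that] by (simp add: linear_commutes(1)[OF f L] L.zero)
    qed (rule wave_op_component[OF f f_def L], use pos eq in auto)
    show ?thesis by (rule wave_decay[OF R]) (use \<epsilon> in simp)
  qed
  show "\<forall>\<^sub>F t in at_top. \<forall>x. norm x \<le> R \<longrightarrow> norm (\<zeta> t x) \<le> \<epsilon>"
    using comp[OF bounded_linear_Re] comp[OF bounded_linear_Im]
  proof eventually_elim
    case (elim t)
    show ?case
    proof (intro allI impI)
      fix x :: "real^3" assume "norm x \<le> R"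
      then have "\<bar>Re (\<zeta> t x)\<bar> \<le> \<epsilon> / 2" "\<bar>Im (\<zeta> t x)\<bar> \<le> \<epsilon> / 2" using elim by (auto simp: f_def)
      then show "norm (\<zeta> t x) \<le> \<epsilon>" using cmod_le[of "\<zeta> t x"] by linarith
    qed
  qed
qed

end
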